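(* Let $(G,\Gamma)$ be a matched pair of finite groups and let $\mathcal C$ be a finite $(G,\Gamma)$-crossed tensor category over $k$ with $\Gamma$-grading $\mathcal C=\bigoplus_{s\in\Gamma}\mathcal C_s$. Then there is a $G\bowtie\Gamma$-grading on the tensor category $\operatorname{Fun}_{\mathcal C^{(G,\Gamma)}}(\mathcal C)^{op}$ with trivial homogeneous component $\mathcal C_e$. This grading is faithful if and only if the $\Gamma$-grading of $\mathcal C$ is faithful.
   Context: $k$ is an algebraically closed field of characteristic zero. A tensor category over $k$ is a $k$-linear abelian rigid monoidal category (assumed strict) in which all objects have finite length, Hom spaces are finite dimensional, $\otimes$ is $k$-bilinear and the unit object $\mathbf 1$ is simple; it is finite if it is finite as a $k$-linear abelian category. Gradings. For a group $L$, an $L$-grading of a tensor category $\mathcal B$ is a decomposition $\mathcal B=\bigoplus_{l\in L}\mathcal B_l$ into abelian subcategories with $\mathcal B_l\otimes\mathcal B_{l'}\subseteq\mathcal B_{ll'}$; it is faithful if all $\mathcal B_l\neq0$. The trivial (neutral) homogeneous component is $\mathcal B_e$. Matched pairs. A matched pair of groups $(G,\Gamma)$ consists of groups $G,\Gamma$ with a left action by permutations $\rhd:\Gamma\times G\to G$ and a right action by permutations $\lhd:\Gamma\times G\to\Gamma$ such that $s\rhd gh=(s\rhd g)((s\lhd g)\rhd h)$ and $st\lhd g=(s\lhd(t\rhd g))(t\lhd g)$. The group $G\bowtie\Gamma$ is the set $G\times\Gamma$ with multiplication $(g,s)(h,t)=(g(s\rhd h),(s\lhd h)t)$. Right actions.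 A right action of $G$ on $\mathcal C$ by $k$-linear autoequivalences is a monoidal functor $\rho:\underline G^{op}\to\operatorname{Aut}_k(\mathcal C)$: $k$-linear functors $\rho^g$ and natural isomorphisms $\rho_2^{g,h}:\rho^g\rho^h\to\rho^{hg}$, $\rho_0:\operatorname{id}\to\rho^e$ with $(\rho_2^{ba,c})_X(\rho_2^{a,b})_{\rho^c(X)}=(\rho_2^{a,cb})_X\,\rho^a((\rho_2^{b,c})_X)$ and $(\rho_2^{a,e})_X\rho^a((\rho_0)_X)=\operatorname{id}=(\rho_2^{e,a})_X(\rho_0)_{\rho^a(X)}$. Crossed actions. A $(G,\Gamma)$-crossed tensor category is a tensor category $\mathcal C$ with a $(G,\Gamma)$-crossed action: a $\Gamma$-grading of $\mathcal C$, a right action $\rho$ of $G$ by $k$-linear autoequivalences with $\rho^g(\mathcal C_s)=\mathcal C_{s\lhd g}$, natural isomorphisms $\gamma^g_{X,Y}:\rho^g(X\otimes Y)\to\rho^{t\rhd g}(X)\otimes\rho^g(Y)$ for $X\in\mathcal C$, $Y\in\mathcal C_t$, $t\in\Gamma$, and isomorphisms $\gamma_0^g:\rho^g(\mathbf 1)\to\mathbf 1$, satisfying: (a) $(\gamma^{t\rhd g}_{X,Y}\otimes\operatorname{id})\gamma^g_{X\otimes Y,Z}=(\operatorname{id}\otimes\gamma^g_{Y,Z})\gamma^g_{X,Y\otimes Z}$ for $Y\in\mathcal C_s$, $Z\in\mathcal C_t$; (b) $(\operatorname{id}_{\rho^g(X)}\otimes\gamma_0^g)\gamma^g_{X,\mathbf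 1}=\operatorname{id}_{\rho^g(X)}=(\gamma^g_0\otimes\operatorname{id}_{\rho^g(X)})\gamma^g_{\mathbf 1,X}$; (c) for $Y\in\mathcal C_s$, $\gamma^{hg}_{X,Y}(\rho_2^{g,h})_{X\otimes Y}=\big((\rho_2^{(s\lhd h)\rhd g,\,s\rhd h})_X\otimes(\rho_2^{g,h})_Y\big)\,\gamma^g_{\rho^{s\rhd h}(X),\rho^h(Y)}\,\rho^g(\gamma^h_{X,Y})$; (d) $\gamma_0^{hg}(\rho_2^{g,h})_{\mathbf 1}=\gamma_0^g\,\rho^g(\gamma_0^h)$; (e) $\gamma^e_{X,Y}(\rho_0)_{X\otimes Y}=(\rho_0)_X\otimes(\rho_0)_Y$ and $\gamma_0^e(\rho_0)_{\mathbf 1}=\operatorname{id}_{\mathbf 1}$. The tensor category $\mathcal C^{(G,\Gamma)}$ has as objects pairs $(X,r)$ with $X\in\mathcal C$ and $r=(r^g:\rho^g(X)\to X)_{g\in G}$ isomorphisms with $r^g\rho^g(r^h)=r^{hg}(\rho_2^{g,h})_X$ and $r^e(\rho_0)_X=\operatorname{id}_X$; morphisms $(X,r)\to(Y,r')$ are morphisms $u:X\to Y$ with $ur^g=r'^g\rho^g(u)$. Its tensor product is $(X,r)\otimes(Y,r')=(X\otimes Y,\tilde r)$, where for $Y=\bigoplus_sY_s$, $Y_s\in\mathcal C_s$, $\tilde r^g$ is the composition $\bigoplus_s\rho^g(X\otimes Y_s)\xrightarrow{\oplus\gamma^g_{X,Y_s}}\bigoplus_s\rho^{s\rhd g}(X)\otimes\rho^g(Y_s)\xrightarrow{\oplus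 r^{s\rhd g}\otimes r'^g_s}\bigoplus_sX\otimes Y_{s\lhd g}=X\otimes Y$. Module category. $\mathcal C$ is a left $\mathcal C^{(G,\Gamma)}$-module category via the forgetful functor: $(M,r)\overline{\otimes}X=M\otimes X$. $\operatorname{Fun}_{\mathcal C^{(G,\Gamma)}}(\mathcal C)$ is the tensor category of right exact $\mathcal C^{(G,\Gamma)}$-module endofunctors of $\mathcal C$, with tensor product given by composition; $op$ denotes the opposite tensor product. $\mathcal C$ (hence $\mathcal C_e$) is regarded as a tensor subcategory of $\operatorname{Fun}_{\mathcal C^{(G,\Gamma)}}(\mathcal C)^{op}$ via $X\mapsto(-\otimes X)$. *)

theory Defs
  imports
    "HOL-Computational_Algebra.Polynomial"
    "HOL-Algebra.Module"
begin

section \<open>Linear categories\<close>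

text \<open>
  Categories are carrier-based: only the elements of \<open>obj\<close> and \<open>arr\<close> count, and every arrow has
  a source and a target.  \<open>g \<cdot> f\<close> is \<open>g\<close> after \<open>f\<close>.
\<close>

record ('o, 'm, 'k) lin_cat =
  obj :: "'o set"
  arr :: "'m set"
  src :: "'m \<Rightarrow> 'o"
  tgt :: "'m \<Rightarrow> 'o"
  ident :: "'o \<Rightarrow> 'm"
  cmp :: "'m \<Rightarrow> 'm \<Rightarrow> 'm"  (infixr \<open>\<cdot>\<index>\<close> 75)
  hzero :: "'o \<Rightarrow> 'o \<Rightarrow> 'm"
  hadd :: "'m \<Rightarrow> 'm \<Rightarrow> 'm"
  hscale :: "'k \<Rightarrow> 'm \<Rightarrow> 'm"

definition Hom :: "('o, 'm, 'k, 'z) lin_cat_scheme \<Rightarrow> 'o \<Rightarrow> 'o \<Rightarrow> 'm set" where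
  "Hom C X Y = {f \<in> arr C. src C f = X \<and> tgt C f = Y}"

definition scalars :: "'k::field ring" where
  "scalars = \<lparr>carrier = UNIV, monoid.mult = (*), one = 1, ring.zero = 0, ring.add = (+)\<rparr>"

text \<open>The ring multiplication fields of a \<open>module\<close> record are irrelevant for modules.\<close>

definition hom_space ::
    "('o, 'm, 'k, 'z) lin_cat_scheme \<Rightarrow> 'o \<Rightarrow> 'o \<Rightarrow> ('k, 'm) module" where
  "hom_space C X Y =
     \<lparr>carrier = Hom C X Y, monoid.mult = (\<lambda>_ _. undefined), one = undefined,
      ring.zero = hzero C X Y, ring.add = hadd C, module.smult = hscale C\<rparr>"

locale linear_category =
  fixes C :: "('o, 'm, 'k::field, 'z) lin_cat_scheme" (structure)
  assumes src_closed: "f \<in> arr C \<Longrightarrow> src C f \<in> obj C"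
    and tgt_closed: "f \<in> arr C \<Longrightarrow> tgt C f \<in> obj C"
    and ident_hom: "X \<in> obj C \<Longrightarrow> ident C X \<in> Hom C X X"
    and cmp_hom: "\<lbrakk>f \<in> Hom C X Y; g \<in> Hom C Y Z\<rbrakk> \<Longrightarrow> g \<cdot> f \<in> Hom C X Z"
    and ident_cmp: "f \<in> Hom C X Y \<Longrightarrow> ident C Y \<cdot> f = f"
    and cmp_ident: "f \<in> Hom C X Y \<Longrightarrow> f \<cdot> ident C X = f"
    and cmp_assoc: "\<lbrakk>f \<in> Hom C W X; g \<in> Hom C X Y; h \<in> Hom C Y Z\<rbrakk>
          \<Longrightarrow> (h \<cdot> g) \<cdot> f = h \<cdot> (g \<cdot> f)"
    and hom_space: "\<lbrakk>X \<in> obj C; Y \<in> obj C\<rbrakk> \<Longrightarrow> Module.module scalars (hom_space C X Y)"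
    and cmp_hadd_left: "\<lbrakk>f \<in> Hom C X Y; g \<in> Hom C Y Z; g' \<in> Hom C Y Z\<rbrakk>
          \<Longrightarrow> hadd C g g' \<cdot> f = hadd C (g \<cdot> f) (g' \<cdot> f)"
    and cmp_hadd_right: "\<lbrakk>f \<in> Hom C X Y; f' \<in> Hom C X Y; g \<in> Hom C Y Z\<rbrakk>
          \<Longrightarrow> g \<cdot> hadd C f f' = hadd C (g \<cdot> f) (g \<cdot> f')"
    and cmp_hscale_left: "\<lbrakk>f \<in> Hom C X Y; g \<in> Hom C Y Z\<rbrakk>
          \<Longrightarrow> hscale C a g \<cdot> f = hscale C a (g \<cdot> f)"
    and cmp_hscale_right: "\<lbrakk>f \<in> Hom C X Y; g \<in> Hom C Y Z\<rbrakk>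
          \<Longrightarrow> g \<cdot> hscale C a f = hscale C a (g \<cdot> f)"


section \<open>Abelian categories\<close>

definition is_mono :: "('o, 'm, 'k, 'z) lin_cat_scheme \<Rightarrow> 'm \<Rightarrow> bool" where
  "is_mono C m \<longleftrightarrow> m \<in> arr C \<and>
     (\<forall>X\<in>obj C. \<forall>f\<in>Hom C X (src C m). \<forall>g\<in>Hom C X (src C m).
        m \<cdot>\<^bsub>C\<^esub> f = m \<cdot>\<^bsub>C\<^esub> g \<longrightarrow> f = g)"

definition is_epi :: "('o, 'm, 'k, 'z) lin_cat_scheme \<Rightarrow> 'm \<Rightarrow> bool" where
  "is_epi C p \<longleftrightarrow> p \<in> arr C \<and>
     (\<forall>X\<in>obj C. \<forall>f\<in>Hom C (tgt C p) X. \<forall>g\<in>Hom C (tgt C p) X.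
        f \<cdot>\<^bsub>C\<^esub> p = g \<cdot>\<^bsub>C\<^esub> p \<longrightarrow> f = g)"

definition is_iso :: "('o, 'm, 'k, 'z) lin_cat_scheme \<Rightarrow> 'm \<Rightarrow> bool" where
  "is_iso C f \<longleftrightarrow> f \<in> arr C \<and>
     (\<exists>g\<in>Hom C (tgt C f) (src C f).
        g \<cdot>\<^bsub>C\<^esub> f = ident C (src C f) \<and> f \<cdot>\<^bsub>C\<^esub> g = ident C (tgt C f))"

definition isomorphic :: "('o, 'm, 'k, 'z) lin_cat_scheme \<Rightarrow> 'o \<Rightarrow> 'o \<Rightarrow> bool" where
  "isomorphic C X Y \<longleftrightarrow> (\<exists>f\<in>Hom C X Y. is_iso C f)"

definition is_zero_obj :: "('o, 'm, 'k, 'z) lin_cat_scheme \<Rightarrow> 'o \<Rightarrow> bool" where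
  "is_zero_obj C Z \<longleftrightarrow> Z \<in> obj C \<and>
     (\<forall>X\<in>obj C. (\<exists>!f. f \<in> Hom C X Z) \<and> (\<exists>!f. f \<in> Hom C Z X))"

definition is_kernel :: "('o, 'm, 'k, 'z) lin_cat_scheme \<Rightarrow> 'm \<Rightarrow> 'm \<Rightarrow> bool" where
  "is_kernel C f k \<longleftrightarrow> f \<in> arr C \<and> k \<in> arr C \<and> tgt C k = src C f \<and>
     f \<cdot>\<^bsub>C\<^esub> k = hzero C (src C k) (tgt C f) \<and>
     (\<forall>W\<in>obj C. \<forall>h\<in>Hom C W (src C f). f \<cdot>\<^bsub>C\<^esub> h = hzero C W (tgt C f) \<longrightarrow>
        (\<exists>!u. u \<in> Hom C W (src C k) \<and> k \<cdot>\<^bsub>C\<^esub> u = h))"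

definition is_cokernel :: "('o, 'm, 'k, 'z) lin_cat_scheme \<Rightarrow> 'm \<Rightarrow> 'm \<Rightarrow> bool" where
  "is_cokernel C f p \<longleftrightarrow> f \<in> arr C \<and> p \<in> arr C \<and> src C p = tgt C f \<and>
     p \<cdot>\<^bsub>C\<^esub> f = hzero C (src C f) (tgt C p) \<and>
     (\<forall>W\<in>obj C. \<forall>h\<in>Hom C (tgt C f) W. h \<cdot>\<^bsub>C\<^esub> f = hzero C (src C f) W \<longrightarrow>
        (\<exists>!u. u \<in> Hom C (tgt C p) W \<and> u \<cdot>\<^bsub>C\<^esub> p = h))"

text \<open>\<open>Y\<close> is the direct sum (biproduct) of the \<open>Z i\<close>, \<open>i \<in> I\<close>; meaningful for finite \<open>I\<close> only.\<close>

definition is_direct_sum ::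
    "('o, 'm, 'k, 'z) lin_cat_scheme \<Rightarrow> 'i set \<Rightarrow> ('i \<Rightarrow> 'o) \<Rightarrow> 'o \<Rightarrow> ('i \<Rightarrow> 'm) \<Rightarrow> ('i \<Rightarrow> 'm) \<Rightarrow> bool"
  where
  "is_direct_sum C I Z Y \<iota> \<pi> \<longleftrightarrow> Y \<in> obj C \<and>
     (\<forall>i\<in>I. Z i \<in> obj C \<and> \<iota> i \<in> Hom C (Z i) Y \<and> \<pi> i \<in> Hom C Y (Z i)) \<and>
     (\<forall>i\<in>I. \<forall>j\<in>I. \<pi> i \<cdot>\<^bsub>C\<^esub> \<iota> j = (if i = j then ident C (Z i) else hzero C (Z j) (Z i))) \<and>
     finsum (hom_space C Y Y) (\<lambda>i. \<iota> i \<cdot>\<^bsub>C\<^esub> \<pi> i) I = ident C Y"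

locale abelian_category = linear_category C
  for C :: "('o, 'm, 'k::field, 'z) lin_cat_scheme" (structure) +
  assumes zero_obj_exists: "\<exists>Z. is_zero_obj C Z"
    and direct_sum_exists: "\<lbrakk>X \<in> obj C; Y \<in> obj C\<rbrakk>
          \<Longrightarrow> \<exists>S \<iota> \<pi>. is_direct_sum C (UNIV :: bool set) (\<lambda>b. if b then X else Y) S \<iota> \<pi>"
    and kernel_exists: "f \<in> arr C \<Longrightarrow> \<exists>k. is_kernel C f k"
    and cokernel_exists: "f \<in> arr C \<Longrightarrow> \<exists>p. is_cokernel C f p"
    and mono_normal: "is_mono C m \<Longrightarrow> \<exists>f. is_kernel C f m"
    and epi_normal: "is_epi C p \<Longrightarrow> \<exists>f. is_cokernel C f p"

definition is_simple :: "('o, 'm, 'k, 'z) lin_cat_scheme \<Rightarrow> 'o \<Rightarrow> bool" where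
  "is_simple C X \<longleftrightarrow> X \<in> obj C \<and> \<not> is_zero_obj C X \<and>
     (\<forall>m. is_mono C m \<and> tgt C m = X \<longrightarrow> is_zero_obj C (src C m) \<or> is_iso C m)"

text \<open>Objects with a finite filtration whose successive quotients are simple.\<close>

inductive finite_length :: "('o, 'm, 'k, 'z) lin_cat_scheme \<Rightarrow> 'o \<Rightarrow> bool"
  for C :: "('o, 'm, 'k, 'z) lin_cat_scheme" where
  zero: "is_zero_obj C X \<Longrightarrow> finite_length C X"
| extend: "\<lbrakk>finite_length C (src C m); is_mono C m; is_cokernel C m p; is_simple C (tgt C p)\<rbrakk>
     \<Longrightarrow> finite_length C (tgt C m)"

definition finite_dim_hom :: "('o, 'm, 'k, 'z) lin_cat_scheme \<Rightarrow> 'o \<Rightarrow> 'o \<Rightarrow> bool" where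
  "finite_dim_hom C X Y \<longleftrightarrow> (\<exists>S. finite S \<and> S \<subseteq> Hom C X Y \<and>
     (\<forall>f\<in>Hom C X Y. \<exists>c. f = finsum (hom_space C X Y) (\<lambda>s. hscale C (c s) s) S))"

definition is_projective :: "('o, 'm, 'k, 'z) lin_cat_scheme \<Rightarrow> 'o \<Rightarrow> bool" where
  "is_projective C P \<longleftrightarrow> P \<in> obj C \<and>
     (\<forall>p. is_epi C p \<longrightarrow> (\<forall>f\<in>Hom C P (tgt C p). \<exists>h\<in>Hom C P (src C p). p \<cdot>\<^bsub>C\<^esub> h = f))"

definition is_projective_cover :: "('o, 'm, 'k, 'z) lin_cat_scheme \<Rightarrow> 'o \<Rightarrow> 'm \<Rightarrow> bool" where
  "is_projective_cover C X p \<longleftrightarrow> is_epi C p \<and> tgt C p = X \<and> is_projective C (src C p) \<and>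
     (\<forall>q. is_epi C q \<and> tgt C q = X \<and> is_projective C (src C q) \<longrightarrow>
        (\<exists>h\<in>Hom C (src C q) (src C p). is_epi C h \<and> p \<cdot>\<^bsub>C\<^esub> h = q))"

text \<open>
  Strictly full abelian subcategories, given by their objects: kernels, cokernels and finite
  direct sums are those of the ambient category.
\<close>

definition abelian_subcategory :: "('o, 'm, 'k, 'z) lin_cat_scheme \<Rightarrow> 'o set \<Rightarrow> bool" where
  "abelian_subcategory C S \<longleftrightarrow> S \<subseteq> obj C \<and>
     (\<forall>X\<in>S. \<forall>Y\<in>obj C. isomorphic C X Y \<longrightarrow> Y \<in> S) \<and>
     (\<forall>Z. is_zero_obj C Z \<longrightarrow> Z \<in> S) \<and>
     (\<forall>X\<in>S. \<forall>Y\<in>S. \<forall>W \<iota> \<pi>.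
        is_direct_sum C (UNIV :: bool set) (\<lambda>b. if b then X else Y) W \<iota> \<pi> \<longrightarrow> W \<in> S) \<and>
     (\<forall>X\<in>S. \<forall>Y\<in>S. \<forall>f\<in>Hom C X Y.
        (\<forall>k. is_kernel C f k \<longrightarrow> src C k \<in> S) \<and> (\<forall>p. is_cokernel C f p \<longrightarrow> tgt C p \<in> S))"


section \<open>Functors\<close>

record ('o, 'm, 'p, 'n) cat_functor =
  fobj :: "'o \<Rightarrow> 'p"
  farr :: "'m \<Rightarrow> 'n"

definition linear_functor ::
    "('o, 'm, 'k, 'y) lin_cat_scheme \<Rightarrow> ('p, 'n, 'k, 'z) lin_cat_scheme \<Rightarrow>
     ('o, 'm, 'p, 'n, 'w) cat_functor_scheme \<Rightarrow> bool" where
  "linear_functor C D F \<longleftrightarrow>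
     (\<forall>X\<in>obj C. fobj F X \<in> obj D) \<and>
     (\<forall>X\<in>obj C. \<forall>Y\<in>obj C. \<forall>f\<in>Hom C X Y. farr F f \<in> Hom D (fobj F X) (fobj F Y)) \<and>
     (\<forall>X\<in>obj C. farr F (ident C X) = ident D (fobj F X)) \<and>
     (\<forall>f\<in>arr C. \<forall>g\<in>arr C. src C g = tgt C f \<longrightarrow>
        farr F (g \<cdot>\<^bsub>C\<^esub> f) = farr F g \<cdot>\<^bsub>D\<^esub> farr F f) \<and>
     (\<forall>X\<in>obj C. \<forall>Y\<in>obj C. \<forall>f\<in>Hom C X Y. \<forall>g\<in>Hom C X Y.
        farr F (hadd C f g) = hadd D (farr F f) (farr F g)) \<and>
     (\<forall>f\<in>arr C. \<forall>a. farr F (hscale C a f) = hscale D a (farr F f))"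

definition fully_faithful ::
    "('o, 'm, 'k, 'y) lin_cat_scheme \<Rightarrow> ('p, 'n, 'k, 'z) lin_cat_scheme \<Rightarrow>
     ('o, 'm, 'p, 'n, 'w) cat_functor_scheme \<Rightarrow> bool" where
  "fully_faithful C D F \<longleftrightarrow>
     (\<forall>X\<in>obj C. \<forall>Y\<in>obj C. bij_betw (farr F) (Hom C X Y) (Hom D (fobj F X) (fobj F Y)))"

definition ess_image ::
    "('p, 'n, 'k, 'z) lin_cat_scheme \<Rightarrow> ('o, 'm, 'p, 'n, 'w) cat_functor_scheme \<Rightarrow> 'o set \<Rightarrow> 'p set"
  where
  "ess_image D F S = {Y \<in> obj D. \<exists>X\<in>S. isomorphic D (fobj F X) Y}"

definition linear_equivalence ::
    "('o, 'm, 'k, 'y) lin_cat_scheme \<Rightarrow> ('p, 'n, 'k, 'z) lin_cat_scheme \<Rightarrow>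
     ('o, 'm, 'p, 'n, 'w) cat_functor_scheme \<Rightarrow> bool" where
  "linear_equivalence C D F \<longleftrightarrow>
     linear_functor C D F \<and> fully_faithful C D F \<and> ess_image D F (obj C) = obj D"

text \<open>\<open>is_cokernel C f p\<close> says that \<open>f\<close> and \<open>p\<close> form a right exact sequence.\<close>

definition right_exact ::
    "('o, 'm, 'k, 'y) lin_cat_scheme \<Rightarrow> ('p, 'n, 'k, 'z) lin_cat_scheme \<Rightarrow>
     ('o, 'm, 'p, 'n, 'w) cat_functor_scheme \<Rightarrow> bool" where
  "right_exact C D F \<longleftrightarrow> (\<forall>f p. is_cokernel C f p \<longrightarrow> is_cokernel D (farr F f) (farr F p))"

definition functor_id :: "('o, 'm, 'o, 'm) cat_functor" where
  "functor_id = \<lparr>fobj = id, farr = id\<rparr>"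

definition functor_comp ::
    "('p, 'n, 'q, 'l) cat_functor \<Rightarrow> ('o, 'm, 'p, 'n) cat_functor \<Rightarrow> ('o, 'm, 'q, 'l) cat_functor"
  where
  "functor_comp F F' = \<lparr>fobj = fobj F \<circ> fobj F', farr = farr F \<circ> farr F'\<rparr>"

definition natural_transformation ::
    "('o, 'm, 'k, 'y) lin_cat_scheme \<Rightarrow> ('p, 'n, 'k, 'z) lin_cat_scheme \<Rightarrow>
     ('o, 'm, 'p, 'n, 'w) cat_functor_scheme \<Rightarrow> ('o, 'm, 'p, 'n, 'w) cat_functor_scheme \<Rightarrow>
     ('o \<Rightarrow> 'n) \<Rightarrow> bool" where
  "natural_transformation C D F F' \<alpha> \<longleftrightarrow>
     (\<forall>X\<in>obj C. \<alpha> X \<in> Hom D (fobj F X) (fobj F' X)) \<and>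
     (\<forall>X\<in>obj C. \<forall>Y\<in>obj C. \<forall>f\<in>Hom C X Y.
        \<alpha> Y \<cdot>\<^bsub>D\<^esub> farr F f = farr F' f \<cdot>\<^bsub>D\<^esub> \<alpha> X)"

definition natural_iso ::
    "('o, 'm, 'k, 'y) lin_cat_scheme \<Rightarrow> ('p, 'n, 'k, 'z) lin_cat_scheme \<Rightarrow>
     ('o, 'm, 'p, 'n, 'w) cat_functor_scheme \<Rightarrow> ('o, 'm, 'p, 'n, 'w) cat_functor_scheme \<Rightarrow>
     ('o \<Rightarrow> 'n) \<Rightarrow> bool" where
  "natural_iso C D F F' \<alpha> \<longleftrightarrow>
     natural_transformation C D F F' \<alpha> \<and> (\<forall>X\<in>obj C. is_iso D (\<alpha> X))"


section \<open>Tensor categories\<close>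

record ('o, 'm, 'k) tensor_cat = "('o, 'm, 'k) lin_cat" +
  tobj :: "'o \<Rightarrow> 'o \<Rightarrow> 'o"  (infixr \<open>\<boxtimes>\<index>\<close> 80)
  tarr :: "'m \<Rightarrow> 'm \<Rightarrow> 'm"  (infixr \<open>\<boxtimes>\<^sub>m\<index>\<close> 80)
  tunit :: "'o"

text \<open>\<open>is_left_dual C X D ev coev\<close>: \<open>D\<close> is a left dual of \<open>X\<close>, hence \<open>X\<close> is a right dual of \<open>D\<close>.\<close>

definition is_left_dual ::
    "('o, 'm, 'k, 'z) tensor_cat_scheme \<Rightarrow> 'o \<Rightarrow> 'o \<Rightarrow> 'm \<Rightarrow> 'm \<Rightarrow> bool" where
  "is_left_dual C X D ev coev \<longleftrightarrow> X \<in> obj C \<and> D \<in> obj C \<and>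
     ev \<in> Hom C (D \<boxtimes>\<^bsub>C\<^esub> X) (tunit C) \<and> coev \<in> Hom C (tunit C) (X \<boxtimes>\<^bsub>C\<^esub> D) \<and>
     (ident C X \<boxtimes>\<^sub>m\<^bsub>C\<^esub> ev) \<cdot>\<^bsub>C\<^esub> (coev \<boxtimes>\<^sub>m\<^bsub>C\<^esub> ident C X) = ident C X \<and>
     (ev \<boxtimes>\<^sub>m\<^bsub>C\<^esub> ident C D) \<cdot>\<^bsub>C\<^esub> (ident C D \<boxtimes>\<^sub>m\<^bsub>C\<^esub> coev) = ident C D"

locale tensor_category = abelian_category C
  for C :: "('o, 'm, 'k::field, 'z) tensor_cat_scheme" (structure) +
  assumes tobj_closed: "\<lbrakk>X \<in> obj C; Y \<in> obj C\<rbrakk> \<Longrightarrow> X \<boxtimes> Y \<in> obj C"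
    and tarr_hom: "\<lbrakk>f \<in> Hom C X X'; g \<in> Hom C Y Y'\<rbrakk>
          \<Longrightarrow> f \<boxtimes>\<^sub>m g \<in> Hom C (X \<boxtimes> Y) (X' \<boxtimes> Y')"
    and tarr_ident: "\<lbrakk>X \<in> obj C; Y \<in> obj C\<rbrakk>
          \<Longrightarrow> ident C X \<boxtimes>\<^sub>m ident C Y = ident C (X \<boxtimes> Y)"
    and tarr_cmp: "\<lbrakk>f \<in> Hom C X X'; f' \<in> Hom C X' X''; g \<in> Hom C Y Y'; g' \<in> Hom C Y' Y''\<rbrakk>
          \<Longrightarrow> (f' \<cdot> f) \<boxtimes>\<^sub>m (g' \<cdot> g) = (f' \<boxtimes>\<^sub>m g') \<cdot> (f \<boxtimes>\<^sub>m g)"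
    and tunit_closed: "tunit C \<in> obj C"
    and tobj_assoc: "\<lbrakk>X \<in> obj C; Y \<in> obj C; Z \<in> obj C\<rbrakk>
          \<Longrightarrow> (X \<boxtimes> Y) \<boxtimes> Z = X \<boxtimes> (Y \<boxtimes> Z)"
    and tarr_assoc: "\<lbrakk>f \<in> arr C; g \<in> arr C; h \<in> arr C\<rbrakk>
          \<Longrightarrow> (f \<boxtimes>\<^sub>m g) \<boxtimes>\<^sub>m h = f \<boxtimes>\<^sub>m (g \<boxtimes>\<^sub>m h)"
    and tobj_unit: "X \<in> obj C \<Longrightarrow> tunit C \<boxtimes> X = X \<and> X \<boxtimes> tunit C = X"
    and tarr_unit: "f \<in> arr C
          \<Longrightarrow> ident C (tunit C) \<boxtimes>\<^sub>m f = f \<and> f \<boxtimes>\<^sub>m ident C (tunit C) = f"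
    and tarr_hadd_left: "\<lbrakk>f \<in> Hom C X X'; f' \<in> Hom C X X'; g \<in> Hom C Y Y'\<rbrakk>
          \<Longrightarrow> hadd C f f' \<boxtimes>\<^sub>m g = hadd C (f \<boxtimes>\<^sub>m g) (f' \<boxtimes>\<^sub>m g)"
    and tarr_hadd_right: "\<lbrakk>f \<in> Hom C X X'; g \<in> Hom C Y Y'; g' \<in> Hom C Y Y'\<rbrakk>
          \<Longrightarrow> f \<boxtimes>\<^sub>m hadd C g g' = hadd C (f \<boxtimes>\<^sub>m g) (f \<boxtimes>\<^sub>m g')"
    and tarr_hscale: "\<lbrakk>f \<in> arr C; g \<in> arr C\<rbrakk>
          \<Longrightarrow> hscale C a f \<boxtimes>\<^sub>m g = hscale C a (f \<boxtimes>\<^sub>m g) \<and> f \<boxtimes>\<^sub>m hscale C a g = hscale C a (f \<boxtimes>\<^sub>m g)"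
    and left_dual_exists: "X \<in> obj C \<Longrightarrow> \<exists>D ev coev. is_left_dual C X D ev coev"
    and right_dual_exists: "X \<in> obj C \<Longrightarrow> \<exists>D ev coev. is_left_dual C D X ev coev"
    and finite_length: "X \<in> obj C \<Longrightarrow> finite_length C X"
    and finite_dim: "\<lbrakk>X \<in> obj C; Y \<in> obj C\<rbrakk> \<Longrightarrow> finite_dim_hom C X Y"
    and tunit_simple: "is_simple C (tunit C)"

text \<open>
  Finite linear abelian categories are those with finite-dimensional Hom spaces and objects of
  finite length (part of \<open>tensor_category\<close>), finitely many isomorphism classes of simple objects,
  and a projective cover of every simple object.
\<close>

locale finite_tensor_category = tensor_category C
  for C :: "('o, 'm, 'k::field, 'z) tensor_cat_scheme" (structure) +
  assumes finitely_many_simples: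
      "\<exists>S. finite S \<and> (\<forall>X. is_simple C X \<longrightarrow> (\<exists>Y\<in>S. isomorphic C X Y))"
    and projective_cover_exists: "is_simple C X \<Longrightarrow> \<exists>p. is_projective_cover C X p"

definition op_tensor :: "('o, 'm, 'k, 'z) tensor_cat_scheme \<Rightarrow> ('o, 'm, 'k, 'z) tensor_cat_scheme"
  where
  "op_tensor C = C\<lparr>tobj := (\<lambda>X Y. Y \<boxtimes>\<^bsub>C\<^esub> X), tarr := (\<lambda>f g. g \<boxtimes>\<^sub>m\<^bsub>C\<^esub> f)\<rparr>"

definition tensor_embedding ::
    "('o, 'm, 'k, 'y) tensor_cat_scheme \<Rightarrow> ('p, 'n, 'k, 'z) tensor_cat_scheme \<Rightarrow>
     ('o, 'm, 'p, 'n, 'w) cat_functor_scheme \<Rightarrow> bool" where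
  "tensor_embedding C D F \<longleftrightarrow> linear_functor C D F \<and> fully_faithful C D F \<and>
     fobj F (tunit C) = tunit D \<and>
     (\<forall>X\<in>obj C. \<forall>Y\<in>obj C. fobj F (X \<boxtimes>\<^bsub>C\<^esub> Y) = fobj F X \<boxtimes>\<^bsub>D\<^esub> fobj F Y) \<and>
     (\<forall>f\<in>arr C. \<forall>g\<in>arr C. farr F (f \<boxtimes>\<^sub>m\<^bsub>C\<^esub> g) = farr F f \<boxtimes>\<^sub>m\<^bsub>D\<^esub> farr F g)"

text \<open>
  The homogeneous components are recorded by their sets of objects.  Being summands of the
  category, they are full subcategories; zero objects belong to every component.
\<close>

locale graded_tensor_category = L: group L + tensor_category B
  for L :: "('l, 'a) monoid_scheme"
    and B :: "('o, 'm, 'k::field, 'z) tensor_cat_scheme" (structure) +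
  fixes component :: "'l \<Rightarrow> 'o set"
  assumes component_abelian: "l \<in> carrier L \<Longrightarrow> abelian_subcategory B (component l)"
    and component_orthogonal: "\<lbrakk>l \<in> carrier L; l' \<in> carrier L; l \<noteq> l'; X \<in> component l;
          Y \<in> component l'\<rbrakk> \<Longrightarrow> Hom B X Y = {hzero B X Y}"
    and decomposition: "X \<in> obj B \<Longrightarrow> \<exists>I Z \<iota> \<pi>. finite I \<and> I \<subseteq> carrier L \<and>
          (\<forall>l\<in>I. Z l \<in> component l) \<and> is_direct_sum B I Z X \<iota> \<pi>"
    and component_tensor: "\<lbrakk>l \<in> carrier L; l' \<in> carrier L; X \<in> component l; Y \<in> component l'\<rbrakk>
          \<Longrightarrow> X \<boxtimes> Y \<in> component (l \<otimes>\<^bsub>L\<^esub> l')"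

definition faithful_grading ::
    "('l, 'a) monoid_scheme \<Rightarrow> ('o, 'm, 'k, 'z) lin_cat_scheme \<Rightarrow> ('l \<Rightarrow> 'o set) \<Rightarrow> bool" where
  "faithful_grading L B component \<longleftrightarrow>
     (\<forall>l\<in>carrier L. \<exists>X\<in>component l. \<not> is_zero_obj B X)"


section \<open>Matched pairs of groups\<close>

locale matched_pair = G: group G + \<Gamma>: group \<Gamma>
  for G :: "('g, 'a) monoid_scheme" and \<Gamma> :: "('s, 'b) monoid_scheme" +
  fixes lact :: "'s \<Rightarrow> 'g \<Rightarrow> 'g"  (infixr \<open>\<triangleright>\<close> 72)
    and ract :: "'s \<Rightarrow> 'g \<Rightarrow> 's"  (infixl \<open>\<triangleleft>\<close> 72)
  assumes lact_closed: "\<lbrakk>s \<in> carrier \<Gamma>; g \<in> carrier G\<rbrakk> \<Longrightarrow> s \<triangleright> g \<in> carrier G"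
    and lact_one: "g \<in> carrier G \<Longrightarrow> \<one>\<^bsub>\<Gamma>\<^esub> \<triangleright> g = g"
    and lact_mult: "\<lbrakk>s \<in> carrier \<Gamma>; t \<in> carrier \<Gamma>; g \<in> carrier G\<rbrakk>
          \<Longrightarrow> (s \<otimes>\<^bsub>\<Gamma>\<^esub> t) \<triangleright> g = s \<triangleright> (t \<triangleright> g)"
    and ract_closed: "\<lbrakk>s \<in> carrier \<Gamma>; g \<in> carrier G\<rbrakk> \<Longrightarrow> s \<triangleleft> g \<in> carrier \<Gamma>"
    and ract_one: "s \<in> carrier \<Gamma> \<Longrightarrow> s \<triangleleft> \<one>\<^bsub>G\<^esub> = s"
    and ract_mult: "\<lbrakk>s \<in> carrier \<Gamma>; g \<in> carrier G; h \<in> carrier G\<rbrakk>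
          \<Longrightarrow> s \<triangleleft> (g \<otimes>\<^bsub>G\<^esub> h) = (s \<triangleleft> g) \<triangleleft> h"
    and lact_compat: "\<lbrakk>s \<in> carrier \<Gamma>; g \<in> carrier G; h \<in> carrier G\<rbrakk>
          \<Longrightarrow> s \<triangleright> (g \<otimes>\<^bsub>G\<^esub> h) = (s \<triangleright> g) \<otimes>\<^bsub>G\<^esub> ((s \<triangleleft> g) \<triangleright> h)"
    and ract_compat: "\<lbrakk>s \<in> carrier \<Gamma>; t \<in> carrier \<Gamma>; g \<in> carrier G\<rbrakk>
          \<Longrightarrow> (s \<otimes>\<^bsub>\<Gamma>\<^esub> t) \<triangleleft> g = (s \<triangleleft> (t \<triangleright> g)) \<otimes>\<^bsub>\<Gamma>\<^esub> (t \<triangleleft> g)"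

definition bicrossed_group ::
    "('g, 'a) monoid_scheme \<Rightarrow> ('s, 'b) monoid_scheme \<Rightarrow> ('s \<Rightarrow> 'g \<Rightarrow> 'g) \<Rightarrow> ('s \<Rightarrow> 'g \<Rightarrow> 's) \<Rightarrow>
     ('g \<times> 's) monoid" where
  "bicrossed_group G \<Gamma> lact ract =
     \<lparr>carrier = carrier G \<times> carrier \<Gamma>,
      monoid.mult = (\<lambda>(g, s) (h, t). (g \<otimes>\<^bsub>G\<^esub> lact s h, ract s h \<otimes>\<^bsub>\<Gamma>\<^esub> t)),
      one = (\<one>\<^bsub>G\<^esub>, \<one>\<^bsub>\<Gamma>\<^esub>)\<rparr>"


section \<open>Crossed tensor categories\<close>

text \<open>
  \<open>rho2 A g h X\<close> is the component at \<open>X\<close> of the isomorphism from \<open>rho A g \<circ> rho A h\<close> to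
  \<open>rho A (h g)\<close>.  \<open>gam A t g X Y\<close> is \<open>\<gamma>\<close> with upper index \<open>g\<close> at \<open>(X, Y)\<close> for \<open>Y\<close> in component
  \<open>t\<close>; the index \<open>t\<close> is needed because a zero object \<open>Y\<close> lies in all components, while the
  codomain of \<open>\<gamma>\<close> depends on \<open>t\<close>.
\<close>

record ('g, 's, 'o, 'm) crossed_action =
  grade :: "'s \<Rightarrow> 'o set"
  rho :: "'g \<Rightarrow> ('o, 'm, 'o, 'm) cat_functor"
  rho2 :: "'g \<Rightarrow> 'g \<Rightarrow> 'o \<Rightarrow> 'm"
  rho0 :: "'o \<Rightarrow> 'm"
  gam :: "'s \<Rightarrow> 'g \<Rightarrow> 'o \<Rightarrow> 'o \<Rightarrow> 'm"
  gam0 :: "'g \<Rightarrow> 'm"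

locale right_action = G: group G + linear_category C
  for G :: "('g, 'a) monoid_scheme"
    and C :: "('o, 'm, 'k::field, 'z) lin_cat_scheme" (structure) +
  fixes \<rho> :: "'g \<Rightarrow> ('o, 'm, 'o, 'm) cat_functor"
    and \<rho>2 :: "'g \<Rightarrow> 'g \<Rightarrow> 'o \<Rightarrow> 'm"
    and \<rho>0 :: "'o \<Rightarrow> 'm"
  assumes rho_equivalence: "g \<in> carrier G \<Longrightarrow> linear_equivalence C C (\<rho> g)"
    and rho2_natural: "\<lbrakk>g \<in> carrier G; h \<in> carrier G\<rbrakk>
          \<Longrightarrow> natural_iso C C (functor_comp (\<rho> g) (\<rho> h)) (\<rho> (h \<otimes>\<^bsub>G\<^esub> g)) (\<rho>2 g h)"
    and rho0_natural: "natural_iso C C functor_id (\<rho> \<one>\<^bsub>G\<^esub>) \<rho>0"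
    and rho2_assoc: "\<lbrakk>a \<in> carrier G; b \<in> carrier G; c \<in> carrier G; X \<in> obj C\<rbrakk>
          \<Longrightarrow> \<rho>2 (b \<otimes>\<^bsub>G\<^esub> a) c X \<cdot> \<rho>2 a b (fobj (\<rho> c) X) =
              \<rho>2 a (c \<otimes>\<^bsub>G\<^esub> b) X \<cdot> farr (\<rho> a) (\<rho>2 b c X)"
    and rho2_one_right: "\<lbrakk>a \<in> carrier G; X \<in> obj C\<rbrakk>
          \<Longrightarrow> \<rho>2 a \<one>\<^bsub>G\<^esub> X \<cdot> farr (\<rho> a) (\<rho>0 X) = ident C (fobj (\<rho> a) X)"
    and rho2_one_left: "\<lbrakk>a \<in> carrier G; X \<in> obj C\<rbrakk>
          \<Longrightarrow> \<rho>2 \<one>\<^bsub>G\<^esub> a X \<cdot> \<rho>0 (fobj (\<rho> a) X) = ident C (fobj (\<rho> a) X)"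

text \<open>
  In \<open>rho_grade\<close> the image of a homogeneous component is its essential image.  In
  \<open>gam_unit_left\<close> the object \<open>X\<close> is homogeneous of degree \<open>t\<close>, so that the first tensor factor of
  the codomain of \<open>gam A t g (tunit C) X\<close> is \<open>\<rho> (t \<triangleright> g)\<close> applied to the unit object.
\<close>

locale crossed_tensor_category =
  matched_pair G \<Gamma> lact ract +
  graded_tensor_category \<Gamma> C "grade A" +
  right_action G C "rho A" "rho2 A" "rho0 A"
  for G :: "('g, 'a) monoid_scheme" and \<Gamma> :: "('s, 'b) monoid_scheme"
    and lact :: "'s \<Rightarrow> 'g \<Rightarrow> 'g"  (infixr \<open>\<triangleright>\<close> 72)
    and ract :: "'s \<Rightarrow> 'g \<Rightarrow> 's"  (infixl \<open>\<triangleleft>\<close> 72)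
    and C :: "('o, 'm, 'k::field, 'z) tensor_cat_scheme" (structure)
    and A :: "('g, 's, 'o, 'm) crossed_action" +
  assumes rho_grade: "\<lbrakk>g \<in> carrier G; s \<in> carrier \<Gamma>\<rbrakk>
          \<Longrightarrow> ess_image C (rho A g) (grade A s) = grade A (s \<triangleleft> g)"
    and gam_iso: "\<lbrakk>g \<in> carrier G; t \<in> carrier \<Gamma>; X \<in> obj C; Y \<in> grade A t\<rbrakk>
          \<Longrightarrow> gam A t g X Y \<in> Hom C (fobj (rho A g) (X \<boxtimes> Y))
                (fobj (rho A (t \<triangleright> g)) X \<boxtimes> fobj (rho A g) Y) \<and> is_iso C (gam A t g X Y)"
    and gam_natural: "\<lbrakk>g \<in> carrier G; t \<in> carrier \<Gamma>; u \<in> Hom C X X'; Y \<in> grade A t;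
          Y' \<in> grade A t; v \<in> Hom C Y Y'\<rbrakk>
          \<Longrightarrow> gam A t g X' Y' \<cdot> farr (rho A g) (u \<boxtimes>\<^sub>m v) =
              (farr (rho A (t \<triangleright> g)) u \<boxtimes>\<^sub>m farr (rho A g) v) \<cdot> gam A t g X Y"
    and gam0_iso: "g \<in> carrier G
          \<Longrightarrow> gam0 A g \<in> Hom C (fobj (rho A g) (tunit C)) (tunit C) \<and> is_iso C (gam0 A g)"
    and gam_assoc: "\<lbrakk>g \<in> carrier G; s \<in> carrier \<Gamma>; t \<in> carrier \<Gamma>; X \<in> obj C;
          Y \<in> grade A s; Z \<in> grade A t\<rbrakk>
          \<Longrightarrow> (gam A s (t \<triangleright> g) X Y \<boxtimes>\<^sub>m ident C (fobj (rho A g) Z)) \<cdot> gam A t g (X \<boxtimes> Y) Z =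
              (ident C (fobj (rho A ((s \<otimes>\<^bsub>\<Gamma>\<^esub> t) \<triangleright> g)) X) \<boxtimes>\<^sub>m gam A t g Y Z)
                \<cdot> gam A (s \<otimes>\<^bsub>\<Gamma>\<^esub> t) g X (Y \<boxtimes> Z)"
    and gam_unit_right: "\<lbrakk>g \<in> carrier G; X \<in> obj C\<rbrakk>
          \<Longrightarrow> (ident C (fobj (rho A g) X) \<boxtimes>\<^sub>m gam0 A g) \<cdot> gam A \<one>\<^bsub>\<Gamma>\<^esub> g X (tunit C) =
              ident C (fobj (rho A g) X)"
    and gam_unit_left: "\<lbrakk>g \<in> carrier G; t \<in> carrier \<Gamma>; X \<in> grade A t\<rbrakk>
          \<Longrightarrow> (gam0 A (t \<triangleright> g) \<boxtimes>\<^sub>m ident C (fobj (rho A g) X)) \<cdot> gam A t g (tunit C) X =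
              ident C (fobj (rho A g) X)"
    and gam_rho2: "\<lbrakk>g \<in> carrier G; h \<in> carrier G; s \<in> carrier \<Gamma>; X \<in> obj C; Y \<in> grade A s\<rbrakk>
          \<Longrightarrow> gam A s (h \<otimes>\<^bsub>G\<^esub> g) X Y \<cdot> rho2 A g h (X \<boxtimes> Y) =
              (rho2 A ((s \<triangleleft> h) \<triangleright> g) (s \<triangleright> h) X \<boxtimes>\<^sub>m rho2 A g h Y)
                \<cdot> gam A (s \<triangleleft> h) g (fobj (rho A (s \<triangleright> h)) X) (fobj (rho A h) Y)
                \<cdot> farr (rho A g) (gam A s h X Y)"
    and gam0_rho2: "\<lbrakk>g \<in> carrier G; h \<in> carrier G\<rbrakk>
          \<Longrightarrow> gam0 A (h \<otimes>\<^bsub>G\<^esub> g) \<cdot> rho2 A g h (tunit C) =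
              gam0 A g \<cdot> farr (rho A g) (gam0 A h)"
    and gam_rho0: "\<lbrakk>t \<in> carrier \<Gamma>; X \<in> obj C; Y \<in> grade A t\<rbrakk>
          \<Longrightarrow> gam A t \<one>\<^bsub>G\<^esub> X Y \<cdot> rho0 A (X \<boxtimes> Y) = rho0 A X \<boxtimes>\<^sub>m rho0 A Y"
    and gam0_rho0: "gam0 A \<one>\<^bsub>G\<^esub> \<cdot> rho0 A (tunit C) = ident C (tunit C)"


section \<open>The equivariant category of a crossed tensor category\<close>

text \<open>
  A chosen decomposition of \<open>Y\<close> as the direct sum of its homogeneous components, for a finite
  group \<open>\<Gamma>\<close>: components, injections and projections.  The tensor product below does not depend on
  this choice.
\<close>

definition homogeneous_parts ::
    "('s, 'b) monoid_scheme \<Rightarrow> ('o, 'm, 'k, 'z) lin_cat_scheme \<Rightarrow> ('s \<Rightarrow> 'o set) \<Rightarrow> 'o \<Rightarrow>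
     ('s \<Rightarrow> 'o) \<times> ('s \<Rightarrow> 'm) \<times> ('s \<Rightarrow> 'm)" where
  "homogeneous_parts \<Gamma> C component Y =
     (SOME (Z, \<iota>, \<pi>). (\<forall>s\<in>carrier \<Gamma>. Z s \<in> component s) \<and> is_direct_sum C (carrier \<Gamma>) Z Y \<iota> \<pi>)"

text \<open>
  The morphism \<open>r'\<close> restricted to \<open>\<rho> g (Z s)\<close> lands in the summand of degree \<open>s \<triangleleft> g\<close>; the direct
  sum of morphisms over \<open>s\<close> is written as the sum of its entries.
\<close>

definition equivariant_tensor_structure ::
    "('g, 'a) monoid_scheme \<Rightarrow> ('s, 'b) monoid_scheme \<Rightarrow> ('s \<Rightarrow> 'g \<Rightarrow> 'g) \<Rightarrow> ('s \<Rightarrow> 'g \<Rightarrow> 's) \<Rightarrow>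
     ('o, 'm, 'k, 'z) tensor_cat_scheme \<Rightarrow> ('g, 's, 'o, 'm) crossed_action \<Rightarrow>
     'o \<Rightarrow> ('g \<Rightarrow> 'm) \<Rightarrow> 'o \<Rightarrow> ('g \<Rightarrow> 'm) \<Rightarrow> 'g \<Rightarrow> 'm" where
  "equivariant_tensor_structure G \<Gamma> lact ract C A X r Y r' =
     (\<lambda>g\<in>carrier G.
        let (Z, \<iota>, \<pi>) = homogeneous_parts \<Gamma> C (grade A) Y in
        finsum (hom_space C (fobj (rho A g) (X \<boxtimes>\<^bsub>C\<^esub> Y)) (X \<boxtimes>\<^bsub>C\<^esub> Y))
          (\<lambda>s. (ident C X \<boxtimes>\<^sub>m\<^bsub>C\<^esub> \<iota> (ract s g))
            \<cdot>\<^bsub>C\<^esub> (r (lact s g) \<boxtimes>\<^sub>m\<^bsub>C\<^esub> (\<pi> (ract s g) \<cdot>\<^bsub>C\<^esub> r' g \<cdot>\<^bsub>C\<^esub> farr (rho A g) (\<iota> s)))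
            \<cdot>\<^bsub>C\<^esub> gam A s g X (Z s)
            \<cdot>\<^bsub>C\<^esub> farr (rho A g) (ident C X \<boxtimes>\<^sub>m\<^bsub>C\<^esub> \<pi> s))
          (carrier \<Gamma>))"

type_synonym ('g, 'o, 'm) equiv_obj = "'o \<times> ('g \<Rightarrow> 'm)"
type_synonym ('g, 'o, 'm) equiv_arr =
  "('g, 'o, 'm) equiv_obj \<times> ('g, 'o, 'm) equiv_obj \<times> 'm"

definition equiv_objs ::
    "('g, 'a) monoid_scheme \<Rightarrow> ('o, 'm, 'k, 'z) lin_cat_scheme \<Rightarrow>
     ('g, 's, 'o, 'm) crossed_action \<Rightarrow> ('g, 'o, 'm) equiv_obj set" where
  "equiv_objs G C A = {(X, r). X \<in> obj C \<and> r \<in> extensional (carrier G) \<and>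
     (\<forall>g\<in>carrier G. r g \<in> Hom C (fobj (rho A g) X) X \<and> is_iso C (r g)) \<and>
     (\<forall>g\<in>carrier G. \<forall>h\<in>carrier G.
        r g \<cdot>\<^bsub>C\<^esub> farr (rho A g) (r h) = r (h \<otimes>\<^bsub>G\<^esub> g) \<cdot>\<^bsub>C\<^esub> rho2 A g h X) \<and>
     r \<one>\<^bsub>G\<^esub> \<cdot>\<^bsub>C\<^esub> rho0 A X = ident C X}"

definition equivariant_category ::
    "('g, 'a) monoid_scheme \<Rightarrow> ('s, 'b) monoid_scheme \<Rightarrow> ('s \<Rightarrow> 'g \<Rightarrow> 'g) \<Rightarrow> ('s \<Rightarrow> 'g \<Rightarrow> 's) \<Rightarrow>
     ('o, 'm, 'k, 'z) tensor_cat_scheme \<Rightarrow> ('g, 's, 'o, 'm) crossed_action \<Rightarrow>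
     (('g, 'o, 'm) equiv_obj, ('g, 'o, 'm) equiv_arr, 'k) tensor_cat" where
  "equivariant_category G \<Gamma> lact ract C A =
     \<lparr>obj = equiv_objs G C A,
      arr = {((X, r), (Y, r'), u). (X, r) \<in> equiv_objs G C A \<and> (Y, r') \<in> equiv_objs G C A \<and>
               u \<in> Hom C X Y \<and>
               (\<forall>g\<in>carrier G. u \<cdot>\<^bsub>C\<^esub> r g = r' g \<cdot>\<^bsub>C\<^esub> farr (rho A g) u)},
      src = (\<lambda>(V, W, u). V),
      tgt = (\<lambda>(V, W, u). W),
      ident = (\<lambda>V. (V, V, ident C (fst V))),
      cmp = (\<lambda>(V', W', v) (V, W, u). (V, W', v \<cdot>\<^bsub>C\<^esub> u)),
      hzero = (\<lambda>V W. (V, W, hzero C (fst V) (fst W))),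
      hadd = (\<lambda>(V, W, u) (V', W', v). (V, W, hadd C u v)),
      hscale = (\<lambda>a (V, W, u). (V, W, hscale C a u)),
      tobj = (\<lambda>(X, r) (Y, r'). (X \<boxtimes>\<^bsub>C\<^esub> Y, equivariant_tensor_structure G \<Gamma> lact ract C A X r Y r')),
      tarr = (\<lambda>((X, r), (X', r'), u) ((Y, q), (Y', q'), v).
         ((X \<boxtimes>\<^bsub>C\<^esub> Y, equivariant_tensor_structure G \<Gamma> lact ract C A X r Y q),
          (X' \<boxtimes>\<^bsub>C\<^esub> Y', equivariant_tensor_structure G \<Gamma> lact ract C A X' r' Y' q'),
          u \<boxtimes>\<^sub>m\<^bsub>C\<^esub> v)),
      tunit = (tunit C, \<lambda>g\<in>carrier G. gam0 A g)\<rparr>"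


section \<open>Module endofunctors\<close>

text \<open>
  The data of a strict left module category structure on \<open>M\<close> over \<open>D\<close>: the action on objects and
  on arrows.  The associativity and unit isomorphisms are identities.
\<close>

record ('d, 'e, 'o, 'm) module_structure =
  aobj :: "'d \<Rightarrow> 'o \<Rightarrow> 'o"
  aarr :: "'e \<Rightarrow> 'm \<Rightarrow> 'm"

record ('d, 'o, 'm) mod_functor = "('o, 'm, 'o, 'm) cat_functor" +
  mconstr :: "'d \<Rightarrow> 'o \<Rightarrow> 'm"

type_synonym ('d, 'o, 'm) mod_transf =
  "('d, 'o, 'm) mod_functor \<times> ('d, 'o, 'm) mod_functor \<times> ('o \<Rightarrow> 'm)"

text \<open>
  \<open>mconstr F V X\<close> is the structure isomorphism from \<open>F (V \<otimes> X)\<close> to \<open>V \<otimes> F X\<close>.  Extensionality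
  makes equality of functors the intended one, so that composition is strictly unital.
\<close>

definition module_functor ::
    "('d, 'e, 'k, 'y) tensor_cat_scheme \<Rightarrow> ('o, 'm, 'k, 'z) lin_cat_scheme \<Rightarrow>
     ('d, 'e, 'o, 'm) module_structure \<Rightarrow> ('d, 'o, 'm) mod_functor \<Rightarrow> bool" where
  "module_functor D M act F \<longleftrightarrow> linear_functor M M F \<and>
     fobj F \<in> extensional (obj M) \<and> farr F \<in> extensional (arr M) \<and>
     mconstr F \<in> extensional (obj D) \<and> (\<forall>V\<in>obj D. mconstr F V \<in> extensional (obj M)) \<and>
     (\<forall>V\<in>obj D. \<forall>X\<in>obj M.
        mconstr F V X \<in> Hom M (fobj F (aobj act V X)) (aobj act V (fobj F X)) \<and>
        is_iso M (mconstr F V X)) \<and>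
     (\<forall>u\<in>arr D. \<forall>f\<in>arr M.
        mconstr F (tgt D u) (tgt M f) \<cdot>\<^bsub>M\<^esub> farr F (aarr act u f) =
        aarr act u (farr F f) \<cdot>\<^bsub>M\<^esub> mconstr F (src D u) (src M f)) \<and>
     (\<forall>V\<in>obj D. \<forall>W\<in>obj D. \<forall>X\<in>obj M.
        mconstr F (V \<boxtimes>\<^bsub>D\<^esub> W) X =
        aarr act (ident D V) (mconstr F W X) \<cdot>\<^bsub>M\<^esub> mconstr F V (aobj act W X)) \<and>
     (\<forall>X\<in>obj M. mconstr F (tunit D) X = ident M (fobj F X))"

definition module_transformation ::
    "('d, 'e, 'k, 'y) tensor_cat_scheme \<Rightarrow> ('o, 'm, 'k, 'z) lin_cat_scheme \<Rightarrow>
     ('d, 'e, 'o, 'm) module_structure \<Rightarrow> ('d, 'o, 'm) mod_functor \<Rightarrow> ('d, 'o, 'm) mod_functor \<Rightarrow>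
     ('o \<Rightarrow> 'm) \<Rightarrow> bool" where
  "module_transformation D M act F F' \<alpha> \<longleftrightarrow>
     natural_transformation M M F F' \<alpha> \<and> \<alpha> \<in> extensional (obj M) \<and>
     (\<forall>V\<in>obj D. \<forall>X\<in>obj M.
        aarr act (ident D V) (\<alpha> X) \<cdot>\<^bsub>M\<^esub> mconstr F V X = mconstr F' V X \<cdot>\<^bsub>M\<^esub> \<alpha> (aobj act V X))"

definition module_functor_comp ::
    "('d, 'e, 'k, 'y) tensor_cat_scheme \<Rightarrow> ('o, 'm, 'k, 'z) lin_cat_scheme \<Rightarrow>
     ('d, 'o, 'm) mod_functor \<Rightarrow> ('d, 'o, 'm) mod_functor \<Rightarrow> ('d, 'o, 'm) mod_functor" where
  "module_functor_comp D M F F' =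
     \<lparr>fobj = (\<lambda>X\<in>obj M. fobj F (fobj F' X)),
      farr = (\<lambda>f\<in>arr M. farr F (farr F' f)),
      mconstr = (\<lambda>V\<in>obj D. \<lambda>X\<in>obj M.
        mconstr F V (fobj F' X) \<cdot>\<^bsub>M\<^esub> farr F (mconstr F' V X))\<rparr>"

text \<open>
  The category of right exact module endofunctors; its tensor product is composition, on arrows
  horizontal composition.
\<close>

definition module_endofunctors ::
    "('d, 'e, 'k, 'y) tensor_cat_scheme \<Rightarrow> ('o, 'm, 'k, 'z) lin_cat_scheme \<Rightarrow>
     ('d, 'e, 'o, 'm) module_structure \<Rightarrow>
     (('d, 'o, 'm) mod_functor, ('d, 'o, 'm) mod_transf, 'k) tensor_cat" where
  "module_endofunctors D M act =
     \<lparr>obj = {F. module_functor D M act F \<and> right_exact M M F},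
      arr = {(F, F', \<alpha>). module_functor D M act F \<and> right_exact M M F \<and>
               module_functor D M act F' \<and> right_exact M M F' \<and>
               module_transformation D M act F F' \<alpha>},
      src = (\<lambda>(F, F', \<alpha>). F),
      tgt = (\<lambda>(F, F', \<alpha>). F'),
      ident = (\<lambda>F. (F, F, \<lambda>X\<in>obj M. ident M (fobj F X))),
      cmp = (\<lambda>(F', F'', \<beta>) (F, F1, \<alpha>). (F, F'', \<lambda>X\<in>obj M. \<beta> X \<cdot>\<^bsub>M\<^esub> \<alpha> X)),
      hzero = (\<lambda>F F'. (F, F', \<lambda>X\<in>obj M. hzero M (fobj F X) (fobj F' X))),
      hadd = (\<lambda>(F, F', \<alpha>) (_, _, \<beta>). (F, F', \<lambda>X\<in>obj M. hadd M (\<alpha> X) (\<beta> X))),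
      hscale = (\<lambda>a (F, F', \<alpha>). (F, F', \<lambda>X\<in>obj M. hscale M a (\<alpha> X))),
      tobj = module_functor_comp D M,
      tarr = (\<lambda>(F, F', \<alpha>) (H, H', \<beta>).
         (module_functor_comp D M F H, module_functor_comp D M F' H',
          \<lambda>X\<in>obj M. \<alpha> (fobj H' X) \<cdot>\<^bsub>M\<^esub> farr F (\<beta> X))),
      tunit = \<lparr>fobj = (\<lambda>X\<in>obj M. X), farr = (\<lambda>f\<in>arr M. f),
               mconstr = (\<lambda>V\<in>obj D. \<lambda>X\<in>obj M. ident M (aobj act V X))\<rparr>\<rparr>"

definition forgetful_action ::
    "('o, 'm, 'k, 'z) tensor_cat_scheme \<Rightarrow>
     (('g, 'o, 'm) equiv_obj, ('g, 'o, 'm) equiv_arr, 'o, 'm) module_structure" where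
  "forgetful_action C =
     \<lparr>aobj = (\<lambda>(X, r) Y. X \<boxtimes>\<^bsub>C\<^esub> Y), aarr = (\<lambda>(V, W, u) f. u \<boxtimes>\<^sub>m\<^bsub>C\<^esub> f)\<rparr>"

definition crossed_dual ::
    "('g, 'a) monoid_scheme \<Rightarrow> ('s, 'b) monoid_scheme \<Rightarrow> ('s \<Rightarrow> 'g \<Rightarrow> 'g) \<Rightarrow> ('s \<Rightarrow> 'g \<Rightarrow> 's) \<Rightarrow>
     ('o, 'm, 'k, 'z) tensor_cat_scheme \<Rightarrow> ('g, 's, 'o, 'm) crossed_action \<Rightarrow>
     ((('g, 'o, 'm) equiv_obj, 'o, 'm) mod_functor,
      (('g, 'o, 'm) equiv_obj, 'o, 'm) mod_transf, 'k) tensor_cat" where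
  "crossed_dual G \<Gamma> lact ract C A =
     op_tensor (module_endofunctors (equivariant_category G \<Gamma> lact ract C A) C (forgetful_action C))"

text \<open>
  The functor sending \<open>X\<close> to right tensoring with \<open>X\<close>, with identity module structure, and \<open>f\<close> to
  right tensoring with \<open>f\<close>.
\<close>

definition right_mult_functor ::
    "('d, 'e, 'k, 'y) tensor_cat_scheme \<Rightarrow> ('o, 'm, 'k, 'z) tensor_cat_scheme \<Rightarrow>
     ('d, 'e, 'o, 'm) module_structure \<Rightarrow> 'o \<Rightarrow> ('d, 'o, 'm) mod_functor" where
  "right_mult_functor D C act X =
     \<lparr>fobj = (\<lambda>Y\<in>obj C. Y \<boxtimes>\<^bsub>C\<^esub> X),
      farr = (\<lambda>f\<in>arr C. f \<boxtimes>\<^sub>m\<^bsub>C\<^esub> ident C X),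
      mconstr = (\<lambda>V\<in>obj D. \<lambda>Y\<in>obj C. ident C (aobj act V Y \<boxtimes>\<^bsub>C\<^esub> X))\<rparr>"

definition right_mult_embedding ::
    "('g, 'a) monoid_scheme \<Rightarrow> ('s, 'b) monoid_scheme \<Rightarrow> ('s \<Rightarrow> 'g \<Rightarrow> 'g) \<Rightarrow> ('s \<Rightarrow> 'g \<Rightarrow> 's) \<Rightarrow>
     ('o, 'm, 'k, 'z) tensor_cat_scheme \<Rightarrow> ('g, 's, 'o, 'm) crossed_action \<Rightarrow>
     ('o, 'm, (('g, 'o, 'm) equiv_obj, 'o, 'm) mod_functor,
      (('g, 'o, 'm) equiv_obj, 'o, 'm) mod_transf) cat_functor" where
  "right_mult_embedding G \<Gamma> lact ract C A =
     (let R = right_mult_functor (equivariant_category G \<Gamma> lact ract C A) C (forgetful_action C) in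
      \<lparr>fobj = R,
       farr = (\<lambda>f. (R (src C f), R (tgt C f), \<lambda>Y\<in>obj C. ident C Y \<boxtimes>\<^sub>m\<^bsub>C\<^esub> f))\<rparr>)"

end

theory Submission
  imports Defs
begin

text \<open>
  Let \<open>B\<close> be the category of right exact module endofunctors of \<open>C\<close>, with \<open>F \<boxtimes> H\<close> being \<open>F\<close> followed by
  \<open>H\<close>.  It contains two families of objects.  The functor \<open>R X\<close> is right tensoring with \<open>X\<close>.  The
  functor \<open>T g\<close> is \<open>\<rho>\<close> at \<open>g\<close>; its module structure \<open>crossing g\<close> is \<open>\<gamma>\<close> followed, on the part of
  degree \<open>t\<close> of the argument, by the action of \<open>t \<triangleright> g\<close> on the equivariant object.  The axioms of a crossed
  action make it natural and multiplicative, and make \<open>\<rho>\<^sub>2\<close>, \<open>\<rho>\<^sub>0\<close> and \<open>\<gamma>\<close> transformations of module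
  functors (\<open>crossing_tensor\<close>, \<open>crossing_rho2\<close>, \<open>crossing_rho0\<close>, \<open>crossing_gam\<close>).

  Put \<open>\<Phi> g X = T g \<boxtimes> R X\<close>, the functor that sends \<open>Y\<close> to \<open>\<rho>\<close> at \<open>g\<close> of \<open>Y\<close>, tensored with \<open>X\<close>.  The
  heart of the proof is that every \<open>\<Phi> g\<close> is a fully faithful functor from \<open>C\<close> to \<open>B\<close>, that the images
  of different \<open>\<Phi> g\<close> are orthogonal, and that every object of \<open>B\<close> is a direct sum of objects \<open>\<Phi> g X\<close>.
  Thus, as a linear category, \<open>B\<close> is a power of \<open>C\<close> with exponent \<open>G\<close>.

  All three statements come from induced objects.  The direct sum \<open>Ind Y\<close> of the \<open>\<rho>\<close> at \<open>x\<close> of \<open>Y\<close>, for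
  \<open>x\<close> in \<open>G\<close>, is equivariant, the group permuting the summands, and \<open>Y\<close> is naturally a retract of it.
  On equivariant objects a module transformation is determined by its component at the unit, hence it is so on all
  objects (\<open>eq_at_tunit\<close>); the component at the unit of a transformation from \<open>\<Phi> g X\<close> to \<open>\<Phi> h Y\<close> is
  essentially an arrow from \<open>X\<close> to \<open>Y\<close>, and comparing the summands of \<open>Ind 1\<close> shows that it vanishes
  unless \<open>g = h\<close> (\<open>\<Phi>_fully_faithful\<close>, \<open>\<Phi>_orthogonal\<close>).  For a module functor \<open>F\<close>, the module
  structure identifies \<open>F (Ind Y)\<close> with \<open>Ind Y \<otimes> F 1\<close>.  So \<open>F\<close> is a retract of the direct sum of the
  \<open>\<Phi> g (F 1)\<close>; the idempotent is diagonal by orthogonality, and its entries are idempotents of \<open>F 1\<close>,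
  which split (\<open>decomposition_exists\<close>).

  Consequently \<open>B\<close> inherits from \<open>C\<close> the abelian structure, finite length and finite-dimensional Hom spaces.
  It has duals because \<open>T g\<close> is invertible, \<open>R\<close> preserves duals, and duals pass to tensor products and direct
  sums.  The component of degree \<open>(g, s)\<close> consists of the objects isomorphic to \<open>\<Phi> g X\<close> with \<open>X\<close> of
  degree \<open>s\<close>.  From \<open>\<rho>\<^sub>2\<close> one has \<open>T g \<boxtimes> T h \<cong> T (g h)\<close>, and from \<open>\<gamma>\<close> one has
  \<open>R X \<boxtimes> T h \<cong> T (s \<triangleright> h) \<boxtimes> R X'\<close> with \<open>X'\<close> of degree \<open>s \<triangleleft> h\<close>; hence the degrees multiply as in the
  bicrossed product.  Since \<open>T 1\<close> is isomorphic to the unit, the neutral component is the image of the neutral component of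
  \<open>C\<close>, and since \<open>\<Phi> g X\<close> is zero only if \<open>X\<close> is, one grading is faithful if and only if the other is.
\<close>

section \<open>Linear categories\<close>

context linear_category
begin

abbreviation idm :: "'o \<Rightarrow> 'm" where "idm \<equiv> ident C"

abbreviation hsum :: "'o \<Rightarrow> 'o \<Rightarrow> ('i \<Rightarrow> 'm) \<Rightarrow> 'i set \<Rightarrow> 'm" where
  "hsum X Y f I \<equiv> finsum (hom_space C X Y) f I"

lemma in_Hom [simp]: "f \<in> Hom C X Y \<longleftrightarrow> f \<in> arr C \<and> src C f = X \<and> tgt C f = Y"
  by (simp add: Hom_def)

lemmas src_closed [simp] = src_closed and tgt_closed [simp] = tgt_closed

lemma ident_arr [simp]:
  "X \<in> obj C \<Longrightarrow> idm X \<in> arr C" "X \<in> obj C \<Longrightarrow> src C (idm X) = X" "X \<in> obj C \<Longrightarrow> tgt C (idm X) = X"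
  using ident_hom by auto

lemma cmp_arr [simp]:
  assumes "f \<in> arr C" "g \<in> arr C" "src C g = tgt C f"
  shows "g \<cdot> f \<in> arr C" "src C (g \<cdot> f) = src C f" "tgt C (g \<cdot> f) = tgt C g"
  using cmp_hom[of f "src C f" "tgt C f" g "tgt C g"] assms by auto

lemma cmp_ids [simp]:
  "\<lbrakk>f \<in> arr C; tgt C f = X\<rbrakk> \<Longrightarrow> idm X \<cdot> f = f"
  "\<lbrakk>f \<in> arr C; src C f = X\<rbrakk> \<Longrightarrow> f \<cdot> idm X = f"
  using ident_cmp[of f] cmp_ident[of f] by auto

lemma assoc [simp]:
  "\<lbrakk>f \<in> arr C; g \<in> arr C; h \<in> arr C; src C g = tgt C f; src C h = tgt C g\<rbrakk>
   \<Longrightarrow> (h \<cdot> g) \<cdot> f = h \<cdot> (g \<cdot> f)"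
  using cmp_assoc[of f "src C f" "tgt C f" g "tgt C g" h "tgt C h"] by auto

text \<open>
  Composites are normalised by nesting to the right, so an equation for \<open>a \<cdot> b\<close> rewrites inside a longer
  composite only after it has been extended by the remaining factor \<open>z\<close>.
\<close>

lemma extend:
  assumes "a \<cdot> b = w" "a \<in> arr C" "b \<in> arr C" "z \<in> arr C" "src C a = tgt C b" "src C b = tgt C z"
  shows "a \<cdot> (b \<cdot> z) = w \<cdot> z"
  using assms by (metis assoc)

lemma hom_space_simps:
  "carrier (hom_space C X Y) = Hom C X Y" "\<zero>\<^bsub>hom_space C X Y\<^esub> = hzero C X Y"
  "f \<oplus>\<^bsub>hom_space C X Y\<^esub> g = hadd C f g" "a \<odot>\<^bsub>hom_space C X Y\<^esub> f = hscale C a f"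
  by (simp_all add: hom_space_def)

lemma hom_abelian: "\<lbrakk>X \<in> obj C; Y \<in> obj C\<rbrakk> \<Longrightarrow> abelian_group (hom_space C X Y)"
  using hom_space by (simp add: Module.module_def)

lemma scalars_simps:
  "\<zero>\<^bsub>scalars\<^esub> = 0" "\<one>\<^bsub>scalars\<^esub> = 1" "carrier scalars = UNIV"
  "a \<oplus>\<^bsub>scalars\<^esub> b = a + b" "a \<otimes>\<^bsub>scalars\<^esub> b = a * b"
  by (simp_all add: scalars_def)

lemma hzero_arr [simp]:
  assumes "X \<in> obj C" "Y \<in> obj C"
  shows "hzero C X Y \<in> arr C" "src C (hzero C X Y) = X" "tgt C (hzero C X Y) = Y"
  using abelian_monoid.zero_closed[OF abelian_group.axioms(1)[OF hom_abelian[OF assms]]]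
  by (auto simp: hom_space_simps)

lemma hadd_arr [simp]:
  assumes "f \<in> arr C" "g \<in> arr C" "src C f = src C g" "tgt C f = tgt C g"
  shows "hadd C f g \<in> arr C" "src C (hadd C f g) = src C g" "tgt C (hadd C f g) = tgt C g"
  using abelian_monoid.a_closed[OF abelian_group.axioms(1)[OF hom_abelian[of "src C g" "tgt C g"]], of f g] assms
  by (auto simp: hom_space_simps)

lemma hscale_arr [simp]:
  assumes "f \<in> arr C"
  shows "hscale C a f \<in> arr C" "src C (hscale C a f) = src C f" "tgt C (hscale C a f) = tgt C f"
  using Module.module.smult_closed[OF hom_space[of "src C f" "tgt C f"], of a f] assms
  by (auto simp: hom_space_simps scalars_simps)

lemma hscale_zero [simp]: "f \<in> arr C \<Longrightarrow> hscale C 0 f = hzero C (src C f) (tgt C f)"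
  using Module.module.smult_l_null[OF hom_space[of "src C f" "tgt C f"], of f]
  by (auto simp: hom_space_simps scalars_simps)

lemma hscale_one [simp]: "f \<in> arr C \<Longrightarrow> hscale C 1 f = f"
  using Module.module.smult_one[OF hom_space[of "src C f" "tgt C f"], of f]
  by (auto simp: hom_space_simps scalars_simps)

lemma hscale_mult: "f \<in> arr C \<Longrightarrow> hscale C (a * b) f = hscale C a (hscale C b f)"
  using Module.module.smult_assoc1[OF hom_space[of "src C f" "tgt C f"], of a b f]
  by (auto simp: hom_space_simps scalars_simps)

lemma hscale_add: "f \<in> arr C \<Longrightarrow> hscale C (a + b) f = hadd C (hscale C a f) (hscale C b f)"
  using Module.module.smult_l_distr[OF hom_space[of "src C f" "tgt C f"], of a b f]
  by (auto simp: hom_space_simps scalars_simps)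

lemma hscale_hadd:
  "\<lbrakk>f \<in> arr C; g \<in> arr C; src C f = src C g; tgt C f = tgt C g\<rbrakk>
   \<Longrightarrow> hscale C a (hadd C f g) = hadd C (hscale C a f) (hscale C a g)"
  using Module.module.smult_r_distr[OF hom_space[of "src C f" "tgt C f"], of a f g]
  by (auto simp: hom_space_simps scalars_simps)

lemma hadd_hzero [simp]:
  assumes "f \<in> arr C" "src C f = X" "tgt C f = Y"
  shows "hadd C f (hzero C X Y) = f" "hadd C (hzero C X Y) f = f"
proof -
  interpret abelian_group "hom_space C X Y" using hom_abelian assms by auto
  show "hadd C f (hzero C X Y) = f" "hadd C (hzero C X Y) f = f"
    using r_zero[of f] l_zero[of f] assms by (auto simp: hom_space_simps)
qed

lemma hadd_commute:
  assumes "f \<in> arr C" "g \<in> arr C" "src C f = src C g" "tgt C f = tgt C g"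
  shows "hadd C f g = hadd C g f"
proof -
  interpret abelian_group "hom_space C (src C g) (tgt C g)" using hom_abelian assms by auto
  show ?thesis using a_comm[of f g] assms by (auto simp: hom_space_simps)
qed

lemma hadd_assoc:
  assumes "f \<in> arr C" "g \<in> arr C" "h \<in> arr C" "src C f = src C g" "tgt C f = tgt C g"
    "src C h = src C g" "tgt C h = tgt C g"
  shows "hadd C (hadd C f g) h = hadd C f (hadd C g h)"
proof -
  interpret abelian_group "hom_space C (src C g) (tgt C g)" using hom_abelian assms by auto
  show ?thesis using a_assoc[of f g h] assms by (auto simp: hom_space_simps)
qed

lemma cmp_hadd:
  "\<lbrakk>f \<in> arr C; g \<in> arr C; g' \<in> arr C; src C g = tgt C f; src C g' = tgt C f; tgt C g = tgt C g'\<rbrakk>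
   \<Longrightarrow> hadd C g g' \<cdot> f = hadd C (g \<cdot> f) (g' \<cdot> f)"
  "\<lbrakk>f \<in> arr C; f' \<in> arr C; g \<in> arr C; src C g = tgt C f; tgt C f' = tgt C f; src C f = src C f'\<rbrakk>
   \<Longrightarrow> g \<cdot> hadd C f f' = hadd C (g \<cdot> f) (g \<cdot> f')"
  using cmp_hadd_left[of f "src C f" "tgt C f" g "tgt C g" g'] cmp_hadd_right[of f "src C f" "tgt C f" f' g "tgt C g"]
  by auto

lemma cmp_hscale:
  "\<lbrakk>f \<in> arr C; g \<in> arr C; src C g = tgt C f\<rbrakk> \<Longrightarrow> hscale C a g \<cdot> f = hscale C a (g \<cdot> f)"
  "\<lbrakk>f \<in> arr C; g \<in> arr C; src C g = tgt C f\<rbrakk> \<Longrightarrow> g \<cdot> hscale C a f = hscale C a (g \<cdot> f)"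
  using cmp_hscale_left[of f "src C f" "tgt C f" g "tgt C g"] cmp_hscale_right[of f "src C f" "tgt C f" g "tgt C g"]
  by auto

lemma cmp_hzero [simp]:
  "\<lbrakk>g \<in> arr C; src C g = Y; X \<in> obj C\<rbrakk> \<Longrightarrow> g \<cdot> hzero C X Y = hzero C X (tgt C g)"
  "\<lbrakk>f \<in> arr C; tgt C f = Y; Z \<in> obj C\<rbrakk> \<Longrightarrow> hzero C Y Z \<cdot> f = hzero C (src C f) Z"
proof -
  assume a: "g \<in> arr C" "src C g = Y" "X \<in> obj C"
  have "g \<cdot> hscale C 0 (hzero C X Y) = hscale C 0 (g \<cdot> hzero C X Y)"
    using a by (intro cmp_hscale) auto
  then show "g \<cdot> hzero C X Y = hzero C X (tgt C g)" using a by auto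
next
  assume a: "f \<in> arr C" "tgt C f = Y" "Z \<in> obj C"
  have "hscale C 0 (hzero C Y Z) \<cdot> f = hscale C 0 (hzero C Y Z \<cdot> f)"
    using a by (intro cmp_hscale) auto
  then show "hzero C Y Z \<cdot> f = hzero C (src C f) Z" using a by auto
qed

lemma hscale_hzero [simp]:
  assumes "X \<in> obj C" "Y \<in> obj C" shows "hscale C a (hzero C X Y) = hzero C X Y"
  using hscale_mult[of "hzero C X Y" a 0] assms by simp

subsection \<open>Finite sums of arrows\<close>

lemma hsum_closed:
  assumes "X \<in> obj C" "Y \<in> obj C" "\<And>i. i \<in> I \<Longrightarrow> f i \<in> Hom C X Y"
  shows "hsum X Y f I \<in> Hom C X Y"
proof -
  interpret abelian_group "hom_space C X Y" using hom_abelian assms by auto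
  show ?thesis using finsum_closed[of f I] assms(3) by (auto simp: hom_space_simps simp del: in_Hom)
qed

lemma hsum_arr [simp]:
  assumes "X \<in> obj C" "Y \<in> obj C" "\<And>i. i \<in> I \<Longrightarrow> f i \<in> arr C \<and> src C (f i) = X \<and> tgt C (f i) = Y"
  shows "hsum X Y f I \<in> arr C" "src C (hsum X Y f I) = X" "tgt C (hsum X Y f I) = Y"
  using hsum_closed[of X Y I f] assms by auto

lemma hsum_empty [simp]: "X \<in> obj C \<Longrightarrow> Y \<in> obj C \<Longrightarrow> hsum X Y f {} = hzero C X Y"
proof -
  assume "X \<in> obj C" "Y \<in> obj C"
  then interpret abelian_group "hom_space C X Y" using hom_abelian by auto
  show ?thesis by (simp add: hom_space_simps)
qed

lemma hsum_insert:
  assumes "finite I" "k \<notin> I" "X \<in> obj C" "Y \<in> obj C"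
    "f k \<in> arr C" "src C (f k) = X" "tgt C (f k) = Y"
    "\<And>i. i \<in> I \<Longrightarrow> f i \<in> arr C \<and> src C (f i) = X \<and> tgt C (f i) = Y"
  shows "hsum X Y f (insert k I) = hadd C (f k) (hsum X Y f I)"
proof -
  interpret abelian_group "hom_space C X Y" using hom_abelian assms by auto
  show ?thesis using finsum_insert[of I k f] assms by (auto simp: hom_space_simps)
qed

lemma hsum_cong:
  assumes "X \<in> obj C" "Y \<in> obj C"
    "\<And>i. i \<in> I \<Longrightarrow> f i \<in> arr C \<and> src C (f i) = X \<and> tgt C (f i) = Y" "\<And>i. i \<in> I \<Longrightarrow> g i = f i"
  shows "hsum X Y g I = hsum X Y f I"
proof -
  interpret abelian_group "hom_space C X Y" using hom_abelian assms by auto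
  show ?thesis by (rule finsum_cong') (use assms in \<open>auto simp: hom_space_simps\<close>)
qed

lemma cmp_hsum:
  assumes "finite I" "X \<in> obj C" "Y \<in> obj C" "g \<in> arr C" "src C g = Y"
    "\<And>i. i \<in> I \<Longrightarrow> f i \<in> arr C \<and> src C (f i) = X \<and> tgt C (f i) = Y"
  shows "g \<cdot> hsum X Y f I = hsum X (tgt C g) (\<lambda>i. g \<cdot> f i) I"
  using assms(1,6)
proof (induction I)
  case empty then show ?case using assms by simp
next
  case (insert k I) then show ?case using assms by (simp add: hsum_insert cmp_hadd)
qed

lemma hsum_cmp:
  assumes "finite I" "X \<in> obj C" "Y \<in> obj C" "g \<in> arr C" "tgt C g = X"
    "\<And>i. i \<in> I \<Longrightarrow> f i \<in> arr C \<and> src C (f i) = X \<and> tgt C (f i) = Y"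
  shows "hsum X Y f I \<cdot> g = hsum (src C g) Y (\<lambda>i. f i \<cdot> g) I"
  using assms(1,6)
proof (induction I)
  case empty then show ?case using assms by simp
next
  case (insert k I) then show ?case using assms by (simp add: hsum_insert cmp_hadd)
qed

lemma hsum_zeros:
  assumes "finite I" "X \<in> obj C" "Y \<in> obj C" "\<And>i. i \<in> I \<Longrightarrow> f i = hzero C X Y"
  shows "hsum X Y f I = hzero C X Y"
  using assms(1,4)
proof (induction I)
  case empty then show ?case using assms by simp
next
  case (insert k I) then show ?case using assms by (simp add: hsum_insert)
qed

lemma hsum_single:
  assumes "finite I" "k \<in> I" "X \<in> obj C" "Y \<in> obj C" "f k \<in> arr C" "src C (f k) = X" "tgt C (f k) = Y"
    "\<And>i. i \<in> I \<Longrightarrow> i \<noteq> k \<Longrightarrow> f i = hzero C X Y"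
  shows "hsum X Y f I = f k"
proof -
  have e: "I = insert k (I - {k})" using assms by auto
  have ar: "\<And>i. i \<in> insert k (I - {k}) \<Longrightarrow> f i \<in> arr C \<and> src C (f i) = X \<and> tgt C (f i) = Y"
    using assms by (metis DiffD1 Diff_iff hzero_arr insertE insertI1)
  have "hsum X Y f (insert k (I - {k})) = hadd C (f k) (hsum X Y f (I - {k}))"
    using assms ar by (intro hsum_insert) auto
  also have "hsum X Y f (I - {k}) = hzero C X Y" using assms by (intro hsum_zeros) auto
  finally show ?thesis using e assms by simp
qed

lemma hscale_hsum:
  assumes "finite I" "X \<in> obj C" "Y \<in> obj C"
    "\<And>i. i \<in> I \<Longrightarrow> f i \<in> arr C \<and> src C (f i) = X \<and> tgt C (f i) = Y"
  shows "hscale C a (hsum X Y f I) = hsum X Y (\<lambda>i. hscale C a (f i)) I"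
  using assms(1,4)
proof (induction I)
  case empty then show ?case using assms by simp
next
  case (insert k I) then show ?case using assms by (simp add: hsum_insert hscale_hadd)
qed

lemma hsum_hadd:
  assumes "finite I" "X \<in> obj C" "Y \<in> obj C"
    "\<And>i. i \<in> I \<Longrightarrow> f i \<in> arr C \<and> src C (f i) = X \<and> tgt C (f i) = Y"
    "\<And>i. i \<in> I \<Longrightarrow> g i \<in> arr C \<and> src C (g i) = X \<and> tgt C (g i) = Y"
  shows "hsum X Y (\<lambda>i. hadd C (f i) (g i)) I = hadd C (hsum X Y f I) (hsum X Y g I)"
proof -
  interpret abelian_group "hom_space C X Y" using hom_abelian assms by auto
  show ?thesis using finsum_addf[of f I g] assms by (auto simp: hom_space_simps)
qed

subsection \<open>Isomorphisms\<close>

definition inv_arr :: "'m \<Rightarrow> 'm" where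
  "inv_arr f = (SOME g. g \<in> Hom C (tgt C f) (src C f) \<and> g \<cdot> f = idm (src C f) \<and> f \<cdot> g = idm (tgt C f))"

lemma inv_arr_aux:
  assumes "is_iso C f"
  shows "inv_arr f \<in> Hom C (tgt C f) (src C f) \<and> inv_arr f \<cdot> f = idm (src C f) \<and> f \<cdot> inv_arr f = idm (tgt C f)"
  unfolding inv_arr_def by (rule someI_ex) (use assms in \<open>unfold is_iso_def; blast\<close>)

lemma iso_arr: "is_iso C f \<Longrightarrow> f \<in> arr C" by (simp add: is_iso_def)

lemma inv_arr [simp]:
  assumes "is_iso C f"
  shows "inv_arr f \<in> arr C" "src C (inv_arr f) = tgt C f" "tgt C (inv_arr f) = src C f"
    "inv_arr f \<cdot> f = idm (src C f)" "f \<cdot> inv_arr f = idm (tgt C f)"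
  using inv_arr_aux[OF assms] by auto

lemma inv_arr_cancel [simp]:
  assumes "is_iso C f" "z \<in> arr C"
  shows "tgt C z = src C f \<Longrightarrow> inv_arr f \<cdot> (f \<cdot> z) = z" "tgt C z = tgt C f \<Longrightarrow> f \<cdot> (inv_arr f \<cdot> z) = z"
  using extend[OF inv_arr(4)[OF assms(1)], of z] extend[OF inv_arr(5)[OF assms(1)], of z] assms iso_arr
  by auto

lemma isoI:
  assumes "f \<in> arr C" "g \<in> arr C" "src C g = tgt C f" "tgt C g = src C f"
    "g \<cdot> f = idm (src C f)" "f \<cdot> g = idm (tgt C f)"
  shows "is_iso C f"
  using assms by (auto simp: is_iso_def)

lemma iso_ident [simp]: "X \<in> obj C \<Longrightarrow> is_iso C (idm X)" by (rule isoI[of _ "idm X"]) auto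

lemma iso_inv [simp]: "is_iso C f \<Longrightarrow> is_iso C (inv_arr f)"
  using iso_arr[of f] by (intro isoI[of _ f]) auto

lemma iso_cmp [simp]:
  assumes "is_iso C f" "is_iso C g" "src C g = tgt C f" shows "is_iso C (g \<cdot> f)"
  using assms iso_arr[of f] iso_arr[of g] by (intro isoI[of _ "inv_arr f \<cdot> inv_arr g"]) auto

lemma isomorphic_sym:
  assumes "isomorphic C X Y" shows "isomorphic C Y X"
proof -
  obtain f where "f \<in> Hom C X Y" "is_iso C f" using assms by (auto simp: isomorphic_def)
  then show ?thesis unfolding isomorphic_def by (intro bexI[of _ "inv_arr f"]) auto
qed

lemma isomorphic_trans:
  assumes "isomorphic C X Y" "isomorphic C Y Z" shows "isomorphic C X Z"
proof -
  obtain f g where "f \<in> Hom C X Y" "is_iso C f" "g \<in> Hom C Y Z" "is_iso C g"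
    using assms by (auto simp: isomorphic_def)
  then show ?thesis unfolding isomorphic_def by (intro bexI[of _ "g \<cdot> f"]) auto
qed

lemma isomorphic_refl: "X \<in> obj C \<Longrightarrow> isomorphic C X X"
  unfolding isomorphic_def by (rule bexI[of _ "idm X"]) auto

lemma iso_cancel_left:
  assumes "is_iso C a" "f \<in> arr C" "g \<in> arr C" "tgt C f = src C a" "tgt C g = src C a" "a \<cdot> f = a \<cdot> g"
  shows "f = g"
proof -
  have "inv_arr a \<cdot> a \<cdot> f = inv_arr a \<cdot> a \<cdot> g" using assms(6) by simp
  then show ?thesis using assms(1-5) by simp
qed

lemma iso_cancel_right:
  assumes "is_iso C a" "f \<in> arr C" "g \<in> arr C" "src C f = tgt C a" "src C g = tgt C a" "f \<cdot> a = g \<cdot> a"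
  shows "f = g"
proof -
  have "(f \<cdot> a) \<cdot> inv_arr a = (g \<cdot> a) \<cdot> inv_arr a" using assms(6) by simp
  then show ?thesis using assms(1-5) iso_arr[of a] by simp
qed

lemma inv_arr_unique:
  assumes "is_iso C f" "g \<in> arr C" "src C g = tgt C f" "tgt C g = src C f" "f \<cdot> g = idm (tgt C f)"
  shows "g = inv_arr f"
  by (rule iso_cancel_left[of f]) (use assms in auto)

subsection \<open>Zero objects\<close>

lemma ident_hzero_arr:
  assumes "idm Z = hzero C Z Z" "f \<in> arr C"
  shows "src C f = Z \<Longrightarrow> f = hzero C Z (tgt C f)" "tgt C f = Z \<Longrightarrow> f = hzero C (src C f) Z"
proof -
  assume "src C f = Z"
  then have "f \<cdot> idm Z = hzero C Z (tgt C f)" using assms by (subst assms(1)) auto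
  then show "f = hzero C Z (tgt C f)" using assms(2) \<open>src C f = Z\<close> by simp
next
  assume "tgt C f = Z"
  then have "idm Z \<cdot> f = hzero C (src C f) Z" using assms by (subst assms(1)) auto
  then show "f = hzero C (src C f) Z" using assms(2) \<open>tgt C f = Z\<close> by simp
qed

lemma zero_obj_iff: "is_zero_obj C Z \<longleftrightarrow> Z \<in> obj C \<and> idm Z = hzero C Z Z"
proof
  assume z: "is_zero_obj C Z"
  then have Z: "Z \<in> obj C" and "\<exists>!f. f \<in> Hom C Z Z" by (auto simp: is_zero_obj_def)
  moreover have "idm Z \<in> Hom C Z Z" "hzero C Z Z \<in> Hom C Z Z" using Z by auto
  ultimately show "Z \<in> obj C \<and> idm Z = hzero C Z Z" by blast
next
  assume a: "Z \<in> obj C \<and> idm Z = hzero C Z Z"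
  have "\<exists>!f. f \<in> Hom C X Z" if "X \<in> obj C" for X
  proof (rule ex1I[of _ "hzero C X Z"])
    fix f assume "f \<in> Hom C X Z"
    then show "f = hzero C X Z" using ident_hzero_arr(2)[of Z f] a by simp
  qed (use a that in simp)
  moreover have "\<exists>!f. f \<in> Hom C Z X" if "X \<in> obj C" for X
  proof (rule ex1I[of _ "hzero C Z X"])
    fix f assume "f \<in> Hom C Z X"
    then show "f = hzero C Z X" using ident_hzero_arr(1)[of Z f] a by simp
  qed (use a that in simp)
  ultimately have "(\<exists>!f. f \<in> Hom C X Z) \<and> (\<exists>!f. f \<in> Hom C Z X)" if "X \<in> obj C" for X
    using that by blast
  then show "is_zero_obj C Z" unfolding is_zero_obj_def using a by blast
qed

lemma zero_obj_arr:
  assumes "is_zero_obj C Z" "f \<in> arr C"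
  shows "src C f = Z \<Longrightarrow> f = hzero C Z (tgt C f)" "tgt C f = Z \<Longrightarrow> f = hzero C (src C f) Z"
  using ident_hzero_arr[of Z f] assms(2) assms(1)[unfolded zero_obj_iff] by blast+

lemma zero_obj_iso: "is_zero_obj C Z \<Longrightarrow> isomorphic C Z X \<Longrightarrow> is_zero_obj C X"
proof -
  assume z: "is_zero_obj C Z" and "isomorphic C Z X"
  then obtain f where f: "f \<in> arr C" "src C f = Z" "tgt C f = X" "is_iso C f" by (auto simp: isomorphic_def)
  have X: "X \<in> obj C" using f tgt_closed by blast
  have "idm X = f \<cdot> idm Z \<cdot> inv_arr f" using f by simp
  also have "\<dots> = hzero C X X" using f z X unfolding zero_obj_iff by simp
  finally show ?thesis using X by (auto simp: zero_obj_iff)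
qed

lemma zero_objs_iso: "is_zero_obj C Z \<Longrightarrow> is_zero_obj C Z' \<Longrightarrow> isomorphic C Z Z'"
  unfolding isomorphic_def
  by (rule bexI[of _ "hzero C Z Z'"], rule isoI[of _ "hzero C Z' Z"]) (auto simp: zero_obj_iff)

subsection \<open>Direct sums\<close>

lemma direct_sumD:
  assumes "is_direct_sum C I Z Y \<iota> \<pi>"
  shows "Y \<in> obj C" "hsum Y Y (\<lambda>i. \<iota> i \<cdot> \<pi> i) I = idm Y"
    "i \<in> I \<Longrightarrow> Z i \<in> obj C" "i \<in> I \<Longrightarrow> \<iota> i \<in> arr C" "i \<in> I \<Longrightarrow> src C (\<iota> i) = Z i"
    "i \<in> I \<Longrightarrow> tgt C (\<iota> i) = Y" "i \<in> I \<Longrightarrow> \<pi> i \<in> arr C" "i \<in> I \<Longrightarrow> src C (\<pi> i) = Y"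
    "i \<in> I \<Longrightarrow> tgt C (\<pi> i) = Z i"
    "i \<in> I \<Longrightarrow> \<pi> i \<cdot> \<iota> i = idm (Z i)" "i \<in> I \<Longrightarrow> j \<in> I \<Longrightarrow> i \<noteq> j \<Longrightarrow> \<pi> i \<cdot> \<iota> j = hzero C (Z j) (Z i)"
  using assms unfolding is_direct_sum_def by auto

lemma direct_sum_cancel:
  assumes "is_direct_sum C I Z Y \<iota> \<pi>" "i \<in> I" "z \<in> arr C"
  shows "tgt C z = Z i \<Longrightarrow> \<pi> i \<cdot> (\<iota> i \<cdot> z) = z"
    "tgt C z = Z j \<Longrightarrow> j \<in> I \<Longrightarrow> i \<noteq> j \<Longrightarrow> \<pi> i \<cdot> (\<iota> j \<cdot> z) = hzero C (src C z) (Z i)"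
  using extend[OF direct_sumD(10)[OF assms(1,2)], of z] extend[OF direct_sumD(11)[OF assms(1,2)], of j z]
    direct_sumD[OF assms(1)] assms by simp_all

lemma direct_sum_ext_src:
  assumes "finite I" "is_direct_sum C I Z Y \<iota> \<pi>" "f \<in> arr C" "g \<in> arr C" "src C f = Y" "src C g = Y"
    "tgt C f = tgt C g" "\<And>i. i \<in> I \<Longrightarrow> f \<cdot> \<iota> i = g \<cdot> \<iota> i"
  shows "f = g"
proof -
  note d = direct_sumD[OF assms(2)]
  have *: "h = hsum Y (tgt C h) (\<lambda>i. (h \<cdot> \<iota> i) \<cdot> \<pi> i) I" if "h \<in> arr C" "src C h = Y" for h
  proof -
    have "h = h \<cdot> hsum Y Y (\<lambda>i. \<iota> i \<cdot> \<pi> i) I" using that d by simp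
    also have "\<dots> = hsum Y (tgt C h) (\<lambda>i. h \<cdot> \<iota> i \<cdot> \<pi> i) I" using that d assms(1) by (intro cmp_hsum) auto
    also have "\<dots> = hsum Y (tgt C h) (\<lambda>i. (h \<cdot> \<iota> i) \<cdot> \<pi> i) I" using that d by (intro hsum_cong) auto
    finally show ?thesis .
  qed
  have "hsum Y (tgt C g) (\<lambda>i. (f \<cdot> \<iota> i) \<cdot> \<pi> i) I = hsum Y (tgt C g) (\<lambda>i. (g \<cdot> \<iota> i) \<cdot> \<pi> i) I"
    using assms d by (intro hsum_cong) auto
  then show ?thesis using *[of f] *[of g] assms by simp
qed

lemma direct_sum_ext_tgt:
  assumes "finite I" "is_direct_sum C I Z Y \<iota> \<pi>" "f \<in> arr C" "g \<in> arr C" "tgt C f = Y" "tgt C g = Y"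
    "src C f = src C g" "\<And>i. i \<in> I \<Longrightarrow> \<pi> i \<cdot> f = \<pi> i \<cdot> g"
  shows "f = g"
proof -
  note d = direct_sumD[OF assms(2)]
  have *: "h = hsum (src C h) Y (\<lambda>i. \<iota> i \<cdot> (\<pi> i \<cdot> h)) I" if "h \<in> arr C" "tgt C h = Y" for h
  proof -
    have "h = hsum Y Y (\<lambda>i. \<iota> i \<cdot> \<pi> i) I \<cdot> h" using that d by simp
    also have "\<dots> = hsum (src C h) Y (\<lambda>i. (\<iota> i \<cdot> \<pi> i) \<cdot> h) I" using that d assms(1) by (intro hsum_cmp) auto
    also have "\<dots> = hsum (src C h) Y (\<lambda>i. \<iota> i \<cdot> (\<pi> i \<cdot> h)) I" using that d by (intro hsum_cong) auto
    finally show ?thesis .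
  qed
  have "hsum (src C g) Y (\<lambda>i. \<iota> i \<cdot> (\<pi> i \<cdot> f)) I = hsum (src C g) Y (\<lambda>i. \<iota> i \<cdot> (\<pi> i \<cdot> g)) I"
    using assms d by (intro hsum_cong) auto
  then show ?thesis using *[of f] *[of g] assms by simp
qed

lemma direct_sum_hsum_iota:
  assumes "finite I" "is_direct_sum C I Z Y \<iota> \<pi>" "j \<in> I" "W \<in> obj C"
    "\<And>i. i \<in> I \<Longrightarrow> f i \<in> arr C \<and> src C (f i) = Z i \<and> tgt C (f i) = W"
  shows "hsum Y W (\<lambda>i. f i \<cdot> \<pi> i) I \<cdot> \<iota> j = f j"
proof -
  note d = direct_sumD[OF assms(2)]
  have "hsum Y W (\<lambda>i. f i \<cdot> \<pi> i) I \<cdot> \<iota> j = hsum (Z j) W (\<lambda>i. (f i \<cdot> \<pi> i) \<cdot> \<iota> j) I"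
    using d assms by (subst hsum_cmp) auto
  also have "\<dots> = (f j \<cdot> \<pi> j) \<cdot> \<iota> j" using d assms by (intro hsum_single) auto
  also have "\<dots> = f j" using d assms by simp
  finally show ?thesis .
qed

text \<open>The inverse is the diagonal sum of the inverses of the entries.\<close>

lemma direct_sum_diagonal_iso:
  assumes "finite I" "is_direct_sum C I Z Y \<iota> \<pi>" "is_direct_sum C I Z' Y' \<iota>' \<pi>'"
    "f \<in> arr C" "src C f = Y" "tgt C f = Y'"
    "\<And>i. i \<in> I \<Longrightarrow> is_iso C (\<phi> i) \<and> src C (\<phi> i) = Z i \<and> tgt C (\<phi> i) = Z' i \<and> f \<cdot> \<iota> i = \<iota>' i \<cdot> \<phi> i"
  shows "is_iso C f"
proof -
  note d = direct_sumD[OF assms(2)] and d' = direct_sumD[OF assms(3)]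
  let ?g = "hsum Y' Y (\<lambda>i. (\<iota> i \<cdot> inv_arr (\<phi> i)) \<cdot> \<pi>' i) I"
  have ar: "\<phi> i \<in> arr C" if "i \<in> I" for i using assms(7) that iso_arr by auto
  have g: "?g \<in> Hom C Y' Y" using d d' assms(7) ar by simp
  have gi: "?g \<cdot> \<iota>' i = \<iota> i \<cdot> inv_arr (\<phi> i)" if "i \<in> I" for i
    using d d' assms that ar by (subst direct_sum_hsum_iota[OF assms(1,3)]) auto
  have fi: "f \<cdot> \<iota> i = \<iota>' i \<cdot> \<phi> i" if "i \<in> I" for i using assms(7) that by auto
  show ?thesis
  proof (rule isoI)
    show "?g \<cdot> f = idm (src C f)"
    proof (rule direct_sum_ext_src[OF assms(1,2)])
      fix i assume i: "i \<in> I"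
      have "(?g \<cdot> f) \<cdot> \<iota> i = ?g \<cdot> \<iota>' i \<cdot> \<phi> i" using g i d assms(4-6) fi by simp
      also have "\<dots> = \<iota> i" using i d d' g ar extend[OF gi[OF i], of "\<phi> i"] assms(7) by simp
      finally show "(?g \<cdot> f) \<cdot> \<iota> i = idm (src C f) \<cdot> \<iota> i" using i d assms by simp
    qed (use g assms d in auto)
    show "f \<cdot> ?g = idm (tgt C f)"
    proof (rule direct_sum_ext_src[OF assms(1,3)])
      fix i assume i: "i \<in> I"
      have "(f \<cdot> ?g) \<cdot> \<iota>' i = f \<cdot> \<iota> i \<cdot> inv_arr (\<phi> i)" using g i d' assms(4-6) gi by simp
      also have "\<dots> = \<iota>' i" using i d d' g ar extend[OF fi[OF i], of "inv_arr (\<phi> i)"] assms by simp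
      finally show "(f \<cdot> ?g) \<cdot> \<iota>' i = idm (tgt C f) \<cdot> \<iota>' i" using i d' assms by simp
    qed (use g assms d' in auto)
  qed (use g assms in auto)
qed

text \<open>A sum over pairs is tested on the summands of both levels, where a single term survives.\<close>

lemma direct_sum_nested:
  assumes "finite I" "finite J" "is_direct_sum C I Z Y \<iota> \<pi>" "\<And>i. i \<in> I \<Longrightarrow> is_direct_sum C J (W i) (Z i) (a i) (b i)"
  shows "is_direct_sum C (I \<times> J) (\<lambda>(i, j). W i j) Y (\<lambda>(i, j). \<iota> i \<cdot> a i j) (\<lambda>(i, j). b i j \<cdot> \<pi> i)"
proof -
  note d = direct_sumD[OF assms(3)] and e = direct_sumD[OF assms(4)]
  let ?t = "\<lambda>p. (case p of (i, j) \<Rightarrow> \<iota> i \<cdot> a i j) \<cdot> (case p of (i, j) \<Rightarrow> b i j \<cdot> \<pi> i)"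
  have orth: "(b i j \<cdot> \<pi> i) \<cdot> \<iota> k \<cdot> a k l = (if (i, j) = (k, l) then idm (W i j) else hzero C (W k l) (W i j))"
    if "i \<in> I" "j \<in> J" "k \<in> I" "l \<in> J" for i j k l
  proof (cases "i = k")
    case True
    then show ?thesis using that d e direct_sum_cancel(1)[OF assms(3), of i "a i l"] by (cases "j = l") simp_all
  next
    case False
    then have "\<pi> i \<cdot> \<iota> k \<cdot> a k l = hzero C (W k l) (Z i)"
      using that d e direct_sum_cancel(2)[OF assms(3), of i "a k l" k] by simp
    then show ?thesis using False that d e by simp
  qed
  have "hsum Y Y ?t (I \<times> J) = idm Y"
  proof (rule direct_sum_ext_src[OF assms(1,3)])
    have t: "?t p \<in> arr C \<and> src C (?t p) = Y \<and> tgt C (?t p) = Y" if "p \<in> I \<times> J" for p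
      using that d e by auto
    show c: "hsum Y Y ?t (I \<times> J) \<in> arr C" "src C (hsum Y Y ?t (I \<times> J)) = Y" "tgt C (hsum Y Y ?t (I \<times> J)) = tgt C (idm Y)"
      using hsum_arr[OF d(1,1) t] d(1) by simp_all
    fix k assume k: "k \<in> I"
    show "hsum Y Y ?t (I \<times> J) \<cdot> \<iota> k = idm Y \<cdot> \<iota> k"
    proof (rule direct_sum_ext_src[OF assms(2) assms(4)[OF k]])
      fix l assume l: "l \<in> J"
      have "hsum Y Y ?t (I \<times> J) \<cdot> (\<iota> k \<cdot> a k l) = hsum (W k l) Y (\<lambda>p. ?t p \<cdot> (\<iota> k \<cdot> a k l)) (I \<times> J)"
        using assms(1,2) d e k l t by (subst hsum_cmp) simp_all
      also have "\<dots> = ?t (k, l) \<cdot> (\<iota> k \<cdot> a k l)"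
      proof (rule hsum_single[where f = "\<lambda>p. ?t p \<cdot> (\<iota> k \<cdot> a k l)"])
        fix p assume p: "p \<in> I \<times> J" "p \<noteq> (k, l)"
        obtain i j where ij: "p = (i, j)" "i \<in> I" "j \<in> J" using p by auto
        then have "(b i j \<cdot> \<pi> i) \<cdot> \<iota> k \<cdot> a k l = hzero C (W k l) (W i j)" using orth[OF ij(2,3) k l] p(2) by auto
        then show "?t p \<cdot> (\<iota> k \<cdot> a k l) = hzero C (W k l) Y" using ij d e k l by simp
      qed (use assms(1,2) d e k l in simp_all)
      also have "\<dots> = \<iota> k \<cdot> a k l" using orth[OF k l k l] d e k l by simp
      finally show "(hsum Y Y ?t (I \<times> J) \<cdot> \<iota> k) \<cdot> a k l = (idm Y \<cdot> \<iota> k) \<cdot> a k l" using c d e k l by simp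
    qed (use c d k in simp_all)
  qed (use d(1) in simp_all)
  then show ?thesis unfolding is_direct_sum_def using d e orth by auto
qed

end

context abelian_category
begin

lemma finite_direct_sum_exists:
  assumes "finite I" "\<And>i. i \<in> I \<Longrightarrow> Z i \<in> obj C"
  shows "\<exists>S \<iota> \<pi>. is_direct_sum C I Z S \<iota> \<pi>"
  using assms
proof (induction I)
  case empty
  obtain Z0 where "is_zero_obj C Z0" using zero_obj_exists by auto
  then have "is_direct_sum C {} Z Z0 \<iota> \<pi>" for \<iota> \<pi> by (auto simp: is_direct_sum_def zero_obj_iff)
  then show ?case by blast
next
  case (insert k I)
  then obtain S \<iota> \<pi> where S: "is_direct_sum C I Z S \<iota> \<pi>" by auto
  note d = direct_sumD[OF S]
  obtain T j p where T: "is_direct_sum C (UNIV::bool set) (\<lambda>b. if b then Z k else S) T j p"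
    using direct_sum_exists[of "Z k" S] insert d by auto
  note t = direct_sumD[OF T]
  note t1 = t(3)[of True, simplified] t(4)[of True, simplified] t(5)[of True, simplified] t(6)[of True, simplified]
    t(7)[of True, simplified] t(8)[of True, simplified] t(9)[of True, simplified] t(10)[of True, simplified]
    t(11)[of True False, simplified]
    t(3)[of False, simplified] t(4)[of False, simplified] t(5)[of False, simplified] t(6)[of False, simplified]
    t(7)[of False, simplified] t(8)[of False, simplified] t(9)[of False, simplified] t(10)[of False, simplified]
    t(11)[of False True, simplified] t(1)
  note c = direct_sum_cancel[OF T, simplified]
  have c1: "p True \<cdot> j False \<cdot> z = hzero C (src C z) (Z k)" if "z \<in> arr C" "tgt C z = S" for z
    using c(2)[of z False True] that by simp
  have c2: "p False \<cdot> j True \<cdot> z = hzero C (src C z) S" if "z \<in> arr C" "tgt C z = Z k" for z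
    using c(2)[of z True False] that by simp
  have c3: "p True \<cdot> j True \<cdot> z = z" if "z \<in> arr C" "tgt C z = Z k" for z using c(1)[of z True] that by simp
  have c4: "p False \<cdot> j False \<cdot> z = z" if "z \<in> arr C" "tgt C z = S" for z using c(1)[of z False] that by simp
  let ?i = "\<lambda>i. if i = k then j True else j False \<cdot> \<iota> i" and ?p = "\<lambda>i. if i = k then p True else \<pi> i \<cdot> p False"
  have "hadd C (j True \<cdot> p True) (j False \<cdot> p False) = idm T"
  proof -
    have "hsum T T (\<lambda>b. j b \<cdot> p b) (insert True {False}) = hadd C (j True \<cdot> p True) (hsum T T (\<lambda>b. j b \<cdot> p b) {False})"
      using t1 t by (intro hsum_insert) auto
    also have "hsum T T (\<lambda>b. j b \<cdot> p b) {False} = j False \<cdot> p False"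
      using t1 t by (intro hsum_single) auto
    finally show ?thesis using t(2) by (simp add: UNIV_bool insert_commute)
  qed
  moreover have "hsum T T (\<lambda>i. ?i i \<cdot> ?p i) I = j False \<cdot> p False"
  proof -
    have "hsum T T (\<lambda>i. ?i i \<cdot> ?p i) I = hsum T T (\<lambda>i. j False \<cdot> (\<iota> i \<cdot> \<pi> i) \<cdot> p False) I"
      using insert(2) d t1 by (intro hsum_cong) auto
    also have "\<dots> = j False \<cdot> hsum T S (\<lambda>i. (\<iota> i \<cdot> \<pi> i) \<cdot> p False) I"
      using insert(1) d t1 by (subst cmp_hsum) auto
    also have "hsum T S (\<lambda>i. (\<iota> i \<cdot> \<pi> i) \<cdot> p False) I = hsum S S (\<lambda>i. \<iota> i \<cdot> \<pi> i) I \<cdot> p False"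
      using insert(1) d t1 by (subst hsum_cmp) auto
    finally show ?thesis using d t1 by simp
  qed
  moreover have "hsum T T (\<lambda>i. ?i i \<cdot> ?p i) (insert k I) = hadd C (j True \<cdot> p True) (hsum T T (\<lambda>i. ?i i \<cdot> ?p i) I)"
    using insert d t1 by (subst hsum_insert) auto
  ultimately have "hsum T T (\<lambda>i. ?i i \<cdot> ?p i) (insert k I) = idm T" by simp
  then have "is_direct_sum C (insert k I) Z T ?i ?p"
    using insert(2,4) d t1 c1 c2 c3 c4
    by (auto simp: is_direct_sum_def direct_sum_cancel[OF S])
  then show ?case by blast
qed

end

section \<open>Linear functors\<close>

context linear_category
begin

lemma functor_obj: "linear_functor C D F \<Longrightarrow> X \<in> obj C \<Longrightarrow> fobj F X \<in> obj D"
  by (simp add: linear_functor_def)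

lemma functor_arr:
  assumes "linear_functor C D F" "f \<in> arr C"
  shows "farr F f \<in> arr D" "src D (farr F f) = fobj F (src C f)" "tgt D (farr F f) = fobj F (tgt C f)"
  using assms src_closed[of f] tgt_closed[of f] unfolding linear_functor_def Hom_def by blast+

lemma functor_ident: "linear_functor C D F \<Longrightarrow> X \<in> obj C \<Longrightarrow> farr F (idm X) = ident D (fobj F X)"
  by (simp add: linear_functor_def)

lemma functor_cmp:
  "\<lbrakk>linear_functor C D F; f \<in> arr C; g \<in> arr C; src C g = tgt C f\<rbrakk>
   \<Longrightarrow> farr F (g \<cdot> f) = farr F g \<cdot>\<^bsub>D\<^esub> farr F f"
  by (simp add: linear_functor_def)

lemma functor_hadd:
  assumes "linear_functor C D F" "f \<in> arr C" "g \<in> arr C" "src C f = src C g" "tgt C f = tgt C g"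
  shows "farr F (hadd C f g) = hadd D (farr F f) (farr F g)"
proof -
  have h: "\<forall>X\<in>obj C. \<forall>Y\<in>obj C. \<forall>f\<in>Hom C X Y. \<forall>g\<in>Hom C X Y.
      farr F (hadd C f g) = hadd D (farr F f) (farr F g)"
    using assms(1) unfolding linear_functor_def by blast
  show ?thesis using assms by (intro h[rule_format, of "src C f" "tgt C f"]) auto
qed

lemma functor_hscale:
  "\<lbrakk>linear_functor C D F; f \<in> arr C\<rbrakk> \<Longrightarrow> farr F (hscale C a f) = hscale D a (farr F f)"
  by (simp add: linear_functor_def)

lemmas functor_simps = functor_obj functor_arr functor_ident functor_cmp functor_hadd functor_hscale

lemma functor_hzero:
  assumes "linear_category D" "linear_functor C D F" "X \<in> obj C" "Y \<in> obj C"
  shows "farr F (hzero C X Y) = hzero D (fobj F X) (fobj F Y)"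
  using functor_hscale[OF assms(2), of "hzero C X Y" 0] assms
    linear_category.hscale_zero[OF assms(1), of "farr F (hzero C X Y)"]
    functor_arr[OF assms(2), of "hzero C X Y"] by simp

lemma functor_hsum:
  assumes "linear_category D" "linear_functor C D F" "X \<in> obj C" "Y \<in> obj C" "finite I"
    "\<And>i. i \<in> I \<Longrightarrow> f i \<in> arr C \<and> src C (f i) = X \<and> tgt C (f i) = Y"
  shows "farr F (hsum X Y f I) = finsum (hom_space D (fobj F X) (fobj F Y)) (\<lambda>i. farr F (f i)) I"
proof -
  interpret D: linear_category D by fact
  show ?thesis using assms(5,6)
  proof (induction I)
    case empty then show ?case using assms functor_hzero by (simp add: functor_obj)
  next
    case (insert k I)
    then have "\<And>i. i \<in> I \<Longrightarrow> f i \<in> arr C \<and> src C (f i) = X \<and> tgt C (f i) = Y"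
      "f k \<in> arr C" "src C (f k) = X" "tgt C (f k) = Y" by auto
    with insert show ?case using assms
      by (simp add: hsum_insert D.hsum_insert functor_simps[OF assms(2)])
  qed
qed

lemma functor_iso:
  assumes "linear_category D" "linear_functor C D F" "is_iso C f"
  shows "is_iso D (farr F f)"
proof -
  interpret D: linear_category D by fact
  note s = functor_simps[OF assms(2)] and i = inv_arr[OF assms(3)] iso_arr[OF assms(3)]
  have "farr F (inv_arr f) \<cdot>\<^bsub>D\<^esub> farr F f = ident D (fobj F (src C f))"
    "farr F f \<cdot>\<^bsub>D\<^esub> farr F (inv_arr f) = ident D (fobj F (tgt C f))"
    using i by (simp_all flip: s(6) add: s(5))
  then show ?thesis using i s by (intro D.isoI[of _ "farr F (inv_arr f)"]) auto
qed

lemma functor_isomorphic: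
  assumes "linear_category D" "linear_functor C D F" "isomorphic C X Y"
  shows "isomorphic D (fobj F X) (fobj F Y)"
proof -
  obtain f where f: "f \<in> arr C" "src C f = X" "tgt C f = Y" "is_iso C f"
    using assms(3) by (auto simp: isomorphic_def)
  then show ?thesis using functor_iso[OF assms(1,2)] functor_arr[OF assms(2)]
    unfolding isomorphic_def Hom_def by (intro bexI[of _ "farr F f"]) auto
qed

lemma functor_zero_obj:
  assumes "linear_category D" "linear_functor C D F" "is_zero_obj C X"
  shows "is_zero_obj D (fobj F X)"
  using assms functor_ident[of D F X] functor_hzero[of D F X X] functor_obj[of D F X]
  by (simp add: zero_obj_iff linear_category.zero_obj_iff)

lemma functor_direct_sum:
  assumes "linear_category D" "linear_functor C D F" "finite I" "is_direct_sum C I Z Y \<iota> \<pi>"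
  shows "is_direct_sum D I (\<lambda>i. fobj F (Z i)) (fobj F Y) (\<lambda>i. farr F (\<iota> i)) (\<lambda>i. farr F (\<pi> i))"
proof -
  interpret D: linear_category D by fact
  note d = direct_sumD[OF assms(4)] and s = functor_simps[OF assms(2)]
  have "finsum (hom_space D (fobj F Y) (fobj F Y)) (\<lambda>i. farr F (\<iota> i) \<cdot>\<^bsub>D\<^esub> farr F (\<pi> i)) I =
        finsum (hom_space D (fobj F Y) (fobj F Y)) (\<lambda>i. farr F (\<iota> i \<cdot> \<pi> i)) I"
    using d s by (intro D.hsum_cong) auto
  also have "\<dots> = farr F (hsum Y Y (\<lambda>i. \<iota> i \<cdot> \<pi> i) I)"
    using d assms by (intro functor_hsum[symmetric]) auto
  also have "\<dots> = ident D (fobj F Y)" using d s by simp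
  finally have 1: "finsum (hom_space D (fobj F Y) (fobj F Y)) (\<lambda>i. farr F (\<iota> i) \<cdot>\<^bsub>D\<^esub> farr F (\<pi> i)) I =
    ident D (fobj F Y)" .
  have 2: "farr F (\<pi> i) \<cdot>\<^bsub>D\<^esub> farr F (\<iota> j) =
      (if i = j then ident D (fobj F (Z i)) else hzero D (fobj F (Z j)) (fobj F (Z i)))"
    if "i \<in> I" "j \<in> I" for i j
  proof -
    have "farr F (\<pi> i) \<cdot>\<^bsub>D\<^esub> farr F (\<iota> j) = farr F (\<pi> i \<cdot> \<iota> j)" using d s that by simp
    also have "\<dots> = (if i = j then ident D (fobj F (Z i)) else hzero D (fobj F (Z j)) (fobj F (Z i)))"
      using d(3,10,11) that functor_hzero[OF assms(1,2)] s(5) by auto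
    finally show ?thesis .
  qed
  show ?thesis using 1 2 d s by (auto simp: is_direct_sum_def)
qed

lemma fully_faithfulD:
  assumes "fully_faithful C D F" "X \<in> obj C" "Y \<in> obj C"
  shows "u \<in> Hom D (fobj F X) (fobj F Y) \<Longrightarrow> \<exists>f\<in>Hom C X Y. farr F f = u"
    "f \<in> Hom C X Y \<Longrightarrow> g \<in> Hom C X Y \<Longrightarrow> farr F f = farr F g \<Longrightarrow> f = g"
proof -
  have b: "bij_betw (farr F) (Hom C X Y) (Hom D (fobj F X) (fobj F Y))"
    using assms by (simp add: fully_faithful_def del: in_Hom)
  show "u \<in> Hom D (fobj F X) (fobj F Y) \<Longrightarrow> \<exists>f\<in>Hom C X Y. farr F f = u"
    by (simp add: bij_betw_imp_surj_on[OF b, symmetric] image_iff Bex_def eq_commute[of u] del: in_Hom)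
  show "f \<in> Hom C X Y \<Longrightarrow> g \<in> Hom C X Y \<Longrightarrow> farr F f = farr F g \<Longrightarrow> f = g"
    using bij_betw_imp_inj_on[OF b] by (auto dest: inj_onD simp del: in_Hom)
qed

lemma direct_sum_iso:
  assumes "finite I" "is_direct_sum C I Z Y \<iota> \<pi>" "is_iso C a" "tgt C a = Y"
  shows "is_direct_sum C I Z (src C a) (\<lambda>i. inv_arr a \<cdot> \<iota> i) (\<lambda>i. \<pi> i \<cdot> a)"
proof -
  note d = direct_sumD[OF assms(2)] and a = iso_arr[OF assms(3)] assms(4)
  have "hsum (src C a) (src C a) (\<lambda>i. (inv_arr a \<cdot> \<iota> i) \<cdot> (\<pi> i \<cdot> a)) I
      = hsum (src C a) (src C a) (\<lambda>i. inv_arr a \<cdot> ((\<iota> i \<cdot> \<pi> i) \<cdot> a)) I"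
    using a d assms(3) by (intro hsum_cong) auto
  also have "\<dots> = inv_arr a \<cdot> hsum (src C a) Y (\<lambda>i. (\<iota> i \<cdot> \<pi> i) \<cdot> a) I"
    using a d assms(1,3) by (subst cmp_hsum) auto
  also have "hsum (src C a) Y (\<lambda>i. (\<iota> i \<cdot> \<pi> i) \<cdot> a) I = hsum Y Y (\<lambda>i. \<iota> i \<cdot> \<pi> i) I \<cdot> a"
    using a d assms(1,3) by (subst hsum_cmp) auto
  also have "inv_arr a \<cdot> \<dots> = idm (src C a)" using a d assms(3) by simp
  finally show ?thesis using a d assms(3) by (auto simp: is_direct_sum_def)
qed

subsection \<open>Kernels\<close>

lemma kernelD:
  assumes "is_kernel C f k"
  shows "f \<in> arr C" "k \<in> arr C" "tgt C k = src C f" "f \<cdot> k = hzero C (src C k) (tgt C f)"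
  using assms by (auto simp: is_kernel_def)

lemma kernel_factor:
  assumes "is_kernel C f k" "h \<in> arr C" "tgt C h = src C f" "f \<cdot> h = hzero C (src C h) (tgt C f)"
  shows "\<exists>u\<in>arr C. src C u = src C h \<and> tgt C u = src C k \<and> k \<cdot> u = h"
proof -
  have "\<forall>W\<in>obj C. \<forall>h\<in>Hom C W (src C f). f \<cdot> h = hzero C W (tgt C f) \<longrightarrow>
      (\<exists>!u. u \<in> Hom C W (src C k) \<and> k \<cdot> u = h)"
    using assms(1) unfolding is_kernel_def by blast
  then have "\<exists>!u. u \<in> Hom C (src C h) (src C k) \<and> k \<cdot> u = h" using assms by simp
  then show ?thesis by auto
qed

lemma kernel_cancel:
  assumes "is_kernel C f k" "u \<in> arr C" "v \<in> arr C" "src C u = src C v" "tgt C u = src C k" "tgt C v = src C k"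
    "k \<cdot> u = k \<cdot> v"
  shows "u = v"
proof -
  note k = kernelD[OF assms(1)]
  have "f \<cdot> k \<cdot> u = hzero C (src C u) (tgt C f)"
    using k assms(2-6) extend[OF k(4), of u] by simp
  moreover have "\<forall>W\<in>obj C. \<forall>h\<in>Hom C W (src C f). f \<cdot> h = hzero C W (tgt C f) \<longrightarrow>
      (\<exists>!u. u \<in> Hom C W (src C k) \<and> k \<cdot> u = h)"
    using assms(1) unfolding is_kernel_def by blast
  moreover have "k \<cdot> u \<in> Hom C (src C u) (src C f)" "src C u \<in> obj C" using k assms(2-6) by simp_all
  ultimately have "\<exists>!w. w \<in> Hom C (src C u) (src C k) \<and> k \<cdot> w = k \<cdot> u" by blast
  moreover have "u \<in> Hom C (src C u) (src C k)" "v \<in> Hom C (src C u) (src C k)" "k \<cdot> v = k \<cdot> u"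
    using assms by auto
  ultimately show ?thesis by blast
qed

lemma kernelI:
  assumes "f \<in> arr C" "k \<in> arr C" "tgt C k = src C f" "f \<cdot> k = hzero C (src C k) (tgt C f)"
    "\<And>h. \<lbrakk>h \<in> arr C; tgt C h = src C f; f \<cdot> h = hzero C (src C h) (tgt C f)\<rbrakk>
       \<Longrightarrow> \<exists>u\<in>arr C. src C u = src C h \<and> tgt C u = src C k \<and> k \<cdot> u = h"
    "\<And>u v. \<lbrakk>u \<in> arr C; v \<in> arr C; src C u = src C v; tgt C u = src C k; tgt C v = src C k; k \<cdot> u = k \<cdot> v\<rbrakk>
       \<Longrightarrow> u = v"
  shows "is_kernel C f k"
  unfolding is_kernel_def
proof (intro conjI ballI impI)
  fix W h assume h: "W \<in> obj C" "h \<in> Hom C W (src C f)" "f \<cdot> h = hzero C W (tgt C f)"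
  then obtain u where "u \<in> arr C" "src C u = src C h" "tgt C u = src C k" "k \<cdot> u = h"
    using assms(5)[of h] by auto
  then show "\<exists>!u. u \<in> Hom C W (src C k) \<and> k \<cdot> u = h"
    using h assms(6) by (intro ex1I[of _ u]) auto
qed (use assms in auto)

lemma kernel_iso_right:
  assumes "is_kernel C f k" "is_iso C a" "tgt C a = src C k"
  shows "is_kernel C f (k \<cdot> a)"
proof (rule kernelI)
  note k = kernelD[OF assms(1)] and a = iso_arr[OF assms(2)] assms(3)
  show "f \<in> arr C" "k \<cdot> a \<in> arr C" "tgt C (k \<cdot> a) = src C f" using k a by auto
  show "f \<cdot> k \<cdot> a = hzero C (src C (k \<cdot> a)) (tgt C f)"
    using k a extend[OF k(4), of a] by auto
  fix h assume "h \<in> arr C" "tgt C h = src C f" "f \<cdot> h = hzero C (src C h) (tgt C f)"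
  then obtain u where u: "u \<in> arr C" "src C u = src C h" "tgt C u = src C k" "k \<cdot> u = h"
    using kernel_factor[OF assms(1)] by blast
  then have "(k \<cdot> a) \<cdot> (inv_arr a \<cdot> u) = h" using k a assms(2) by simp
  then show "\<exists>u\<in>arr C. src C u = src C h \<and> tgt C u = src C (k \<cdot> a) \<and> (k \<cdot> a) \<cdot> u = h"
    using u k a assms(2) by (intro bexI[of _ "inv_arr a \<cdot> u"]) auto
next
  note k = kernelD[OF assms(1)] and a = iso_arr[OF assms(2)] assms(3)
  fix u v assume "u \<in> arr C" "v \<in> arr C" "src C u = src C v" "tgt C u = src C (k \<cdot> a)"
    "tgt C v = src C (k \<cdot> a)" "(k \<cdot> a) \<cdot> u = (k \<cdot> a) \<cdot> v"
  then show "u = v" using k a kernel_cancel[OF assms(1), of "a \<cdot> u" "a \<cdot> v"] iso_cancel_left[OF assms(2), of u v]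
    by simp
qed

lemma kernel_iso_left:
  assumes "is_kernel C f k" "is_iso C a" "src C a = tgt C f"
  shows "is_kernel C (a \<cdot> f) k"
proof (rule kernelI)
  note k = kernelD[OF assms(1)] and a = iso_arr[OF assms(2)] assms(3)
  show "a \<cdot> f \<in> arr C" "k \<in> arr C" "tgt C k = src C (a \<cdot> f)" using k a by auto
  show "(a \<cdot> f) \<cdot> k = hzero C (src C k) (tgt C (a \<cdot> f))" using k a by simp
  fix h assume h: "h \<in> arr C" "tgt C h = src C (a \<cdot> f)" "(a \<cdot> f) \<cdot> h = hzero C (src C h) (tgt C (a \<cdot> f))"
  have "f \<cdot> h = hzero C (src C h) (tgt C f)"
    by (rule iso_cancel_left[OF assms(2)]) (use h k a in auto)
  then show "\<exists>u\<in>arr C. src C u = src C h \<and> tgt C u = src C k \<and> k \<cdot> u = h"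
    using kernel_factor[OF assms(1), of h] h k a by auto
next
  fix u v assume "u \<in> arr C" "v \<in> arr C" "src C u = src C v" "tgt C u = src C k"
    "tgt C v = src C k" "k \<cdot> u = k \<cdot> v"
  then show "u = v" by (rule kernel_cancel[OF assms(1)])
qed

lemma kernel_iso_zero:
  assumes "is_iso C f" "is_zero_obj C Z" shows "is_kernel C f (hzero C Z (src C f))"
proof (rule kernelI)
  have z: "Z \<in> obj C" using assms(2) by (simp add: zero_obj_iff)
  note f = iso_arr[OF assms(1)]
  show "f \<in> arr C" "hzero C Z (src C f) \<in> arr C" "tgt C (hzero C Z (src C f)) = src C f"
    "f \<cdot> hzero C Z (src C f) = hzero C (src C (hzero C Z (src C f))) (tgt C f)" using f z by auto
  fix h assume h: "h \<in> arr C" "tgt C h = src C f" "f \<cdot> h = hzero C (src C h) (tgt C f)"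
  have "h = hzero C (src C h) (src C f)" by (rule iso_cancel_left[OF assms(1), of h]) (use h f in auto)
  then have "hzero C Z (src C f) \<cdot> hzero C (src C h) Z = h" using h f z by simp
  then show "\<exists>u\<in>arr C. src C u = src C h \<and> tgt C u = src C (hzero C Z (src C f)) \<and> hzero C Z (src C f) \<cdot> u = h"
    using h z f by (intro bexI[of _ "hzero C (src C h) Z"]) auto
next
  note f = iso_arr[OF assms(1)] and z = assms(2)[unfolded zero_obj_iff]
  fix u v assume "u \<in> arr C" "v \<in> arr C" "src C u = src C v" "tgt C u = src C (hzero C Z (src C f))"
    "tgt C v = src C (hzero C Z (src C f))"
  then have "tgt C u = Z" "tgt C v = Z" "u \<in> arr C" "v \<in> arr C" "src C u = src C v" using z f by auto
  then show "u = v" using zero_obj_arr(2)[OF assms(2), of u] zero_obj_arr(2)[OF assms(2), of v] by metis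
qed

lemma isomorphic_iff:
  "isomorphic C X Y \<longleftrightarrow> (\<exists>f\<in>arr C. src C f = X \<and> tgt C f = Y \<and> is_iso C f)"
  by (auto simp: isomorphic_def)

lemma monoI:
  assumes "m \<in> arr C"
    "\<And>u v. \<lbrakk>u \<in> arr C; v \<in> arr C; src C u = src C v; tgt C u = src C m; tgt C v = src C m; m \<cdot> u = m \<cdot> v\<rbrakk> \<Longrightarrow> u = v"
  shows "is_mono C m"
  using assms by (auto simp: is_mono_def)

lemma kernel_mono: "is_kernel C f k \<Longrightarrow> is_mono C k"
  by (rule monoI, erule kernelD(2)) (rule kernel_cancel)

lemma monoD:
  assumes "is_mono C m" "u \<in> arr C" "v \<in> arr C" "src C u = src C v" "tgt C u = src C m" "tgt C v = src C m"
    "m \<cdot> u = m \<cdot> v"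
  shows "u = v"
proof -
  have "\<forall>X\<in>obj C. \<forall>f\<in>Hom C X (src C m). \<forall>g\<in>Hom C X (src C m). m \<cdot> f = m \<cdot> g \<longrightarrow> f = g"
    using assms(1) unfolding is_mono_def by blast
  moreover have "u \<in> Hom C (src C u) (src C m)" "v \<in> Hom C (src C u) (src C m)" "src C u \<in> obj C"
    using assms by auto
  ultimately show ?thesis using assms(7) by blast
qed

lemma mono_arr: "is_mono C m \<Longrightarrow> m \<in> arr C" by (simp add: is_mono_def)

lemma iso_mono: "is_iso C m \<Longrightarrow> is_mono C m"
  by (rule monoI) (auto intro: iso_cancel_left dest: iso_arr)

lemma mono_cmp_iso:
  assumes "is_mono C m" "is_iso C a" "src C a = tgt C m" "is_iso C b" "tgt C b = src C m"
  shows "is_mono C (a \<cdot> m \<cdot> b)"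
proof (rule monoI)
  note m = mono_arr[OF assms(1)] iso_arr[OF assms(2)] iso_arr[OF assms(4)] assms(3,5)
  show "a \<cdot> m \<cdot> b \<in> arr C" using m by simp
  fix u v assume h: "u \<in> arr C" "v \<in> arr C" "src C u = src C v" "tgt C u = src C (a \<cdot> m \<cdot> b)"
    "tgt C v = src C (a \<cdot> m \<cdot> b)" "(a \<cdot> m \<cdot> b) \<cdot> u = (a \<cdot> m \<cdot> b) \<cdot> v"
  have 1: "m \<cdot> b \<cdot> u = m \<cdot> b \<cdot> v" by (rule iso_cancel_left[OF assms(2)]) (use h m in auto)
  have 2: "b \<cdot> u = b \<cdot> v" by (rule monoD[OF assms(1)]) (use h m 1 in auto)
  show "u = v" by (rule iso_cancel_left[OF assms(4)]) (use h m 2 in auto)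
qed

end

text \<open>The summand is the kernel of the complementary idempotent \<open>1 - u\<close>.\<close>

lemma (in abelian_category) idempotent_splits:
  assumes "u \<in> arr C" "src C u = Z" "tgt C u = Z" "u \<cdot> u = u"
  shows "\<exists>X j q. X \<in> obj C \<and> j \<in> arr C \<and> src C j = X \<and> tgt C j = Z \<and> q \<in> arr C \<and> src C q = Z \<and> tgt C q = X \<and>
    q \<cdot> j = idm X \<and> j \<cdot> q = u"
proof -
  have Z: "Z \<in> obj C" using assms src_closed by blast
  let ?v = "hadd C (idm Z) (hscale C (-1) u)"
  have v: "?v \<in> arr C" "src C ?v = Z" "tgt C ?v = Z" using assms Z by simp_all
  have cancel: "hadd C z (hscale C (-1) z) = hzero C (src C z) (tgt C z)" if "z \<in> arr C" for z
    using hscale_add[OF that, of 1 "-1"] that by simp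
  obtain k where k: "is_kernel C ?v k" using kernel_exists[OF v(1)] by blast
  note k' = kernelD[OF k]
  have "?v \<cdot> u = hzero C Z Z" using assms Z cancel[of u] by (simp add: cmp_hadd cmp_hscale)
  then obtain q where q: "q \<in> arr C" "src C q = Z" "tgt C q = src C k" "k \<cdot> q = u"
    using kernel_factor[OF k, of u] assms v Z by auto
  have uk: "u \<cdot> k = k"
  proof -
    have "hadd C k (hscale C (-1) (u \<cdot> k)) = hzero C (src C k) Z"
      using k'(4) k'(1-3) assms Z v by (simp add: cmp_hadd cmp_hscale)
    then have "hadd C (hadd C k (hscale C (-1) (u \<cdot> k))) (u \<cdot> k) = u \<cdot> k" using k' assms v Z by simp
    moreover have "hadd C (hadd C k (hscale C (-1) (u \<cdot> k))) (u \<cdot> k) = hadd C k (hadd C (hscale C (-1) (u \<cdot> k)) (u \<cdot> k))"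
      by (rule hadd_assoc) (use k' assms v Z in simp_all)
    moreover have "hadd C (hscale C (-1) (u \<cdot> k)) (u \<cdot> k) = hadd C (u \<cdot> k) (hscale C (-1) (u \<cdot> k))"
      by (rule hadd_commute) (use k' assms v Z in simp_all)
    moreover have "hadd C (u \<cdot> k) (hscale C (-1) (u \<cdot> k)) = hzero C (src C k) Z"
      using cancel[of "u \<cdot> k"] k' assms v Z by simp
    moreover have "hadd C k (hzero C (src C k) Z) = k" using k' v by simp
    ultimately show ?thesis by metis
  qed
  have e: "k \<cdot> q \<cdot> k = k \<cdot> idm (src C k)"
    using uk q k' v extend[OF q(4), of k] by simp
  have "q \<cdot> k = idm (src C k)"
    by (rule kernel_cancel[OF k _ _ _ _ _ e]) (use q k' v in simp_all)
  then show ?thesis using q k' v by (intro exI[of _ "src C k"] exI[of _ k] exI[of _ q]) simp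
qed

text \<open>Reversing all arrows turns statements on kernels into statements on cokernels.\<close>

definition dual_cat :: "('o, 'm, 'k, 'z) lin_cat_scheme \<Rightarrow> ('o, 'm, 'k, 'z) lin_cat_scheme" where
  "dual_cat C = C\<lparr>src := tgt C, tgt := src C, cmp := \<lambda>g f. f \<cdot>\<^bsub>C\<^esub> g, hzero := \<lambda>X Y. hzero C Y X\<rparr>"

lemma dual_cat_simps [simp]:
  "obj (dual_cat C) = obj C" "arr (dual_cat C) = arr C" "src (dual_cat C) = tgt C" "tgt (dual_cat C) = src C"
  "ident (dual_cat C) = ident C" "cmp (dual_cat C) g f = f \<cdot>\<^bsub>C\<^esub> g" "hzero (dual_cat C) X Y = hzero C Y X"
  "hadd (dual_cat C) = hadd C" "hscale (dual_cat C) = hscale C" "Hom (dual_cat C) X Y = Hom C Y X"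
  "hom_space (dual_cat C) X Y = hom_space C Y X"
  by (auto simp: dual_cat_def Hom_def hom_space_def)

lemma linear_category_dual:
  assumes "linear_category C" shows "linear_category (dual_cat C)"
proof -
  interpret linear_category C by fact
  show ?thesis
    by (rule linear_category.intro) (auto simp: hom_space cmp_hadd cmp_hscale)
qed

lemma linear_functor_dual: "linear_functor C D F \<Longrightarrow> linear_functor (dual_cat C) (dual_cat D) F"
  unfolding linear_functor_def by (simp add: Hom_def)

lemma dual_kernel: "is_kernel (dual_cat C) f p \<longleftrightarrow> is_cokernel C f p"
  unfolding is_kernel_def is_cokernel_def by simp

lemma dual_mono: "is_mono (dual_cat C) p \<longleftrightarrow> is_epi C p"
  unfolding is_mono_def is_epi_def by simp

lemma dual_iso: "is_iso (dual_cat C) f \<longleftrightarrow> is_iso C f"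
  unfolding is_iso_def by auto

lemma dual_isomorphic: "isomorphic (dual_cat C) X Y \<longleftrightarrow> isomorphic C Y X"
  unfolding isomorphic_def by (simp add: dual_iso)

lemma dual_zero_obj: "is_zero_obj (dual_cat C) Z \<longleftrightarrow> is_zero_obj C Z"
  unfolding is_zero_obj_def by auto

context linear_category
begin

lemma cokernelD:
  assumes "is_cokernel C f p"
  shows "f \<in> arr C" "p \<in> arr C" "src C p = tgt C f" "p \<cdot> f = hzero C (src C f) (tgt C p)"
  using assms by (auto simp: is_cokernel_def)

lemma cokernel_factor:
  assumes "is_cokernel C f p" "h \<in> arr C" "src C h = tgt C f" "h \<cdot> f = hzero C (src C f) (tgt C h)"
  shows "\<exists>u\<in>arr C. src C u = tgt C p \<and> tgt C u = tgt C h \<and> u \<cdot> p = h"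
proof -
  interpret D: linear_category "dual_cat C" by (rule linear_category_dual) unfold_locales
  show ?thesis using D.kernel_factor[of f p h] assms by (auto simp: dual_kernel)
qed

lemma cokernel_cancel:
  assumes "is_cokernel C f p" "u \<in> arr C" "v \<in> arr C" "tgt C u = tgt C v" "src C u = tgt C p" "src C v = tgt C p"
    "u \<cdot> p = v \<cdot> p"
  shows "u = v"
proof -
  interpret D: linear_category "dual_cat C" by (rule linear_category_dual) unfold_locales
  show ?thesis using D.kernel_cancel[of f p u v] assms by (simp add: dual_kernel)
qed

lemma cokernelI:
  assumes "f \<in> arr C" "p \<in> arr C" "src C p = tgt C f" "p \<cdot> f = hzero C (src C f) (tgt C p)"
    "\<And>h. \<lbrakk>h \<in> arr C; src C h = tgt C f; h \<cdot> f = hzero C (src C f) (tgt C h)\<rbrakk>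
       \<Longrightarrow> \<exists>u\<in>arr C. src C u = tgt C p \<and> tgt C u = tgt C h \<and> u \<cdot> p = h"
    "\<And>u v. \<lbrakk>u \<in> arr C; v \<in> arr C; tgt C u = tgt C v; src C u = tgt C p; src C v = tgt C p; u \<cdot> p = v \<cdot> p\<rbrakk>
       \<Longrightarrow> u = v"
  shows "is_cokernel C f p"
proof -
  interpret D: linear_category "dual_cat C" by (rule linear_category_dual) unfold_locales
  have "is_kernel (dual_cat C) f p"
  proof (rule D.kernelI)
    fix h assume "h \<in> arr (dual_cat C)" "tgt (dual_cat C) h = src (dual_cat C) f"
      "f \<cdot>\<^bsub>dual_cat C\<^esub> h = hzero (dual_cat C) (src (dual_cat C) h) (tgt (dual_cat C) f)"
    then show "\<exists>u\<in>arr (dual_cat C). src (dual_cat C) u = src (dual_cat C) h \<and> tgt (dual_cat C) u = src (dual_cat C) p \<and>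
       p \<cdot>\<^bsub>dual_cat C\<^esub> u = h" using assms(5)[of h] by auto
  next
    fix u v assume "u \<in> arr (dual_cat C)" "v \<in> arr (dual_cat C)" "src (dual_cat C) u = src (dual_cat C) v"
      "tgt (dual_cat C) u = src (dual_cat C) p" "tgt (dual_cat C) v = src (dual_cat C) p"
      "p \<cdot>\<^bsub>dual_cat C\<^esub> u = p \<cdot>\<^bsub>dual_cat C\<^esub> v"
    then show "u = v" using assms(6)[of u v] by simp
  qed (use assms(1-4) in auto)
  then show ?thesis by (simp add: dual_kernel)
qed

end

lemma (in abelian_category) zero_subcategory: "abelian_subcategory C {Z. is_zero_obj C Z}"
  unfolding abelian_subcategory_def
proof (intro conjI ballI allI impI)
  show "{Z. is_zero_obj C Z} \<subseteq> obj C" by (auto simp: zero_obj_iff)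
  show "Y \<in> {Z. is_zero_obj C Z}" if "X \<in> {Z. is_zero_obj C Z}" "isomorphic C X Y" for X Y using that zero_obj_iso by blast
  show "W \<in> {Z. is_zero_obj C Z}" if h: "X \<in> {Z. is_zero_obj C Z}" "Y \<in> {Z. is_zero_obj C Z}"
    "is_direct_sum C (UNIV :: bool set) (\<lambda>b. if b then X else Y) W \<iota> \<pi>" for X Y W \<iota> \<pi>
  proof -
    note d = direct_sumD[OF h(3)]
    have z: "is_zero_obj C (if i then X else Y)" for i using h by simp
    have "\<pi> i = hzero C W (if i then X else Y)" for i using zero_obj_arr(2)[OF z d(7), of i] d(8,9)[of i] by simp
    then have "hsum W W (\<lambda>i. \<iota> i \<cdot> \<pi> i) UNIV = hzero C W W" using d(1) d(4-6) by (intro hsum_zeros) simp_all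
    then show ?thesis using d(1,2) by (simp add: zero_obj_iff)
  qed
  fix X Y f assume h: "X \<in> {Z. is_zero_obj C Z}" "Y \<in> {Z. is_zero_obj C Z}" "f \<in> Hom C X Y"
  show "src C k \<in> {Z. is_zero_obj C Z}" if k: "is_kernel C f k" for k
  proof -
    note k' = kernelD[OF k]
    have "k = hzero C (src C k) X" using zero_obj_arr(2)[of X k] h k' by simp
    then have e: "k \<cdot> idm (src C k) = k \<cdot> hzero C (src C k) (src C k)" using k' h by simp
    have "idm (src C k) = hzero C (src C k) (src C k)" by (rule kernel_cancel[OF k _ _ _ _ _ e]) (use k' in simp_all)
    then show ?thesis using k' by (simp add: zero_obj_iff)
  qed
  show "tgt C p \<in> {Z. is_zero_obj C Z}" if p: "is_cokernel C f p" for p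
  proof -
    note p' = cokernelD[OF p]
    have "p = hzero C Y (tgt C p)" using zero_obj_arr(1)[of Y p] h p' by simp
    then have e: "idm (tgt C p) \<cdot> p = hzero C (tgt C p) (tgt C p) \<cdot> p" using p' h by simp
    have "idm (tgt C p) = hzero C (tgt C p) (tgt C p)" by (rule cokernel_cancel[OF p _ _ _ _ _ e]) (use p' in simp_all)
    then show ?thesis using p' by (simp add: zero_obj_iff)
  qed
qed simp

section \<open>Categories equivalent to a finite power of an abelian category\<close>

text \<open>
  The functors \<open>\<Psi> i\<close> are the coordinates of an equivalence from \<open>B\<close> to the power of \<open>C\<close> with exponent \<open>I\<close>.
  Stating this by joint faithfulness, fullness and surjectivity avoids the power itself, and the conditions
  are preserved when all arrows are reversed.
\<close>

locale jointly_equivalent = B: linear_category B + C: linear_category C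
  for B :: "('p, 'n, 'k::field, 'y) lin_cat_scheme" and C :: "('o, 'm, 'k, 'z) lin_cat_scheme" +
  fixes I :: "'i set" and \<Psi> :: "'i \<Rightarrow> ('p, 'n, 'o, 'm) cat_functor"
  assumes finite_I: "finite I"
    and linear: "i \<in> I \<Longrightarrow> linear_functor B C (\<Psi> i)"
    and faithful: "\<lbrakk>f \<in> arr B; g \<in> arr B; src B f = src B g; tgt B f = tgt B g;
          \<And>i. i \<in> I \<Longrightarrow> farr (\<Psi> i) f = farr (\<Psi> i) g\<rbrakk> \<Longrightarrow> f = g"
    and full: "\<lbrakk>X \<in> obj B; Y \<in> obj B;
          \<And>i. i \<in> I \<Longrightarrow> u i \<in> arr C \<and> src C (u i) = fobj (\<Psi> i) X \<and> tgt C (u i) = fobj (\<Psi> i) Y\<rbrakk>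
          \<Longrightarrow> \<exists>f\<in>arr B. src B f = X \<and> tgt B f = Y \<and> (\<forall>i\<in>I. farr (\<Psi> i) f = u i)"
    and surjective: "(\<And>i. i \<in> I \<Longrightarrow> Z i \<in> obj C) \<Longrightarrow> \<exists>X\<in>obj B. \<forall>i\<in>I. isomorphic C (fobj (\<Psi> i) X) (Z i)"
begin

lemmas \<Psi>_simps = B.functor_simps[OF linear]

lemma \<Psi>_hzero: "\<lbrakk>i \<in> I; X \<in> obj B; Y \<in> obj B\<rbrakk> \<Longrightarrow> farr (\<Psi> i) (hzero B X Y) = hzero C (fobj (\<Psi> i) X) (fobj (\<Psi> i) Y)"
  using B.functor_hzero[OF C.linear_category_axioms linear] by blast

lemma surjective_iso:
  assumes "\<And>i. i \<in> I \<Longrightarrow> Z i \<in> obj C"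
  shows "\<exists>X a. X \<in> obj B \<and> (\<forall>i\<in>I. is_iso C (a i) \<and> a i \<in> arr C \<and> src C (a i) = fobj (\<Psi> i) X \<and> tgt C (a i) = Z i)"
proof -
  obtain X where X: "X \<in> obj B" "\<forall>i\<in>I. isomorphic C (fobj (\<Psi> i) X) (Z i)" using surjective assms by blast
  then have "\<forall>i\<in>I. \<exists>a. is_iso C a \<and> a \<in> arr C \<and> src C a = fobj (\<Psi> i) X \<and> tgt C a = Z i"
    using C.isomorphic_iff by blast
  then show ?thesis using X(1) by (auto dest: bchoice)
qed

lemma lift_at:
  assumes "i \<in> I" "X \<in> obj B" "Y \<in> obj B" "u \<in> arr C" "src C u = fobj (\<Psi> i) X" "tgt C u = fobj (\<Psi> i) Y"
  shows "\<exists>f\<in>arr B. src B f = X \<and> tgt B f = Y \<and> farr (\<Psi> i) f = u \<and>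
    (\<forall>j\<in>I. j \<noteq> i \<longrightarrow> farr (\<Psi> j) f = hzero C (fobj (\<Psi> j) X) (fobj (\<Psi> j) Y))"
proof -
  let ?u = "\<lambda>j. if j = i then u else hzero C (fobj (\<Psi> j) X) (fobj (\<Psi> j) Y)"
  have "\<exists>f\<in>arr B. src B f = X \<and> tgt B f = Y \<and> (\<forall>j\<in>I. farr (\<Psi> j) f = ?u j)"
    by (rule full) (use assms \<Psi>_simps in auto)
  then obtain f where "f \<in> arr B" "src B f = X" "tgt B f = Y" "\<forall>j\<in>I. farr (\<Psi> j) f = ?u j" by blast
  then show ?thesis using assms(1) by (intro bexI[of _ f]) auto
qed

lemma iso_reflect:
  assumes "f \<in> arr B" "\<And>i. i \<in> I \<Longrightarrow> is_iso C (farr (\<Psi> i) f)"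
  shows "is_iso B f"
proof -
  obtain g where g: "g \<in> arr B" "src B g = tgt B f" "tgt B g = src B f"
    "\<forall>i\<in>I. farr (\<Psi> i) g = C.inv_arr (farr (\<Psi> i) f)"
    using full[of "tgt B f" "src B f" "\<lambda>i. C.inv_arr (farr (\<Psi> i) f)"] assms \<Psi>_simps by auto
  show ?thesis
  proof (rule B.isoI[of f g])
    show "g \<cdot>\<^bsub>B\<^esub> f = ident B (src B f)" by (rule faithful) (use g assms \<Psi>_simps in auto)
    show "f \<cdot>\<^bsub>B\<^esub> g = ident B (tgt B f)" by (rule faithful) (use g assms \<Psi>_simps in auto)
  qed (use g assms in auto)
qed

lemma isomorphic_reflect:
  assumes "X \<in> obj B" "Y \<in> obj B" "\<And>i. i \<in> I \<Longrightarrow> isomorphic C (fobj (\<Psi> i) X) (fobj (\<Psi> i) Y)"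
  shows "isomorphic B X Y"
proof -
  have "\<forall>i\<in>I. \<exists>u. is_iso C u \<and> u \<in> arr C \<and> src C u = fobj (\<Psi> i) X \<and> tgt C u = fobj (\<Psi> i) Y"
    using assms(3) C.isomorphic_iff by blast
  then obtain u where u: "\<forall>i\<in>I. is_iso C (u i) \<and> u i \<in> arr C \<and> src C (u i) = fobj (\<Psi> i) X \<and> tgt C (u i) = fobj (\<Psi> i) Y"
    by (auto dest: bchoice)
  then obtain f where "f \<in> arr B" "src B f = X" "tgt B f = Y" "\<forall>i\<in>I. farr (\<Psi> i) f = u i"
    using full[of X Y u] assms by auto
  then show ?thesis unfolding B.isomorphic_iff using iso_reflect[of f] u by auto
qed

lemma zero_obj_reflect:
  assumes "X \<in> obj B" "\<And>i. i \<in> I \<Longrightarrow> is_zero_obj C (fobj (\<Psi> i) X)"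
  shows "is_zero_obj B X"
proof -
  have "ident B X = hzero B X X"
    by (rule faithful) (use assms \<Psi>_simps \<Psi>_hzero in \<open>auto simp: C.zero_obj_iff\<close>)
  then show ?thesis using assms by (simp add: B.zero_obj_iff)
qed

lemma mono_reflect:
  assumes "m \<in> arr B" "\<And>i. i \<in> I \<Longrightarrow> is_mono C (farr (\<Psi> i) m)"
  shows "is_mono B m"
proof (rule B.monoI)
  fix u v assume h: "u \<in> arr B" "v \<in> arr B" "src B u = src B v" "tgt B u = src B m" "tgt B v = src B m"
    "m \<cdot>\<^bsub>B\<^esub> u = m \<cdot>\<^bsub>B\<^esub> v"
  show "u = v"
  proof (rule faithful)
    fix i assume i: "i \<in> I"
    have "farr (\<Psi> i) (m \<cdot>\<^bsub>B\<^esub> u) = farr (\<Psi> i) (m \<cdot>\<^bsub>B\<^esub> v)" using h(6) by simp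
    then show "farr (\<Psi> i) u = farr (\<Psi> i) v"
      by - (rule C.monoD[OF assms(2)[OF i]]; use h(1-5) assms(1) \<Psi>_simps[OF i] in auto)
  qed (use h in auto)
qed (use assms in auto)

text \<open>
  Arrows into the \<open>i\<close>-th coordinate that are to be distinguished are lifted to \<open>B\<close> by zero at the other
  coordinates; their common source is first replaced by an isomorphic coordinate of an object of \<open>B\<close>.
\<close>

lemma mono_preserve:
  assumes "is_mono B m" "i \<in> I" shows "is_mono C (farr (\<Psi> i) m)"
proof (rule C.monoI)
  note m = B.mono_arr[OF assms(1)]
  show "farr (\<Psi> i) m \<in> arr C" using m assms \<Psi>_simps by auto
  fix u v assume h: "u \<in> arr C" "v \<in> arr C" "src C u = src C v" "tgt C u = src C (farr (\<Psi> i) m)"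
    "tgt C v = src C (farr (\<Psi> i) m)" "farr (\<Psi> i) m \<cdot>\<^bsub>C\<^esub> u = farr (\<Psi> i) m \<cdot>\<^bsub>C\<^esub> v"
  obtain W a where W: "W \<in> obj B" "\<forall>i\<in>I. is_iso C (a i) \<and> a i \<in> arr C \<and> src C (a i) = fobj (\<Psi> i) W \<and> tgt C (a i) = src C v"
    using surjective_iso[of "\<lambda>_. src C v"] h by auto
  have lift: "\<exists>f\<in>arr B. src B f = W \<and> tgt B f = src B m \<and> farr (\<Psi> i) f = w \<cdot>\<^bsub>C\<^esub> a i \<and>
      (\<forall>j\<in>I. j \<noteq> i \<longrightarrow> farr (\<Psi> j) f = hzero C (fobj (\<Psi> j) W) (fobj (\<Psi> j) (src B m)))"
    if "w \<in> arr C" "src C w = src C v" "tgt C w = src C (farr (\<Psi> i) m)" for w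
    using lift_at[of i W "src B m" "w \<cdot>\<^bsub>C\<^esub> a i"] assms(2) W m that \<Psi>_simps[OF assms(2)] by auto
  obtain f where f: "f \<in> arr B" "src B f = W" "tgt B f = src B m" "farr (\<Psi> i) f = u \<cdot>\<^bsub>C\<^esub> a i"
      "\<forall>j\<in>I. j \<noteq> i \<longrightarrow> farr (\<Psi> j) f = hzero C (fobj (\<Psi> j) W) (fobj (\<Psi> j) (src B m))"
    using lift[of u] h by auto
  obtain g where g: "g \<in> arr B" "src B g = W" "tgt B g = src B m" "farr (\<Psi> i) g = v \<cdot>\<^bsub>C\<^esub> a i"
      "\<forall>j\<in>I. j \<noteq> i \<longrightarrow> farr (\<Psi> j) g = hzero C (fobj (\<Psi> j) W) (fobj (\<Psi> j) (src B m))"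
    using lift[of v] h by auto
  have "m \<cdot>\<^bsub>B\<^esub> f = m \<cdot>\<^bsub>B\<^esub> g"
  proof (rule faithful)
    fix j assume j: "j \<in> I"
    show "farr (\<Psi> j) (m \<cdot>\<^bsub>B\<^esub> f) = farr (\<Psi> j) (m \<cdot>\<^bsub>B\<^esub> g)"
    proof (cases "j = i")
      case True
      have "farr (\<Psi> i) m \<cdot>\<^bsub>C\<^esub> u \<cdot>\<^bsub>C\<^esub> a i = farr (\<Psi> i) m \<cdot>\<^bsub>C\<^esub> v \<cdot>\<^bsub>C\<^esub> a i"
        using C.extend[OF h(6), of "a i"] h(1-5) W(2) \<Psi>_simps[OF assms(2)] m assms(2) by simp
      then show ?thesis using True f g m j \<Psi>_simps by simp
    next
      case False then show ?thesis using f g m j \<Psi>_simps by simp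
    qed
  qed (use f g m in auto)
  then have "f = g" by - (rule B.monoD[OF assms(1)]; use f g in auto)
  then have "u \<cdot>\<^bsub>C\<^esub> a i = v \<cdot>\<^bsub>C\<^esub> a i" using f g by simp
  then show "u = v" by - (rule C.iso_cancel_right[of "a i" u v]; use W h assms(2) in auto)
qed

lemma kernel_reflect:
  assumes "f \<in> arr B" "k \<in> arr B" "tgt B k = src B f"
    "\<And>i. i \<in> I \<Longrightarrow> is_kernel C (farr (\<Psi> i) f) (farr (\<Psi> i) k)"
  shows "is_kernel B f k"
proof (rule B.kernelI)
  show "f \<cdot>\<^bsub>B\<^esub> k = hzero B (src B k) (tgt B f)"
    by (rule faithful) (use assms C.kernelD(4)[OF assms(4)] \<Psi>_simps \<Psi>_hzero in auto)
  fix h assume h: "h \<in> arr B" "tgt B h = src B f" "f \<cdot>\<^bsub>B\<^esub> h = hzero B (src B h) (tgt B f)"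
  have "\<exists>u\<in>arr C. src C u = fobj (\<Psi> i) (src B h) \<and> tgt C u = fobj (\<Psi> i) (src B k) \<and>
      farr (\<Psi> i) k \<cdot>\<^bsub>C\<^esub> u = farr (\<Psi> i) h" if i: "i \<in> I" for i
  proof -
    note s = \<Psi>_simps[OF i]
    have "farr (\<Psi> i) (f \<cdot>\<^bsub>B\<^esub> h) = farr (\<Psi> i) (hzero B (src B h) (tgt B f))" using h(3) by simp
    then have "farr (\<Psi> i) f \<cdot>\<^bsub>C\<^esub> farr (\<Psi> i) h = hzero C (src C (farr (\<Psi> i) h)) (tgt C (farr (\<Psi> i) f))"
      using h(1,2) s assms(1) \<Psi>_hzero i by simp
    then show ?thesis using C.kernel_factor[OF assms(4)[OF i], of "farr (\<Psi> i) h"] h(1,2) s assms(1,2) by simp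
  qed
  then obtain u where "\<forall>i\<in>I. u i \<in> arr C \<and> src C (u i) = fobj (\<Psi> i) (src B h) \<and> tgt C (u i) = fobj (\<Psi> i) (src B k) \<and>
      farr (\<Psi> i) k \<cdot>\<^bsub>C\<^esub> u i = farr (\<Psi> i) h" by (metis (mono_tags, lifting))
  then obtain w where w: "w \<in> arr B" "src B w = src B h" "tgt B w = src B k" "\<forall>i\<in>I. farr (\<Psi> i) w = u i"
    "\<forall>i\<in>I. farr (\<Psi> i) k \<cdot>\<^bsub>C\<^esub> u i = farr (\<Psi> i) h"
    using full[of "src B h" "src B k" u] h assms by auto
  have "k \<cdot>\<^bsub>B\<^esub> w = h" by (rule faithful) (use w h assms \<Psi>_simps in auto)
  then show "\<exists>u\<in>arr B. src B u = src B h \<and> tgt B u = src B k \<and> k \<cdot>\<^bsub>B\<^esub> u = h" using w by auto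
next
  have "is_mono B k"
    by (rule mono_reflect) (use assms C.kernel_mono in blast)+
  then show "u = v" if "u \<in> arr B" "v \<in> arr B" "src B u = src B v" "tgt B u = src B k" "tgt B v = src B k"
    "k \<cdot>\<^bsub>B\<^esub> u = k \<cdot>\<^bsub>B\<^esub> v" for u v using that B.monoD by blast
qed (use assms in auto)

lemma kernel_exists:
  assumes "\<And>f. f \<in> arr C \<Longrightarrow> \<exists>k. is_kernel C f k" "f \<in> arr B"
  shows "\<exists>k. is_kernel B f k \<and> (\<forall>i\<in>I. is_kernel C (farr (\<Psi> i) f) (farr (\<Psi> i) k))"
proof -
  have "\<forall>i\<in>I. \<exists>k. is_kernel C (farr (\<Psi> i) f) k" using assms \<Psi>_simps by blast
  then obtain k where k: "\<forall>i\<in>I. is_kernel C (farr (\<Psi> i) f) (k i)" by (auto dest: bchoice)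
  then have "src C (k i) \<in> obj C" if "i \<in> I" for i using that C.kernelD(2) C.src_closed by blast
  then obtain X a where X: "X \<in> obj B" "\<forall>i\<in>I. is_iso C (a i) \<and> a i \<in> arr C \<and> src C (a i) = fobj (\<Psi> i) X \<and> tgt C (a i) = src C (k i)"
    using surjective_iso[of "\<lambda>i. src C (k i)"] by blast
  have "\<exists>l\<in>arr B. src B l = X \<and> tgt B l = src B f \<and> (\<forall>i\<in>I. farr (\<Psi> i) l = k i \<cdot>\<^bsub>C\<^esub> a i)"
    by (rule full) (use X k C.kernelD \<Psi>_simps assms in auto)
  then obtain l where l: "l \<in> arr B" "src B l = X" "tgt B l = src B f" "\<forall>i\<in>I. farr (\<Psi> i) l = k i \<cdot>\<^bsub>C\<^esub> a i"
    by blast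
  then have *: "\<forall>i\<in>I. is_kernel C (farr (\<Psi> i) f) (farr (\<Psi> i) l)" using X k C.kernel_iso_right by auto
  then have "is_kernel B f l" using l assms(2) by (intro kernel_reflect) auto
  then show ?thesis using * by blast
qed

text \<open>A kernel that is one in every coordinate exists, and all kernels of \<open>f\<close> are isomorphic.\<close>

lemma kernel_preserve:
  assumes "\<And>f. f \<in> arr C \<Longrightarrow> \<exists>k. is_kernel C f k" "is_kernel B f k" "i \<in> I"
  shows "is_kernel C (farr (\<Psi> i) f) (farr (\<Psi> i) k)"
proof -
  note k = B.kernelD[OF assms(2)]
  obtain l where l: "is_kernel B f l" "\<forall>i\<in>I. is_kernel C (farr (\<Psi> i) f) (farr (\<Psi> i) l)"
    using kernel_exists[OF assms(1) k(1)] by blast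
  note l' = B.kernelD[OF l(1)]
  obtain u where u: "u \<in> arr B" "src B u = src B k" "tgt B u = src B l" "l \<cdot>\<^bsub>B\<^esub> u = k"
    using B.kernel_factor[OF l(1), of k] k by auto
  obtain v where v: "v \<in> arr B" "src B v = src B l" "tgt B v = src B k" "k \<cdot>\<^bsub>B\<^esub> v = l"
    using B.kernel_factor[OF assms(2), of l] l' by auto
  have "v \<cdot>\<^bsub>B\<^esub> u = ident B (src B k)"
    by (rule B.kernel_cancel[OF assms(2)]) (use u v k l' B.extend[OF v(4), of u] in auto)
  moreover have "u \<cdot>\<^bsub>B\<^esub> v = ident B (src B l)"
    by (rule B.kernel_cancel[OF l(1)]) (use u v k l' B.extend[OF u(4), of v] in auto)
  ultimately have "is_iso B u" using u v by (intro B.isoI[of u v]) auto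
  then have "is_iso C (farr (\<Psi> i) u)" using B.functor_iso[OF C.linear_category_axioms linear] assms(3) by blast
  moreover have "farr (\<Psi> i) k = farr (\<Psi> i) l \<cdot>\<^bsub>C\<^esub> farr (\<Psi> i) u"
    using u(1-3) l' \<Psi>_simps[OF assms(3)] by (simp flip: u(4))
  ultimately show ?thesis using C.kernel_iso_right[of _ _ "farr (\<Psi> i) u"] l(2) u(1-3) l' \<Psi>_simps[OF assms(3)] assms(3) by auto
qed

lemma mono_normal:
  assumes "\<And>m. is_mono C m \<Longrightarrow> \<exists>f. is_kernel C f m" "is_mono B m"
  shows "\<exists>f. is_kernel B f m"
proof -
  note m = B.mono_arr[OF assms(2)]
  have "\<forall>i\<in>I. \<exists>f. is_kernel C f (farr (\<Psi> i) m)" using assms mono_preserve by blast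
  then obtain f where f: "\<forall>i\<in>I. is_kernel C (f i) (farr (\<Psi> i) m)" by (auto dest: bchoice)
  have f': "f i \<in> arr C" "src C (f i) = fobj (\<Psi> i) (tgt B m)" if "i \<in> I" for i
    using that f m C.kernelD(1) C.kernelD(3)[of "f i" "farr (\<Psi> i) m"] \<Psi>_simps by auto
  then obtain X a where X: "X \<in> obj B" "\<forall>i\<in>I. is_iso C (a i) \<and> a i \<in> arr C \<and> src C (a i) = fobj (\<Psi> i) X \<and> tgt C (a i) = tgt C (f i)"
    using surjective_iso[of "\<lambda>i. tgt C (f i)"] by auto
  have "\<exists>l\<in>arr B. src B l = tgt B m \<and> tgt B l = X \<and> (\<forall>i\<in>I. farr (\<Psi> i) l = C.inv_arr (a i) \<cdot>\<^bsub>C\<^esub> f i)"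
    by (rule full) (use X f' \<Psi>_simps m in auto)
  then obtain l where l: "l \<in> arr B" "src B l = tgt B m" "tgt B l = X" "\<forall>i\<in>I. farr (\<Psi> i) l = C.inv_arr (a i) \<cdot>\<^bsub>C\<^esub> f i"
    by blast
  then have "is_kernel C (farr (\<Psi> i) l) (farr (\<Psi> i) m)" if "i \<in> I" for i
    using that X f C.kernel_iso_left[of "f i" "farr (\<Psi> i) m" "C.inv_arr (a i)"] by auto
  then show ?thesis using l m by (intro exI[of _ l] kernel_reflect) auto
qed

lemma jointly_equivalent_dual: "jointly_equivalent (dual_cat B) (dual_cat C) I \<Psi>"
proof -
  interpret B': linear_category "dual_cat B" by (rule linear_category_dual) unfold_locales
  interpret C': linear_category "dual_cat C" by (rule linear_category_dual) unfold_locales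
  show ?thesis
  proof
    show "\<exists>f\<in>arr (dual_cat B). src (dual_cat B) f = X \<and> tgt (dual_cat B) f = Y \<and> (\<forall>i\<in>I. farr (\<Psi> i) f = u i)"
      if "X \<in> obj (dual_cat B)" "Y \<in> obj (dual_cat B)"
        "\<And>i. i \<in> I \<Longrightarrow> u i \<in> arr (dual_cat C) \<and> src (dual_cat C) (u i) = fobj (\<Psi> i) X \<and> tgt (dual_cat C) (u i) = fobj (\<Psi> i) Y"
      for X Y u using full[of Y X u] that by auto
    show "\<exists>X\<in>obj (dual_cat B). \<forall>i\<in>I. isomorphic (dual_cat C) (fobj (\<Psi> i) X) (Z i)"
      if Zo: "\<And>i. i \<in> I \<Longrightarrow> Z i \<in> obj (dual_cat C)" for Z
    proof -
      obtain X where "X \<in> obj B" "\<forall>i\<in>I. isomorphic C (fobj (\<Psi> i) X) (Z i)" using surjective[of Z] Zo by auto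
      then show ?thesis using C.isomorphic_sym by (intro bexI[of _ X]) (auto simp: dual_isomorphic)
    qed
    show "f = g" if "f \<in> arr (dual_cat B)" "g \<in> arr (dual_cat B)" "src (dual_cat B) f = src (dual_cat B) g"
       "tgt (dual_cat B) f = tgt (dual_cat B) g" "\<And>i. i \<in> I \<Longrightarrow> farr (\<Psi> i) f = farr (\<Psi> i) g" for f g
      using faithful that by auto
  qed (use finite_I linear linear_functor_dual in auto)
qed

lemma direct_sum_reflect:
  assumes "finite J" "Y \<in> obj B"
    "\<And>j. j \<in> J \<Longrightarrow> Z j \<in> obj B \<and> \<iota> j \<in> arr B \<and> src B (\<iota> j) = Z j \<and> tgt B (\<iota> j) = Y \<and>
       \<pi> j \<in> arr B \<and> src B (\<pi> j) = Y \<and> tgt B (\<pi> j) = Z j"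
    "\<And>i. i \<in> I \<Longrightarrow> is_direct_sum C J (\<lambda>j. fobj (\<Psi> i) (Z j)) (fobj (\<Psi> i) Y) (\<lambda>j. farr (\<Psi> i) (\<iota> j)) (\<lambda>j. farr (\<Psi> i) (\<pi> j))"
  shows "is_direct_sum B J Z Y \<iota> \<pi>"
proof -
  note d = C.direct_sumD[OF assms(4)]
  have 1: "\<pi> j \<cdot>\<^bsub>B\<^esub> \<iota> k = (if j = k then ident B (Z j) else hzero B (Z k) (Z j))" if "j \<in> J" "k \<in> J" for j k
    by (rule faithful) (use assms(2,3) that d \<Psi>_simps \<Psi>_hzero in auto)
  have 2: "B.hsum Y Y (\<lambda>j. \<iota> j \<cdot>\<^bsub>B\<^esub> \<pi> j) J = ident B Y"
  proof (rule faithful)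
    fix i assume i: "i \<in> I"
    have "farr (\<Psi> i) (B.hsum Y Y (\<lambda>j. \<iota> j \<cdot>\<^bsub>B\<^esub> \<pi> j) J) =
      C.hsum (fobj (\<Psi> i) Y) (fobj (\<Psi> i) Y) (\<lambda>j. farr (\<Psi> i) (\<iota> j \<cdot>\<^bsub>B\<^esub> \<pi> j)) J"
      using assms(1-3) by (intro B.functor_hsum[OF C.linear_category_axioms linear[OF i]]) auto
    also have "\<dots> = C.hsum (fobj (\<Psi> i) Y) (fobj (\<Psi> i) Y) (\<lambda>j. farr (\<Psi> i) (\<iota> j) \<cdot>\<^bsub>C\<^esub> farr (\<Psi> i) (\<pi> j)) J"
      using assms(2,3) \<Psi>_simps[OF i] by (intro C.hsum_cong) auto
    finally show "farr (\<Psi> i) (B.hsum Y Y (\<lambda>j. \<iota> j \<cdot>\<^bsub>B\<^esub> \<pi> j) J) = farr (\<Psi> i) (ident B Y)"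
      using d(2)[OF i] \<Psi>_simps[OF i] assms(2) by simp
  qed (use assms in auto)
  show ?thesis using 1 2 assms(2,3) by (auto simp: is_direct_sum_def)
qed

end

context linear_category
begin

definition lin_span :: "'o \<Rightarrow> 'o \<Rightarrow> 'm set \<Rightarrow> 'm set" where
  "lin_span X Y S = {hsum X Y (\<lambda>s. hscale C (c s) s) S |c. True}"

lemma finite_dim_hom_iff:
  "finite_dim_hom C X Y \<longleftrightarrow> (\<exists>S. finite S \<and> S \<subseteq> Hom C X Y \<and> Hom C X Y \<subseteq> lin_span X Y S)"
  unfolding finite_dim_hom_def lin_span_def subset_iff Ball_def mem_Collect_eq by (simp del: in_Hom)

lemma lin_span_closed:
  assumes "finite S" "S \<subseteq> Hom C X Y" "X \<in> obj C" "Y \<in> obj C"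
  shows "hzero C X Y \<in> lin_span X Y S" "s \<in> S \<Longrightarrow> s \<in> lin_span X Y S"
    "f \<in> lin_span X Y S \<Longrightarrow> g \<in> lin_span X Y S \<Longrightarrow> hadd C f g \<in> lin_span X Y S"
    "f \<in> lin_span X Y S \<Longrightarrow> hscale C a f \<in> lin_span X Y S"
proof -
  have S: "s \<in> arr C \<and> src C s = X \<and> tgt C s = Y" if "s \<in> S" for s using assms that by auto
  have "hsum X Y (\<lambda>s. hscale C 0 s) S = hzero C X Y" by (rule hsum_zeros) (use assms S in auto)
  then show "hzero C X Y \<in> lin_span X Y S" unfolding lin_span_def by (auto intro!: exI[of _ "\<lambda>_. 0"])
  show "s \<in> lin_span X Y S" if s: "s \<in> S"
  proof -
    have "hsum X Y (\<lambda>t. hscale C (if t = s then 1 else 0) t) S = hscale C (if s = s then 1 else 0) s"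
      by (rule hsum_single[where f = "\<lambda>t. hscale C (if t = s then 1 else 0) t"]) (use assms S s in auto)
    then show ?thesis using S[OF s] unfolding lin_span_def
      by (auto intro!: exI[of _ "\<lambda>t. if t = s then 1 else 0"])
  qed
  show "hadd C f g \<in> lin_span X Y S" if fg: "f \<in> lin_span X Y S" "g \<in> lin_span X Y S"
  proof -
    obtain c d where "f = hsum X Y (\<lambda>s. hscale C (c s) s) S" "g = hsum X Y (\<lambda>s. hscale C (d s) s) S"
      using fg unfolding lin_span_def by auto
    then have "hadd C f g = hsum X Y (\<lambda>s. hadd C (hscale C (c s) s) (hscale C (d s) s)) S"
      using S assms by (subst hsum_hadd) auto
    also have "\<dots> = hsum X Y (\<lambda>s. hscale C (c s + d s) s) S"
      using S assms by (intro hsum_cong) (auto simp: hscale_add)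
    finally show ?thesis unfolding lin_span_def by (auto intro!: exI[of _ "\<lambda>s. c s + d s"])
  qed
  show "hscale C a f \<in> lin_span X Y S" if f: "f \<in> lin_span X Y S"
  proof -
    obtain c where "f = hsum X Y (\<lambda>s. hscale C (c s) s) S" using f unfolding lin_span_def by auto
    then have "hscale C a f = hsum X Y (\<lambda>s. hscale C a (hscale C (c s) s)) S"
      using S assms by (simp add: hscale_hsum)
    also have "\<dots> = hsum X Y (\<lambda>s. hscale C (a * c s) s) S"
      using S assms by (intro hsum_cong) (auto simp: hscale_mult)
    finally show ?thesis unfolding lin_span_def by (auto intro!: exI[of _ "\<lambda>s. a * c s"])
  qed
qed

lemma lin_span_arr:
  assumes "S \<subseteq> Hom C X Y" "X \<in> obj C" "Y \<in> obj C" "f \<in> lin_span X Y S"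
  shows "f \<in> Hom C X Y"
  using assms unfolding lin_span_def by (fastforce simp: subset_iff)

lemma hsum_in_lin_span:
  assumes "finite S" "S \<subseteq> Hom C X Y" "X \<in> obj C" "Y \<in> obj C" "finite J" "\<And>j. j \<in> J \<Longrightarrow> f j \<in> lin_span X Y S"
  shows "hsum X Y f J \<in> lin_span X Y S"
  using assms(5,6)
proof (induction J)
  case empty then show ?case using lin_span_closed(1)[OF assms(1-4)] assms by simp
next
  case (insert k J)
  have a: "f j \<in> arr C \<and> src C (f j) = X \<and> tgt C (f j) = Y" if "j \<in> insert k J" for j
    using lin_span_arr[OF assms(2-4) insert(4)[OF that]] by auto
  have "hsum X Y f (insert k J) = hadd C (f k) (hsum X Y f J)"
    by (rule hsum_insert) (use insert a assms in auto)
  then show ?case using insert lin_span_closed(3)[OF assms(1-4)] by auto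
qed

lemma kernel_iso_src:
  assumes "is_kernel C f k" "b \<in> arr C" "b' \<in> arr C" "tgt C b = src C f" "src C b' = tgt C b" "tgt C b' = src C b"
    "b \<cdot> b' = idm (tgt C b)" "b' \<cdot> b = idm (src C b)"
  shows "is_kernel C (f \<cdot> b) (b' \<cdot> k)"
proof (rule kernelI)
  note k = kernelD[OF assms(1)]
  have bk: "b \<cdot> b' \<cdot> z = z" if "z \<in> arr C" "tgt C z = src C f" for z
    using extend[OF assms(7), of z] assms that by simp
  have kb: "b' \<cdot> b \<cdot> z = z" if "z \<in> arr C" "tgt C z = src C b" for z
    using extend[OF assms(8), of z] assms that by simp
  show "f \<cdot> b \<in> arr C" "b' \<cdot> k \<in> arr C" "tgt C (b' \<cdot> k) = src C (f \<cdot> b)" using k assms by auto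
  show "(f \<cdot> b) \<cdot> b' \<cdot> k = hzero C (src C (b' \<cdot> k)) (tgt C (f \<cdot> b))" using k assms bk by simp
  fix h assume h: "h \<in> arr C" "tgt C h = src C (f \<cdot> b)" "(f \<cdot> b) \<cdot> h = hzero C (src C h) (tgt C (f \<cdot> b))"
  have "\<exists>u\<in>arr C. src C u = src C (b \<cdot> h) \<and> tgt C u = src C k \<and> k \<cdot> u = b \<cdot> h"
    by (rule kernel_factor[OF assms(1)]) (use h k assms in auto)
  then obtain u where u: "u \<in> arr C" "src C u = src C h" "tgt C u = src C k" "k \<cdot> u = b \<cdot> h"
    using h k assms by auto
  then have "(b' \<cdot> k) \<cdot> u = h" using h k assms kb by simp
  then show "\<exists>u\<in>arr C. src C u = src C h \<and> tgt C u = src C (b' \<cdot> k) \<and> (b' \<cdot> k) \<cdot> u = h"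
    using u k assms by (intro bexI[of _ u]) auto
next
  note k = kernelD[OF assms(1)]
  have i: "is_iso C b'" using assms by (intro isoI[of b' b]) auto
  fix u v assume h: "u \<in> arr C" "v \<in> arr C" "src C u = src C v" "tgt C u = src C (b' \<cdot> k)"
    "tgt C v = src C (b' \<cdot> k)" "(b' \<cdot> k) \<cdot> u = (b' \<cdot> k) \<cdot> v"
  have "k \<cdot> u = k \<cdot> v" by (rule iso_cancel_left[OF i]) (use h k assms in auto)
  then show "u = v" by - (rule kernel_cancel[OF assms(1)]; use h k assms in auto)
qed

lemma kernel_conj:
  assumes "is_kernel C f k" "b \<in> arr C" "b' \<in> arr C" "tgt C b = src C f" "src C b' = tgt C b" "tgt C b' = src C b"
    "b \<cdot> b' = idm (tgt C b)" "b' \<cdot> b = idm (src C b)" "is_iso C c" "src C c = tgt C f" "is_iso C a" "tgt C a = src C k"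
  shows "is_kernel C (c \<cdot> f \<cdot> b) (b' \<cdot> k \<cdot> a)"
proof -
  note k = kernelD[OF assms(1)] and a = iso_arr[OF assms(11)]
  have 1: "is_kernel C (c \<cdot> f \<cdot> b) (b' \<cdot> k)"
    by (rule kernel_iso_left[OF kernel_iso_src[OF assms(1-8)] assms(9)]) (use assms k in auto)
  have "is_kernel C (c \<cdot> f \<cdot> b) ((b' \<cdot> k) \<cdot> a)"
    by (rule kernel_iso_right[OF 1 assms(11)]) (use assms k in auto)
  then show ?thesis using assms k a by simp
qed

lemma cokernel_conj:
  assumes "is_cokernel C m p" "is_iso C a" "is_iso C b" "is_iso C c" "tgt C a = src C m" "tgt C b = tgt C m" "tgt C c = tgt C p"
  shows "is_cokernel C (inv_arr b \<cdot> m \<cdot> a) (inv_arr c \<cdot> p \<cdot> b)"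
proof -
  interpret D: linear_category "dual_cat C" by (rule linear_category_dual) unfold_locales
  have p: "m \<in> arr C" "p \<in> arr C" "src C p = tgt C m" using assms(1) by (auto simp: is_cokernel_def)
  note i = iso_arr[OF assms(2)] iso_arr[OF assms(3)] iso_arr[OF assms(4)]
  have "is_kernel (dual_cat C) m p" using assms(1) by (simp add: dual_kernel)
  from D.kernel_conj[OF this, of "inv_arr b" b a "inv_arr c"]
  have "is_kernel (dual_cat C) ((inv_arr b \<cdot> m) \<cdot> a) ((inv_arr c \<cdot> p) \<cdot> b)"
    using assms p i by (simp add: dual_iso del: assoc)
  then show ?thesis using assms p i by (simp add: dual_kernel)
qed

lemma inv_arr_inv [simp]: "is_iso C f \<Longrightarrow> inv_arr (inv_arr f) = f"
  using iso_arr[of f] by (intro inv_arr_unique[symmetric]) auto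

lemma inv_arr_ident [simp]: "X \<in> obj C \<Longrightarrow> inv_arr (idm X) = idm X"
  by (intro inv_arr_unique[symmetric]) auto

lemma finite_length_iso:
  assumes "finite_length C X" "isomorphic C X Y" shows "finite_length C Y"
  using assms(1)
proof cases
  case zero then show ?thesis using zero_obj_iso[OF _ assms(2)] by (intro finite_length.zero)
next
  case (extend m p)
  obtain a where a: "a \<in> arr C" "src C a = tgt C m" "tgt C a = Y" "is_iso C a"
    using assms(2) extend(1) unfolding isomorphic_iff by blast
  note m = mono_arr[OF extend(3)]
  have p: "p \<in> arr C" "src C p = tgt C m" using extend(4) by (auto simp: is_cokernel_def)
  have 1: "is_mono C (a \<cdot> m)" using mono_cmp_iso[OF extend(3) a(4) a(2), of "idm (src C m)"] m a by simp
  have 2: "is_cokernel C (a \<cdot> m) (p \<cdot> inv_arr a)"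
    using cokernel_conj[OF extend(4), of "idm (src C m)" "inv_arr a" "idm (tgt C p)"] m p a by simp
  have "finite_length C (tgt C (a \<cdot> m))"
    by (rule finite_length.extend[of C "a \<cdot> m" "p \<cdot> inv_arr a"]) (use 1 2 extend a m p in auto)
  then show ?thesis using a m by simp
qed

lemma simple_iso:
  assumes "is_simple C X" "isomorphic C X Y" shows "is_simple C Y"
  unfolding is_simple_def
proof (intro conjI allI impI)
  obtain a where a: "a \<in> arr C" "src C a = X" "tgt C a = Y" "is_iso C a"
    using assms(2) unfolding isomorphic_iff by blast
  show "Y \<in> obj C" using a tgt_closed by blast
  show "\<not> is_zero_obj C Y"
    using assms zero_obj_iso isomorphic_sym unfolding is_simple_def by blast
  fix m assume m: "is_mono C m \<and> tgt C m = Y"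
  note m' = mono_arr[OF conjunct1[OF m]]
  have 1: "is_mono C (inv_arr a \<cdot> m)" "tgt C (inv_arr a \<cdot> m) = X" "src C (inv_arr a \<cdot> m) = src C m"
    using mono_cmp_iso[of m "inv_arr a" "idm (src C m)"] m m' a by auto
  then have "is_zero_obj C (src C m) \<or> is_iso C (inv_arr a \<cdot> m)"
    using assms(1) unfolding is_simple_def by metis
  moreover have "is_iso C m" if "is_iso C (inv_arr a \<cdot> m)"
  proof -
    have e: "a \<cdot> inv_arr a \<cdot> m = m" using a m m' by simp
    show ?thesis by (subst e[symmetric], rule iso_cmp) (use that a m m' in auto)
  qed
  ultimately show "is_zero_obj C (src C m) \<or> is_iso C m" by blast
qed

lemma cokernel_iso_zero:
  assumes "is_iso C f" "is_zero_obj C Z" shows "is_cokernel C f (hzero C (tgt C f) Z)"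
proof -
  interpret D: linear_category "dual_cat C" by (rule linear_category_dual) unfold_locales
  show ?thesis using D.kernel_iso_zero[of f Z] assms by (simp add: dual_kernel dual_iso dual_zero_obj)
qed

end

locale jointly_equivalent_abelian = jointly_equivalent B C I \<Psi> + C: abelian_category C
  for B :: "('p, 'n, 'k::field, 'y) lin_cat_scheme" and C :: "('o, 'm, 'k, 'z) lin_cat_scheme"
    and I :: "'i set" and \<Psi> :: "'i \<Rightarrow> ('p, 'n, 'o, 'm) cat_functor"
begin

lemma direct_sum_exists_via:
  assumes "finite J" "\<And>j. j \<in> J \<Longrightarrow> Z j \<in> obj B"
  shows "\<exists>Y \<iota> \<pi>. is_direct_sum B J Z Y \<iota> \<pi>"
proof -
  have "\<forall>i\<in>I. \<exists>D. is_direct_sum C J (\<lambda>j. fobj (\<Psi> i) (Z j)) (fst D) (fst (snd D)) (snd (snd D))"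
  proof
    fix i assume "i \<in> I"
    then obtain S a b where "is_direct_sum C J (\<lambda>j. fobj (\<Psi> i) (Z j)) S a b"
      using C.finite_direct_sum_exists[of J "\<lambda>j. fobj (\<Psi> i) (Z j)"] assms \<Psi>_simps by auto
    then show "\<exists>D. is_direct_sum C J (\<lambda>j. fobj (\<Psi> i) (Z j)) (fst D) (fst (snd D)) (snd (snd D))"
      by (intro exI[of _ "(S, a, b)"]) simp
  qed
  then obtain D where D: "\<forall>i\<in>I. is_direct_sum C J (\<lambda>j. fobj (\<Psi> i) (Z j)) (fst (D i)) (fst (snd (D i))) (snd (snd (D i)))"
    by (rule bchoice[THEN exE])
  obtain Y a where Y: "Y \<in> obj B" "\<forall>i\<in>I. is_iso C (a i) \<and> a i \<in> arr C \<and> src C (a i) = fobj (\<Psi> i) Y \<and> tgt C (a i) = fst (D i)"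
    using surjective_iso[of "\<lambda>i. fst (D i)"] D C.direct_sumD(1) by blast
  let ?i = "\<lambda>i j. C.inv_arr (a i) \<cdot>\<^bsub>C\<^esub> fst (snd (D i)) j" and ?p = "\<lambda>i j. snd (snd (D i)) j \<cdot>\<^bsub>C\<^esub> a i"
  have S: "is_direct_sum C J (\<lambda>j. fobj (\<Psi> i) (Z j)) (fobj (\<Psi> i) Y) (?i i) (?p i)" if "i \<in> I" for i
    using C.direct_sum_iso[OF assms(1) bspec[OF D that], of "a i"] Y(2) that by auto
  note d = C.direct_sumD[OF S]
  have "\<forall>j\<in>J. \<exists>f. f \<in> arr B \<and> src B f = Z j \<and> tgt B f = Y \<and> (\<forall>i\<in>I. farr (\<Psi> i) f = ?i i j)"
  proof
    fix j assume j: "j \<in> J"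
    have "\<exists>f\<in>arr B. src B f = Z j \<and> tgt B f = Y \<and> (\<forall>i\<in>I. farr (\<Psi> i) f = ?i i j)"
      by (rule full) (use d(4-6) j Y(1) assms(2) in blast)+
    then show "\<exists>f. f \<in> arr B \<and> src B f = Z j \<and> tgt B f = Y \<and> (\<forall>i\<in>I. farr (\<Psi> i) f = ?i i j)" by blast
  qed
  then obtain \<iota> where \<iota>: "\<forall>j\<in>J. \<iota> j \<in> arr B \<and> src B (\<iota> j) = Z j \<and> tgt B (\<iota> j) = Y \<and> (\<forall>i\<in>I. farr (\<Psi> i) (\<iota> j) = ?i i j)"
    by (auto dest: bchoice)
  have "\<forall>j\<in>J. \<exists>f. f \<in> arr B \<and> src B f = Y \<and> tgt B f = Z j \<and> (\<forall>i\<in>I. farr (\<Psi> i) f = ?p i j)"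
  proof
    fix j assume j: "j \<in> J"
    have "\<exists>f\<in>arr B. src B f = Y \<and> tgt B f = Z j \<and> (\<forall>i\<in>I. farr (\<Psi> i) f = ?p i j)"
      by (rule full) (use d(7-9) j Y(1) assms(2) in blast)+
    then show "\<exists>f. f \<in> arr B \<and> src B f = Y \<and> tgt B f = Z j \<and> (\<forall>i\<in>I. farr (\<Psi> i) f = ?p i j)" by blast
  qed
  then obtain \<pi> where \<pi>: "\<forall>j\<in>J. \<pi> j \<in> arr B \<and> src B (\<pi> j) = Y \<and> tgt B (\<pi> j) = Z j \<and> (\<forall>i\<in>I. farr (\<Psi> i) (\<pi> j) = ?p i j)"
    by (auto dest: bchoice)
  have "is_direct_sum B J Z Y \<iota> \<pi>"
  proof (rule direct_sum_reflect)
    fix i assume i: "i \<in> I"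
    show "is_direct_sum C J (\<lambda>j. fobj (\<Psi> i) (Z j)) (fobj (\<Psi> i) Y) (\<lambda>j. farr (\<Psi> i) (\<iota> j)) (\<lambda>j. farr (\<Psi> i) (\<pi> j))"
    proof -
      have "C.hsum (fobj (\<Psi> i) Y) (fobj (\<Psi> i) Y) (\<lambda>j. farr (\<Psi> i) (\<iota> j) \<cdot>\<^bsub>C\<^esub> farr (\<Psi> i) (\<pi> j)) J =
         C.hsum (fobj (\<Psi> i) Y) (fobj (\<Psi> i) Y) (\<lambda>j. ?i i j \<cdot>\<^bsub>C\<^esub> ?p i j) J"
        using d(1,4-9)[OF i] \<iota> \<pi> i by (intro C.hsum_cong) auto
      then show ?thesis using S[OF i] \<iota> \<pi> i by (simp add: is_direct_sum_def)
    qed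
  qed (use assms Y \<iota> \<pi> in auto)
  then show ?thesis by blast
qed

lemma cokernel_reflect:
  assumes "f \<in> arr B" "p \<in> arr B" "src B p = tgt B f"
    "\<And>i. i \<in> I \<Longrightarrow> is_cokernel C (farr (\<Psi> i) f) (farr (\<Psi> i) p)"
  shows "is_cokernel B f p"
proof -
  interpret D: jointly_equivalent "dual_cat B" "dual_cat C" I \<Psi> by (rule jointly_equivalent_dual)
  show ?thesis using D.kernel_reflect[of f p] assms by (simp add: dual_kernel)
qed

lemma cokernel_preserve:
  assumes "is_cokernel B f p" "i \<in> I" shows "is_cokernel C (farr (\<Psi> i) f) (farr (\<Psi> i) p)"
proof -
  interpret D: jointly_equivalent "dual_cat B" "dual_cat C" I \<Psi> by (rule jointly_equivalent_dual)
  show ?thesis using D.kernel_preserve[of f p i] assms C.cokernel_exists by (simp add: dual_kernel)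
qed

lemma abelian: "abelian_category B"
proof
  interpret D: jointly_equivalent "dual_cat B" "dual_cat C" I \<Psi> by (rule jointly_equivalent_dual)
  show "\<exists>Z. is_zero_obj B Z"
  proof -
    obtain Z where Z: "is_zero_obj C Z" using C.zero_obj_exists by blast
    then obtain X where X: "X \<in> obj B" "\<forall>i\<in>I. isomorphic C (fobj (\<Psi> i) X) Z"
      using surjective[of "\<lambda>_. Z"] by (auto simp: C.zero_obj_iff)
    then have "is_zero_obj B X" using Z C.zero_obj_iso C.isomorphic_sym by (intro zero_obj_reflect) blast+
    then show ?thesis by blast
  qed
  show "\<exists>S \<iota> \<pi>. is_direct_sum B (UNIV::bool set) (\<lambda>b. if b then X else Y) S \<iota> \<pi>"
    if "X \<in> obj B" "Y \<in> obj B" for X Y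
    using direct_sum_exists_via[of "UNIV::bool set" "\<lambda>b. if b then X else Y"] that by simp
  show "\<exists>k. is_kernel B f k" if "f \<in> arr B" for f using kernel_exists[OF C.kernel_exists that] by blast
  show "\<exists>p. is_cokernel B f p" if "f \<in> arr B" for f
    using D.kernel_exists[of f] that C.cokernel_exists by (auto simp: dual_kernel)
  show "\<exists>f. is_kernel B f m" if "is_mono B m" for m using mono_normal[OF C.mono_normal that] by blast
  show "\<exists>f. is_cokernel B f p" if "is_epi B p" for p
    using D.mono_normal[of p] that C.epi_normal by (auto simp: dual_kernel dual_mono)
qed

text \<open>A subobject vanishes at the coordinates where the object does, and at \<open>i\<close> it is zero or everything.\<close>

lemma simple_reflect:
  assumes "X \<in> obj B" "i \<in> I" "is_simple C (fobj (\<Psi> i) X)" "\<And>j. j \<in> I \<Longrightarrow> j \<noteq> i \<Longrightarrow> is_zero_obj C (fobj (\<Psi> j) X)"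
  shows "is_simple B X"
  unfolding is_simple_def
proof (intro conjI allI impI)
  show "\<not> is_zero_obj B X"
    using assms B.functor_zero_obj[OF C.linear_category_axioms linear] by (auto simp: is_simple_def)
  fix m assume m: "is_mono B m \<and> tgt B m = X"
  note m' = B.mono_arr[OF conjunct1[OF m]]
  have z: "is_zero_obj C (fobj (\<Psi> j) (src B m))" if "j \<in> I" "j \<noteq> i" for j
  proof -
    note mj = mono_preserve[OF conjunct1[OF m] that(1)]
    have s: "fobj (\<Psi> j) (src B m) \<in> obj C" using \<Psi>_simps that m' by auto
    have e: "farr (\<Psi> j) m = hzero C (fobj (\<Psi> j) (src B m)) (fobj (\<Psi> j) X)"
      using C.zero_obj_arr(2)[OF assms(4)[OF that], of "farr (\<Psi> j) m"] \<Psi>_simps[OF that(1)] m m' by metis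
    have 1: "farr (\<Psi> j) m \<cdot>\<^bsub>C\<^esub> ident C (fobj (\<Psi> j) (src B m)) = farr (\<Psi> j) m \<cdot>\<^bsub>C\<^esub> hzero C (fobj (\<Psi> j) (src B m)) (fobj (\<Psi> j) (src B m))"
      unfolding e using \<Psi>_simps(1)[OF that(1) assms(1)] s by simp
    have "ident C (fobj (\<Psi> j) (src B m)) = hzero C (fobj (\<Psi> j) (src B m)) (fobj (\<Psi> j) (src B m))"
      by (rule C.monoD[OF mj]) (use 1 \<Psi>_simps that m' s in auto)
    then show ?thesis using s by (simp add: C.zero_obj_iff)
  qed
  have "is_mono C (farr (\<Psi> i) m)" "tgt C (farr (\<Psi> i) m) = fobj (\<Psi> i) X"
    using mono_preserve m assms(2) m' \<Psi>_simps by auto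
  then have "is_zero_obj C (fobj (\<Psi> i) (src B m)) \<or> is_iso C (farr (\<Psi> i) m)"
    using assms(2,3) \<Psi>_simps m' by (auto simp: is_simple_def)
  then show "is_zero_obj B (src B m) \<or> is_iso B m"
  proof
    assume "is_zero_obj C (fobj (\<Psi> i) (src B m))"
    then have "is_zero_obj B (src B m)" using z m' by (intro zero_obj_reflect) auto
    then show ?thesis by simp
  next
    assume i: "is_iso C (farr (\<Psi> i) m)"
    have "is_iso C (farr (\<Psi> j) m)" if "j \<in> I" "j \<noteq> i" for j
    proof (rule C.isoI[of _ "hzero C (fobj (\<Psi> j) X) (fobj (\<Psi> j) (src B m))"])
      note o = assms(4)[OF that] z[OF that]
      have "ident C (fobj (\<Psi> j) X) = hzero C (fobj (\<Psi> j) X) (fobj (\<Psi> j) X)"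
         "ident C (fobj (\<Psi> j) (src B m)) = hzero C (fobj (\<Psi> j) (src B m)) (fobj (\<Psi> j) (src B m))"
        using o by (auto simp: C.zero_obj_iff)
      then show "hzero C (fobj (\<Psi> j) X) (fobj (\<Psi> j) (src B m)) \<cdot>\<^bsub>C\<^esub> farr (\<Psi> j) m = ident C (src C (farr (\<Psi> j) m))"
        "farr (\<Psi> j) m \<cdot>\<^bsub>C\<^esub> hzero C (fobj (\<Psi> j) X) (fobj (\<Psi> j) (src B m)) = ident C (tgt C (farr (\<Psi> j) m))"
        using m m' \<Psi>_simps[OF that(1)] assms(1) by auto
    qed (use m m' \<Psi>_simps[OF that(1)] assms(1) in auto)
    then have "is_iso B m" using i m' by (intro iso_reflect) metis+
    then show ?thesis by simp
  qed
qed (use assms in auto)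

text \<open>A composition series of the \<open>i\<close>-th coordinate lifts to one that leaves the other coordinates fixed.\<close>

lemma finite_length_coordinate:
  assumes "finite_length C Z" "i \<in> I" "X \<in> obj B" "Y \<in> obj B" "finite_length B Y" "isomorphic C (fobj (\<Psi> i) X) Z"
    "is_zero_obj C (fobj (\<Psi> i) Y)" "\<And>j. j \<in> I \<Longrightarrow> j \<noteq> i \<Longrightarrow> isomorphic C (fobj (\<Psi> j) X) (fobj (\<Psi> j) Y)"
  shows "finite_length B X"
  using assms(1,3,6,8)
proof (induction arbitrary: X rule: finite_length.induct)
  case (zero Z)
  have "isomorphic C (fobj (\<Psi> i) X) (fobj (\<Psi> i) Y)"
    using C.isomorphic_trans[OF zero(3) C.zero_objs_iso[OF zero(1) assms(7)]] .
  then have "isomorphic B X Y" using zero assms(2,4) by (intro isomorphic_reflect) metis+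
  then show ?case using B.finite_length_iso[OF assms(5)] B.isomorphic_sym by blast
next
  case (extend m p)
  note m = C.mono_arr[OF extend(2)]
  have p: "p \<in> arr C" "src C p = tgt C m" using extend(3) by (auto simp: is_cokernel_def)
  obtain Z0 where Z0: "is_zero_obj C Z0" using C.zero_obj_exists by blast
  obtain b where b: "is_iso C b" "b \<in> arr C" "src C b = fobj (\<Psi> i) X" "tgt C b = tgt C m"
    using extend(7) unfolding C.isomorphic_iff by blast
  have oX0: "(if j = i then src C m else fobj (\<Psi> j) X) \<in> obj C" "(if j = i then tgt C p else Z0) \<in> obj C" if "j \<in> I" for j
    using m p Z0 extend(6) \<Psi>_simps(1)[OF that] by (auto simp: C.zero_obj_iff)
  obtain X0 a where X0: "X0 \<in> obj B" "\<forall>j\<in>I. is_iso C (a j) \<and> a j \<in> arr C \<and> src C (a j) = fobj (\<Psi> j) X0 \<and>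
      tgt C (a j) = (if j = i then src C m else fobj (\<Psi> j) X)"
    using surjective_iso[of "\<lambda>j. if j = i then src C m else fobj (\<Psi> j) X", OF oX0(1)] by blast
  obtain S c where S: "S \<in> obj B" "\<forall>j\<in>I. is_iso C (c j) \<and> c j \<in> arr C \<and> src C (c j) = fobj (\<Psi> j) S \<and>
      tgt C (c j) = (if j = i then tgt C p else Z0)"
    using surjective_iso[of "\<lambda>j. if j = i then tgt C p else Z0", OF oX0(2)] by blast
  let ?m = "\<lambda>j. if j = i then C.inv_arr b \<cdot>\<^bsub>C\<^esub> m \<cdot>\<^bsub>C\<^esub> a i else a j"
  let ?p = "\<lambda>j. if j = i then C.inv_arr (c i) \<cdot>\<^bsub>C\<^esub> p \<cdot>\<^bsub>C\<^esub> b else hzero C (fobj (\<Psi> j) X) (fobj (\<Psi> j) S)"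
  have am: "a i \<in> arr C" "src C (a i) = fobj (\<Psi> i) X0" "tgt C (a i) = src C m" "is_iso C (a i)"
    "c i \<in> arr C" "src C (c i) = fobj (\<Psi> i) S" "tgt C (c i) = tgt C p" "is_iso C (c i)"
    using X0 S assms(2) by auto
  have "\<exists>f\<in>arr B. src B f = X0 \<and> tgt B f = X \<and> (\<forall>j\<in>I. farr (\<Psi> j) f = ?m j)"
    by (rule full) (use X0 am b m extend(6) in auto)
  then obtain \<mu> where \<mu>: "\<mu> \<in> arr B" "src B \<mu> = X0" "tgt B \<mu> = X" "\<forall>j\<in>I. farr (\<Psi> j) \<mu> = ?m j" by blast
  have "\<exists>f\<in>arr B. src B f = X \<and> tgt B f = S \<and> (\<forall>j\<in>I. farr (\<Psi> j) f = ?p j)"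
    by (rule full) (use S am b p extend(6) \<Psi>_simps in auto)
  then obtain q where q: "q \<in> arr B" "src B q = X" "tgt B q = S" "\<forall>j\<in>I. farr (\<Psi> j) q = ?p j" by blast
  have zS: "is_zero_obj C (fobj (\<Psi> j) S)" if "j \<in> I" "j \<noteq> i" for j
  proof -
    have "isomorphic C (fobj (\<Psi> j) S) Z0" using S(2) that unfolding C.isomorphic_iff by metis
    then show ?thesis using Z0 C.zero_obj_iso C.isomorphic_sym by blast
  qed
  have "is_mono B \<mu>"
    by (rule mono_reflect) (use \<mu> X0 am C.iso_mono C.mono_cmp_iso[OF extend(2), of "C.inv_arr b" "a i"] b in auto)
  moreover have "is_cokernel B \<mu> q"
  proof (rule cokernel_reflect)
    fix j assume j: "j \<in> I"
    show "is_cokernel C (farr (\<Psi> j) \<mu>) (farr (\<Psi> j) q)"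
    proof (cases "j = i")
      case True then show ?thesis using \<mu>(4) q(4) j C.cokernel_conj[OF extend(3), of "a i" b "c i"] am b by simp
    next
      case False then show ?thesis
        using \<mu>(4) q(4) j C.cokernel_iso_zero[of "a j", OF _ zS[OF j False]] X0(2) by simp
    qed
  qed (use \<mu> q in auto)
  moreover have "is_simple B S"
  proof (rule simple_reflect[OF S(1) assms(2)])
    show "is_simple C (fobj (\<Psi> i) S)"
      using extend(4) C.simple_iso[of "tgt C p" "fobj (\<Psi> i) S"] am C.isomorphic_sym
      unfolding C.isomorphic_iff by metis
  qed (rule zS)
  moreover have "finite_length B X0"
  proof (rule extend(5))
    show "isomorphic C (fobj (\<Psi> i) X0) (src C m)" unfolding C.isomorphic_iff using am by blast
    show "isomorphic C (fobj (\<Psi> j) X0) (fobj (\<Psi> j) Y)" if "j \<in> I" "j \<noteq> i" for j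
      using C.isomorphic_trans[OF _ extend(8)[OF that], of "fobj (\<Psi> j) X0"] X0(2) that
      unfolding C.isomorphic_iff by metis
  qed (rule X0(1))
  ultimately show ?case using finite_length.extend[of B \<mu> q] \<mu> q by simp
qed

text \<open>The coordinates are cleared one after the other.\<close>

lemma finite_length:
  assumes "\<And>Z. Z \<in> obj C \<Longrightarrow> finite_length C Z" "X \<in> obj B"
  shows "finite_length B X"
proof -
  obtain Z0 where Z0: "is_zero_obj C Z0" using C.zero_obj_exists by blast
  have "finite_length B X" if "finite J" "J \<subseteq> I" "X \<in> obj B" "\<And>j. j \<in> I \<Longrightarrow> j \<notin> J \<Longrightarrow> is_zero_obj C (fobj (\<Psi> j) X)" for J X
    using that
  proof (induction J arbitrary: X)
    case empty then show ?case by (intro finite_length.zero zero_obj_reflect) auto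
  next
    case (insert i J)
    have oX: "(if j = i then Z0 else fobj (\<Psi> j) X) \<in> obj C" if "j \<in> I" for j
      using Z0 insert.prems \<Psi>_simps(1)[OF that] by (auto simp: C.zero_obj_iff)
    obtain Y where Y: "Y \<in> obj B" "\<forall>j\<in>I. isomorphic C (fobj (\<Psi> j) Y) (if j = i then Z0 else fobj (\<Psi> j) X)"
      using surjective[of "\<lambda>j. if j = i then Z0 else fobj (\<Psi> j) X", OF oX] by blast
    have i: "i \<in> I" using insert by simp
    have zi: "is_zero_obj C (fobj (\<Psi> i) Y)"
      using bspec[OF Y(2) i] Z0 C.zero_obj_iso C.isomorphic_sym by auto
    have iso: "isomorphic C (fobj (\<Psi> j) X) (fobj (\<Psi> j) Y)" if "j \<in> I" "j \<noteq> i" for j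
      using bspec[OF Y(2) that(1)] that C.isomorphic_sym by auto
    have "finite_length B Y"
    proof (rule insert.IH)
      fix j assume j: "j \<in> I" "j \<notin> J"
      show "is_zero_obj C (fobj (\<Psi> j) Y)"
      proof (cases "j = i")
        case False
        then have "is_zero_obj C (fobj (\<Psi> j) X)" using insert j by auto
        then show ?thesis using iso[OF j(1) False] C.zero_obj_iso by blast
      qed (use zi in simp)
    qed (use insert Y in auto)
    then show ?case
      by (intro finite_length_coordinate[of "fobj (\<Psi> i) X" i X Y])
        (use i insert.prems assms(1) zi iso Y C.isomorphic_refl \<Psi>_simps in auto)
  qed
  from this[of I X] show ?thesis using finite_I assms(2) by auto
qed

text \<open>Spanning sets of the coordinates, extended by zero to arrows of \<open>B\<close>, together span.\<close>

lemma finite_dim_hom: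
  assumes "\<And>X Y. X \<in> obj C \<Longrightarrow> Y \<in> obj C \<Longrightarrow> finite_dim_hom C X Y" "X \<in> obj B" "Y \<in> obj B"
  shows "finite_dim_hom B X Y"
proof -
  have "\<forall>i\<in>I. \<exists>S. finite S \<and> S \<subseteq> Hom C (fobj (\<Psi> i) X) (fobj (\<Psi> i) Y) \<and>
      Hom C (fobj (\<Psi> i) X) (fobj (\<Psi> i) Y) \<subseteq> C.lin_span (fobj (\<Psi> i) X) (fobj (\<Psi> i) Y) S"
    using assms \<Psi>_simps(1) by (simp add: C.finite_dim_hom_iff del: C.in_Hom)
  then obtain S where "\<forall>i\<in>I. finite (S i) \<and> S i \<subseteq> Hom C (fobj (\<Psi> i) X) (fobj (\<Psi> i) Y) \<and>
      Hom C (fobj (\<Psi> i) X) (fobj (\<Psi> i) Y) \<subseteq> C.lin_span (fobj (\<Psi> i) X) (fobj (\<Psi> i) Y) (S i)"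
    by (rule bchoice[THEN exE])
  then have S: "finite (S i)" "S i \<subseteq> Hom C (fobj (\<Psi> i) X) (fobj (\<Psi> i) Y)"
    "Hom C (fobj (\<Psi> i) X) (fobj (\<Psi> i) Y) \<subseteq> C.lin_span (fobj (\<Psi> i) X) (fobj (\<Psi> i) Y) (S i)" if "i \<in> I" for i
    using that by blast+
  define L where "L i s = (SOME f. f \<in> arr B \<and> src B f = X \<and> tgt B f = Y \<and> farr (\<Psi> i) f = s \<and>
      (\<forall>j\<in>I. j \<noteq> i \<longrightarrow> farr (\<Psi> j) f = hzero C (fobj (\<Psi> j) X) (fobj (\<Psi> j) Y)))" for i s
  have L: "L i s \<in> arr B" "src B (L i s) = X" "tgt B (L i s) = Y" "farr (\<Psi> i) (L i s) = s"
      "\<forall>j\<in>I. j \<noteq> i \<longrightarrow> farr (\<Psi> j) (L i s) = hzero C (fobj (\<Psi> j) X) (fobj (\<Psi> j) Y)"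
    if "i \<in> I" "s \<in> arr C" "src C s = fobj (\<Psi> i) X" "tgt C s = fobj (\<Psi> i) Y" for i s
  proof -
    have "\<exists>f. f \<in> arr B \<and> src B f = X \<and> tgt B f = Y \<and> farr (\<Psi> i) f = s \<and>
      (\<forall>j\<in>I. j \<noteq> i \<longrightarrow> farr (\<Psi> j) f = hzero C (fobj (\<Psi> j) X) (fobj (\<Psi> j) Y))"
      using lift_at[of i X Y s] that assms by blast
    from someI_ex[OF this, folded L_def]
    show "L i s \<in> arr B" "src B (L i s) = X" "tgt B (L i s) = Y" "farr (\<Psi> i) (L i s) = s"
      "\<forall>j\<in>I. j \<noteq> i \<longrightarrow> farr (\<Psi> j) (L i s) = hzero C (fobj (\<Psi> j) X) (fobj (\<Psi> j) Y)" by blast+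
  qed
  define T where "T = (\<Union>i\<in>I. L i ` S i)"
  have Si: "s \<in> arr C" "src C s = fobj (\<Psi> i) X" "tgt C s = fobj (\<Psi> i) Y" if "i \<in> I" "s \<in> S i" for i s
    using S(2)[OF that(1)] that(2) by auto
  have T: "finite T" "T \<subseteq> Hom B X Y" using S(1) finite_I L Si by (auto simp: T_def)
  note span = B.lin_span_closed[OF T assms(2,3)] B.hsum_in_lin_span[OF T assms(2,3)]
  have "f \<in> B.lin_span X Y T" if f: "f \<in> arr B" "src B f = X" "tgt B f = Y" for f
  proof -
    have "\<exists>c. farr (\<Psi> i) f = C.hsum (fobj (\<Psi> i) X) (fobj (\<Psi> i) Y) (\<lambda>s. hscale C (c s) s) (S i)" if "i \<in> I" for i
      using S(3)[OF that] f \<Psi>_simps[OF that] unfolding C.lin_span_def by (auto simp: subset_iff)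
    then obtain c where c: "\<And>i. i \<in> I \<Longrightarrow> farr (\<Psi> i) f = C.hsum (fobj (\<Psi> i) X) (fobj (\<Psi> i) Y) (\<lambda>s. hscale C (c i s) s) (S i)"
      by metis
    define g where "g i = B.hsum X Y (\<lambda>s. hscale B (c i s) (L i s)) (S i)" for i
    have g: "g i \<in> arr B \<and> src B (g i) = X \<and> tgt B (g i) = Y" if "i \<in> I" for i
      unfolding g_def using L[OF that Si[OF that]] assms(2,3) by simp
    have pg: "farr (\<Psi> j) (g i) = (if j = i then farr (\<Psi> i) f else hzero C (fobj (\<Psi> j) X) (fobj (\<Psi> j) Y))"
      if "i \<in> I" "j \<in> I" for i j
    proof -
      have "farr (\<Psi> j) (g i) = C.hsum (fobj (\<Psi> j) X) (fobj (\<Psi> j) Y) (\<lambda>s. farr (\<Psi> j) (hscale B (c i s) (L i s))) (S i)"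
        unfolding g_def
        by (rule B.functor_hsum[OF C.linear_category_axioms linear[OF that(2)]])
          (use assms(2,3) S(1)[OF that(1)] L[OF that(1) Si[OF that(1)]] in auto)
      also have "\<dots> = (if j = i then farr (\<Psi> i) f else hzero C (fobj (\<Psi> j) X) (fobj (\<Psi> j) Y))"
      proof (cases "j = i")
        case True then show ?thesis unfolding c[OF that(1)]
          using L[OF that(1) Si[OF that(1)]] \<Psi>_simps[OF that(2)] assms(2,3) Si[OF that(1)]
          by (auto intro!: C.hsum_cong)
      next
        case False then show ?thesis
          using L[OF that(1) Si[OF that(1)]] \<Psi>_simps[OF that(2)] assms(2,3) that S(1)[OF that(1)]
          by (auto intro!: C.hsum_zeros)
      qed
      finally show ?thesis .
    qed
    have "f = B.hsum X Y g I"
    proof (rule faithful)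
      fix j assume j: "j \<in> I"
      have "farr (\<Psi> j) (B.hsum X Y g I) = C.hsum (fobj (\<Psi> j) X) (fobj (\<Psi> j) Y) (\<lambda>i. farr (\<Psi> j) (g i)) I"
        by (rule B.functor_hsum[OF C.linear_category_axioms linear[OF j]]) (use assms finite_I g in auto)
      also have "\<dots> = farr (\<Psi> j) (g j)"
        by (rule C.hsum_single) (use j finite_I assms \<Psi>_simps[OF j] g pg f in auto)
      finally show "farr (\<Psi> j) f = farr (\<Psi> j) (B.hsum X Y g I)" using pg[OF j j] by simp
    qed (use f g assms in auto)
    moreover have "g i \<in> B.lin_span X Y T" if "i \<in> I" for i
      unfolding g_def using that S(1) by (intro span(5) span(4) span(2)) (auto simp: T_def)
    ultimately show ?thesis using span(5)[OF finite_I, of g] by simp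
  qed
  then have "Hom B X Y \<subseteq> B.lin_span X Y T" by auto
  then show ?thesis using T unfolding B.finite_dim_hom_iff by blast
qed

lemma coordinatewise_subcategory:
  assumes "\<And>i. i \<in> I \<Longrightarrow> abelian_subcategory C (S i)"
  shows "abelian_subcategory B {F \<in> obj B. \<forall>i\<in>I. fobj (\<Psi> i) F \<in> S i}" (is "abelian_subcategory B ?S")
proof -
  have S: "\<And>X Y. X \<in> S i \<Longrightarrow> Y \<in> obj C \<Longrightarrow> isomorphic C X Y \<Longrightarrow> Y \<in> S i" "\<And>Z. is_zero_obj C Z \<Longrightarrow> Z \<in> S i"
    "\<And>X Y W \<iota> \<pi>. X \<in> S i \<Longrightarrow> Y \<in> S i \<Longrightarrow> is_direct_sum C (UNIV :: bool set) (\<lambda>b. if b then X else Y) W \<iota> \<pi> \<Longrightarrow> W \<in> S i"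
    "\<And>f k. src C f \<in> S i \<Longrightarrow> tgt C f \<in> S i \<Longrightarrow> f \<in> arr C \<Longrightarrow> is_kernel C f k \<Longrightarrow> src C k \<in> S i"
    "\<And>f p. src C f \<in> S i \<Longrightarrow> tgt C f \<in> S i \<Longrightarrow> f \<in> arr C \<Longrightarrow> is_cokernel C f p \<Longrightarrow> tgt C p \<in> S i" if "i \<in> I" for i
    using assms[OF that] unfolding abelian_subcategory_def Hom_def by blast+
  show ?thesis unfolding abelian_subcategory_def
  proof (intro conjI ballI allI impI)
    show "Y \<in> ?S" if "X \<in> ?S" "Y \<in> obj B" "isomorphic B X Y" for X Y
      using that S(1) B.functor_isomorphic[OF C.linear_category_axioms linear that(3)] \<Psi>_simps(1) by blast
    show "Z \<in> ?S" if "is_zero_obj B Z" for Z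
      using that S(2) B.functor_zero_obj[OF C.linear_category_axioms linear that] by (auto simp: B.zero_obj_iff)
    show "W \<in> ?S" if h: "X \<in> ?S" "Y \<in> ?S" "is_direct_sum B (UNIV :: bool set) (\<lambda>b. if b then X else Y) W \<iota> \<pi>" for X Y W \<iota> \<pi>
    proof -
      have "fobj (\<Psi> i) W \<in> S i" if i: "i \<in> I" for i
        using S(3)[OF i, of "fobj (\<Psi> i) X" "fobj (\<Psi> i) Y" "fobj (\<Psi> i) W"] h(1,2) i
          B.functor_direct_sum[OF C.linear_category_axioms linear[OF i] _ h(3)] by (simp add: if_distrib[of "fobj (\<Psi> i)"])
      then show ?thesis using B.direct_sumD(1)[OF h(3)] by simp
    qed
    fix X Y f assume h: "X \<in> ?S" "Y \<in> ?S" "f \<in> Hom B X Y"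
    have f: "farr (\<Psi> i) f \<in> arr C" "src C (farr (\<Psi> i) f) \<in> S i" "tgt C (farr (\<Psi> i) f) \<in> S i" if "i \<in> I" for i
      using h \<Psi>_simps[OF that] that by auto
    show "src B k \<in> ?S" if k: "is_kernel B f k" for k
      using S(4)[OF _ f(2,3,1) kernel_preserve[OF C.kernel_exists k]] \<Psi>_simps(3) B.kernelD[OF k] by auto
    show "tgt B p \<in> ?S" if p: "is_cokernel B f p" for p
      using S(5)[OF _ f(2,3,1) cokernel_preserve[OF p]] \<Psi>_simps(4) B.cokernelD[OF p] by auto
  qed blast
qed

end

section \<open>Orthogonal decompositions\<close>

text \<open>
  Such a decomposition makes \<open>B\<close> equivalent to a power of \<open>C\<close>: the \<open>i\<close>-th coordinate of an object is the
  object whose image under \<open>\<Phi> i\<close> is the \<open>i\<close>-th summand in a chosen decomposition.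
\<close>

locale orthogonal_decomposition = B: linear_category B + C: abelian_category C
  for B :: "('p, 'n, 'k::field, 'y) lin_cat_scheme" and C :: "('o, 'm, 'k, 'z) lin_cat_scheme" +
  fixes I :: "'i set" and \<Phi> :: "'i \<Rightarrow> ('o, 'm, 'p, 'n) cat_functor"
  assumes finite_I: "finite I"
    and \<Phi>_linear: "i \<in> I \<Longrightarrow> linear_functor C B (\<Phi> i)"
    and fully_faithful: "i \<in> I \<Longrightarrow> fully_faithful C B (\<Phi> i)"
    and orthogonal: "\<lbrakk>i \<in> I; j \<in> I; i \<noteq> j; X \<in> obj C; Y \<in> obj C; f \<in> arr B;
          src B f = fobj (\<Phi> i) X; tgt B f = fobj (\<Phi> j) Y\<rbrakk> \<Longrightarrow> f = hzero B (fobj (\<Phi> i) X) (fobj (\<Phi> j) Y)"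
    and decomposes: "F \<in> obj B \<Longrightarrow> \<exists>Z \<iota> \<pi>. (\<forall>i\<in>I. Z i \<in> obj C) \<and> is_direct_sum B I (\<lambda>i. fobj (\<Phi> i) (Z i)) F \<iota> \<pi>"
    and sums: "(\<And>i. i \<in> I \<Longrightarrow> Z i \<in> obj C) \<Longrightarrow> \<exists>F \<iota> \<pi>. is_direct_sum B I (\<lambda>i. fobj (\<Phi> i) (Z i)) F \<iota> \<pi>"
begin

lemmas \<Phi>_simps = C.functor_simps[OF \<Phi>_linear]

definition decomposition :: "'p \<Rightarrow> ('i \<Rightarrow> 'o) \<times> ('i \<Rightarrow> 'n) \<times> ('i \<Rightarrow> 'n)" where
  "decomposition F = (SOME D. (\<forall>i\<in>I. fst D i \<in> obj C) \<and>
     is_direct_sum B I (\<lambda>i. fobj (\<Phi> i) (fst D i)) F (fst (snd D)) (snd (snd D)))"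

abbreviation "part i F \<equiv> fst (decomposition F) i"
abbreviation "incl i F \<equiv> fst (snd (decomposition F)) i"
abbreviation "prj i F \<equiv> snd (snd (decomposition F)) i"

lemma decomposition:
  assumes "F \<in> obj B"
  shows "(\<forall>i\<in>I. part i F \<in> obj C) \<and>
    is_direct_sum B I (\<lambda>i. fobj (\<Phi> i) (part i F)) F (\<lambda>i. incl i F) (\<lambda>i. prj i F)"
proof -
  obtain X \<iota> \<pi> where "(\<forall>i\<in>I. X i \<in> obj C) \<and> is_direct_sum B I (\<lambda>i. fobj (\<Phi> i) (X i)) F \<iota> \<pi>"
    using decomposes[OF assms] by blast
  then have "\<exists>D. (\<forall>i\<in>I. fst D i \<in> obj C) \<and>
     is_direct_sum B I (\<lambda>i. fobj (\<Phi> i) (fst D i)) F (fst (snd D)) (snd (snd D))"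
    by (intro exI[of _ "(X, \<iota>, \<pi>)"]) simp
  from someI_ex[OF this, folded decomposition_def] show ?thesis by simp
qed

lemma part_obj: "F \<in> obj B \<Longrightarrow> i \<in> I \<Longrightarrow> part i F \<in> obj C"
  using decomposition by blast

lemmas ds = decomposition[THEN conjunct2]
lemmas ds_simps = B.direct_sumD(4-10)[OF ds] part_obj

definition coordinate :: "'i \<Rightarrow> ('p, 'n, 'o, 'm) cat_functor" where
  "coordinate i = \<lparr>fobj = part i, farr = \<lambda>f. SOME u. u \<in> arr C \<and> src C u = part i (src B f) \<and>
     tgt C u = part i (tgt B f) \<and> farr (\<Phi> i) u = prj i (tgt B f) \<cdot>\<^bsub>B\<^esub> f \<cdot>\<^bsub>B\<^esub> incl i (src B f)\<rparr>"

lemma coordinate_obj [simp]: "fobj (coordinate i) F = part i F" by (simp add: coordinate_def)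

lemma coordinate_arr:
  assumes "i \<in> I" "f \<in> arr B"
  shows "farr (coordinate i) f \<in> arr C" "src C (farr (coordinate i) f) = part i (src B f)"
    "tgt C (farr (coordinate i) f) = part i (tgt B f)"
    "farr (\<Phi> i) (farr (coordinate i) f) = prj i (tgt B f) \<cdot>\<^bsub>B\<^esub> f \<cdot>\<^bsub>B\<^esub> incl i (src B f)"
proof -
  have "prj i (tgt B f) \<cdot>\<^bsub>B\<^esub> f \<cdot>\<^bsub>B\<^esub> incl i (src B f) \<in> Hom B (fobj (\<Phi> i) (part i (src B f))) (fobj (\<Phi> i) (part i (tgt B f)))"
    using assms ds_simps by simp
  then have "\<exists>u\<in>Hom C (part i (src B f)) (part i (tgt B f)). farr (\<Phi> i) u = prj i (tgt B f) \<cdot>\<^bsub>B\<^esub> f \<cdot>\<^bsub>B\<^esub> incl i (src B f)"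
    using C.fully_faithfulD(1)[OF fully_faithful[OF assms(1)]] assms part_obj by simp
  then have "\<exists>u. u \<in> arr C \<and> src C u = part i (src B f) \<and> tgt C u = part i (tgt B f) \<and>
     farr (\<Phi> i) u = prj i (tgt B f) \<cdot>\<^bsub>B\<^esub> f \<cdot>\<^bsub>B\<^esub> incl i (src B f)" by (simp add: Bex_def conj_assoc)
  from someI_ex[OF this]
  show "farr (coordinate i) f \<in> arr C" "src C (farr (coordinate i) f) = part i (src B f)"
    "tgt C (farr (coordinate i) f) = part i (tgt B f)"
    "farr (\<Phi> i) (farr (coordinate i) f) = prj i (tgt B f) \<cdot>\<^bsub>B\<^esub> f \<cdot>\<^bsub>B\<^esub> incl i (src B f)"
    by (simp_all add: coordinate_def)
qed

text \<open>
  By orthogonality an arrow respects the decompositions of its source and target, so that taking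
  coordinates is functorial.
\<close>

lemma cmp_incl:
  assumes "i \<in> I" "f \<in> arr B"
  shows "f \<cdot>\<^bsub>B\<^esub> incl i (src B f) = incl i (tgt B f) \<cdot>\<^bsub>B\<^esub> farr (\<Phi> i) (farr (coordinate i) f)"
proof (rule B.direct_sum_ext_tgt[OF finite_I ds[of "tgt B f"]])
  note s = ds_simps coordinate_arr[OF assms] \<Phi>_simps
  fix j assume j: "j \<in> I"
  show "prj j (tgt B f) \<cdot>\<^bsub>B\<^esub> f \<cdot>\<^bsub>B\<^esub> incl i (src B f) =
      prj j (tgt B f) \<cdot>\<^bsub>B\<^esub> incl i (tgt B f) \<cdot>\<^bsub>B\<^esub> farr (\<Phi> i) (farr (coordinate i) f)"
  proof (cases "j = i")
    case True
    then show ?thesis using s assms j B.direct_sum_cancel(1)[OF ds[of "tgt B f"] assms(1)] by simp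
  next
    case False
    have "prj j (tgt B f) \<cdot>\<^bsub>B\<^esub> f \<cdot>\<^bsub>B\<^esub> incl i (src B f) = hzero B (fobj (\<Phi> i) (part i (src B f))) (fobj (\<Phi> j) (part j (tgt B f)))"
      by (rule orthogonal) (use s assms j False in auto)
    moreover have "prj j (tgt B f) \<cdot>\<^bsub>B\<^esub> incl i (tgt B f) \<cdot>\<^bsub>B\<^esub> farr (\<Phi> i) (farr (coordinate i) f)
        = hzero B (fobj (\<Phi> i) (part i (src B f))) (fobj (\<Phi> j) (part j (tgt B f)))"
      by (rule orthogonal) (use s assms j False in auto)
    ultimately show ?thesis by simp
  qed
qed (use assms ds_simps coordinate_arr[OF assms] \<Phi>_simps in auto)

lemma coordinate_eqI:
  assumes "i \<in> I" "f \<in> arr B" "u \<in> arr C" "src C u = part i (src B f)" "tgt C u = part i (tgt B f)"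
    "farr (\<Phi> i) u = prj i (tgt B f) \<cdot>\<^bsub>B\<^esub> f \<cdot>\<^bsub>B\<^esub> incl i (src B f)"
  shows "farr (coordinate i) f = u"
  by (rule C.fully_faithfulD(2)[OF fully_faithful[OF assms(1)], of "part i (src B f)" "part i (tgt B f)"])
    (use assms coordinate_arr part_obj in auto)

lemma coordinate_linear: "i \<in> I \<Longrightarrow> linear_functor B C (coordinate i)"
  unfolding linear_functor_def
proof (intro conjI ballI allI impI)
  assume i: "i \<in> I"
  note s = ds_simps[OF _ i] coordinate_arr[OF i] \<Phi>_simps[OF i]
  show "farr (coordinate i) (ident B X) = ident C (fobj (coordinate i) X)" if "X \<in> obj B" for X
    by (rule coordinate_eqI) (use i s that in auto)
  show "farr (coordinate i) (g \<cdot>\<^bsub>B\<^esub> f) = farr (coordinate i) g \<cdot>\<^bsub>C\<^esub> farr (coordinate i) f"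
    if "f \<in> arr B" "g \<in> arr B" "src B g = tgt B f" for f g
  proof (rule coordinate_eqI)
    have "prj i (tgt B g) \<cdot>\<^bsub>B\<^esub> g \<cdot>\<^bsub>B\<^esub> f \<cdot>\<^bsub>B\<^esub> incl i (src B f) =
        prj i (tgt B g) \<cdot>\<^bsub>B\<^esub> g \<cdot>\<^bsub>B\<^esub> incl i (tgt B f) \<cdot>\<^bsub>B\<^esub> farr (\<Phi> i) (farr (coordinate i) f)"
      using cmp_incl[OF i that(1)] that s by simp
    then show "farr (\<Phi> i) (farr (coordinate i) g \<cdot>\<^bsub>C\<^esub> farr (coordinate i) f) =
        prj i (tgt B (g \<cdot>\<^bsub>B\<^esub> f)) \<cdot>\<^bsub>B\<^esub> (g \<cdot>\<^bsub>B\<^esub> f) \<cdot>\<^bsub>B\<^esub> incl i (src B (g \<cdot>\<^bsub>B\<^esub> f))"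
      using that s by simp
  qed (use i that s in auto)
  show "farr (coordinate i) (hadd B f g) = hadd C (farr (coordinate i) f) (farr (coordinate i) g)"
    if "X \<in> obj B" "Y \<in> obj B" "f \<in> Hom B X Y" "g \<in> Hom B X Y" for X Y f g
    by (rule coordinate_eqI) (use i that s in \<open>auto simp: B.cmp_hadd\<close>)
  show "farr (coordinate i) (hscale B a f) = hscale C a (farr (coordinate i) f)" if "f \<in> arr B" for a f
    by (rule coordinate_eqI) (use i that s in \<open>auto simp: B.cmp_hscale\<close>)
qed (use part_obj coordinate_arr in auto)

text \<open>
  By orthogonality two decompositions of the same object are compared by a diagonal matrix, whose entries are
  therefore invertible; full faithfulness moves them to \<open>C\<close>.
\<close>

lemma parts_of_direct_sum:
  assumes "\<And>i. i \<in> I \<Longrightarrow> X i \<in> obj C" "is_direct_sum B I (\<lambda>i. fobj (\<Phi> i) (X i)) F \<iota> \<pi>" "i \<in> I"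
  shows "isomorphic C (part i F) (X i)"
proof -
  note d = B.direct_sumD[OF assms(2)] and F = B.direct_sumD(1)[OF assms(2)]
  note s = ds_simps[OF F assms(3)] d(3-10)[OF assms(3)] \<Phi>_simps[OF assms(3)] assms(1)[OF assms(3)]
  have 1: "f \<cdot>\<^bsub>B\<^esub> incl i F \<cdot>\<^bsub>B\<^esub> prj i F \<cdot>\<^bsub>B\<^esub> g = f \<cdot>\<^bsub>B\<^esub> g"
    if "f \<in> arr B" "src B f = F" "tgt B f = fobj (\<Phi> i) Y" "g \<in> arr B" "tgt B g = F" "src B g = fobj (\<Phi> i) Z"
      "Y \<in> obj C" "Z \<in> obj C" for f g Y Z
  proof -
    have "incl i F \<cdot>\<^bsub>B\<^esub> prj i F \<cdot>\<^bsub>B\<^esub> g = g"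
    proof (rule B.direct_sum_ext_tgt[OF finite_I ds[OF F]])
      fix j assume j: "j \<in> I"
      show "prj j F \<cdot>\<^bsub>B\<^esub> incl i F \<cdot>\<^bsub>B\<^esub> prj i F \<cdot>\<^bsub>B\<^esub> g = prj j F \<cdot>\<^bsub>B\<^esub> g"
      proof (cases "j = i")
        case True then show ?thesis using s that B.direct_sum_cancel(1)[OF ds[OF F] assms(3)] by simp
      next
        case False
        have "prj j F \<cdot>\<^bsub>B\<^esub> g = hzero B (fobj (\<Phi> i) Z) (fobj (\<Phi> j) (part j F))"
          by (rule orthogonal) (use assms(3) j False that ds_simps[OF F j] in auto)
        moreover have "prj j F \<cdot>\<^bsub>B\<^esub> incl i F \<cdot>\<^bsub>B\<^esub> prj i F \<cdot>\<^bsub>B\<^esub> g = hzero B (fobj (\<Phi> i) Z) (fobj (\<Phi> j) (part j F))"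
          by (rule orthogonal) (use assms(3) j False that ds_simps[OF F j] s in auto)
        ultimately show ?thesis by simp
      qed
    qed (use s that in auto)
    then show ?thesis by simp
  qed
  have 2: "f \<cdot>\<^bsub>B\<^esub> \<iota> i \<cdot>\<^bsub>B\<^esub> \<pi> i \<cdot>\<^bsub>B\<^esub> g = f \<cdot>\<^bsub>B\<^esub> g"
    if "f \<in> arr B" "src B f = F" "tgt B f = fobj (\<Phi> i) Y" "g \<in> arr B" "tgt B g = F" "src B g = fobj (\<Phi> i) Z"
      "Y \<in> obj C" "Z \<in> obj C" for f g Y Z
  proof -
    have "\<iota> i \<cdot>\<^bsub>B\<^esub> \<pi> i \<cdot>\<^bsub>B\<^esub> g = g"
    proof (rule B.direct_sum_ext_tgt[OF finite_I assms(2)])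
      fix j assume j: "j \<in> I"
      show "\<pi> j \<cdot>\<^bsub>B\<^esub> \<iota> i \<cdot>\<^bsub>B\<^esub> \<pi> i \<cdot>\<^bsub>B\<^esub> g = \<pi> j \<cdot>\<^bsub>B\<^esub> g"
      proof (cases "j = i")
        case True then show ?thesis using s that B.direct_sum_cancel(1)[OF assms(2,3)] by simp
      next
        case False
        have "\<pi> j \<cdot>\<^bsub>B\<^esub> g = hzero B (fobj (\<Phi> i) Z) (fobj (\<Phi> j) (X j))"
          by (rule orthogonal) (use assms(3) j False that d(3-10)[OF j] assms(1)[OF j] in auto)
        moreover have "\<pi> j \<cdot>\<^bsub>B\<^esub> \<iota> i \<cdot>\<^bsub>B\<^esub> \<pi> i \<cdot>\<^bsub>B\<^esub> g = hzero B (fobj (\<Phi> i) Z) (fobj (\<Phi> j) (X j))"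
          by (rule orthogonal) (use assms(3) j False that d(3-10)[OF j] assms(1)[OF j] s in auto)
        ultimately show ?thesis by simp
      qed
    qed (use s that in auto)
    then show ?thesis by simp
  qed
  obtain u where u: "u \<in> arr C" "src C u = part i F" "tgt C u = X i" "farr (\<Phi> i) u = \<pi> i \<cdot>\<^bsub>B\<^esub> incl i F"
    using C.fully_faithfulD(1)[OF fully_faithful[OF assms(3)], of "part i F" "X i" "\<pi> i \<cdot>\<^bsub>B\<^esub> incl i F"] s by auto
  obtain v where v: "v \<in> arr C" "src C v = X i" "tgt C v = part i F" "farr (\<Phi> i) v = prj i F \<cdot>\<^bsub>B\<^esub> \<iota> i"
    using C.fully_faithfulD(1)[OF fully_faithful[OF assms(3)], of "X i" "part i F" "prj i F \<cdot>\<^bsub>B\<^esub> \<iota> i"] s by auto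
  have "v \<cdot>\<^bsub>C\<^esub> u = ident C (part i F)"
    by (rule C.fully_faithfulD(2)[OF fully_faithful[OF assms(3)], of "part i F" "part i F"])
      (use u v s 2[of "prj i F" _ "incl i F"] in auto)
  moreover have "u \<cdot>\<^bsub>C\<^esub> v = ident C (X i)"
    by (rule C.fully_faithfulD(2)[OF fully_faithful[OF assms(3)], of "X i" "X i"])
      (use u v s 1[of "\<pi> i" _ "\<iota> i"] in auto)
  ultimately have "is_iso C u" using u v by (intro C.isoI[of u v]) auto
  then show ?thesis unfolding C.isomorphic_iff using u by auto
qed

sublocale jointly_equivalent_abelian B C I coordinate
proof
  show "f = g" if "f \<in> arr B" "g \<in> arr B" "src B f = src B g" "tgt B f = tgt B g"
    "\<And>i. i \<in> I \<Longrightarrow> farr (coordinate i) f = farr (coordinate i) g" for f g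
  proof (rule B.direct_sum_ext_src[OF finite_I ds[of "src B g"]])
    fix i assume i: "i \<in> I"
    show "f \<cdot>\<^bsub>B\<^esub> incl i (src B g) = g \<cdot>\<^bsub>B\<^esub> incl i (src B g)"
      using cmp_incl[OF i that(1)] cmp_incl[OF i that(2)] that i by simp
  qed (use that in auto)
  show "\<exists>f\<in>arr B. src B f = X \<and> tgt B f = Y \<and> (\<forall>i\<in>I. farr (coordinate i) f = u i)"
    if h: "X \<in> obj B" "Y \<in> obj B" "\<And>i. i \<in> I \<Longrightarrow> u i \<in> arr C \<and> src C (u i) = fobj (coordinate i) X \<and> tgt C (u i) = fobj (coordinate i) Y"
    for X Y u
  proof -
    let ?f = "B.hsum X Y (\<lambda>i. (incl i Y \<cdot>\<^bsub>B\<^esub> farr (\<Phi> i) (u i)) \<cdot>\<^bsub>B\<^esub> prj i X) I"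
    note s = ds_simps[OF h(1)] ds_simps[OF h(2)]
    have u: "u i \<in> arr C" "src C (u i) = part i X" "tgt C (u i) = part i Y" "farr (\<Phi> i) (u i) \<in> arr B"
      "src B (farr (\<Phi> i) (u i)) = fobj (\<Phi> i) (part i X)" "tgt B (farr (\<Phi> i) (u i)) = fobj (\<Phi> i) (part i Y)"
      if "i \<in> I" for i using h(3)[OF that] \<Phi>_simps[OF that] by auto
    have f: "?f \<in> arr B" "src B ?f = X" "tgt B ?f = Y" using s u h(1,2) by simp_all
    have "farr (coordinate i) ?f = u i" if i: "i \<in> I" for i
    proof (rule coordinate_eqI[OF i f(1)])
      have "?f \<cdot>\<^bsub>B\<^esub> incl i X = incl i Y \<cdot>\<^bsub>B\<^esub> farr (\<Phi> i) (u i)"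
        by (rule B.direct_sum_hsum_iota[OF finite_I ds[OF h(1)] i h(2)]) (use s u in auto)
      then show "farr (\<Phi> i) (u i) = prj i (tgt B ?f) \<cdot>\<^bsub>B\<^esub> ?f \<cdot>\<^bsub>B\<^esub> incl i (src B ?f)"
        unfolding f using B.direct_sum_cancel(1)[OF ds[OF h(2)] i] u[OF i] by simp
    qed (use u[OF i] f in auto)
    then show ?thesis using f by blast
  qed
  show "\<exists>F\<in>obj B. \<forall>i\<in>I. isomorphic C (fobj (coordinate i) F) (Z i)" if Z: "\<And>i. i \<in> I \<Longrightarrow> Z i \<in> obj C" for Z
  proof -
    obtain F \<iota> \<pi> where "is_direct_sum B I (\<lambda>i. fobj (\<Phi> i) (Z i)) F \<iota> \<pi>" using sums[of Z, OF Z] by blast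
    then show ?thesis using parts_of_direct_sum[OF Z] B.direct_sumD(1) by (intro bexI[of _ F]) auto
  qed
qed (use finite_I coordinate_linear in auto)

lemma direct_sum_concentrated:
  assumes "i \<in> I" "X \<in> obj C" "is_zero_obj C Z"
  shows "\<exists>\<iota> \<pi>. is_direct_sum B I (\<lambda>j. fobj (\<Phi> j) (if j = i then X else Z)) (fobj (\<Phi> i) X) \<iota> \<pi>"
proof -
  let ?F = "fobj (\<Phi> i) X"
  let ?i = "\<lambda>j. if j = i then ident B ?F else hzero B (fobj (\<Phi> j) Z) ?F"
  let ?p = "\<lambda>j. if j = i then ident B ?F else hzero B ?F (fobj (\<Phi> j) Z)"
  have Z: "is_zero_obj B (fobj (\<Phi> j) Z)" "fobj (\<Phi> j) Z \<in> obj B" if "j \<in> I" for j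
    using C.functor_zero_obj[OF B.linear_category_axioms \<Phi>_linear[OF that] assms(3)] by (auto simp: B.zero_obj_iff)
  have F: "?F \<in> obj B" using assms \<Phi>_simps by blast
  have "B.hsum ?F ?F (\<lambda>j. ?i j \<cdot>\<^bsub>B\<^esub> ?p j) I = ?i i \<cdot>\<^bsub>B\<^esub> ?p i"
    by (rule B.hsum_single) (use finite_I assms F Z in auto)
  then have "is_direct_sum B I (\<lambda>j. fobj (\<Phi> j) (if j = i then X else Z)) ?F ?i ?p"
    using F Z by (auto simp: is_direct_sum_def B.zero_obj_iff)
  then show ?thesis by blast
qed

lemma coordinate_\<Phi>:
  assumes "i \<in> I" "X \<in> obj C" "j \<in> I"
  shows "i = j \<Longrightarrow> isomorphic C (part j (fobj (\<Phi> i) X)) X" "i \<noteq> j \<Longrightarrow> is_zero_obj C (part j (fobj (\<Phi> i) X))"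
proof -
  obtain Z where Z: "is_zero_obj C Z" using C.zero_obj_exists by blast
  obtain \<iota> \<pi> where *: "is_direct_sum B I (\<lambda>j. fobj (\<Phi> j) (if j = i then X else Z)) (fobj (\<Phi> i) X) \<iota> \<pi>"
    using direct_sum_concentrated[OF assms(1,2) Z] by blast
  have "(if k = i then X else Z) \<in> obj C" if "k \<in> I" for k using Z assms by (auto simp: C.zero_obj_iff)
  then have "isomorphic C (part j (fobj (\<Phi> i) X)) (if j = i then X else Z)"
    using parts_of_direct_sum[OF _ * assms(3)] by blast
  then show "i = j \<Longrightarrow> isomorphic C (part j (fobj (\<Phi> i) X)) X" "i \<noteq> j \<Longrightarrow> is_zero_obj C (part j (fobj (\<Phi> i) X))"
    using Z C.zero_obj_iso C.isomorphic_sym by auto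
qed

lemma isomorphic_\<Phi>_iff:
  assumes "i \<in> I" "X \<in> obj C" "F \<in> obj B"
  shows "isomorphic B (fobj (\<Phi> i) X) F \<longleftrightarrow> isomorphic C X (part i F) \<and> (\<forall>j\<in>I. j \<noteq> i \<longrightarrow> is_zero_obj C (part j F))"
proof
  assume a: "isomorphic B (fobj (\<Phi> i) X) F"
  have b: "isomorphic C (part j (fobj (\<Phi> i) X)) (part j F)" if "j \<in> I" for j
    using B.functor_isomorphic[OF C.linear_category_axioms coordinate_linear[OF that] a] by simp
  show "isomorphic C X (part i F) \<and> (\<forall>j\<in>I. j \<noteq> i \<longrightarrow> is_zero_obj C (part j F))"
  proof (intro conjI ballI impI)
    show "isomorphic C X (part i F)"
      using C.isomorphic_trans[OF C.isomorphic_sym[OF coordinate_\<Phi>(1)[OF assms(1,2,1) refl]] b[OF assms(1)]] .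
    show "is_zero_obj C (part j F)" if "j \<in> I" "j \<noteq> i" for j
      using C.zero_obj_iso[OF coordinate_\<Phi>(2)[OF assms(1,2) that(1)] b[OF that(1)]] that(2) by blast
  qed
next
  assume a: "isomorphic C X (part i F) \<and> (\<forall>j\<in>I. j \<noteq> i \<longrightarrow> is_zero_obj C (part j F))"
  show "isomorphic B (fobj (\<Phi> i) X) F"
  proof (rule isomorphic_reflect)
    fix j assume j: "j \<in> I"
    show "isomorphic C (fobj (coordinate j) (fobj (\<Phi> i) X)) (fobj (coordinate j) F)"
    proof (cases "j = i")
      case True then show ?thesis using coordinate_\<Phi>(1)[OF assms(1,2) j] a C.isomorphic_trans by auto
    next
      case False then show ?thesis using coordinate_\<Phi>(2)[OF assms(1,2) j] a j C.zero_objs_iso by auto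
    qed
  qed (use assms \<Phi>_simps in auto)
qed

end

section \<open>Strict monoidal linear categories\<close>

text \<open>
  The tensor structure of a tensor category without the abelian structure and the duals.  Its axioms are
  stated for arrows with matching sources and targets, which makes most of them rewrite rules.
\<close>

locale linear_monoidal = linear_category C
  for C :: "('o, 'm, 'k::field, 'z) tensor_cat_scheme" (structure) +
  assumes tobj_closed [simp]: "\<lbrakk>X \<in> obj C; Y \<in> obj C\<rbrakk> \<Longrightarrow> X \<boxtimes> Y \<in> obj C"
    and tarr_arr [simp]: "\<lbrakk>f \<in> arr C; g \<in> arr C\<rbrakk> \<Longrightarrow> f \<boxtimes>\<^sub>m g \<in> arr C"
      "\<lbrakk>f \<in> arr C; g \<in> arr C\<rbrakk> \<Longrightarrow> src C (f \<boxtimes>\<^sub>m g) = src C f \<boxtimes> src C g"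
      "\<lbrakk>f \<in> arr C; g \<in> arr C\<rbrakk> \<Longrightarrow> tgt C (f \<boxtimes>\<^sub>m g) = tgt C f \<boxtimes> tgt C g"
    and tarr_ident [simp]: "\<lbrakk>X \<in> obj C; Y \<in> obj C\<rbrakk> \<Longrightarrow> idm X \<boxtimes>\<^sub>m idm Y = idm (X \<boxtimes> Y)"
    and interchange: "\<lbrakk>f \<in> arr C; f' \<in> arr C; g \<in> arr C; g' \<in> arr C; src C f' = tgt C f; src C g' = tgt C g\<rbrakk>
          \<Longrightarrow> (f' \<boxtimes>\<^sub>m g') \<cdot> (f \<boxtimes>\<^sub>m g) = (f' \<cdot> f) \<boxtimes>\<^sub>m (g' \<cdot> g)"
    and tunit_closed [simp]: "tunit C \<in> obj C"
    and tobj_assoc [simp]: "\<lbrakk>X \<in> obj C; Y \<in> obj C; Z \<in> obj C\<rbrakk> \<Longrightarrow> (X \<boxtimes> Y) \<boxtimes> Z = X \<boxtimes> (Y \<boxtimes> Z)"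
    and tarr_assoc [simp]: "\<lbrakk>f \<in> arr C; g \<in> arr C; h \<in> arr C\<rbrakk> \<Longrightarrow> (f \<boxtimes>\<^sub>m g) \<boxtimes>\<^sub>m h = f \<boxtimes>\<^sub>m (g \<boxtimes>\<^sub>m h)"
    and tobj_unit [simp]: "X \<in> obj C \<Longrightarrow> tunit C \<boxtimes> X = X" "X \<in> obj C \<Longrightarrow> X \<boxtimes> tunit C = X"
    and tarr_unit [simp]: "f \<in> arr C \<Longrightarrow> idm (tunit C) \<boxtimes>\<^sub>m f = f" "f \<in> arr C \<Longrightarrow> f \<boxtimes>\<^sub>m idm (tunit C) = f"
    and tarr_hadd: "\<lbrakk>f \<in> arr C; f' \<in> arr C; g \<in> arr C; src C f = src C f'; tgt C f = tgt C f'\<rbrakk>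
          \<Longrightarrow> hadd C f f' \<boxtimes>\<^sub>m g = hadd C (f \<boxtimes>\<^sub>m g) (f' \<boxtimes>\<^sub>m g)"
      "\<lbrakk>f \<in> arr C; g \<in> arr C; g' \<in> arr C; src C g = src C g'; tgt C g = tgt C g'\<rbrakk>
          \<Longrightarrow> f \<boxtimes>\<^sub>m hadd C g g' = hadd C (f \<boxtimes>\<^sub>m g) (f \<boxtimes>\<^sub>m g')"
    and tarr_hscale: "\<lbrakk>f \<in> arr C; g \<in> arr C\<rbrakk> \<Longrightarrow> hscale C a f \<boxtimes>\<^sub>m g = hscale C a (f \<boxtimes>\<^sub>m g)"
      "\<lbrakk>f \<in> arr C; g \<in> arr C\<rbrakk> \<Longrightarrow> f \<boxtimes>\<^sub>m hscale C a g = hscale C a (f \<boxtimes>\<^sub>m g)"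

lemma (in tensor_category) linear_monoidal: "linear_monoidal C"
proof
  show "f \<boxtimes>\<^sub>m g \<in> arr C" "src C (f \<boxtimes>\<^sub>m g) = src C f \<boxtimes> src C g" "tgt C (f \<boxtimes>\<^sub>m g) = tgt C f \<boxtimes> tgt C g"
    if "f \<in> arr C" "g \<in> arr C" for f g
    using tarr_hom[of f "src C f" "tgt C f" g "src C g" "tgt C g"] that by auto
  show "(f' \<boxtimes>\<^sub>m g') \<cdot> (f \<boxtimes>\<^sub>m g) = (f' \<cdot> f) \<boxtimes>\<^sub>m (g' \<cdot> g)"
    if "f \<in> arr C" "f' \<in> arr C" "g \<in> arr C" "g' \<in> arr C" "src C f' = tgt C f" "src C g' = tgt C g" for f f' g g'
    using tarr_cmp[of f "src C f" "tgt C f" f' "tgt C f'" g "src C g" "tgt C g" g' "tgt C g'"] that by auto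
  show "hadd C f f' \<boxtimes>\<^sub>m g = hadd C (f \<boxtimes>\<^sub>m g) (f' \<boxtimes>\<^sub>m g)"
    if "f \<in> arr C" "f' \<in> arr C" "g \<in> arr C" "src C f = src C f'" "tgt C f = tgt C f'" for f f' g
    using tarr_hadd_left[of f "src C f" "tgt C f" f' g "src C g" "tgt C g"] that by auto
  show "f \<boxtimes>\<^sub>m hadd C g g' = hadd C (f \<boxtimes>\<^sub>m g) (f \<boxtimes>\<^sub>m g')"
    if "f \<in> arr C" "g \<in> arr C" "g' \<in> arr C" "src C g = src C g'" "tgt C g = tgt C g'" for f g g'
    using tarr_hadd_right[of f "src C f" "tgt C f" g "src C g" "tgt C g" g'] that by auto
qed (use tobj_closed tarr_ident tunit_closed tobj_assoc tarr_assoc tobj_unit tarr_unit tarr_hscale in auto)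

lemma (in linear_monoidal) tarr_hzero:
  "\<lbrakk>V \<in> obj C; W \<in> obj C; g \<in> arr C\<rbrakk> \<Longrightarrow> hzero C V W \<boxtimes>\<^sub>m g = hzero C (V \<boxtimes> src C g) (W \<boxtimes> tgt C g)"
  "\<lbrakk>V \<in> obj C; W \<in> obj C; g \<in> arr C\<rbrakk> \<Longrightarrow> g \<boxtimes>\<^sub>m hzero C V W = hzero C (src C g \<boxtimes> V) (tgt C g \<boxtimes> W)"
  using tarr_hscale(1)[of "hzero C V W" g 0] tarr_hscale(2)[of g "hzero C V W" 0] by simp_all

lemma (in linear_monoidal) tensor_categoryI:
  assumes "abelian_category C"
    and "\<And>X. X \<in> obj C \<Longrightarrow> \<exists>D ev coev. is_left_dual C X D ev coev"
    and "\<And>X. X \<in> obj C \<Longrightarrow> \<exists>D ev coev. is_left_dual C D X ev coev"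
    and "\<And>X. X \<in> obj C \<Longrightarrow> finite_length C X"
    and "\<And>X Y. X \<in> obj C \<Longrightarrow> Y \<in> obj C \<Longrightarrow> finite_dim_hom C X Y"
    and "is_simple C (tunit C)"
  shows "tensor_category C"
  by (rule tensor_category.intro[OF assms(1)], rule tensor_category_axioms.intro)
    (use assms(2-6) in \<open>auto simp: interchange tarr_hadd tarr_hscale\<close>)

text \<open>The module axioms for a space of arrows; the additive inverse is scaling by \<open>-1\<close>.\<close>

lemma hom_space_moduleI:
  fixes C :: "('o, 'm, 'k::field, 'z) lin_cat_scheme"
  assumes "hzero C X Y \<in> Hom C X Y"
    and "\<And>f g. f \<in> Hom C X Y \<Longrightarrow> g \<in> Hom C X Y \<Longrightarrow> hadd C f g \<in> Hom C X Y \<and> hadd C f g = hadd C g f"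
    and "\<And>f g h. f \<in> Hom C X Y \<Longrightarrow> g \<in> Hom C X Y \<Longrightarrow> h \<in> Hom C X Y \<Longrightarrow> hadd C (hadd C f g) h = hadd C f (hadd C g h)"
    and "\<And>f a b. f \<in> Hom C X Y \<Longrightarrow> hadd C (hzero C X Y) f = f \<and> hscale C a f \<in> Hom C X Y \<and> hscale C 1 f = f \<and>
        hscale C 0 f = hzero C X Y \<and> hscale C (a * b) f = hscale C a (hscale C b f) \<and>
        hscale C (a + b) f = hadd C (hscale C a f) (hscale C b f)"
    and "\<And>f g a. f \<in> Hom C X Y \<Longrightarrow> g \<in> Hom C X Y \<Longrightarrow> hscale C a (hadd C f g) = hadd C (hscale C a f) (hscale C a g)"
  shows "Module.module scalars (hom_space C X Y)"
proof (rule moduleI)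
  have "f \<oplus>\<^bsub>scalars\<^esub> g = f + g" "f \<otimes>\<^bsub>scalars\<^esub> g = f * g" for f g :: 'k by (simp_all add: scalars_def)
  moreover have "carrier scalars = (UNIV :: 'k set)" "\<zero>\<^bsub>scalars\<^esub> = (0::'k)" "\<one>\<^bsub>scalars\<^esub> = (1::'k)"
    by (simp_all add: scalars_def)
  moreover have "\<exists>y. y + x = 0" for x :: 'k by (rule exI[of _ "- x"]) simp
  ultimately show "cring (scalars :: 'k ring)"
    by (intro cringI abelian_groupI comm_monoidI) (auto simp: algebra_simps)
  have neg: "hadd C (hscale C (-1) f) f = hzero C X Y" if "f \<in> Hom C X Y" for f
    using assms(4)[OF that, of "-1" 1] by (metis ab_left_minus)
  show "abelian_group (hom_space C X Y)"
  proof (rule abelian_groupI)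
    show "\<exists>y\<in>carrier (hom_space C X Y). y \<oplus>\<^bsub>hom_space C X Y\<^esub> x = \<zero>\<^bsub>hom_space C X Y\<^esub>"
      if "x \<in> carrier (hom_space C X Y)" for x
      using that neg[of x] assms(4)[of x "-1", THEN conjunct2, THEN conjunct1]
      by (intro bexI[of _ "hscale C (-1) x"]) (simp_all add: hom_space_def)
    show "x \<oplus>\<^bsub>hom_space C X Y\<^esub> y = y \<oplus>\<^bsub>hom_space C X Y\<^esub> x"
      if "x \<in> carrier (hom_space C X Y)" "y \<in> carrier (hom_space C X Y)" for x y
      using assms(2)[of x y] that by (simp add: hom_space_def)
  qed (simp_all add: hom_space_def assms(1,3,4) assms(2)[THEN conjunct1])
qed (simp_all add: hom_space_def scalars_def assms(3,4,5))

section \<open>Module endofunctors\<close>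

text \<open>
  A module functor sees \<open>D\<close> through its objects, its tensor product, its identities and the action on \<open>M\<close>,
  so these are the data that the locale speaks about.
\<close>

locale strict_module_category = M: abelian_category M
  for D :: "('d, 'e, 'k::field, 'y) tensor_cat_scheme" and M :: "('o, 'm, 'k, 'z) lin_cat_scheme" (structure)
    and act :: "('d, 'e, 'o, 'm) module_structure" +
  assumes D_tobj [simp]: "\<lbrakk>V \<in> obj D; W \<in> obj D\<rbrakk> \<Longrightarrow> V \<boxtimes>\<^bsub>D\<^esub> W \<in> obj D" "tunit D \<in> obj D"
    and D_arr [simp]: "u \<in> arr D \<Longrightarrow> src D u \<in> obj D" "u \<in> arr D \<Longrightarrow> tgt D u \<in> obj D"
    and D_ident [simp]: "V \<in> obj D \<Longrightarrow> ident D V \<in> arr D" "V \<in> obj D \<Longrightarrow> src D (ident D V) = V"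
      "V \<in> obj D \<Longrightarrow> tgt D (ident D V) = V"
    and aobj_closed [simp]: "\<lbrakk>V \<in> obj D; X \<in> obj M\<rbrakk> \<Longrightarrow> aobj act V X \<in> obj M"
    and aobj_assoc [simp]: "\<lbrakk>V \<in> obj D; W \<in> obj D; X \<in> obj M\<rbrakk> \<Longrightarrow> aobj act (V \<boxtimes>\<^bsub>D\<^esub> W) X = aobj act V (aobj act W X)"
    and aobj_unit [simp]: "X \<in> obj M \<Longrightarrow> aobj act (tunit D) X = X"
    and aarr_arr [simp]: "\<lbrakk>u \<in> arr D; f \<in> arr M\<rbrakk> \<Longrightarrow> aarr act u f \<in> arr M"
      "\<lbrakk>u \<in> arr D; f \<in> arr M\<rbrakk> \<Longrightarrow> src M (aarr act u f) = aobj act (src D u) (src M f)"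
      "\<lbrakk>u \<in> arr D; f \<in> arr M\<rbrakk> \<Longrightarrow> tgt M (aarr act u f) = aobj act (tgt D u) (tgt M f)"
    and aarr_ident [simp]: "\<lbrakk>V \<in> obj D; X \<in> obj M\<rbrakk> \<Longrightarrow> aarr act (ident D V) (ident M X) = ident M (aobj act V X)"
    and aarr_cmp: "\<lbrakk>V \<in> obj D; f \<in> arr M; g \<in> arr M; src M g = tgt M f\<rbrakk>
       \<Longrightarrow> aarr act (ident D V) (g \<cdot> f) = aarr act (ident D V) g \<cdot> aarr act (ident D V) f"
    and aarr_absorb: "\<lbrakk>u \<in> arr D; f \<in> arr M; g \<in> arr M; src M g = tgt M f; V = tgt D u\<rbrakk>
       \<Longrightarrow> aarr act (ident D V) g \<cdot> aarr act u f = aarr act u (g \<cdot> f)"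
      "\<lbrakk>u \<in> arr D; f \<in> arr M; g \<in> arr M; src M g = tgt M f; V = src D u\<rbrakk>
       \<Longrightarrow> aarr act u g \<cdot> aarr act (ident D V) f = aarr act u (g \<cdot> f)"
    and aarr_assoc: "\<lbrakk>V \<in> obj D; W \<in> obj D; f \<in> arr M\<rbrakk>
       \<Longrightarrow> aarr act (ident D (V \<boxtimes>\<^bsub>D\<^esub> W)) f = aarr act (ident D V) (aarr act (ident D W) f)"
    and aarr_unit: "f \<in> arr M \<Longrightarrow> aarr act (ident D (tunit D)) f = f"
    and aarr_hadd: "\<lbrakk>V \<in> obj D; f \<in> arr M; g \<in> arr M; src M f = src M g; tgt M f = tgt M g\<rbrakk>
       \<Longrightarrow> aarr act (ident D V) (hadd M f g) = hadd M (aarr act (ident D V) f) (aarr act (ident D V) g)"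
    and aarr_hscale: "\<lbrakk>V \<in> obj D; f \<in> arr M\<rbrakk>
       \<Longrightarrow> aarr act (ident D V) (hscale M a f) = hscale M a (aarr act (ident D V) f)"
begin

abbreviation whisker :: "'d \<Rightarrow> 'm \<Rightarrow> 'm" where "whisker V f \<equiv> aarr act (ident D V) f"

abbreviation acted :: "'d \<Rightarrow> 'o \<Rightarrow> 'o" where "acted \<equiv> aobj act"

abbreviation B where "B \<equiv> op_tensor (module_endofunctors D M act)"

abbreviation comp :: "('d, 'o, 'm) mod_transf \<Rightarrow> 'o \<Rightarrow> 'm" where "comp a \<equiv> snd (snd a)"

definition action_functor :: "'d \<Rightarrow> ('o, 'm, 'o, 'm) cat_functor" where
  "action_functor V = \<lparr>fobj = aobj act V, farr = aarr act (ident D V)\<rparr>"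

lemma action_functor_simps [simp]:
  "fobj (action_functor V) = aobj act V" "farr (action_functor V) = aarr act (ident D V)"
  by (simp_all add: action_functor_def)

lemma action_functor_linear: "V \<in> obj D \<Longrightarrow> linear_functor M M (action_functor V)"
  by (auto simp: linear_functor_def aarr_cmp aarr_hadd aarr_hscale)

lemma whisker_hzero: "\<lbrakk>V \<in> obj D; X \<in> obj M; Y \<in> obj M\<rbrakk> \<Longrightarrow> whisker V (hzero M X Y) = hzero M (acted V X) (acted V Y)"
  using M.functor_hzero[OF M.linear_category_axioms action_functor_linear] by simp

lemma objD:
  assumes "F \<in> obj B"
  shows "linear_functor M M F" "is_cokernel M f p \<Longrightarrow> is_cokernel M (farr F f) (farr F p)"
    "fobj F \<in> extensional (obj M)" "farr F \<in> extensional (arr M)" "mconstr F \<in> extensional (obj D)"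
    "V \<in> obj D \<Longrightarrow> mconstr F V \<in> extensional (obj M)"
  using assms by (auto simp: op_tensor_def module_endofunctors_def module_functor_def right_exact_def)

lemma F_simps [simp]:
  assumes "F \<in> obj B"
  shows "X \<in> obj M \<Longrightarrow> fobj F X \<in> obj M" "f \<in> arr M \<Longrightarrow> farr F f \<in> arr M"
    "f \<in> arr M \<Longrightarrow> src M (farr F f) = fobj F (src M f)" "f \<in> arr M \<Longrightarrow> tgt M (farr F f) = fobj F (tgt M f)"
    "X \<in> obj M \<Longrightarrow> farr F (ident M X) = ident M (fobj F X)"
    "\<lbrakk>f \<in> arr M; g \<in> arr M; src M g = tgt M f\<rbrakk> \<Longrightarrow> farr F (g \<cdot> f) = farr F g \<cdot> farr F f"
    "\<lbrakk>X \<in> obj M; Y \<in> obj M\<rbrakk> \<Longrightarrow> farr F (hzero M X Y) = hzero M (fobj F X) (fobj F Y)"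
  using M.functor_simps[OF objD(1)[OF assms]] M.functor_hzero[OF M.linear_category_axioms objD(1)[OF assms]] by auto

lemma mconstr:
  assumes "F \<in> obj B" "V \<in> obj D" "X \<in> obj M"
  shows "mconstr F V X \<in> arr M" "src M (mconstr F V X) = fobj F (acted V X)"
    "tgt M (mconstr F V X) = acted V (fobj F X)" "is_iso M (mconstr F V X)"
  using assms by (auto simp: op_tensor_def module_endofunctors_def module_functor_def)

declare mconstr [simp]

lemma obj_module_functor: "F \<in> obj B \<Longrightarrow> module_functor D M act F"
  by (simp add: op_tensor_def module_endofunctors_def)

lemma mconstr_natural:
  assumes "F \<in> obj B" "u \<in> arr D" "f \<in> arr M"
  shows "mconstr F (tgt D u) (tgt M f) \<cdot> farr F (aarr act u f) = aarr act u (farr F f) \<cdot> mconstr F (src D u) (src M f)"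
  using obj_module_functor[OF assms(1)] assms(2-) unfolding module_functor_def by blast

lemma mconstr_whisker:
  assumes "F \<in> obj B" "V \<in> obj D" "f \<in> arr M"
  shows "mconstr F V (tgt M f) \<cdot> farr F (whisker V f) = whisker V (farr F f) \<cdot> mconstr F V (src M f)"
  using mconstr_natural[of F "ident D V" f] assms by simp

lemma mconstr_tobj:
  assumes "F \<in> obj B" "V \<in> obj D" "W \<in> obj D" "X \<in> obj M"
  shows "mconstr F (V \<boxtimes>\<^bsub>D\<^esub> W) X = whisker V (mconstr F W X) \<cdot> mconstr F V (acted W X)"
  using obj_module_functor[OF assms(1)] assms(2-) unfolding module_functor_def by blast

lemma mconstr_tunit:
  assumes "F \<in> obj B" "X \<in> obj M" shows "mconstr F (tunit D) X = ident M (fobj F X)"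
  using obj_module_functor[OF assms(1)] assms(2-) unfolding module_functor_def by blast

lemma objI:
  assumes "linear_functor M M F" "\<And>f p. is_cokernel M f p \<Longrightarrow> is_cokernel M (farr F f) (farr F p)"
    "fobj F \<in> extensional (obj M)" "farr F \<in> extensional (arr M)" "mconstr F \<in> extensional (obj D)"
    "\<And>V. V \<in> obj D \<Longrightarrow> mconstr F V \<in> extensional (obj M)"
    "\<And>V X. V \<in> obj D \<Longrightarrow> X \<in> obj M \<Longrightarrow> mconstr F V X \<in> arr M \<and> src M (mconstr F V X) = fobj F (acted V X) \<and>
       tgt M (mconstr F V X) = acted V (fobj F X) \<and> is_iso M (mconstr F V X)"
    "\<And>u f. u \<in> arr D \<Longrightarrow> f \<in> arr M \<Longrightarrow>
       mconstr F (tgt D u) (tgt M f) \<cdot> farr F (aarr act u f) = aarr act u (farr F f) \<cdot> mconstr F (src D u) (src M f)"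
    "\<And>V W X. V \<in> obj D \<Longrightarrow> W \<in> obj D \<Longrightarrow> X \<in> obj M \<Longrightarrow>
       mconstr F (V \<boxtimes>\<^bsub>D\<^esub> W) X = whisker V (mconstr F W X) \<cdot> mconstr F V (acted W X)"
    "\<And>X. X \<in> obj M \<Longrightarrow> mconstr F (tunit D) X = ident M (fobj F X)"
  shows "F \<in> obj B"
proof -
  have "mconstr F V X \<in> Hom M (fobj F (acted V X)) (acted V (fobj F X)) \<and> is_iso M (mconstr F V X)"
    if "V \<in> obj D" "X \<in> obj M" for V X using assms(7)[OF that] by simp
  then have "module_functor D M act F"
    unfolding module_functor_def using assms(1,3,4,5,6,8,9,10) by blast
  then show ?thesis using assms(2) by (simp add: op_tensor_def module_endofunctors_def right_exact_def)
qed

lemma src_B [simp]: "src B a = fst a" "tgt B a = fst (snd a)"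
  by (simp_all add: op_tensor_def module_endofunctors_def split_beta)

lemma arrD:
  assumes "a \<in> arr B"
  shows "fst a \<in> obj B" "fst (snd a) \<in> obj B" "comp a \<in> extensional (obj M)"
    "X \<in> obj M \<Longrightarrow> comp a X \<in> arr M" "X \<in> obj M \<Longrightarrow> src M (comp a X) = fobj (fst a) X"
    "X \<in> obj M \<Longrightarrow> tgt M (comp a X) = fobj (fst (snd a)) X"
  using assms by (auto simp: op_tensor_def module_endofunctors_def module_transformation_def natural_transformation_def)

lemma arr_module_transformation:
  "a \<in> arr B \<Longrightarrow> module_transformation D M act (fst a) (fst (snd a)) (comp a)"
  by (auto simp: op_tensor_def module_endofunctors_def)

lemma arr_natural:
  assumes "a \<in> arr B" "f \<in> arr M"
  shows "comp a (tgt M f) \<cdot> farr (fst a) f = farr (fst (snd a)) f \<cdot> comp a (src M f)"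
  using arr_module_transformation[OF assms(1)] assms(2)
  by (simp add: module_transformation_def natural_transformation_def)

lemma arr_module:
  assumes "a \<in> arr B" "V \<in> obj D" "X \<in> obj M"
  shows "whisker V (comp a X) \<cdot> mconstr (fst a) V X = mconstr (fst (snd a)) V X \<cdot> comp a (acted V X)"
  using arr_module_transformation[OF assms(1)] assms(2,3) unfolding module_transformation_def by blast

lemma arrI:
  assumes "F \<in> obj B" "F' \<in> obj B" "\<And>X. X \<in> obj M \<Longrightarrow> t X \<in> arr M \<and> src M (t X) = fobj F X \<and> tgt M (t X) = fobj F' X"
    "\<And>f. f \<in> arr M \<Longrightarrow> t (tgt M f) \<cdot> farr F f = farr F' f \<cdot> t (src M f)"
    "\<And>V X. V \<in> obj D \<Longrightarrow> X \<in> obj M \<Longrightarrow> whisker V (t X) \<cdot> mconstr F V X = mconstr F' V X \<cdot> t (acted V X)"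
  shows "(F, F', \<lambda>X\<in>obj M. t X) \<in> arr B"
  using assms by (auto simp: op_tensor_def module_endofunctors_def module_transformation_def natural_transformation_def)

lemma arr_eqI:
  assumes "a \<in> arr B" "b \<in> arr B" "fst a = fst b" "fst (snd a) = fst (snd b)" "\<And>X. X \<in> obj M \<Longrightarrow> comp a X = comp b X"
  shows "a = b"
proof -
  have "comp a = comp b" using arrD(3)[OF assms(1)] arrD(3)[OF assms(2)] assms(5) by (rule extensionalityI)
  then show ?thesis using assms by (simp add: prod_eq_iff)
qed

lemma B_simps:
  "ident B F = (F, F, \<lambda>X\<in>obj M. ident M (fobj F X))"
  "a \<cdot>\<^bsub>B\<^esub> b = (fst b, fst (snd a), \<lambda>X\<in>obj M. comp a X \<cdot> comp b X)"
  "hzero B F F' = (F, F', \<lambda>X\<in>obj M. hzero M (fobj F X) (fobj F' X))"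
  "hadd B a b = (fst a, fst (snd a), \<lambda>X\<in>obj M. hadd M (comp a X) (comp b X))"
  "hscale B c a = (fst a, fst (snd a), \<lambda>X\<in>obj M. hscale M c (comp a X))"
  "F \<boxtimes>\<^bsub>B\<^esub> H = module_functor_comp D M H F"
  "tunit B = \<lparr>fobj = (\<lambda>X\<in>obj M. X), farr = (\<lambda>f\<in>arr M. f), mconstr = (\<lambda>V\<in>obj D. \<lambda>X\<in>obj M. ident M (aobj act V X))\<rparr>"
  "a \<boxtimes>\<^sub>m\<^bsub>B\<^esub> b = (fst a \<boxtimes>\<^bsub>B\<^esub> fst b, fst (snd a) \<boxtimes>\<^bsub>B\<^esub> fst (snd b),
     \<lambda>X\<in>obj M. comp b (fobj (fst (snd a)) X) \<cdot> farr (fst b) (comp a X))"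
  by (simp_all add: op_tensor_def module_endofunctors_def split_beta)

lemma B_fst [simp]:
  "fst (ident B F) = F" "fst (snd (ident B F)) = F" "fst (a \<cdot>\<^bsub>B\<^esub> b) = fst b" "fst (snd (a \<cdot>\<^bsub>B\<^esub> b)) = fst (snd a)"
  "fst (hzero B F F') = F" "fst (snd (hzero B F F')) = F'"
  "fst (hadd B a b) = fst a" "fst (snd (hadd B a b)) = fst (snd a)"
  "fst (hscale B c a) = fst a" "fst (snd (hscale B c a)) = fst (snd a)"
  "fst (a \<boxtimes>\<^sub>m\<^bsub>B\<^esub> b) = fst a \<boxtimes>\<^bsub>B\<^esub> fst b" "fst (snd (a \<boxtimes>\<^sub>m\<^bsub>B\<^esub> b)) = fst (snd a) \<boxtimes>\<^bsub>B\<^esub> fst (snd b)"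
  unfolding B_simps by simp_all

lemma B_comp [simp]:
  assumes "X \<in> obj M"
  shows "comp (ident B F) X = ident M (fobj F X)" "comp (a \<cdot>\<^bsub>B\<^esub> b) X = comp a X \<cdot> comp b X"
    "comp (hzero B F F') X = hzero M (fobj F X) (fobj F' X)"
    "comp (hadd B a b) X = hadd M (comp a X) (comp b X)" "comp (hscale B c a) X = hscale M c (comp a X)"
    "comp (a \<boxtimes>\<^sub>m\<^bsub>B\<^esub> b) X = comp b (fobj (fst (snd a)) X) \<cdot> farr (fst b) (comp a X)"
  unfolding B_simps using assms by simp_all

lemma B_tobj [simp]:
  "X \<in> obj M \<Longrightarrow> fobj (F \<boxtimes>\<^bsub>B\<^esub> H) X = fobj H (fobj F X)" "f \<in> arr M \<Longrightarrow> farr (F \<boxtimes>\<^bsub>B\<^esub> H) f = farr H (farr F f)"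
  "V \<in> obj D \<Longrightarrow> X \<in> obj M \<Longrightarrow> mconstr (F \<boxtimes>\<^bsub>B\<^esub> H) V X = mconstr H V (fobj F X) \<cdot> farr H (mconstr F V X)"
  "X \<in> obj M \<Longrightarrow> fobj (tunit B) X = X" "f \<in> arr M \<Longrightarrow> farr (tunit B) f = f"
  "V \<in> obj D \<Longrightarrow> X \<in> obj M \<Longrightarrow> mconstr (tunit B) V X = ident M (acted V X)"
  unfolding B_simps by (simp_all add: module_functor_comp_def)

lemma obj_eqI:
  assumes "F \<in> obj B" "F' \<in> obj B" "\<And>X. X \<in> obj M \<Longrightarrow> fobj F X = fobj F' X" "\<And>f. f \<in> arr M \<Longrightarrow> farr F f = farr F' f"
    "\<And>V X. V \<in> obj D \<Longrightarrow> X \<in> obj M \<Longrightarrow> mconstr F V X = mconstr F' V X"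
  shows "F = F'"
proof (rule mod_functor.equality)
  note e = objD[OF assms(1)] and e' = objD[OF assms(2)]
  show "fobj F = fobj F'" using e(3) e'(3) assms(3) by (rule extensionalityI)
  show "farr F = farr F'" using e(4) e'(4) assms(4) by (rule extensionalityI)
  show "mconstr F = mconstr F'" using e(5) e'(5)
  proof (rule extensionalityI)
    fix V assume V: "V \<in> obj D"
    show "mconstr F V = mconstr F' V" using e(6)[OF V] e'(6)[OF V] assms(5)[OF V] by (rule extensionalityI)
  qed
qed simp

lemma tobj_B [simp]:
  assumes "F \<in> obj B" "H \<in> obj B" shows "F \<boxtimes>\<^bsub>B\<^esub> H \<in> obj B"
proof (rule objI)
  note l = M.functor_simps[OF objD(1)[OF assms(1)]] M.functor_simps[OF objD(1)[OF assms(2)]]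
  show "linear_functor M M (F \<boxtimes>\<^bsub>B\<^esub> H)"
    unfolding linear_functor_def using assms l by auto
  show "is_cokernel M (farr (F \<boxtimes>\<^bsub>B\<^esub> H) f) (farr (F \<boxtimes>\<^bsub>B\<^esub> H) p)" if "is_cokernel M f p" for f p
    using objD(2)[OF assms(2) objD(2)[OF assms(1) that]] M.cokernelD[OF that] by simp
  show "mconstr (F \<boxtimes>\<^bsub>B\<^esub> H) V X \<in> arr M \<and> src M (mconstr (F \<boxtimes>\<^bsub>B\<^esub> H) V X) = fobj (F \<boxtimes>\<^bsub>B\<^esub> H) (acted V X) \<and>
       tgt M (mconstr (F \<boxtimes>\<^bsub>B\<^esub> H) V X) = acted V (fobj (F \<boxtimes>\<^bsub>B\<^esub> H) X) \<and> is_iso M (mconstr (F \<boxtimes>\<^bsub>B\<^esub> H) V X)"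
    if "V \<in> obj D" "X \<in> obj M" for V X
    using that assms M.functor_iso[OF M.linear_category_axioms objD(1)[OF assms(2)]] by simp
  show "mconstr (F \<boxtimes>\<^bsub>B\<^esub> H) (tgt D u) (tgt M f) \<cdot> farr (F \<boxtimes>\<^bsub>B\<^esub> H) (aarr act u f) =
      aarr act u (farr (F \<boxtimes>\<^bsub>B\<^esub> H) f) \<cdot> mconstr (F \<boxtimes>\<^bsub>B\<^esub> H) (src D u) (src M f)" if "u \<in> arr D" "f \<in> arr M" for u f
  proof -
    have "mconstr H (tgt D u) (fobj F (tgt M f)) \<cdot> farr H (mconstr F (tgt D u) (tgt M f)) \<cdot> farr H (farr F (aarr act u f)) =
       mconstr H (tgt D u) (fobj F (tgt M f)) \<cdot> farr H (mconstr F (tgt D u) (tgt M f) \<cdot> farr F (aarr act u f))"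
      using that assms by simp
    also have "\<dots> = (mconstr H (tgt D u) (tgt M (farr F f)) \<cdot> farr H (aarr act u (farr F f))) \<cdot> farr H (mconstr F (src D u) (src M f))"
      unfolding mconstr_natural[OF assms(1) that] using that assms by simp
    also have "\<dots> = (aarr act u (farr H (farr F f)) \<cdot> mconstr H (src D u) (src M (farr F f))) \<cdot> farr H (mconstr F (src D u) (src M f))"
      using mconstr_natural[OF assms(2) that(1), of "farr F f"] that assms by simp
    finally show ?thesis using that assms by simp
  qed
  show "mconstr (F \<boxtimes>\<^bsub>B\<^esub> H) (V \<boxtimes>\<^bsub>D\<^esub> W) X = whisker V (mconstr (F \<boxtimes>\<^bsub>B\<^esub> H) W X) \<cdot> mconstr (F \<boxtimes>\<^bsub>B\<^esub> H) V (acted W X)"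
    if h: "V \<in> obj D" "W \<in> obj D" "X \<in> obj M" for V W X
  proof -
    have "mconstr H V (acted W (fobj F X)) \<cdot> farr H (whisker V (mconstr F W X)) =
        whisker V (farr H (mconstr F W X)) \<cdot> mconstr H V (fobj F (acted W X))"
      using mconstr_whisker[OF assms(2) h(1), of "mconstr F W X"] h assms by simp
    from M.extend[OF this, of "farr H (mconstr F V (acted W X))"]
    show ?thesis using h assms by (simp add: mconstr_tobj aarr_cmp)
  qed
  show "mconstr (F \<boxtimes>\<^bsub>B\<^esub> H) (tunit D) X = ident M (fobj (F \<boxtimes>\<^bsub>B\<^esub> H) X)" if "X \<in> obj M" for X
    using that assms by (simp add: mconstr_tunit)
qed (unfold B_simps module_functor_comp_def, auto)

lemma tunit_B [simp]: "tunit B \<in> obj B"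
proof (rule objI)
  show "linear_functor M M (tunit B)" unfolding linear_functor_def by auto
  show "is_cokernel M (farr (tunit B) f) (farr (tunit B) p)" if "is_cokernel M f p" for f p
    using that M.cokernelD[OF that] by simp
qed (simp_all, unfold B_simps, auto)

lemma B_arr [simp]:
  "F \<in> obj B \<Longrightarrow> ident B F \<in> arr B"
  "\<lbrakk>a \<in> arr B; b \<in> arr B; fst a = fst (snd b)\<rbrakk> \<Longrightarrow> a \<cdot>\<^bsub>B\<^esub> b \<in> arr B"
  "\<lbrakk>F \<in> obj B; F' \<in> obj B\<rbrakk> \<Longrightarrow> hzero B F F' \<in> arr B"
  "\<lbrakk>a \<in> arr B; b \<in> arr B; fst a = fst b; fst (snd a) = fst (snd b)\<rbrakk> \<Longrightarrow> hadd B a b \<in> arr B"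
  "a \<in> arr B \<Longrightarrow> hscale B c a \<in> arr B"
proof -
  show "ident B F \<in> arr B" if "F \<in> obj B" unfolding B_simps by (rule arrI) (use that in auto)
  show "a \<cdot>\<^bsub>B\<^esub> b \<in> arr B" if h: "a \<in> arr B" "b \<in> arr B" "fst a = fst (snd b)" for a b
    unfolding B_simps
  proof (rule arrI)
    note s = arrD[OF h(1)] arrD[OF h(2)] h(3)
    show "(comp a (tgt M f) \<cdot> comp b (tgt M f)) \<cdot> farr (fst b) f = farr (fst (snd a)) f \<cdot> comp a (src M f) \<cdot> comp b (src M f)"
      if "f \<in> arr M" for f
      using M.extend[OF arr_natural[OF h(1) that], of "comp b (src M f)"] arr_natural[OF h(2) that] s that by simp
    show "whisker V (comp a X \<cdot> comp b X) \<cdot> mconstr (fst b) V X = mconstr (fst (snd a)) V X \<cdot> comp a (acted V X) \<cdot> comp b (acted V X)"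
      if "V \<in> obj D" "X \<in> obj M" for V X
      using M.extend[OF arr_module[OF h(1) that], of "comp b (acted V X)"] arr_module[OF h(2) that] s that
      by (simp add: aarr_cmp)
  qed (use arrD[OF h(1)] arrD[OF h(2)] h(3) in auto)
  show "hzero B F F' \<in> arr B" if "F \<in> obj B" "F' \<in> obj B"
    unfolding B_simps by (rule arrI) (use that in \<open>auto simp: whisker_hzero\<close>)
  show "hadd B a b \<in> arr B" if h: "a \<in> arr B" "b \<in> arr B" "fst a = fst b" "fst (snd a) = fst (snd b)" for a b
    unfolding B_simps
    by (rule arrI) (use arrD[OF h(1)] arrD[OF h(2)] h(3,4) arr_natural[OF h(1)] arr_natural[OF h(2)] arr_module[OF h(1)] arr_module[OF h(2)]
       in \<open>auto simp: M.cmp_hadd aarr_hadd\<close>)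
  show "hscale B c a \<in> arr B" if h: "a \<in> arr B" for a c
    unfolding B_simps
    by (rule arrI) (use arrD[OF h(1)] arr_natural[OF h(1)] arr_module[OF h(1)]
       in \<open>auto simp: M.cmp_hscale aarr_hscale\<close>)
qed

lemma tarr_B [simp]:
  assumes "a \<in> arr B" "b \<in> arr B" shows "a \<boxtimes>\<^sub>m\<^bsub>B\<^esub> b \<in> arr B"
  unfolding B_simps(8)
proof (rule arrI)
  note s = arrD[OF assms(1)] arrD[OF assms(2)]
  let ?t = "\<lambda>X. comp b (fobj (fst (snd a)) X) \<cdot> farr (fst b) (comp a X)"
  show "?t (tgt M f) \<cdot> farr (fst a \<boxtimes>\<^bsub>B\<^esub> fst b) f = farr (fst (snd a) \<boxtimes>\<^bsub>B\<^esub> fst (snd b)) f \<cdot> ?t (src M f)" if f: "f \<in> arr M" for f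
  proof -
    have "?t (tgt M f) \<cdot> farr (fst b) (farr (fst a) f) = comp b (fobj (fst (snd a)) (tgt M f)) \<cdot> farr (fst b) (comp a (tgt M f) \<cdot> farr (fst a) f)"
      using s f by simp
    also have "\<dots> = (comp b (tgt M (farr (fst (snd a)) f)) \<cdot> farr (fst b) (farr (fst (snd a)) f)) \<cdot> farr (fst b) (comp a (src M f))"
      unfolding arr_natural[OF assms(1) f] using s f by simp
    also have "\<dots> = (farr (fst (snd b)) (farr (fst (snd a)) f) \<cdot> comp b (src M (farr (fst (snd a)) f))) \<cdot> farr (fst b) (comp a (src M f))"
      using arr_natural[OF assms(2), of "farr (fst (snd a)) f"] s f by simp
    finally show ?thesis using s f by simp
  qed
  show "whisker V (?t X) \<cdot> mconstr (fst a \<boxtimes>\<^bsub>B\<^esub> fst b) V X = mconstr (fst (snd a) \<boxtimes>\<^bsub>B\<^esub> fst (snd b)) V X \<cdot> ?t (acted V X)"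
    if h: "V \<in> obj D" "X \<in> obj M" for V X
  proof -
    have 1: "whisker V (farr (fst b) (comp a X)) \<cdot> mconstr (fst b) V (fobj (fst a) X) =
        mconstr (fst b) V (fobj (fst (snd a)) X) \<cdot> farr (fst b) (whisker V (comp a X))"
      using mconstr_whisker[OF s(7) h(1), of "comp a X"] s h by simp
    have 2: "farr (fst b) (whisker V (comp a X)) \<cdot> farr (fst b) (mconstr (fst a) V X) =
        farr (fst b) (mconstr (fst (snd a)) V X) \<cdot> farr (fst b) (comp a (acted V X))"
      using arg_cong[OF arr_module[OF assms(1) h], of "farr (fst b)"] s h by simp
    have 3: "whisker V (comp b (fobj (fst (snd a)) X)) \<cdot> mconstr (fst b) V (fobj (fst (snd a)) X) =
        mconstr (fst (snd b)) V (fobj (fst (snd a)) X) \<cdot> comp b (acted V (fobj (fst (snd a)) X))"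
      using arr_module[OF assms(2) h(1), of "fobj (fst (snd a)) X"] s h by simp
    have 4: "comp b (acted V (fobj (fst (snd a)) X)) \<cdot> farr (fst b) (mconstr (fst (snd a)) V X) =
        farr (fst (snd b)) (mconstr (fst (snd a)) V X) \<cdot> comp b (fobj (fst (snd a)) (acted V X))"
      using arr_natural[OF assms(2), of "mconstr (fst (snd a)) V X"] s h by simp
    show ?thesis
      using M.extend[OF 1, of "farr (fst b) (mconstr (fst a) V X)"] 2
        M.extend[OF 3, of "farr (fst b) (mconstr (fst (snd a)) V X) \<cdot> farr (fst b) (comp a (acted V X))"]
        M.extend[OF 4, of "farr (fst b) (comp a (acted V X))"] s h by (simp add: aarr_cmp)
  qed
qed (use arrD[OF assms(1)] arrD[OF assms(2)] in auto)

lemma linear_category_B: "linear_category B"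
proof (rule linear_category.intro)
  show "Module.module scalars (hom_space B F F')" if "F \<in> obj B" "F' \<in> obj B" for F F'
  proof (rule hom_space_moduleI)
    fix f g h a b assume f: "f \<in> Hom B F F'"
    note s = arrD[of f]
    show "hadd B (hzero B F F') f = f \<and> hscale B a f \<in> Hom B F F' \<and> hscale B 1 f = f \<and>
        hscale B 0 f = hzero B F F' \<and> hscale B (a * b) f = hscale B a (hscale B b f) \<and>
        hscale B (a + b) f = hadd B (hscale B a f) (hscale B b f)"
      using f that s by (auto simp: Hom_def M.hscale_mult M.hscale_add intro!: arr_eqI)
    assume g: "g \<in> Hom B F F'"
    note t = arrD[of g]
    show "hadd B f g \<in> Hom B F F' \<and> hadd B f g = hadd B g f"
      using f g that s t by (auto simp: Hom_def intro!: arr_eqI M.hadd_commute)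
    show "hscale B a (hadd B f g) = hadd B (hscale B a f) (hscale B a g)"
      using f g that s t by (auto simp: Hom_def M.hscale_hadd intro!: arr_eqI)
    assume h: "h \<in> Hom B F F'"
    show "hadd B (hadd B f g) h = hadd B f (hadd B g h)"
      using f g h that s t arrD[of h] by (auto simp: Hom_def intro!: arr_eqI M.hadd_assoc)
  qed (use that in \<open>auto simp: Hom_def\<close>)
  show "(h \<cdot>\<^bsub>B\<^esub> g) \<cdot>\<^bsub>B\<^esub> f = h \<cdot>\<^bsub>B\<^esub> g \<cdot>\<^bsub>B\<^esub> f"
    if "f \<in> Hom B W X" "g \<in> Hom B X Y" "h \<in> Hom B Y Z" for f g h W X Y Z
    by (rule arr_eqI) (use that in \<open>simp_all add: Hom_def arrD\<close>)
  show "ident B Y \<cdot>\<^bsub>B\<^esub> f = f" "f \<cdot>\<^bsub>B\<^esub> ident B X = f" if "f \<in> Hom B X Y" for f X Y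
    using arrD(1,2)[of f] that by (auto simp: Hom_def arrD intro!: arr_eqI simp del: split_paired_All split_paired_all)
  show "hadd B g g' \<cdot>\<^bsub>B\<^esub> f = hadd B (g \<cdot>\<^bsub>B\<^esub> f) (g' \<cdot>\<^bsub>B\<^esub> f)"
    if "f \<in> Hom B X Y" "g \<in> Hom B Y Z" "g' \<in> Hom B Y Z" for f g g' X Y Z
    by (rule arr_eqI) (use that in \<open>simp_all add: Hom_def arrD M.cmp_hadd\<close>)
  show "g \<cdot>\<^bsub>B\<^esub> hadd B f f' = hadd B (g \<cdot>\<^bsub>B\<^esub> f) (g \<cdot>\<^bsub>B\<^esub> f')"
    if "f \<in> Hom B X Y" "f' \<in> Hom B X Y" "g \<in> Hom B Y Z" for f f' g X Y Z
    by (rule arr_eqI) (use that in \<open>simp_all add: Hom_def arrD M.cmp_hadd\<close>)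
  show "hscale B a g \<cdot>\<^bsub>B\<^esub> f = hscale B a (g \<cdot>\<^bsub>B\<^esub> f)" "g \<cdot>\<^bsub>B\<^esub> hscale B a f = hscale B a (g \<cdot>\<^bsub>B\<^esub> f)"
    if "f \<in> Hom B X Y" "g \<in> Hom B Y Z" for f g a X Y Z
    by (rule arr_eqI; use that in \<open>simp add: Hom_def arrD M.cmp_hscale\<close>)+
qed (simp_all add: Hom_def arrD)

lemma linear_monoidal_B: "linear_monoidal B"
proof (rule linear_monoidal.intro[OF linear_category_B], rule linear_monoidal_axioms.intro)
  show "(X \<boxtimes>\<^bsub>B\<^esub> Y) \<boxtimes>\<^bsub>B\<^esub> Z = X \<boxtimes>\<^bsub>B\<^esub> (Y \<boxtimes>\<^bsub>B\<^esub> Z)" if "X \<in> obj B" "Y \<in> obj B" "Z \<in> obj B" for X Y Z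
    by (rule obj_eqI) (use that in simp_all)
  show "tunit B \<boxtimes>\<^bsub>B\<^esub> X = X" "X \<boxtimes>\<^bsub>B\<^esub> tunit B = X" if "X \<in> obj B" for X
    by (rule obj_eqI; use that in simp)+
  show "ident B X \<boxtimes>\<^sub>m\<^bsub>B\<^esub> ident B Y = ident B (X \<boxtimes>\<^bsub>B\<^esub> Y)" if "X \<in> obj B" "Y \<in> obj B" for X Y
    by (rule arr_eqI) (use that in simp_all)
  have assoc: "(X \<boxtimes>\<^bsub>B\<^esub> Y) \<boxtimes>\<^bsub>B\<^esub> Z = X \<boxtimes>\<^bsub>B\<^esub> (Y \<boxtimes>\<^bsub>B\<^esub> Z)" if "X \<in> obj B" "Y \<in> obj B" "Z \<in> obj B" for X Y Z
    by (rule obj_eqI) (use that in simp_all)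
  have unit: "tunit B \<boxtimes>\<^bsub>B\<^esub> X = X" "X \<boxtimes>\<^bsub>B\<^esub> tunit B = X" if "X \<in> obj B" for X
    by (rule obj_eqI; use that in simp)+
  show "(f' \<boxtimes>\<^sub>m\<^bsub>B\<^esub> g') \<cdot>\<^bsub>B\<^esub> (f \<boxtimes>\<^sub>m\<^bsub>B\<^esub> g) = (f' \<cdot>\<^bsub>B\<^esub> f) \<boxtimes>\<^sub>m\<^bsub>B\<^esub> (g' \<cdot>\<^bsub>B\<^esub> g)"
    if h: "f \<in> arr B" "f' \<in> arr B" "g \<in> arr B" "g' \<in> arr B" "src B f' = tgt B f" "src B g' = tgt B g" for f f' g g'
  proof (rule arr_eqI)
    fix X assume X: "X \<in> obj M"
    note s = arrD[OF h(1)] arrD[OF h(2)] arrD[OF h(3)] arrD[OF h(4)] h(5,6)[simplified]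
    have "comp g (fobj (fst (snd f')) X) \<cdot> farr (fst g) (comp f' X) = farr (fst g') (comp f' X) \<cdot> comp g (fobj (fst (snd f)) X)"
      using arr_natural[OF h(3), of "comp f' X"] s X by simp
    from M.extend[OF this, of "farr (fst g) (comp f X)"]
    show "comp ((f' \<boxtimes>\<^sub>m\<^bsub>B\<^esub> g') \<cdot>\<^bsub>B\<^esub> (f \<boxtimes>\<^sub>m\<^bsub>B\<^esub> g)) X = comp ((f' \<cdot>\<^bsub>B\<^esub> f) \<boxtimes>\<^sub>m\<^bsub>B\<^esub> (g' \<cdot>\<^bsub>B\<^esub> g)) X"
      using s X by simp
  qed (use h arrD in simp_all)
  show "(f \<boxtimes>\<^sub>m\<^bsub>B\<^esub> g) \<boxtimes>\<^sub>m\<^bsub>B\<^esub> h = f \<boxtimes>\<^sub>m\<^bsub>B\<^esub> (g \<boxtimes>\<^sub>m\<^bsub>B\<^esub> h)" if "f \<in> arr B" "g \<in> arr B" "h \<in> arr B" for f g h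
    by (rule arr_eqI) (use that in \<open>simp_all add: arrD assoc\<close>)
  show "ident B (tunit B) \<boxtimes>\<^sub>m\<^bsub>B\<^esub> f = f" "f \<boxtimes>\<^sub>m\<^bsub>B\<^esub> ident B (tunit B) = f" if "f \<in> arr B" for f
    by (rule arr_eqI; use that in \<open>simp add: arrD unit\<close>)+
  show "hadd B f f' \<boxtimes>\<^sub>m\<^bsub>B\<^esub> g = hadd B (f \<boxtimes>\<^sub>m\<^bsub>B\<^esub> g) (f' \<boxtimes>\<^sub>m\<^bsub>B\<^esub> g)"
    if "f \<in> arr B" "f' \<in> arr B" "g \<in> arr B" "src B f = src B f'" "tgt B f = tgt B f'" for f f' g
    by (rule arr_eqI) (use that in \<open>simp_all add: arrD M.cmp_hadd M.functor_hadd[OF objD(1)]\<close>)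
  show "f \<boxtimes>\<^sub>m\<^bsub>B\<^esub> hadd B g g' = hadd B (f \<boxtimes>\<^sub>m\<^bsub>B\<^esub> g) (f \<boxtimes>\<^sub>m\<^bsub>B\<^esub> g')"
    if "f \<in> arr B" "g \<in> arr B" "g' \<in> arr B" "src B g = src B g'" "tgt B g = tgt B g'" for f g g'
    by (rule arr_eqI) (use that in \<open>simp_all add: arrD M.cmp_hadd\<close>)
  show "hscale B a f \<boxtimes>\<^sub>m\<^bsub>B\<^esub> g = hscale B a (f \<boxtimes>\<^sub>m\<^bsub>B\<^esub> g)" "f \<boxtimes>\<^sub>m\<^bsub>B\<^esub> hscale B a g = hscale B a (f \<boxtimes>\<^sub>m\<^bsub>B\<^esub> g)"
    if "f \<in> arr B" "g \<in> arr B" for a f g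
    by (rule arr_eqI; use that in \<open>simp add: arrD M.cmp_hscale M.functor_hscale[OF objD(1)]\<close>)+
qed simp_all

end

subsection \<open>Direct sums of module endofunctors\<close>

context strict_module_category
begin

sublocale B: linear_monoidal B by (rule linear_monoidal_B)

definition evaluation :: "'o \<Rightarrow> (('d, 'o, 'm) mod_functor, ('d, 'o, 'm) mod_transf, 'o, 'm) cat_functor" where
  "evaluation X = \<lparr>fobj = \<lambda>F. fobj F X, farr = \<lambda>a. comp a X\<rparr>"

lemma evaluation_linear: "X \<in> obj M \<Longrightarrow> linear_functor B M (evaluation X)"
  by (simp add: linear_functor_def evaluation_def arrD)

lemma comp_hsum:
  assumes "finite J" "F \<in> obj B" "F' \<in> obj B" "X \<in> obj M"
    "\<And>j. j \<in> J \<Longrightarrow> a j \<in> arr B \<and> fst (a j) = F \<and> fst (snd (a j)) = F'"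
  shows "comp (B.hsum F F' a J) X = M.hsum (fobj F X) (fobj F' X) (\<lambda>j. comp (a j) X) J"
  using B.functor_hsum[OF M.linear_category_axioms evaluation_linear[OF assms(4)] assms(2,3,1), of a] assms(5)
  by (simp add: evaluation_def)

text \<open>The pointwise inverses again form a module transformation.\<close>

lemma iso_pointwise:
  assumes "a \<in> arr B" "\<And>X. X \<in> obj M \<Longrightarrow> is_iso M (comp a X)"
  shows "is_iso B a"
proof -
  note s = arrD[OF assms(1)]
  let ?b = "(fst (snd a), fst a, \<lambda>X\<in>obj M. M.inv_arr (comp a X))"
  have b: "?b \<in> arr B"
  proof (rule arrI[OF s(2,1)])
    show "M.inv_arr (comp a (tgt M f)) \<cdot> farr (fst (snd a)) f = farr (fst a) f \<cdot> M.inv_arr (comp a (src M f))"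
      if f: "f \<in> arr M" for f
    proof (rule M.iso_cancel_right[of "comp a (src M f)"])
      show "(M.inv_arr (comp a (tgt M f)) \<cdot> farr (fst (snd a)) f) \<cdot> comp a (src M f) =
          (farr (fst a) f \<cdot> M.inv_arr (comp a (src M f))) \<cdot> comp a (src M f)"
        using arr_natural[OF assms(1) f, symmetric] f s assms(2) by simp
    qed (use f s assms(2) in simp_all)
    show "whisker V (M.inv_arr (comp a X)) \<cdot> mconstr (fst (snd a)) V X = mconstr (fst a) V X \<cdot> M.inv_arr (comp a (acted V X))"
      if h: "V \<in> obj D" "X \<in> obj M" for V X
    proof (rule M.iso_cancel_right[of "comp a (acted V X)"])
      have "whisker V (M.inv_arr (comp a X)) \<cdot> whisker V (comp a X) \<cdot> mconstr (fst a) V X = mconstr (fst a) V X"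
        using M.extend[OF aarr_cmp[OF h(1), of "comp a X" "M.inv_arr (comp a X)", symmetric], of "mconstr (fst a) V X"]
          h s assms(2) by simp
      then show "(whisker V (M.inv_arr (comp a X)) \<cdot> mconstr (fst (snd a)) V X) \<cdot> comp a (acted V X) =
          (mconstr (fst a) V X \<cdot> M.inv_arr (comp a (acted V X))) \<cdot> comp a (acted V X)"
        using arr_module[OF assms(1) h, symmetric] h s assms(2) by simp
    qed (use h s assms(2) in simp_all)
  qed (use s assms(2) in simp)
  show ?thesis
  proof (rule B.isoI[OF assms(1) b])
    show "?b \<cdot>\<^bsub>B\<^esub> a = ident B (src B a)" by (rule arr_eqI) (use assms b s in simp_all)
    show "a \<cdot>\<^bsub>B\<^esub> ?b = ident B (tgt B a)" by (rule arr_eqI) (use assms b s in simp_all)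
  qed simp_all
qed

definition pointwise_sum ::
    "'i set \<Rightarrow> ('i \<Rightarrow> ('d, 'o, 'm) mod_functor) \<Rightarrow> 'o \<Rightarrow> 'o \<times> ('i \<Rightarrow> 'm) \<times> ('i \<Rightarrow> 'm)" where
  "pointwise_sum J F X = (SOME S. is_direct_sum M J (\<lambda>j. fobj (F j) X) (fst S) (fst (snd S)) (snd (snd S)))"

abbreviation "psum J F X \<equiv> fst (pointwise_sum J F X)"
abbreviation "pincl J F X j \<equiv> fst (snd (pointwise_sum J F X)) j"
abbreviation "pproj J F X j \<equiv> snd (snd (pointwise_sum J F X)) j"

text \<open>A direct sum is chosen at every object; arrows and module structures act diagonally on the summands.\<close>

definition sum_functor ::
    "'i set \<Rightarrow> ('i \<Rightarrow> ('d, 'o, 'm) mod_functor) \<Rightarrow> ('d, 'o, 'm) mod_functor" where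
  "sum_functor J F = (let S = pointwise_sum J F in
     \<lparr>fobj = (\<lambda>X\<in>obj M. fst (S X)),
      farr = (\<lambda>f\<in>arr M. M.hsum (fst (S (src M f))) (fst (S (tgt M f)))
        (\<lambda>j. (fst (snd (S (tgt M f))) j \<cdot> farr (F j) f) \<cdot> snd (snd (S (src M f))) j) J),
      mconstr = (\<lambda>V\<in>obj D. \<lambda>X\<in>obj M. M.hsum (fst (S (acted V X))) (acted V (fst (S X)))
        (\<lambda>j. (whisker V (fst (snd (S X)) j) \<cdot> mconstr (F j) V X) \<cdot> snd (snd (S (acted V X))) j) J)\<rparr>)"

context
  fixes J :: "'i set" and F :: "'i \<Rightarrow> ('d, 'o, 'm) mod_functor"
  assumes fin: "finite J" and F: "\<And>j. j \<in> J \<Longrightarrow> F j \<in> obj B"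
begin

lemma pointwise_sum:
  assumes "X \<in> obj M" shows "is_direct_sum M J (\<lambda>j. fobj (F j) X) (psum J F X) (\<lambda>j. pincl J F X j) (\<lambda>j. pproj J F X j)"
proof -
  obtain S i p where "is_direct_sum M J (\<lambda>j. fobj (F j) X) S i p"
    using M.finite_direct_sum_exists[OF fin, of "\<lambda>j. fobj (F j) X"] F assms by auto
  then have "\<exists>S. is_direct_sum M J (\<lambda>j. fobj (F j) X) (fst S) (fst (snd S)) (snd (snd S))"
    by (intro exI[of _ "(S, i, p)"]) simp
  from someI_ex[OF this, folded pointwise_sum_def] show ?thesis by simp
qed

lemmas sum_simps [simp] = M.direct_sumD(1,4-10)[OF pointwise_sum]
lemmas sum_zero = M.direct_sumD(11)[OF pointwise_sum]
lemmas sum_cancel = M.direct_sum_cancel[OF pointwise_sum]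
lemmas sum_ext = M.direct_sum_ext_src[OF fin pointwise_sum]

lemma sum_fobj [simp]: "X \<in> obj M \<Longrightarrow> fobj (sum_functor J F) X = psum J F X"
  by (simp add: sum_functor_def Let_def)

lemma sum_farr [simp]:
  assumes "f \<in> arr M"
  shows "farr (sum_functor J F) f \<in> arr M" "src M (farr (sum_functor J F) f) = psum J F (src M f)" "tgt M (farr (sum_functor J F) f) = psum J F (tgt M f)"
  using assms F by (simp_all add: sum_functor_def Let_def)

lemma sum_farr_iota:
  assumes "f \<in> arr M" "j \<in> J" "X = src M f"
  shows "farr (sum_functor J F) f \<cdot> pincl J F X j = pincl J F (tgt M f) j \<cdot> farr (F j) f"
  using assms F M.direct_sum_hsum_iota[OF fin pointwise_sum[of "src M f"] assms(2), of "psum J F (tgt M f)" "\<lambda>j. pincl J F (tgt M f) j \<cdot> farr (F j) f"]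
  by (simp add: sum_functor_def Let_def)

lemma sum_farr_iota_cmp:
  assumes "f \<in> arr M" "j \<in> J" "X = src M f" "z \<in> arr M" "tgt M z = fobj (F j) X"
  shows "farr (sum_functor J F) f \<cdot> pincl J F X j \<cdot> z = pincl J F (tgt M f) j \<cdot> farr (F j) f \<cdot> z"
  using M.extend[OF sum_farr_iota[OF assms(1-3)], of z] assms F by simp

lemma sum_mconstr [simp]:
  assumes "V \<in> obj D" "X \<in> obj M"
  shows "mconstr (sum_functor J F) V X \<in> arr M" "src M (mconstr (sum_functor J F) V X) = psum J F (acted V X)"
    "tgt M (mconstr (sum_functor J F) V X) = acted V (psum J F X)"
  using assms F by (simp_all add: sum_functor_def Let_def)

lemma sum_mconstr_iota:
  assumes "V \<in> obj D" "X \<in> obj M" "j \<in> J"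
  shows "mconstr (sum_functor J F) V X \<cdot> pincl J F (acted V X) j = whisker V (pincl J F X j) \<cdot> mconstr (F j) V X"
  using assms F M.direct_sum_hsum_iota[OF fin pointwise_sum[of "acted V X"] assms(3), of "acted V (psum J F X)"
      "\<lambda>j. whisker V (pincl J F X j) \<cdot> mconstr (F j) V X"]
  by (simp add: sum_functor_def Let_def)

lemma sum_mconstr_iota_cmp:
  assumes "V \<in> obj D" "X \<in> obj M" "j \<in> J" "z \<in> arr M" "tgt M z = fobj (F j) (acted V X)"
  shows "mconstr (sum_functor J F) V X \<cdot> pincl J F (acted V X) j \<cdot> z = whisker V (pincl J F X j) \<cdot> mconstr (F j) V X \<cdot> z"
  using M.extend[OF sum_mconstr_iota[OF assms(1-3)], of z] assms F by simp

lemma sum_mconstr_iso: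
  assumes "V \<in> obj D" "X \<in> obj M" shows "is_iso M (mconstr (sum_functor J F) V X)"
proof (rule M.direct_sum_diagonal_iso[OF fin pointwise_sum[of "acted V X"]])
  show "is_direct_sum M J (\<lambda>j. acted V (fobj (F j) X)) (acted V (psum J F X)) (\<lambda>j. whisker V (pincl J F X j)) (\<lambda>j. whisker V (pproj J F X j))"
    using M.functor_direct_sum[OF M.linear_category_axioms action_functor_linear[OF assms(1)] fin pointwise_sum[OF assms(2)]]
    by simp
  show "is_iso M (mconstr (F j) V X) \<and> src M (mconstr (F j) V X) = fobj (F j) (acted V X) \<and>
      tgt M (mconstr (F j) V X) = acted V (fobj (F j) X) \<and>
      mconstr (sum_functor J F) V X \<cdot> pincl J F (acted V X) j = whisker V (pincl J F X j) \<cdot> mconstr (F j) V X" if "j \<in> J" for j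
    using sum_mconstr_iota[OF assms that] F[OF that] assms by simp
qed (use assms in simp_all)

lemma sum_functor_linear: "linear_functor M M (sum_functor J F)"
  unfolding linear_functor_def
proof (intro conjI ballI allI impI)
  show "farr (sum_functor J F) (ident M X) = ident M (fobj (sum_functor J F) X)" if "X \<in> obj M" for X
    by (rule sum_ext[of X]) (use that F in \<open>simp_all add: sum_farr_iota\<close>)
  show "farr (sum_functor J F) (g \<cdot> f) = farr (sum_functor J F) g \<cdot> farr (sum_functor J F) f"
    if "f \<in> arr M" "g \<in> arr M" "src M g = tgt M f" for f g
    by (rule sum_ext[of "src M f"]) (use that F in \<open>simp_all add: sum_farr_iota sum_farr_iota_cmp\<close>)
  show "farr (sum_functor J F) (hadd M f g) = hadd M (farr (sum_functor J F) f) (farr (sum_functor J F) g)"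
    if "X \<in> obj M" "Y \<in> obj M" "f \<in> Hom M X Y" "g \<in> Hom M X Y" for X Y f g
    by (rule sum_ext[of X]) (use that F in \<open>simp_all add: sum_farr_iota M.cmp_hadd M.functor_hadd[OF objD(1)]\<close>)
  show "farr (sum_functor J F) (hscale M c f) = hscale M c (farr (sum_functor J F) f)" if "f \<in> arr M" for f c
    by (rule sum_ext[of "src M f"]) (use that F in \<open>simp_all add: sum_farr_iota M.cmp_hscale M.functor_hscale[OF objD(1)]\<close>)
qed simp_all

text \<open>Arrows out of a direct sum are families of arrows, so cokernels may be formed summand by summand.\<close>

lemma sum_functor_right_exact:
  assumes "is_cokernel M f p" shows "is_cokernel M (farr (sum_functor J F) f) (farr (sum_functor J F) p)"
proof (rule M.cokernelI)
  note c = M.cokernelD[OF assms]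
  note s = M.functor_simps[OF sum_functor_linear]
  have "farr (sum_functor J F) (p \<cdot> f) = hzero M (psum J F (src M f)) (psum J F (tgt M p))"
    using M.functor_hzero[OF M.linear_category_axioms sum_functor_linear, of "src M f" "tgt M p"] c by simp
  then show "farr (sum_functor J F) p \<cdot> farr (sum_functor J F) f = hzero M (src M (farr (sum_functor J F) f)) (tgt M (farr (sum_functor J F) p))"
    using c s(6)[of f p] by simp
  show "\<exists>u\<in>arr M. src M u = tgt M (farr (sum_functor J F) p) \<and> tgt M u = tgt M h \<and> u \<cdot> farr (sum_functor J F) p = h"
    if h: "h \<in> arr M" "src M h = tgt M (farr (sum_functor J F) f)" "h \<cdot> farr (sum_functor J F) f = hzero M (src M (farr (sum_functor J F) f)) (tgt M h)" for h
  proof -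
    have "\<exists>u\<in>arr M. src M u = fobj (F j) (tgt M p) \<and> tgt M u = tgt M h \<and> u \<cdot> farr (F j) p = h \<cdot> pincl J F (tgt M f) j" if j: "j \<in> J" for j
    proof -
      have "h \<cdot> farr (sum_functor J F) f \<cdot> pincl J F (src M f) j = hzero M (fobj (F j) (src M f)) (tgt M h)"
        using M.extend[OF h(3), of "pincl J F (src M f) j"] h(1,2) c j F by simp
      then have "(h \<cdot> pincl J F (tgt M f) j) \<cdot> farr (F j) f = hzero M (fobj (F j) (src M f)) (tgt M h)"
        using sum_farr_iota[OF c(1) j refl] h(1,2) c j F by simp
      then show ?thesis
        using M.cokernel_factor[OF objD(2)[OF F[OF j] assms], of "h \<cdot> pincl J F (tgt M f) j"] h(1,2) c j F by simp
    qed
    then obtain u where u: "\<And>j. j \<in> J \<Longrightarrow> u j \<in> arr M \<and> src M (u j) = fobj (F j) (tgt M p) \<and> tgt M (u j) = tgt M h \<and>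
        u j \<cdot> farr (F j) p = h \<cdot> pincl J F (tgt M f) j" by (metis (no_types))
    let ?u = "M.hsum (psum J F (tgt M p)) (tgt M h) (\<lambda>j. u j \<cdot> pproj J F (tgt M p) j) J"
    have a: "?u \<in> arr M" "src M ?u = psum J F (tgt M p)" "tgt M ?u = tgt M h" using u c h by simp_all
    have ui: "?u \<cdot> pincl J F (tgt M p) j = u j" if "j \<in> J" for j
      by (rule M.direct_sum_hsum_iota[OF fin pointwise_sum that]) (use u c h in simp_all)
    have "?u \<cdot> farr (sum_functor J F) p = h"
    proof (rule sum_ext[of "src M p"])
      fix j assume j: "j \<in> J"
      have "(?u \<cdot> farr (sum_functor J F) p) \<cdot> pincl J F (src M p) j = ?u \<cdot> pincl J F (tgt M p) j \<cdot> farr (F j) p"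
        using sum_farr_iota[OF c(2) j refl] a c j by simp
      also have "\<dots> = h \<cdot> pincl J F (src M p) j"
        using M.extend[OF ui[OF j], of "farr (F j) p"] a c j F[OF j] u[OF j] by simp
      finally show "(?u \<cdot> farr (sum_functor J F) p) \<cdot> pincl J F (src M p) j = h \<cdot> pincl J F (src M p) j" .
    qed (use a c h in simp_all)
    then show ?thesis using a c by (intro bexI[of _ ?u]) simp_all
  qed
  show "u = v" if h: "u \<in> arr M" "v \<in> arr M" "tgt M u = tgt M v" "src M u = tgt M (farr (sum_functor J F) p)"
    "src M v = tgt M (farr (sum_functor J F) p)" "u \<cdot> farr (sum_functor J F) p = v \<cdot> farr (sum_functor J F) p" for u v
  proof (rule sum_ext[of "tgt M p"])
    fix j assume j: "j \<in> J"
    have "u \<cdot> farr (sum_functor J F) p \<cdot> pincl J F (src M p) j = v \<cdot> farr (sum_functor J F) p \<cdot> pincl J F (src M p) j"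
      using M.extend[OF h(6), of "pincl J F (src M p) j"] h(1-5) c j by simp
    then have e: "(u \<cdot> pincl J F (tgt M p) j) \<cdot> farr (F j) p = (v \<cdot> pincl J F (tgt M p) j) \<cdot> farr (F j) p"
      using sum_farr_iota[OF c(2) j refl] h(1-5) c j F[OF j] by simp
    show "u \<cdot> pincl J F (tgt M p) j = v \<cdot> pincl J F (tgt M p) j"
      by (rule M.cokernel_cancel[OF objD(2)[OF F[OF j] assms]]) (use e h(1-5) c j F[OF j] in simp_all)
  qed (use h c in simp_all)
qed (use M.cokernelD[OF assms] in simp_all)

lemma sum_functor_obj: "(sum_functor J F) \<in> obj B"
proof (rule objI)
  show "mconstr (sum_functor J F) (tgt D u) (tgt M f) \<cdot> farr (sum_functor J F) (aarr act u f) =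
      aarr act u (farr (sum_functor J F) f) \<cdot> mconstr (sum_functor J F) (src D u) (src M f)" if h: "u \<in> arr D" "f \<in> arr M" for u f
  proof (rule sum_ext[of "acted (src D u) (src M f)"])
    fix j assume j: "j \<in> J"
    note Fj = F[OF j]
    have "(mconstr (sum_functor J F) (tgt D u) (tgt M f) \<cdot> farr (sum_functor J F) (aarr act u f)) \<cdot> pincl J F (acted (src D u) (src M f)) j =
        whisker (tgt D u) (pincl J F (tgt M f) j) \<cdot> mconstr (F j) (tgt D u) (tgt M f) \<cdot> farr (F j) (aarr act u f)"
      using h j Fj by (simp add: sum_farr_iota sum_mconstr_iota_cmp)
    also have "\<dots> = aarr act u (pincl J F (tgt M f) j \<cdot> farr (F j) f) \<cdot> mconstr (F j) (src D u) (src M f)"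
      unfolding mconstr_natural[OF Fj h]
      using h j Fj M.extend[OF aarr_absorb(1)[OF h(1), of "farr (F j) f" "pincl J F (tgt M f) j" "tgt D u"],
          of "mconstr (F j) (src D u) (src M f)"] by simp
    also have "\<dots> = (aarr act u (farr (sum_functor J F) f) \<cdot> mconstr (sum_functor J F) (src D u) (src M f)) \<cdot> pincl J F (acted (src D u) (src M f)) j"
      using h j Fj M.extend[OF aarr_absorb(2)[OF h(1), of "pincl J F (src M f) j" "farr (sum_functor J F) f" "src D u"],
          of "mconstr (F j) (src D u) (src M f)"]
      by (simp add: sum_farr_iota sum_mconstr_iota)
    finally show "(mconstr (sum_functor J F) (tgt D u) (tgt M f) \<cdot> farr (sum_functor J F) (aarr act u f)) \<cdot> pincl J F (acted (src D u) (src M f)) j =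
        (aarr act u (farr (sum_functor J F) f) \<cdot> mconstr (sum_functor J F) (src D u) (src M f)) \<cdot> pincl J F (acted (src D u) (src M f)) j" .
  qed (use h in simp_all)
  show "mconstr (sum_functor J F) (V \<boxtimes>\<^bsub>D\<^esub> W) X = whisker V (mconstr (sum_functor J F) W X) \<cdot> mconstr (sum_functor J F) V (acted W X)"
    if h: "V \<in> obj D" "W \<in> obj D" "X \<in> obj M" for V W X
  proof (rule sum_ext[of "acted V (acted W X)"])
    fix j assume j: "j \<in> J"
    note Fj = F[OF j]
    have "mconstr (sum_functor J F) (V \<boxtimes>\<^bsub>D\<^esub> W) X \<cdot> pincl J F (acted V (acted W X)) j =
        whisker V (whisker W (pincl J F X j)) \<cdot> whisker V (mconstr (F j) W X) \<cdot> mconstr (F j) V (acted W X)"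
      using h j Fj sum_mconstr_iota[of "V \<boxtimes>\<^bsub>D\<^esub> W" X j] by (simp add: mconstr_tobj aarr_assoc)
    also have "\<dots> = whisker V (mconstr (sum_functor J F) W X) \<cdot> whisker V (pincl J F (acted W X) j) \<cdot> mconstr (F j) V (acted W X)"
      using h j Fj arg_cong[OF sum_mconstr_iota[of W X j], of "whisker V"]
        M.extend[OF aarr_cmp[OF h(1), symmetric, of "mconstr (F j) W X" "whisker W (pincl J F X j)"], of "mconstr (F j) V (acted W X)"]
        M.extend[OF aarr_cmp[OF h(1), symmetric, of "pincl J F (acted W X) j" "mconstr (sum_functor J F) W X"], of "mconstr (F j) V (acted W X)"]
      by simp
    finally show "mconstr (sum_functor J F) (V \<boxtimes>\<^bsub>D\<^esub> W) X \<cdot> pincl J F (acted V (acted W X)) j =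
        (whisker V (mconstr (sum_functor J F) W X) \<cdot> mconstr (sum_functor J F) V (acted W X)) \<cdot> pincl J F (acted V (acted W X)) j"
      using h j Fj by (simp add: sum_mconstr_iota)
  qed (use h in simp_all)
  show "mconstr (sum_functor J F) (tunit D) X = ident M (fobj (sum_functor J F) X)" if "X \<in> obj M" for X
    by (rule sum_ext[of X]) (use that F sum_mconstr_iota[of "tunit D" X] in \<open>simp_all add: aarr_unit mconstr_tunit\<close>)
  show "fobj (sum_functor J F) \<in> extensional (obj M)" "farr (sum_functor J F) \<in> extensional (arr M)" "mconstr (sum_functor J F) \<in> extensional (obj D)"
    by (simp_all add: sum_functor_def Let_def)
  show "mconstr (sum_functor J F) V \<in> extensional (obj M)" if "V \<in> obj D" for V using that by (simp add: sum_functor_def Let_def)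
qed (use sum_functor_linear sum_functor_right_exact sum_mconstr_iso in simp_all)

lemma sum_functor_direct_sum:
  "is_direct_sum B J F (sum_functor J F) (\<lambda>j. (F j, (sum_functor J F), \<lambda>X\<in>obj M. pincl J F X j)) (\<lambda>j. ((sum_functor J F), F j, \<lambda>X\<in>obj M. pproj J F X j))"
proof -
  let ?i = "\<lambda>j. (F j, (sum_functor J F), \<lambda>X\<in>obj M. pincl J F X j)" and ?p = "\<lambda>j. ((sum_functor J F), F j, \<lambda>X\<in>obj M. pproj J F X j)"
  have i: "?i j \<in> arr B" if "j \<in> J" for j
    by (rule arrI) (use that F sum_functor_obj in \<open>simp_all add: sum_farr_iota sum_mconstr_iota\<close>)
  have p: "?p j \<in> arr B" if j: "j \<in> J" for j
  proof (rule arrI)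
    show "pproj J F (tgt M f) j \<cdot> farr (sum_functor J F) f = farr (F j) f \<cdot> pproj J F (src M f) j" if f: "f \<in> arr M" for f
    proof (rule sum_ext[of "src M f"])
      fix k assume k: "k \<in> J"
      show "(pproj J F (tgt M f) j \<cdot> farr (sum_functor J F) f) \<cdot> pincl J F (src M f) k = (farr (F j) f \<cdot> pproj J F (src M f) j) \<cdot> pincl J F (src M f) k"
        using f j k F sum_cancel[OF _ j] sum_zero[OF _ j k]
        by (cases "j = k") (simp_all add: sum_farr_iota)
    qed (use f j F in simp_all)
    show "whisker V (pproj J F X j) \<cdot> mconstr (sum_functor J F) V X = mconstr (F j) V X \<cdot> pproj J F (acted V X) j"
      if h: "V \<in> obj D" "X \<in> obj M" for V X
    proof (rule sum_ext[of "acted V X"])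
      fix k assume k: "k \<in> J"
      have "whisker V (pproj J F X j) \<cdot> whisker V (pincl J F X k) \<cdot> mconstr (F k) V X = whisker V (pproj J F X j \<cdot> pincl J F X k) \<cdot> mconstr (F k) V X"
        using h j k F by (intro M.extend aarr_cmp[symmetric]) simp_all
      then show "(whisker V (pproj J F X j) \<cdot> mconstr (sum_functor J F) V X) \<cdot> pincl J F (acted V X) k = (mconstr (F j) V X \<cdot> pproj J F (acted V X) j) \<cdot> pincl J F (acted V X) k"
        using h j k F sum_zero[OF _ j k]
        by (cases "j = k") (simp_all add: sum_mconstr_iota whisker_hzero)
    qed (use h j F in simp_all)
  qed (use j F sum_functor_obj in simp_all)
  have "?p j \<cdot>\<^bsub>B\<^esub> ?i k = (if j = k then ident B (F j) else hzero B (F k) (F j))" if "j \<in> J" "k \<in> J" for j k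
    by (rule arr_eqI) (use that i p F sum_zero[OF _ that] in \<open>simp_all split: if_splits\<close>)
  moreover have "B.hsum (sum_functor J F) (sum_functor J F) (\<lambda>j. ?i j \<cdot>\<^bsub>B\<^esub> ?p j) J = ident B (sum_functor J F)"
  proof (rule arr_eqI)
    show "comp (B.hsum (sum_functor J F) (sum_functor J F) (\<lambda>j. ?i j \<cdot>\<^bsub>B\<^esub> ?p j) J) X = comp (ident B (sum_functor J F)) X" if X: "X \<in> obj M" for X
    proof -
      have "comp (B.hsum (sum_functor J F) (sum_functor J F) (\<lambda>j. ?i j \<cdot>\<^bsub>B\<^esub> ?p j) J) X =
          M.hsum (fobj (sum_functor J F) X) (fobj (sum_functor J F) X) (\<lambda>j. comp (?i j \<cdot>\<^bsub>B\<^esub> ?p j) X) J"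
        by (rule comp_hsum) (use fin sum_functor_obj X i p in simp_all)
      also have "\<dots> = M.hsum (psum J F X) (psum J F X) (\<lambda>j. pincl J F X j \<cdot> pproj J F X j) J"
        using X by simp
      finally show ?thesis using M.direct_sumD(2)[OF pointwise_sum[OF X]] X by simp
    qed
  qed (use sum_functor_obj i p B.hsum_arr[of "sum_functor J F" "sum_functor J F" J "\<lambda>j. ?i j \<cdot>\<^bsub>B\<^esub> ?p j"] in \<open>simp_all\<close>)
  ultimately show ?thesis using i p F sum_functor_obj by (simp add: is_direct_sum_def)
qed

end

end

section \<open>Duals\<close>

context linear_monoidal
begin

lemma left_dualD:
  assumes "is_left_dual C X D ev coev"
  shows "X \<in> obj C" "D \<in> obj C" "ev \<in> arr C" "src C ev = D \<boxtimes> X" "tgt C ev = tunit C"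
    "coev \<in> arr C" "src C coev = tunit C" "tgt C coev = X \<boxtimes> D"
    "(idm X \<boxtimes>\<^sub>m ev) \<cdot> (coev \<boxtimes>\<^sub>m idm X) = idm X" "(ev \<boxtimes>\<^sub>m idm D) \<cdot> (idm D \<boxtimes>\<^sub>m coev) = idm D"
  using assms by (auto simp: is_left_dual_def)

lemma interchange_cmp:
  "\<lbrakk>f \<in> arr C; f' \<in> arr C; g \<in> arr C; g' \<in> arr C; src C f' = tgt C f; src C g' = tgt C g;
    z \<in> arr C; tgt C z = src C f \<boxtimes> src C g\<rbrakk>
   \<Longrightarrow> (f' \<boxtimes>\<^sub>m g') \<cdot> (f \<boxtimes>\<^sub>m g) \<cdot> z = ((f' \<cdot> f) \<boxtimes>\<^sub>m (g' \<cdot> g)) \<cdot> z"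
  by (rule extend[OF interchange]) simp_all

lemma left_dual_tensor:
  assumes "is_left_dual C X D ev coev" "is_left_dual C Y E ev' coev'"
  shows "is_left_dual C (X \<boxtimes> Y) (E \<boxtimes> D) (ev' \<cdot> (idm E \<boxtimes>\<^sub>m ev \<boxtimes>\<^sub>m idm Y)) ((idm X \<boxtimes>\<^sub>m coev' \<boxtimes>\<^sub>m idm D) \<cdot> coev)"
proof -
  note s = left_dualD[OF assms(1)] and t = left_dualD[OF assms(2)]
  have 1: "(idm (X \<boxtimes> Y \<boxtimes> E) \<boxtimes>\<^sub>m (ev \<boxtimes>\<^sub>m idm Y)) \<cdot> ((idm X \<boxtimes>\<^sub>m coev') \<boxtimes>\<^sub>m idm (D \<boxtimes> X \<boxtimes> Y)) =
      ((idm X \<boxtimes>\<^sub>m coev') \<boxtimes>\<^sub>m idm Y) \<cdot> (idm X \<boxtimes>\<^sub>m (ev \<boxtimes>\<^sub>m idm Y))"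
    using s(1-8) t(1-8) by (simp add: interchange del: tarr_assoc)
  have 2: "(idm (E \<boxtimes> D \<boxtimes> X) \<boxtimes>\<^sub>m (coev' \<boxtimes>\<^sub>m idm D)) = (idm E \<boxtimes>\<^sub>m (idm (D \<boxtimes> X) \<boxtimes>\<^sub>m (coev' \<boxtimes>\<^sub>m idm D)))"
    using s(1-8) t(1-8) by (simp flip: tarr_assoc)
  show ?thesis
    unfolding is_left_dual_def
  proof (intro conjI)
    let ?ev = "ev' \<cdot> (idm E \<boxtimes>\<^sub>m ev \<boxtimes>\<^sub>m idm Y)" and ?co = "(idm X \<boxtimes>\<^sub>m coev' \<boxtimes>\<^sub>m idm D) \<cdot> coev"
    have "(idm (X \<boxtimes> Y) \<boxtimes>\<^sub>m ?ev) \<cdot> (?co \<boxtimes>\<^sub>m idm (X \<boxtimes> Y)) =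
       (idm (X \<boxtimes> Y) \<boxtimes>\<^sub>m ev') \<cdot> ((idm (X \<boxtimes> Y \<boxtimes> E) \<boxtimes>\<^sub>m (ev \<boxtimes>\<^sub>m idm Y)) \<cdot> ((idm X \<boxtimes>\<^sub>m coev') \<boxtimes>\<^sub>m idm (D \<boxtimes> X \<boxtimes> Y))) \<cdot> (coev \<boxtimes>\<^sub>m idm (X \<boxtimes> Y))"
    proof -
      have "idm (X \<boxtimes> Y) \<boxtimes>\<^sub>m ?ev = (idm (X \<boxtimes> Y) \<boxtimes>\<^sub>m ev') \<cdot> (idm (X \<boxtimes> Y) \<boxtimes>\<^sub>m (idm E \<boxtimes>\<^sub>m ev \<boxtimes>\<^sub>m idm Y))"
        using s(1-8) t(1-8) by (subst interchange) simp_all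
      also have "idm (X \<boxtimes> Y) \<boxtimes>\<^sub>m (idm E \<boxtimes>\<^sub>m ev \<boxtimes>\<^sub>m idm Y) = idm (X \<boxtimes> Y \<boxtimes> E) \<boxtimes>\<^sub>m (ev \<boxtimes>\<^sub>m idm Y)"
        using s(1-8) t(1-8) by (simp flip: tarr_assoc)
      finally have a: "idm (X \<boxtimes> Y) \<boxtimes>\<^sub>m ?ev = (idm (X \<boxtimes> Y) \<boxtimes>\<^sub>m ev') \<cdot> (idm (X \<boxtimes> Y \<boxtimes> E) \<boxtimes>\<^sub>m (ev \<boxtimes>\<^sub>m idm Y))" .
      have "?co \<boxtimes>\<^sub>m idm (X \<boxtimes> Y) = ((idm X \<boxtimes>\<^sub>m coev' \<boxtimes>\<^sub>m idm D) \<boxtimes>\<^sub>m idm (X \<boxtimes> Y)) \<cdot> (coev \<boxtimes>\<^sub>m idm (X \<boxtimes> Y))"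
        using s(1-8) t(1-8) by (subst interchange) simp_all
      also have "(idm X \<boxtimes>\<^sub>m coev' \<boxtimes>\<^sub>m idm D) \<boxtimes>\<^sub>m idm (X \<boxtimes> Y) = (idm X \<boxtimes>\<^sub>m coev') \<boxtimes>\<^sub>m idm (D \<boxtimes> X \<boxtimes> Y)"
        using s(1-8) t(1-8) by simp
      finally show ?thesis unfolding a using s(1-8) t(1-8) by (simp del: tarr_assoc)
    qed
    also have "\<dots> = ((idm (X \<boxtimes> Y) \<boxtimes>\<^sub>m ev') \<cdot> ((idm X \<boxtimes>\<^sub>m coev') \<boxtimes>\<^sub>m idm Y)) \<cdot> ((idm X \<boxtimes>\<^sub>m (ev \<boxtimes>\<^sub>m idm Y)) \<cdot> (coev \<boxtimes>\<^sub>m idm (X \<boxtimes> Y)))"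
      unfolding 1 using s(1-8) t(1-8) by (simp del: tarr_assoc)
    also have "(idm (X \<boxtimes> Y) \<boxtimes>\<^sub>m ev') \<cdot> ((idm X \<boxtimes>\<^sub>m coev') \<boxtimes>\<^sub>m idm Y) = idm X \<boxtimes>\<^sub>m ((idm Y \<boxtimes>\<^sub>m ev') \<cdot> (coev' \<boxtimes>\<^sub>m idm Y))"
      using s(1-8) t(1-8) interchange[of "idm X" "idm X" "coev' \<boxtimes>\<^sub>m idm Y" "idm Y \<boxtimes>\<^sub>m ev'"]
      by (simp flip: tarr_ident)
    also have "(idm X \<boxtimes>\<^sub>m (ev \<boxtimes>\<^sub>m idm Y)) \<cdot> (coev \<boxtimes>\<^sub>m idm (X \<boxtimes> Y)) = ((idm X \<boxtimes>\<^sub>m ev) \<cdot> (coev \<boxtimes>\<^sub>m idm X)) \<boxtimes>\<^sub>m idm Y"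
      using s(1-8) t(1-8) interchange[of "coev \<boxtimes>\<^sub>m idm X" "idm X \<boxtimes>\<^sub>m ev" "idm Y" "idm Y"]
      by (simp flip: tarr_ident)
    finally show "(idm (X \<boxtimes> Y) \<boxtimes>\<^sub>m ?ev) \<cdot> (?co \<boxtimes>\<^sub>m idm (X \<boxtimes> Y)) = idm (X \<boxtimes> Y)" using s t by simp
    have "?ev \<boxtimes>\<^sub>m idm (E \<boxtimes> D) = (ev' \<boxtimes>\<^sub>m idm (E \<boxtimes> D)) \<cdot> ((idm E \<boxtimes>\<^sub>m ev \<boxtimes>\<^sub>m idm Y) \<boxtimes>\<^sub>m idm (E \<boxtimes> D))"
      using s(1-8) t(1-8) by (subst interchange) simp_all
    also have "(idm E \<boxtimes>\<^sub>m ev \<boxtimes>\<^sub>m idm Y) \<boxtimes>\<^sub>m idm (E \<boxtimes> D) = (idm E \<boxtimes>\<^sub>m ev) \<boxtimes>\<^sub>m idm (Y \<boxtimes> E \<boxtimes> D)"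
      using s(1-8) t(1-8) by simp
    finally have a: "?ev \<boxtimes>\<^sub>m idm (E \<boxtimes> D) = (ev' \<boxtimes>\<^sub>m idm (E \<boxtimes> D)) \<cdot> ((idm E \<boxtimes>\<^sub>m ev) \<boxtimes>\<^sub>m idm (Y \<boxtimes> E \<boxtimes> D))" .
    have "idm (E \<boxtimes> D) \<boxtimes>\<^sub>m ?co = (idm (E \<boxtimes> D) \<boxtimes>\<^sub>m (idm X \<boxtimes>\<^sub>m coev' \<boxtimes>\<^sub>m idm D)) \<cdot> (idm (E \<boxtimes> D) \<boxtimes>\<^sub>m coev)"
      using s(1-8) t(1-8) by (subst interchange) simp_all
    also have "idm (E \<boxtimes> D) \<boxtimes>\<^sub>m (idm X \<boxtimes>\<^sub>m coev' \<boxtimes>\<^sub>m idm D) = idm (E \<boxtimes> D \<boxtimes> X) \<boxtimes>\<^sub>m (coev' \<boxtimes>\<^sub>m idm D)"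
      using s(1-8) t(1-8) by (simp flip: tarr_assoc)
    finally have b: "idm (E \<boxtimes> D) \<boxtimes>\<^sub>m ?co = (idm (E \<boxtimes> D \<boxtimes> X) \<boxtimes>\<^sub>m (coev' \<boxtimes>\<^sub>m idm D)) \<cdot> (idm (E \<boxtimes> D) \<boxtimes>\<^sub>m coev)" .
    have c: "((idm E \<boxtimes>\<^sub>m ev) \<boxtimes>\<^sub>m idm (Y \<boxtimes> E \<boxtimes> D)) \<cdot> (idm (E \<boxtimes> D \<boxtimes> X) \<boxtimes>\<^sub>m (coev' \<boxtimes>\<^sub>m idm D)) =
        (idm E \<boxtimes>\<^sub>m (coev' \<boxtimes>\<^sub>m idm D)) \<cdot> ((idm E \<boxtimes>\<^sub>m ev) \<boxtimes>\<^sub>m idm D)"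
      using s(1-8) t(1-8) by (simp add: interchange del: tarr_assoc)
    have "(?ev \<boxtimes>\<^sub>m idm (E \<boxtimes> D)) \<cdot> (idm (E \<boxtimes> D) \<boxtimes>\<^sub>m ?co) =
        (ev' \<boxtimes>\<^sub>m idm (E \<boxtimes> D)) \<cdot> (((idm E \<boxtimes>\<^sub>m ev) \<boxtimes>\<^sub>m idm (Y \<boxtimes> E \<boxtimes> D)) \<cdot> (idm (E \<boxtimes> D \<boxtimes> X) \<boxtimes>\<^sub>m (coev' \<boxtimes>\<^sub>m idm D))) \<cdot> (idm (E \<boxtimes> D) \<boxtimes>\<^sub>m coev)"
      unfolding a b using s(1-8) t(1-8) by (simp del: tarr_assoc)
    also have "\<dots> = ((ev' \<boxtimes>\<^sub>m idm (E \<boxtimes> D)) \<cdot> (idm E \<boxtimes>\<^sub>m (coev' \<boxtimes>\<^sub>m idm D))) \<cdot> (((idm E \<boxtimes>\<^sub>m ev) \<boxtimes>\<^sub>m idm D) \<cdot> (idm (E \<boxtimes> D) \<boxtimes>\<^sub>m coev))"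
      unfolding c using s(1-8) t(1-8) by (simp del: tarr_assoc)
    also have "(ev' \<boxtimes>\<^sub>m idm (E \<boxtimes> D)) \<cdot> (idm E \<boxtimes>\<^sub>m (coev' \<boxtimes>\<^sub>m idm D)) = ((ev' \<boxtimes>\<^sub>m idm E) \<cdot> (idm E \<boxtimes>\<^sub>m coev')) \<boxtimes>\<^sub>m idm D"
      using s(1-8) t(1-8) interchange[of "idm E \<boxtimes>\<^sub>m coev'" "ev' \<boxtimes>\<^sub>m idm E" "idm D" "idm D"] by (simp flip: tarr_ident)
    also have "((idm E \<boxtimes>\<^sub>m ev) \<boxtimes>\<^sub>m idm D) \<cdot> (idm (E \<boxtimes> D) \<boxtimes>\<^sub>m coev) = idm E \<boxtimes>\<^sub>m ((ev \<boxtimes>\<^sub>m idm D) \<cdot> (idm D \<boxtimes>\<^sub>m coev))"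
      using s(1-8) t(1-8) interchange[of "idm E" "idm E" "idm D \<boxtimes>\<^sub>m coev" "ev \<boxtimes>\<^sub>m idm D"] by (simp flip: tarr_ident)
    finally show "(?ev \<boxtimes>\<^sub>m idm (E \<boxtimes> D)) \<cdot> (idm (E \<boxtimes> D) \<boxtimes>\<^sub>m ?co) = idm (E \<boxtimes> D)" using s t by simp
  qed (use s t in simp_all)
qed

lemma hsum_tarr_left:
  assumes "finite I" "X \<in> obj C" "Y \<in> obj C" "g \<in> arr C"
    "\<And>i. i \<in> I \<Longrightarrow> f i \<in> arr C \<and> src C (f i) = X \<and> tgt C (f i) = Y"
  shows "hsum X Y f I \<boxtimes>\<^sub>m g = hsum (X \<boxtimes> src C g) (Y \<boxtimes> tgt C g) (\<lambda>i. f i \<boxtimes>\<^sub>m g) I"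
proof -
  show ?thesis using assms(1,5)
  proof (induction I)
    case empty then show ?case using assms by (simp add: tarr_hzero)
  next
    case (insert k I)
    then have "f k \<in> arr C" "src C (f k) = X" "tgt C (f k) = Y"
      "\<And>i. i \<in> I \<Longrightarrow> f i \<in> arr C \<and> src C (f i) = X \<and> tgt C (f i) = Y" by auto
    with insert show ?case using assms(2-4) by (simp add: hsum_insert tarr_hadd)
  qed
qed

text \<open>
  Evaluation and coevaluation are the diagonal sums of those of the summands.  The zigzag identities
  are tested on the summands, where all but one term vanish.
\<close>

lemma left_dual_direct_sum:
  assumes "finite I" "is_direct_sum C I X Y \<iota> \<pi>" "is_direct_sum C I D E \<iota>' \<pi>'"
    "\<And>i. i \<in> I \<Longrightarrow> is_left_dual C (X i) (D i) (ev i) (coev i)"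
  shows "is_left_dual C Y E (hsum (E \<boxtimes> Y) (tunit C) (\<lambda>i. ev i \<cdot> (\<pi>' i \<boxtimes>\<^sub>m \<pi> i)) I)
    (hsum (tunit C) (Y \<boxtimes> E) (\<lambda>i. (\<iota> i \<boxtimes>\<^sub>m \<iota>' i) \<cdot> coev i) I)"
proof -
  let ?ev = "hsum (E \<boxtimes> Y) (tunit C) (\<lambda>i. ev i \<cdot> (\<pi>' i \<boxtimes>\<^sub>m \<pi> i)) I"
  let ?co = "hsum (tunit C) (Y \<boxtimes> E) (\<lambda>i. (\<iota> i \<boxtimes>\<^sub>m \<iota>' i) \<cdot> coev i) I"
  note d = direct_sumD[OF assms(2)] and e = direct_sumD[OF assms(3)] and s = left_dualD[OF assms(4)]
  have ty: "?ev \<in> arr C" "src C ?ev = E \<boxtimes> Y" "tgt C ?ev = tunit C" "?co \<in> arr C" "src C ?co = tunit C" "tgt C ?co = Y \<boxtimes> E"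
    using d e s by simp_all
  have 1: "?ev \<cdot> (idm E \<boxtimes>\<^sub>m \<iota> j) = ev j \<cdot> (\<pi>' j \<boxtimes>\<^sub>m idm (X j))" if j: "j \<in> I" for j
  proof -
    have "?ev \<cdot> (idm E \<boxtimes>\<^sub>m \<iota> j) = hsum (E \<boxtimes> X j) (tunit C) (\<lambda>i. (ev i \<cdot> (\<pi>' i \<boxtimes>\<^sub>m \<pi> i)) \<cdot> (idm E \<boxtimes>\<^sub>m \<iota> j)) I"
      using d e s j assms(1) by (subst hsum_cmp) simp_all
    also have "\<dots> = (ev j \<cdot> (\<pi>' j \<boxtimes>\<^sub>m \<pi> j)) \<cdot> (idm E \<boxtimes>\<^sub>m \<iota> j)"
      by (rule hsum_single) (use d e s j assms(1) tarr_hzero in \<open>simp_all add: interchange\<close>)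
    finally show ?thesis using d e s j by (simp add: interchange)
  qed
  have 2: "?ev \<cdot> (\<iota>' j \<boxtimes>\<^sub>m idm Y) = ev j \<cdot> (idm (D j) \<boxtimes>\<^sub>m \<pi> j)" if j: "j \<in> I" for j
  proof -
    have "?ev \<cdot> (\<iota>' j \<boxtimes>\<^sub>m idm Y) = hsum (D j \<boxtimes> Y) (tunit C) (\<lambda>i. (ev i \<cdot> (\<pi>' i \<boxtimes>\<^sub>m \<pi> i)) \<cdot> (\<iota>' j \<boxtimes>\<^sub>m idm Y)) I"
      using d e s j assms(1) by (subst hsum_cmp) simp_all
    also have "\<dots> = (ev j \<cdot> (\<pi>' j \<boxtimes>\<^sub>m \<pi> j)) \<cdot> (\<iota>' j \<boxtimes>\<^sub>m idm Y)"
      by (rule hsum_single) (use d e s j assms(1) tarr_hzero in \<open>simp_all add: interchange\<close>)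
    finally show ?thesis using d e s j by (simp add: interchange)
  qed
  have 3: "(idm Y \<boxtimes>\<^sub>m \<pi>' j) \<cdot> ?co = (\<iota> j \<boxtimes>\<^sub>m idm (D j)) \<cdot> coev j" if j: "j \<in> I" for j
  proof -
    have "(idm Y \<boxtimes>\<^sub>m \<pi>' j) \<cdot> ?co = hsum (tunit C) (Y \<boxtimes> D j) (\<lambda>i. (idm Y \<boxtimes>\<^sub>m \<pi>' j) \<cdot> (\<iota> i \<boxtimes>\<^sub>m \<iota>' i) \<cdot> coev i) I"
      using d e s j assms(1) by (subst cmp_hsum) simp_all
    also have "\<dots> = (idm Y \<boxtimes>\<^sub>m \<pi>' j) \<cdot> (\<iota> j \<boxtimes>\<^sub>m \<iota>' j) \<cdot> coev j"
      by (rule hsum_single) (use d e s j assms(1) tarr_hzero in \<open>simp_all add: interchange_cmp\<close>)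
    finally show ?thesis using d e s j by (simp add: interchange_cmp)
  qed
  have 4: "(\<pi> j \<boxtimes>\<^sub>m idm E) \<cdot> ?co = (idm (X j) \<boxtimes>\<^sub>m \<iota>' j) \<cdot> coev j" if j: "j \<in> I" for j
  proof -
    have "(\<pi> j \<boxtimes>\<^sub>m idm E) \<cdot> ?co = hsum (tunit C) (X j \<boxtimes> E) (\<lambda>i. (\<pi> j \<boxtimes>\<^sub>m idm E) \<cdot> (\<iota> i \<boxtimes>\<^sub>m \<iota>' i) \<cdot> coev i) I"
      using d e s j assms(1) by (subst cmp_hsum) simp_all
    also have "\<dots> = (\<pi> j \<boxtimes>\<^sub>m idm E) \<cdot> (\<iota> j \<boxtimes>\<^sub>m \<iota>' j) \<cdot> coev j"
      by (rule hsum_single) (use d e s j assms(1) tarr_hzero in \<open>simp_all add: interchange_cmp\<close>)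
    finally show ?thesis using d e s j by (simp add: interchange_cmp)
  qed
  have "(idm Y \<boxtimes>\<^sub>m ?ev) \<cdot> (?co \<boxtimes>\<^sub>m idm Y) = idm Y"
  proof (rule direct_sum_ext_src[OF assms(1,2)])
    fix j assume j: "j \<in> I"
    have "(?co \<boxtimes>\<^sub>m idm Y) \<cdot> \<iota> j = (idm (Y \<boxtimes> E) \<boxtimes>\<^sub>m \<iota> j) \<cdot> (?co \<boxtimes>\<^sub>m idm (X j))"
      using interchange[of "idm (tunit C)" ?co "\<iota> j" "idm Y"] interchange[of ?co "idm (Y \<boxtimes> E)" "idm (X j)" "\<iota> j"] d e j ty by simp
    then have "((idm Y \<boxtimes>\<^sub>m ?ev) \<cdot> (?co \<boxtimes>\<^sub>m idm Y)) \<cdot> \<iota> j = (idm Y \<boxtimes>\<^sub>m ?ev) \<cdot> (idm Y \<boxtimes>\<^sub>m (idm E \<boxtimes>\<^sub>m \<iota> j)) \<cdot> (?co \<boxtimes>\<^sub>m idm (X j))"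
      using d e j ty by (simp flip: tarr_ident)
    also have "\<dots> = (idm Y \<boxtimes>\<^sub>m (ev j \<cdot> (\<pi>' j \<boxtimes>\<^sub>m idm (X j)))) \<cdot> (?co \<boxtimes>\<^sub>m idm (X j))"
      using d e j ty by (subst interchange_cmp) (simp_all add: 1)
    also have "\<dots> = (idm Y \<boxtimes>\<^sub>m ev j) \<cdot> ((idm Y \<boxtimes>\<^sub>m \<pi>' j) \<boxtimes>\<^sub>m idm (X j)) \<cdot> (?co \<boxtimes>\<^sub>m idm (X j))"
      using d e j ty s interchange_cmp[of "idm Y" "idm Y" "\<pi>' j \<boxtimes>\<^sub>m idm (X j)" "ev j" "?co \<boxtimes>\<^sub>m idm (X j)"] by simp
    also have "\<dots> = (idm Y \<boxtimes>\<^sub>m ev j) \<cdot> (((\<iota> j \<boxtimes>\<^sub>m idm (D j)) \<cdot> coev j) \<boxtimes>\<^sub>m idm (X j))"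
      using d e j ty s interchange[of ?co "idm Y \<boxtimes>\<^sub>m \<pi>' j" "idm (X j)" "idm (X j)"] 3[OF j] by simp
    also have "\<dots> = (idm Y \<boxtimes>\<^sub>m ev j) \<cdot> (\<iota> j \<boxtimes>\<^sub>m idm (D j \<boxtimes> X j)) \<cdot> (coev j \<boxtimes>\<^sub>m idm (X j))"
      using d e j ty s interchange[of "coev j" "\<iota> j \<boxtimes>\<^sub>m idm (D j)" "idm (X j)" "idm (X j)"] by simp
    also have "\<dots> = (\<iota> j \<boxtimes>\<^sub>m idm (tunit C)) \<cdot> (idm (X j) \<boxtimes>\<^sub>m ev j) \<cdot> (coev j \<boxtimes>\<^sub>m idm (X j))"
      using d e j ty s interchange_cmp[of "\<iota> j" "idm Y" "idm (D j \<boxtimes> X j)" "ev j" "coev j \<boxtimes>\<^sub>m idm (X j)"]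
        interchange_cmp[of "idm (X j)" "\<iota> j" "ev j" "idm (tunit C)" "coev j \<boxtimes>\<^sub>m idm (X j)"] by (simp del: tarr_unit)
    finally show "((idm Y \<boxtimes>\<^sub>m ?ev) \<cdot> (?co \<boxtimes>\<^sub>m idm Y)) \<cdot> \<iota> j = idm Y \<cdot> \<iota> j"
      using d e j s by simp
  qed (use d e ty in simp_all)
  moreover have "(?ev \<boxtimes>\<^sub>m idm E) \<cdot> (idm E \<boxtimes>\<^sub>m ?co) = idm E"
  proof (rule direct_sum_ext_src[OF assms(1,3)])
    fix j assume j: "j \<in> I"
    have "(idm E \<boxtimes>\<^sub>m ?co) \<cdot> \<iota>' j = (\<iota>' j \<boxtimes>\<^sub>m idm (Y \<boxtimes> E)) \<cdot> (idm (D j) \<boxtimes>\<^sub>m ?co)"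
      using interchange[of "\<iota>' j" "idm E" "idm (tunit C)" ?co] interchange[of "idm (D j)" "\<iota>' j" ?co "idm (Y \<boxtimes> E)"] d e j ty by simp
    then have "((?ev \<boxtimes>\<^sub>m idm E) \<cdot> (idm E \<boxtimes>\<^sub>m ?co)) \<cdot> \<iota>' j = (?ev \<boxtimes>\<^sub>m idm E) \<cdot> ((\<iota>' j \<boxtimes>\<^sub>m idm Y) \<boxtimes>\<^sub>m idm E) \<cdot> (idm (D j) \<boxtimes>\<^sub>m ?co)"
      using d e j ty by simp
    also have "\<dots> = ((ev j \<cdot> (idm (D j) \<boxtimes>\<^sub>m \<pi> j)) \<boxtimes>\<^sub>m idm E) \<cdot> (idm (D j) \<boxtimes>\<^sub>m ?co)"
      using d e j ty by (subst interchange_cmp) (simp_all add: 2)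
    also have "\<dots> = (ev j \<boxtimes>\<^sub>m idm E) \<cdot> (idm (D j) \<boxtimes>\<^sub>m (\<pi> j \<boxtimes>\<^sub>m idm E)) \<cdot> (idm (D j) \<boxtimes>\<^sub>m ?co)"
      using d e j ty s interchange_cmp[of "idm (D j) \<boxtimes>\<^sub>m \<pi> j" "ev j" "idm E" "idm E" "idm (D j) \<boxtimes>\<^sub>m ?co"] by simp
    also have "\<dots> = (ev j \<boxtimes>\<^sub>m idm E) \<cdot> (idm (D j) \<boxtimes>\<^sub>m ((idm (X j) \<boxtimes>\<^sub>m \<iota>' j) \<cdot> coev j))"
      using d e j ty s interchange[of "idm (D j)" "idm (D j)" ?co "\<pi> j \<boxtimes>\<^sub>m idm E"] 4[OF j] by simp
    also have "\<dots> = (ev j \<boxtimes>\<^sub>m idm E) \<cdot> (idm (D j \<boxtimes> X j) \<boxtimes>\<^sub>m \<iota>' j) \<cdot> (idm (D j) \<boxtimes>\<^sub>m coev j)"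
      using d e j ty s interchange[of "idm (D j)" "idm (D j)" "coev j" "idm (X j) \<boxtimes>\<^sub>m \<iota>' j"] by (simp flip: tarr_assoc)
    also have "\<dots> = (idm (tunit C) \<boxtimes>\<^sub>m \<iota>' j) \<cdot> (ev j \<boxtimes>\<^sub>m idm (D j)) \<cdot> (idm (D j) \<boxtimes>\<^sub>m coev j)"
      using d e j ty s interchange_cmp[of "idm (D j \<boxtimes> X j)" "ev j" "\<iota>' j" "idm E" "idm (D j) \<boxtimes>\<^sub>m coev j"]
        interchange_cmp[of "ev j" "idm (tunit C)" "idm (D j)" "\<iota>' j" "idm (D j) \<boxtimes>\<^sub>m coev j"] by (simp del: tarr_unit)
    finally show "((?ev \<boxtimes>\<^sub>m idm E) \<cdot> (idm E \<boxtimes>\<^sub>m ?co)) \<cdot> \<iota>' j = idm E \<cdot> \<iota>' j"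
      using d e j s by simp
  qed (use d e ty in simp_all)
  ultimately show ?thesis unfolding is_left_dual_def using d e ty by simp
qed

lemma left_dual_functor:
  assumes "tensor_embedding C C' F" "is_left_dual C X D ev coev"
  shows "is_left_dual C' (fobj F X) (fobj F D) (farr F ev) (farr F coev)"
proof -
  note s = left_dualD[OF assms(2)]
  have F: "linear_functor C C' F" "fobj F (tunit C) = tunit C'"
    "\<And>X Y. X \<in> obj C \<Longrightarrow> Y \<in> obj C \<Longrightarrow> fobj F (X \<boxtimes> Y) = fobj F X \<boxtimes>\<^bsub>C'\<^esub> fobj F Y"
    "\<And>f g. f \<in> arr C \<Longrightarrow> g \<in> arr C \<Longrightarrow> farr F (f \<boxtimes>\<^sub>m g) = farr F f \<boxtimes>\<^sub>m\<^bsub>C'\<^esub> farr F g"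
    using assms(1) unfolding tensor_embedding_def by blast+
  note l = functor_simps[OF F(1)]
  have "farr F ((idm X \<boxtimes>\<^sub>m ev) \<cdot> (coev \<boxtimes>\<^sub>m idm X)) = ident C' (fobj F X)"
    "farr F ((ev \<boxtimes>\<^sub>m idm D) \<cdot> (idm D \<boxtimes>\<^sub>m coev)) = ident C' (fobj F D)"
    using s l by simp_all
  moreover have "farr F ((idm X \<boxtimes>\<^sub>m ev) \<cdot> (coev \<boxtimes>\<^sub>m idm X)) =
      (ident C' (fobj F X) \<boxtimes>\<^sub>m\<^bsub>C'\<^esub> farr F ev) \<cdot>\<^bsub>C'\<^esub> (farr F coev \<boxtimes>\<^sub>m\<^bsub>C'\<^esub> ident C' (fobj F X))"
    "farr F ((ev \<boxtimes>\<^sub>m idm D) \<cdot> (idm D \<boxtimes>\<^sub>m coev)) =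
      (farr F ev \<boxtimes>\<^sub>m\<^bsub>C'\<^esub> ident C' (fobj F D)) \<cdot>\<^bsub>C'\<^esub> (ident C' (fobj F D) \<boxtimes>\<^sub>m\<^bsub>C'\<^esub> farr F coev)"
    using s(1-8) l F by simp_all
  ultimately show ?thesis unfolding is_left_dual_def using s(1-8) l F(2,3) by (simp add: Hom_def)
qed

end

lemma (in linear_monoidal) tensor_iso [simp]:
  assumes "is_iso C f" "is_iso C g" shows "is_iso C (f \<boxtimes>\<^sub>m g)"
  using assms iso_arr[of f] iso_arr[of g]
  by (intro isoI[of _ "inv_arr f \<boxtimes>\<^sub>m inv_arr g"]) (simp_all add: interchange)

lemma (in linear_monoidal) isomorphic_tensor:
  assumes "isomorphic C X X'" "isomorphic C Y Y'" shows "isomorphic C (X \<boxtimes> Y) (X' \<boxtimes> Y')"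
proof -
  obtain f g where "f \<in> arr C" "src C f = X" "tgt C f = X'" "is_iso C f"
    "g \<in> arr C" "src C g = Y" "tgt C g = Y'" "is_iso C g"
    using assms unfolding isomorphic_iff by blast
  then show ?thesis unfolding isomorphic_iff by (intro bexI[of _ "f \<boxtimes>\<^sub>m g"]) (simp_all add: tensor_iso)
qed

text \<open>Tensoring with an object that has a left dual is a left adjoint, hence right exact.\<close>

lemma (in linear_monoidal) tensor_right_exact:
  assumes "is_left_dual C X D ev coev" "is_cokernel C f p"
  shows "is_cokernel C (f \<boxtimes>\<^sub>m idm X) (p \<boxtimes>\<^sub>m idm X)"
proof (rule cokernelI)
  note c = cokernelD[OF assms(2)] and s = left_dualD[OF assms(1)]
  show "(p \<boxtimes>\<^sub>m idm X) \<cdot> (f \<boxtimes>\<^sub>m idm X) = hzero C (src C (f \<boxtimes>\<^sub>m idm X)) (tgt C (p \<boxtimes>\<^sub>m idm X))"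
    using c s by (simp add: interchange tarr_hzero)
  let ?t = "\<lambda>h P. (h \<boxtimes>\<^sub>m idm D) \<cdot> (idm P \<boxtimes>\<^sub>m coev)"
  have untwist: "(idm (tgt C h) \<boxtimes>\<^sub>m ev) \<cdot> (?t h P \<boxtimes>\<^sub>m idm X) = h" if "h \<in> arr C" "src C h = P \<boxtimes> X" "P \<in> obj C" for h P
  proof -
    have "?t h P \<boxtimes>\<^sub>m idm X = ((h \<boxtimes>\<^sub>m idm D) \<boxtimes>\<^sub>m idm X) \<cdot> ((idm P \<boxtimes>\<^sub>m coev) \<boxtimes>\<^sub>m idm X)"
      using that s(1-8) by (subst interchange) simp_all
    also have "\<dots> = (h \<boxtimes>\<^sub>m idm (D \<boxtimes> X)) \<cdot> (idm P \<boxtimes>\<^sub>m (coev \<boxtimes>\<^sub>m idm X))"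
      using that s(1-8) by simp
    finally have "(idm (tgt C h) \<boxtimes>\<^sub>m ev) \<cdot> (?t h P \<boxtimes>\<^sub>m idm X) =
        (idm (tgt C h) \<boxtimes>\<^sub>m ev) \<cdot> (h \<boxtimes>\<^sub>m idm (D \<boxtimes> X)) \<cdot> (idm P \<boxtimes>\<^sub>m (coev \<boxtimes>\<^sub>m idm X))" by simp
    also have "\<dots> = (h \<boxtimes>\<^sub>m idm (tunit C)) \<cdot> (idm (P \<boxtimes> X) \<boxtimes>\<^sub>m ev) \<cdot> (idm P \<boxtimes>\<^sub>m (coev \<boxtimes>\<^sub>m idm X))"
      using that s(1-8) by (simp add: interchange_cmp del: tarr_unit)
    also have "(idm (P \<boxtimes> X) \<boxtimes>\<^sub>m ev) \<cdot> (idm P \<boxtimes>\<^sub>m (coev \<boxtimes>\<^sub>m idm X)) = idm P \<boxtimes>\<^sub>m ((idm X \<boxtimes>\<^sub>m ev) \<cdot> (coev \<boxtimes>\<^sub>m idm X))"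
      using that s(1-8) interchange[of "idm P" "idm P" "coev \<boxtimes>\<^sub>m idm X" "idm X \<boxtimes>\<^sub>m ev"] by (simp flip: tarr_ident)
    finally show ?thesis using that s by simp
  qed
  have move: "?t h (tgt C k) \<cdot> k = ?t (h \<cdot> (k \<boxtimes>\<^sub>m idm X)) (src C k)"
    if "h \<in> arr C" "k \<in> arr C" "src C h = tgt C k \<boxtimes> X" for h k
  proof -
    have "(idm (tgt C k) \<boxtimes>\<^sub>m coev) \<cdot> (k \<boxtimes>\<^sub>m idm (tunit C)) = ((k \<boxtimes>\<^sub>m idm X) \<boxtimes>\<^sub>m idm D) \<cdot> (idm (src C k) \<boxtimes>\<^sub>m coev)"
      using that s(1-8) by (simp add: interchange del: tarr_unit)
    then have "?t h (tgt C k) \<cdot> k = (h \<boxtimes>\<^sub>m idm D) \<cdot> ((k \<boxtimes>\<^sub>m idm X) \<boxtimes>\<^sub>m idm D) \<cdot> (idm (src C k) \<boxtimes>\<^sub>m coev)"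
      using that s(1-8) by simp
    also have "\<dots> = ?t (h \<cdot> (k \<boxtimes>\<^sub>m idm X)) (src C k)"
      using that s(1-8) by (subst interchange_cmp) (simp_all del: tarr_assoc)
    finally show ?thesis .
  qed
  show "\<exists>u\<in>arr C. src C u = tgt C (p \<boxtimes>\<^sub>m idm X) \<and> tgt C u = tgt C h \<and> u \<cdot> (p \<boxtimes>\<^sub>m idm X) = h"
    if h: "h \<in> arr C" "src C h = tgt C (f \<boxtimes>\<^sub>m idm X)" "h \<cdot> (f \<boxtimes>\<^sub>m idm X) = hzero C (src C (f \<boxtimes>\<^sub>m idm X)) (tgt C h)" for h
  proof -
    have h2: "src C h = tgt C f \<boxtimes> X" using h c s by simp
    have "?t h (tgt C f) \<cdot> f = hzero C (src C f) (tgt C h \<boxtimes> D)"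
      using move[of h f] h h2 c s(1-8) by (simp add: tarr_hzero)
    then have "\<exists>u\<in>arr C. src C u = tgt C p \<and> tgt C u = tgt C (?t h (tgt C f)) \<and> u \<cdot> p = ?t h (tgt C f)"
      using h h2 c s(1-8) by (intro cokernel_factor[OF assms(2)]) simp_all
    then obtain u where u: "u \<in> arr C" "src C u = tgt C p" "tgt C u = tgt C h \<boxtimes> D" "u \<cdot> p = ?t h (tgt C f)"
      using h h2 c s(1-8) by auto
    have "((idm (tgt C h) \<boxtimes>\<^sub>m ev) \<cdot> (u \<boxtimes>\<^sub>m idm X)) \<cdot> (p \<boxtimes>\<^sub>m idm X) = (idm (tgt C h) \<boxtimes>\<^sub>m ev) \<cdot> (?t h (tgt C f) \<boxtimes>\<^sub>m idm X)"
      using u h h2 c s(1-8) by (simp add: interchange)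
    then have "((idm (tgt C h) \<boxtimes>\<^sub>m ev) \<cdot> (u \<boxtimes>\<^sub>m idm X)) \<cdot> (p \<boxtimes>\<^sub>m idm X) = h"
      using untwist[of h "tgt C f"] h h2 c by simp
    then show ?thesis using u h c s(1-8) by (intro bexI[of _ "(idm (tgt C h) \<boxtimes>\<^sub>m ev) \<cdot> (u \<boxtimes>\<^sub>m idm X)"]) simp_all
  qed
  show "u = v" if h: "u \<in> arr C" "v \<in> arr C" "tgt C u = tgt C v" "src C u = tgt C (p \<boxtimes>\<^sub>m idm X)"
    "src C v = tgt C (p \<boxtimes>\<^sub>m idm X)" "u \<cdot> (p \<boxtimes>\<^sub>m idm X) = v \<cdot> (p \<boxtimes>\<^sub>m idm X)" for u v
  proof -
    have h2: "src C u = tgt C p \<boxtimes> X" "src C v = tgt C p \<boxtimes> X" using h c s by simp_all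
    have e: "?t u (tgt C p) \<cdot> p = ?t v (tgt C p) \<cdot> p"
      using move[of u p] move[of v p] h h2 c by simp
    have e': "?t u (tgt C p) = ?t v (tgt C p)"
      by (rule cokernel_cancel[OF assms(2) _ _ _ _ _ e]) (use h h2 c s(1-8) in simp_all)
    have "tgt C p \<in> obj C" using c by simp
    from untwist[OF h(1) h2(1) this] untwist[OF h(2) h2(2) this] show "u = v"
      unfolding e' h(3) by (rule subst)
  qed
qed (use cokernelD[OF assms(2)] left_dualD[OF assms(1)] in simp_all)

section \<open>The bicrossed product\<close>

lemma (in matched_pair) bicrossed_group: "group (bicrossed_group G \<Gamma> (\<triangleright>) (\<triangleleft>))" (is "group ?L")
proof (rule groupI)
  have one: "s \<triangleright> \<one>\<^bsub>G\<^esub> = \<one>\<^bsub>G\<^esub>" if "s \<in> carrier \<Gamma>" for s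
    using lact_compat[OF that G.one_closed G.one_closed] that ract_one lact_closed[OF that G.one_closed] by simp
  have one': "\<one>\<^bsub>\<Gamma>\<^esub> \<triangleleft> g = \<one>\<^bsub>\<Gamma>\<^esub>" if "g \<in> carrier G" for g
    using ract_compat[OF \<Gamma>.one_closed \<Gamma>.one_closed that] that lact_one ract_closed[OF \<Gamma>.one_closed that] by simp
  show "(x \<otimes>\<^bsub>?L\<^esub> y) \<otimes>\<^bsub>?L\<^esub> z = x \<otimes>\<^bsub>?L\<^esub> (y \<otimes>\<^bsub>?L\<^esub> z)" if "x \<in> carrier ?L" "y \<in> carrier ?L" "z \<in> carrier ?L" for x y z
    using that by (auto simp: bicrossed_group_def lact_closed ract_closed lact_compat ract_compat lact_mult ract_mult G.m_assoc \<Gamma>.m_assoc)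
  show "\<one>\<^bsub>?L\<^esub> \<otimes>\<^bsub>?L\<^esub> x = x" if "x \<in> carrier ?L" for x
    using that by (auto simp: bicrossed_group_def lact_one one')
  show "\<exists>y\<in>carrier ?L. y \<otimes>\<^bsub>?L\<^esub> x = \<one>\<^bsub>?L\<^esub>" if x: "x \<in> carrier ?L" for x
  proof -
    obtain g s where gs: "x = (g, s)" "g \<in> carrier G" "s \<in> carrier \<Gamma>" using x by (auto simp: bicrossed_group_def)
    \<comment> \<open>the second component has to become the inverse of \<open>s\<close> after \<open>g\<close> has acted\<close>
    define t where "t = inv\<^bsub>\<Gamma>\<^esub> s \<triangleleft> inv\<^bsub>G\<^esub> g"
    have t: "t \<in> carrier \<Gamma>" "t \<triangleleft> g = inv\<^bsub>\<Gamma>\<^esub> s"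
      using gs ract_mult[of "inv\<^bsub>\<Gamma>\<^esub> s" "inv\<^bsub>G\<^esub> g" g] by (simp_all add: t_def ract_closed ract_one)
    then show ?thesis using gs lact_closed[OF t(1) gs(2)]
      by (intro bexI[of _ "(inv\<^bsub>G\<^esub> (t \<triangleright> g), t)"]) (simp_all add: bicrossed_group_def)
  qed
qed (auto simp: bicrossed_group_def lact_closed ract_closed)

section \<open>Crossed actions\<close>

locale finite_crossed = crossed_tensor_category G \<Gamma> lact ract C A
  for G :: "('g, 'a) monoid_scheme" and \<Gamma> :: "('s, 'b) monoid_scheme"
    and lact :: "'s \<Rightarrow> 'g \<Rightarrow> 'g"  (infixr \<open>\<triangleright>\<close> 72)
    and ract :: "'s \<Rightarrow> 'g \<Rightarrow> 's"  (infixl \<open>\<triangleleft>\<close> 72)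
    and C :: "('o, 'm, 'k::field) tensor_cat" (structure)
    and A :: "('g, 's, 'o, 'm) crossed_action" +
  assumes finite_G: "finite (carrier G)" and finite_\<Gamma>: "finite (carrier \<Gamma>)"
begin

sublocale T: linear_monoidal C by (rule linear_monoidal)

abbreviation ro :: "'g \<Rightarrow> 'o \<Rightarrow> 'o" where "ro g X \<equiv> fobj (rho A g) X"
abbreviation ra :: "'g \<Rightarrow> 'm \<Rightarrow> 'm" where "ra g f \<equiv> farr (rho A g) f"

declare lact_closed [simp] ract_closed [simp] lact_one [simp] ract_one [simp]

lemma rho_linear: "g \<in> carrier G \<Longrightarrow> linear_functor C C (rho A g)"
  using rho_equivalence by (simp add: linear_equivalence_def)

lemma rho_simps [simp]:
  assumes "g \<in> carrier G"
  shows "X \<in> obj C \<Longrightarrow> ro g X \<in> obj C" "f \<in> arr C \<Longrightarrow> ra g f \<in> arr C"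
    "f \<in> arr C \<Longrightarrow> src C (ra g f) = ro g (src C f)" "f \<in> arr C \<Longrightarrow> tgt C (ra g f) = ro g (tgt C f)"
    "X \<in> obj C \<Longrightarrow> ra g (idm X) = idm (ro g X)"
    "X \<in> obj C \<Longrightarrow> Y \<in> obj C \<Longrightarrow> ra g (hzero C X Y) = hzero C (ro g X) (ro g Y)"
  using functor_simps[OF rho_linear[OF assms]] functor_hzero[OF linear_category_axioms rho_linear[OF assms]] by auto

lemmas ra_cmp = functor_cmp[OF rho_linear]

lemma rho2:
  assumes "g \<in> carrier G" "h \<in> carrier G"
  shows "X \<in> obj C \<Longrightarrow> rho2 A g h X \<in> arr C" "X \<in> obj C \<Longrightarrow> src C (rho2 A g h X) = ro g (ro h X)"
    "X \<in> obj C \<Longrightarrow> tgt C (rho2 A g h X) = ro (h \<otimes>\<^bsub>G\<^esub> g) X" "X \<in> obj C \<Longrightarrow> is_iso C (rho2 A g h X)"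
    "f \<in> arr C \<Longrightarrow> rho2 A g h (tgt C f) \<cdot> ra g (ra h f) = ra (h \<otimes>\<^bsub>G\<^esub> g) f \<cdot> rho2 A g h (src C f)"
  using rho2_natural[OF assms] by (auto simp: natural_iso_def natural_transformation_def functor_comp_def)

declare rho2(1-4) [simp]

lemma rho0:
  "X \<in> obj C \<Longrightarrow> rho0 A X \<in> arr C" "X \<in> obj C \<Longrightarrow> src C (rho0 A X) = X"
  "X \<in> obj C \<Longrightarrow> tgt C (rho0 A X) = ro \<one>\<^bsub>G\<^esub> X" "X \<in> obj C \<Longrightarrow> is_iso C (rho0 A X)"
  "f \<in> arr C \<Longrightarrow> rho0 A (tgt C f) \<cdot> f = ra \<one>\<^bsub>G\<^esub> f \<cdot> rho0 A (src C f)"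
  using rho0_natural by (auto simp: natural_iso_def natural_transformation_def functor_id_def)

declare rho0(1-4) [simp]

lemma grade_subcategory:
  assumes "s \<in> carrier \<Gamma>"
  shows "grade A s \<subseteq> obj C" "\<forall>X\<in>grade A s. \<forall>Y\<in>obj C. isomorphic C X Y \<longrightarrow> Y \<in> grade A s"
    "\<forall>Z. is_zero_obj C Z \<longrightarrow> Z \<in> grade A s"
  using component_abelian[OF assms] unfolding abelian_subcategory_def by blast+

lemma grade_obj [simp]: "X \<in> grade A s \<Longrightarrow> s \<in> carrier \<Gamma> \<Longrightarrow> X \<in> obj C"
  using grade_subcategory(1) by blast

lemma grade_iso:
  assumes "s \<in> carrier \<Gamma>" "X \<in> grade A s" "isomorphic C X Y" shows "Y \<in> grade A s"
proof -
  have "Y \<in> obj C" using assms(3) tgt_closed unfolding isomorphic_iff by blast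
  then show ?thesis using grade_subcategory(2)[OF assms(1)] assms(2,3) by blast
qed

lemma grade_rho: "g \<in> carrier G \<Longrightarrow> s \<in> carrier \<Gamma> \<Longrightarrow> X \<in> grade A s \<Longrightarrow> ro g X \<in> grade A (s \<triangleleft> g)"
proof -
  assume h: "g \<in> carrier G" "s \<in> carrier \<Gamma>" "X \<in> grade A s"
  then have "ro g X \<in> obj C" by simp
  then have "ro g X \<in> ess_image C (rho A g) (grade A s)"
    using h(3) isomorphic_refl[of "ro g X"] unfolding ess_image_def by blast
  then show ?thesis using rho_grade[OF h(1,2)] by simp
qed

lemma grade_zero: "s \<in> carrier \<Gamma> \<Longrightarrow> is_zero_obj C Z \<Longrightarrow> Z \<in> grade A s"
  using grade_subcategory(3) by blast

lemma grade_orthogonal: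
  "\<lbrakk>s \<in> carrier \<Gamma>; t \<in> carrier \<Gamma>; s \<noteq> t; f \<in> arr C; src C f \<in> grade A s; tgt C f \<in> grade A t\<rbrakk>
   \<Longrightarrow> f = hzero C (src C f) (tgt C f)"
  using component_orthogonal[of s t "src C f" "tgt C f"] by (auto simp: Hom_def)

lemma gam:
  assumes "g \<in> carrier G" "t \<in> carrier \<Gamma>" "X \<in> obj C" "Y \<in> grade A t"
  shows "gam A t g X Y \<in> arr C" "src C (gam A t g X Y) = ro g (X \<boxtimes> Y)"
    "tgt C (gam A t g X Y) = ro (t \<triangleright> g) X \<boxtimes> ro g Y" "is_iso C (gam A t g X Y)"
  using gam_iso[OF assms] by auto

declare gam [simp]

lemma gam_nat:
  assumes "g \<in> carrier G" "t \<in> carrier \<Gamma>" "u \<in> arr C" "v \<in> arr C" "src C v \<in> grade A t" "tgt C v \<in> grade A t"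
  shows "gam A t g (tgt C u) (tgt C v) \<cdot> ra g (u \<boxtimes>\<^sub>m v) = (ra (t \<triangleright> g) u \<boxtimes>\<^sub>m ra g v) \<cdot> gam A t g (src C u) (src C v)"
  using gam_natural[of g t u "src C u" "tgt C u" "src C v" "tgt C v" v] assms by auto

lemma gam0:
  assumes "g \<in> carrier G"
  shows "gam0 A g \<in> arr C" "src C (gam0 A g) = ro g (tunit C)" "tgt C (gam0 A g) = tunit C" "is_iso C (gam0 A g)"
  using gam0_iso[OF assms] by auto

declare gam0 [simp]

text \<open>The unit object is simple, hence homogeneous, and its degree is idempotent.\<close>

lemma tunit_grade [simp]: "tunit C \<in> grade A \<one>\<^bsub>\<Gamma>\<^esub>"
proof -
  obtain I Z \<iota> \<pi> where d: "finite I" "I \<subseteq> carrier \<Gamma>" "\<forall>l\<in>I. Z l \<in> grade A l" "is_direct_sum C I Z (tunit C) \<iota> \<pi>"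
    using decomposition[OF T.tunit_closed] by blast
  note s = direct_sumD[OF d(4)]
  have nz: "idm (tunit C) \<noteq> hzero C (tunit C) (tunit C)"
    using tunit_simple zero_obj_iff by (auto simp: is_simple_def)
  have "\<exists>l\<in>I. \<not> is_zero_obj C (Z l)"
  proof (rule ccontr)
    assume "\<not> (\<exists>l\<in>I. \<not> is_zero_obj C (Z l))"
    then have "\<iota> l \<cdot> \<pi> l = hzero C (tunit C) (tunit C)" if "l \<in> I" for l
      using that s zero_obj_arr(2)[of "Z l" "\<pi> l"] by simp
    then have "hsum (tunit C) (tunit C) (\<lambda>l. \<iota> l \<cdot> \<pi> l) I = hzero C (tunit C) (tunit C)"
      by (intro hsum_zeros) (use d in auto)
    then show False using s(2) nz by simp
  qed
  then obtain l where l: "l \<in> I" "\<not> is_zero_obj C (Z l)" by blast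
  have "is_mono C (\<iota> l)"
  proof (rule monoI)
    fix u v assume h: "u \<in> arr C" "v \<in> arr C" "src C u = src C v" "tgt C u = src C (\<iota> l)" "tgt C v = src C (\<iota> l)" "\<iota> l \<cdot> u = \<iota> l \<cdot> v"
    have "\<pi> l \<cdot> \<iota> l \<cdot> u = \<pi> l \<cdot> \<iota> l \<cdot> v" using h(6) by simp
    then show "u = v" using h(1-5) s(4-9)[OF l(1)] direct_sum_cancel(1)[OF d(4) l(1)] by simp
  qed (use s l in simp)
  then have "is_zero_obj C (src C (\<iota> l)) \<or> is_iso C (\<iota> l)"
    using tunit_simple s(6)[OF l(1)] unfolding is_simple_def by blast
  then have "is_iso C (\<iota> l)" using l s(5)[OF l(1)] by simp
  then have "isomorphic C (Z l) (tunit C)" unfolding isomorphic_iff using s l(1) by blast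
  moreover have lc: "l \<in> carrier \<Gamma>" using l d by blast
  ultimately have tl: "tunit C \<in> grade A l" using grade_iso d(3) l(1) by blast
  then have tll: "tunit C \<in> grade A (l \<otimes>\<^bsub>\<Gamma>\<^esub> l)" using component_tensor[OF lc lc tl tl] by simp
  have "l = l \<otimes>\<^bsub>\<Gamma>\<^esub> l"
  proof (rule ccontr)
    assume "l \<noteq> l \<otimes>\<^bsub>\<Gamma>\<^esub> l"
    from grade_orthogonal[OF lc _ this, of "idm (tunit C)"] show False using nz tl tll lc by simp
  qed
  then have "l = \<one>\<^bsub>\<Gamma>\<^esub>" using lc by (metis \<Gamma>.l_cancel_one')
  then show ?thesis using tl by simp
qed

abbreviation "parts Y \<equiv> homogeneous_parts \<Gamma> C (grade A) Y"
abbreviation "hpart Y s \<equiv> fst (parts Y) s"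
abbreviation "hincl Y s \<equiv> fst (snd (parts Y)) s"
abbreviation "hproj Y s \<equiv> snd (snd (parts Y)) s"

text \<open>
  A decomposition over a finite set of degrees is completed by zero objects, which belong to every
  component.
\<close>

lemma homogeneous_parts:
  assumes "Y \<in> obj C"
  shows "(\<forall>s\<in>carrier \<Gamma>. hpart Y s \<in> grade A s) \<and>
    is_direct_sum C (carrier \<Gamma>) (\<lambda>s. hpart Y s) Y (\<lambda>s. hincl Y s) (\<lambda>s. hproj Y s)"
proof -
  obtain I Z \<iota> \<pi> where d: "finite I" "I \<subseteq> carrier \<Gamma>" "\<forall>l\<in>I. Z l \<in> grade A l" "is_direct_sum C I Z Y \<iota> \<pi>"
    using decomposition[OF assms] by blast
  note s = direct_sumD[OF d(4)]
  obtain N where N: "is_zero_obj C N" using zero_obj_exists by blast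
  let ?Z = "\<lambda>l. if l \<in> I then Z l else N"
  let ?i = "\<lambda>l. if l \<in> I then \<iota> l else hzero C N Y" and ?p = "\<lambda>l. if l \<in> I then \<pi> l else hzero C Y N"
  have "hsum Y Y (\<lambda>l. ?i l \<cdot> ?p l) J = hsum Y Y (\<lambda>l. \<iota> l \<cdot> \<pi> l) I" if "finite J" "I \<subseteq> J" for J
    using that
  proof (induction "J - I" arbitrary: J rule: infinite_finite_induct)
    case infinite then show ?case by simp
  next
    case empty
    then have "J = I" by auto
    show ?case unfolding \<open>J = I\<close> using s by (intro hsum_cong) simp_all
  next
    case (insert k F)
    then have J: "J = insert k (J - {k})" "k \<notin> I" "F = (J - {k}) - I" by auto
    have "hsum Y Y (\<lambda>l. ?i l \<cdot> ?p l) (insert k (J - {k})) = hadd C (?i k \<cdot> ?p k) (hsum Y Y (\<lambda>l. ?i l \<cdot> ?p l) (J - {k}))"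
      by (rule hsum_insert) (use insert J s N in \<open>auto simp: zero_obj_iff\<close>)
    also have "hsum Y Y (\<lambda>l. ?i l \<cdot> ?p l) (J - {k}) = hsum Y Y (\<lambda>l. \<iota> l \<cdot> \<pi> l) I"
      using insert J by (intro insert(3)) auto
    also have "?i k \<cdot> ?p k = hzero C Y Y" using J N s by (simp add: zero_obj_iff)
    also have "hadd C (hzero C Y Y) (hsum Y Y (\<lambda>l. \<iota> l \<cdot> \<pi> l) I) = hsum Y Y (\<lambda>l. \<iota> l \<cdot> \<pi> l) I"
      using s by simp
    finally show ?case using J(1) by simp
  qed
  then have "hsum Y Y (\<lambda>l. ?i l \<cdot> ?p l) (carrier \<Gamma>) = idm Y" using s(2) d(2) finite_\<Gamma> by simp
  then have "is_direct_sum C (carrier \<Gamma>) ?Z Y ?i ?p"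
    using s N by (auto simp: is_direct_sum_def zero_obj_iff)
  moreover have "\<forall>s\<in>carrier \<Gamma>. ?Z s \<in> grade A s" using d(3) N grade_zero by auto
  ultimately have "\<exists>p. case p of (Z, \<iota>, \<pi>) \<Rightarrow> (\<forall>s\<in>carrier \<Gamma>. Z s \<in> grade A s) \<and> is_direct_sum C (carrier \<Gamma>) Z Y \<iota> \<pi>"
    by (intro exI[of _ "(?Z, ?i, ?p)"]) simp
  from someI_ex[OF this, folded homogeneous_parts_def] show ?thesis by (simp add: split_beta)
qed

lemma hpart_grade [simp]: "Y \<in> obj C \<Longrightarrow> s \<in> carrier \<Gamma> \<Longrightarrow> hpart Y s \<in> grade A s"
  using homogeneous_parts by blast

lemmas hparts = homogeneous_parts[THEN conjunct2]
lemmas hparts_simps [simp] = direct_sumD(3-10)[OF hparts]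

text \<open>
  A linear functor of \<open>Y\<close> preserves the decomposition of \<open>Y\<close> into homogeneous parts, so arrows out of
  its value are determined by homogeneous arrows into \<open>Y\<close>.
\<close>

definition rho_tensor :: "'g \<Rightarrow> 'o \<Rightarrow> 'o \<Rightarrow> ('o, 'm, 'o, 'm) cat_functor" where
  "rho_tensor g X Y' = \<lparr>fobj = \<lambda>Y. ro g (X \<boxtimes> Y \<boxtimes> Y'), farr = \<lambda>f. ra g (idm X \<boxtimes>\<^sub>m f \<boxtimes>\<^sub>m idm Y')\<rparr>"

lemma rho_tensor_linear:
  assumes "g \<in> carrier G" "X \<in> obj C" "Y' \<in> obj C" shows "linear_functor C C (rho_tensor g X Y')"
proof -
  have "ra g (idm X \<boxtimes>\<^sub>m (k \<cdot> f) \<boxtimes>\<^sub>m idm Y') = ra g (idm X \<boxtimes>\<^sub>m k \<boxtimes>\<^sub>m idm Y') \<cdot> ra g (idm X \<boxtimes>\<^sub>m f \<boxtimes>\<^sub>m idm Y')"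
    if "f \<in> arr C" "k \<in> arr C" "src C k = tgt C f" for f k
    using ra_cmp[OF assms(1), of "idm X \<boxtimes>\<^sub>m f \<boxtimes>\<^sub>m idm Y'" "idm X \<boxtimes>\<^sub>m k \<boxtimes>\<^sub>m idm Y'"] assms that by (simp add: T.interchange)
  then show ?thesis unfolding linear_functor_def rho_tensor_def using assms
    by (auto simp: T.tarr_hadd T.tarr_hscale functor_hadd[OF rho_linear[OF assms(1)]] functor_hscale[OF rho_linear[OF assms(1)]])
qed

lemma homogeneous_ext2:
  assumes "g \<in> carrier G" "X \<in> obj C" "Y \<in> obj C" "Y' \<in> obj C"
    "\<phi> \<in> arr C" "\<psi> \<in> arr C" "src C \<phi> = ro g (X \<boxtimes> Y \<boxtimes> Y')" "src C \<psi> = ro g (X \<boxtimes> Y \<boxtimes> Y')" "tgt C \<phi> = tgt C \<psi>"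
    "\<And>t f. \<lbrakk>t \<in> carrier \<Gamma>; f \<in> arr C; src C f \<in> grade A t; tgt C f = Y\<rbrakk> \<Longrightarrow>
       \<phi> \<cdot> ra g (idm X \<boxtimes>\<^sub>m f \<boxtimes>\<^sub>m idm Y') = \<psi> \<cdot> ra g (idm X \<boxtimes>\<^sub>m f \<boxtimes>\<^sub>m idm Y')"
  shows "\<phi> = \<psi>"
  by (rule direct_sum_ext_src[OF finite_\<Gamma> functor_direct_sum[OF linear_category_axioms rho_tensor_linear[OF assms(1,2,4)] finite_\<Gamma> hparts[OF assms(3)]]])
    (use assms in \<open>simp_all add: rho_tensor_def\<close>)

lemma homogeneous_ext:
  assumes "g \<in> carrier G" "X \<in> obj C" "Y \<in> obj C"
    "\<phi> \<in> arr C" "\<psi> \<in> arr C" "src C \<phi> = ro g (X \<boxtimes> Y)" "src C \<psi> = ro g (X \<boxtimes> Y)" "tgt C \<phi> = tgt C \<psi>"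
    "\<And>t f. \<lbrakk>t \<in> carrier \<Gamma>; f \<in> arr C; src C f \<in> grade A t; tgt C f = Y\<rbrakk> \<Longrightarrow>
       \<phi> \<cdot> ra g (idm X \<boxtimes>\<^sub>m f) = \<psi> \<cdot> ra g (idm X \<boxtimes>\<^sub>m f)"
  shows "\<phi> = \<psi>"
  by (rule homogeneous_ext2[of g X Y "tunit C"]) (use assms in simp_all)

subsection \<open>Equivariant objects\<close>

abbreviation "Q \<equiv> equivariant_category G \<Gamma> lact ract C A"

lemma Q_simps [simp]:
  "ident Q V = (V, V, idm (fst V))" "src Q a = fst a" "tgt Q a = fst (snd a)"
  by (simp_all add: equivariant_category_def split_beta)

lemma Q_objD:
  assumes "V \<in> obj Q"
  shows "fst V \<in> obj C" "snd V \<in> extensional (carrier G)" "g \<in> carrier G \<Longrightarrow> snd V g \<in> arr C"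
    "g \<in> carrier G \<Longrightarrow> src C (snd V g) = ro g (fst V)" "g \<in> carrier G \<Longrightarrow> tgt C (snd V g) = fst V"
    "g \<in> carrier G \<Longrightarrow> is_iso C (snd V g)"
    "snd V \<one>\<^bsub>G\<^esub> \<cdot> rho0 A (fst V) = idm (fst V)"
  using assms by (auto simp: equivariant_category_def equiv_objs_def)

lemma Q_equivariant:
  assumes "V \<in> obj Q" "g \<in> carrier G" "h \<in> carrier G"
  shows "snd V g \<cdot> ra g (snd V h) = snd V (h \<otimes>\<^bsub>G\<^esub> g) \<cdot> rho2 A g h (fst V)"
  using assms by (auto simp: equivariant_category_def equiv_objs_def)

lemma Q_objI:
  assumes "X \<in> obj C" "r \<in> extensional (carrier G)"
    "\<And>g. g \<in> carrier G \<Longrightarrow> r g \<in> arr C \<and> src C (r g) = ro g X \<and> tgt C (r g) = X \<and> is_iso C (r g)"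
    "\<And>g h. g \<in> carrier G \<Longrightarrow> h \<in> carrier G \<Longrightarrow> r g \<cdot> ra g (r h) = r (h \<otimes>\<^bsub>G\<^esub> g) \<cdot> rho2 A g h X"
    "r \<one>\<^bsub>G\<^esub> \<cdot> rho0 A X = idm X"
  shows "(X, r) \<in> obj Q"
  unfolding equivariant_category_def equiv_objs_def using assms by simp

declare Q_objD(1,3-6) [simp]

lemma Q_arr_iff:
  "a \<in> arr Q \<longleftrightarrow> fst a \<in> obj Q \<and> fst (snd a) \<in> obj Q \<and> snd (snd a) \<in> arr C \<and> src C (snd (snd a)) = fst (fst a) \<and>
     tgt C (snd (snd a)) = fst (fst (snd a)) \<and>
     (\<forall>g\<in>carrier G. snd (snd a) \<cdot> snd (fst a) g = snd (fst (snd a)) g \<cdot> ra g (snd (snd a)))"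
  by (cases a) (auto simp: equivariant_category_def)

text \<open>
  The module structure of \<open>\<rho>\<close> at \<open>g\<close>.  For homogeneous \<open>Y\<close> of degree \<open>t\<close> it is \<open>\<gamma>\<close> followed by the
  action of \<open>t \<triangleright> g\<close> on \<open>V\<close>; in general it is the sum of these over the homogeneous parts of \<open>Y\<close>.
\<close>

definition crossing :: "'g \<Rightarrow> 'o \<times> ('g \<Rightarrow> 'm) \<Rightarrow> 'o \<Rightarrow> 'm" where
  "crossing g V Y = hsum (ro g (fst V \<boxtimes> Y)) (fst V \<boxtimes> ro g Y)
     (\<lambda>s. (snd V (s \<triangleright> g) \<boxtimes>\<^sub>m ra g (hincl Y s)) \<cdot> gam A s g (fst V) (hpart Y s) \<cdot> ra g (idm (fst V) \<boxtimes>\<^sub>m hproj Y s)) (carrier \<Gamma>)"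

lemma crossing_arr [simp]:
  assumes "g \<in> carrier G" "V \<in> obj Q" "Y \<in> obj C"
  shows "crossing g V Y \<in> arr C" "src C (crossing g V Y) = ro g (fst V \<boxtimes> Y)" "tgt C (crossing g V Y) = fst V \<boxtimes> ro g Y"
  using assms by (simp_all add: crossing_def)

lemma incl_proj:
  assumes "s \<in> carrier \<Gamma>" "f \<in> arr C" "src C f \<in> grade A s" "tgt C f = Y"
  shows "hincl Y s \<cdot> hproj Y s \<cdot> f = f"
proof (rule direct_sum_ext_tgt[OF finite_\<Gamma> hparts[of Y]])
  fix t assume t: "t \<in> carrier \<Gamma>"
  have Y: "Y \<in> obj C" using assms tgt_closed by blast
  show "hproj Y t \<cdot> hincl Y s \<cdot> hproj Y s \<cdot> f = hproj Y t \<cdot> f"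
  proof (cases "t = s")
    case True then show ?thesis using direct_sum_cancel(1)[OF hparts[OF Y] t] assms Y by simp
  next
    case False
    have "hproj Y t \<cdot> f = hzero C (src C f) (hpart Y t)"
      using grade_orthogonal[of s t "hproj Y t \<cdot> f"] assms t False Y by auto
    then show ?thesis using direct_sum_cancel(2)[OF hparts[OF Y] t] assms t False Y by simp
  qed
qed (use assms tgt_closed[of f] in auto)

text \<open>
  By orthogonality only the term of degree \<open>t\<close> contributes.  Since homogeneous arrows into \<open>Y\<close> detect
  equality, this characterises \<open>crossing\<close> independently of the chosen decomposition of \<open>Y\<close>.
\<close>

lemma crossing_homogeneous:
  assumes "g \<in> carrier G" "V \<in> obj Q" "t \<in> carrier \<Gamma>" "f \<in> arr C" "src C f \<in> grade A t" "tgt C f = Y"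
  shows "crossing g V Y \<cdot> ra g (idm (fst V) \<boxtimes>\<^sub>m f) = (snd V (t \<triangleright> g) \<boxtimes>\<^sub>m ra g f) \<cdot> gam A t g (fst V) (src C f)"
proof -
  have Y: "Y \<in> obj C" using assms tgt_closed by blast
  let ?k = "\<lambda>s. (snd V (s \<triangleright> g) \<boxtimes>\<^sub>m ra g (hincl Y s)) \<cdot> gam A s g (fst V) (hpart Y s) \<cdot> ra g (idm (fst V) \<boxtimes>\<^sub>m hproj Y s)"
  have m: "ra g (idm (fst V) \<boxtimes>\<^sub>m hproj Y s) \<cdot> ra g (idm (fst V) \<boxtimes>\<^sub>m f) = ra g (idm (fst V) \<boxtimes>\<^sub>m (hproj Y s \<cdot> f))"
    if "s \<in> carrier \<Gamma>" for s
    using that assms Y by (subst ra_cmp[symmetric]) (simp_all add: T.interchange)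
  have "crossing g V Y \<cdot> ra g (idm (fst V) \<boxtimes>\<^sub>m f) =
      hsum (ro g (fst V \<boxtimes> src C f)) (fst V \<boxtimes> ro g Y) (\<lambda>s. ?k s \<cdot> ra g (idm (fst V) \<boxtimes>\<^sub>m f)) (carrier \<Gamma>)"
    unfolding crossing_def using finite_\<Gamma> assms Y by (subst hsum_cmp) simp_all
  also have "\<dots> = ?k t \<cdot> ra g (idm (fst V) \<boxtimes>\<^sub>m f)"
  proof (rule hsum_single[where f = "\<lambda>s. ?k s \<cdot> ra g (idm (fst V) \<boxtimes>\<^sub>m f)"])
    fix s assume s: "s \<in> carrier \<Gamma>" "s \<noteq> t"
    have "hproj Y s \<cdot> f = hzero C (src C f) (hpart Y s)"
      using grade_orthogonal[of t s "hproj Y s \<cdot> f"] assms s Y by auto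
    moreover have "idm (fst V) \<boxtimes>\<^sub>m hzero C (src C f) (hpart Y s) = hzero C (fst V \<boxtimes> src C f) (fst V \<boxtimes> hpart Y s)"
      using T.tarr_hscale(2)[of "idm (fst V)" "hzero C (src C f) (hpart Y s)" 0] assms s Y by simp
    ultimately show "?k s \<cdot> ra g (idm (fst V) \<boxtimes>\<^sub>m f) = hzero C (ro g (fst V \<boxtimes> src C f)) (fst V \<boxtimes> ro g Y)"
      using m[OF s(1)] assms s Y by simp
  qed (use finite_\<Gamma> assms Y in simp_all)
  also have "\<dots> = (snd V (t \<triangleright> g) \<boxtimes>\<^sub>m ra g (hincl Y t)) \<cdot> gam A t g (fst V) (hpart Y t) \<cdot> ra g (idm (fst V) \<boxtimes>\<^sub>m (hproj Y t \<cdot> f))"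
    using m[OF assms(3)] assms Y by simp
  also have "gam A t g (fst V) (hpart Y t) \<cdot> ra g (idm (fst V) \<boxtimes>\<^sub>m (hproj Y t \<cdot> f)) =
      (idm (ro (t \<triangleright> g) (fst V)) \<boxtimes>\<^sub>m ra g (hproj Y t \<cdot> f)) \<cdot> gam A t g (fst V) (src C f)"
    using gam_nat[OF assms(1,3), of "idm (fst V)" "hproj Y t \<cdot> f"] assms Y by simp
  also have "(snd V (t \<triangleright> g) \<boxtimes>\<^sub>m ra g (hincl Y t)) \<cdot> \<dots> = (snd V (t \<triangleright> g) \<boxtimes>\<^sub>m (ra g (hincl Y t) \<cdot> ra g (hproj Y t \<cdot> f))) \<cdot> gam A t g (fst V) (src C f)"
    using assms Y by (subst T.interchange_cmp) simp_all
  also have "ra g (hincl Y t) \<cdot> ra g (hproj Y t \<cdot> f) = ra g f"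
    using assms Y incl_proj[OF assms(3-6)] by (subst ra_cmp[symmetric]) simp_all
  finally show ?thesis .
qed

lemma crossing_homogeneous_cmp:
  assumes "g \<in> carrier G" "V \<in> obj Q" "t \<in> carrier \<Gamma>" "f \<in> arr C" "src C f \<in> grade A t" "tgt C f = Y"
    "z \<in> arr C" "tgt C z = ro g (fst V \<boxtimes> src C f)"
  shows "crossing g V Y \<cdot> ra g (idm (fst V) \<boxtimes>\<^sub>m f) \<cdot> z = (snd V (t \<triangleright> g) \<boxtimes>\<^sub>m ra g f) \<cdot> gam A t g (fst V) (src C f) \<cdot> z"
  using extend[OF crossing_homogeneous[OF assms(1-6)], of z] assms tgt_closed[of f] by auto

lemma crossing_degree:
  assumes "g \<in> carrier G" "V \<in> obj Q" "t \<in> carrier \<Gamma>" "Y \<in> grade A t"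
  shows "crossing g V Y = (snd V (t \<triangleright> g) \<boxtimes>\<^sub>m idm (ro g Y)) \<cdot> gam A t g (fst V) Y"
  using crossing_homogeneous[OF assms(1-3), of "idm Y" Y] assms by simp

lemma crossing_iso [simp]:
  assumes "g \<in> carrier G" "V \<in> obj Q" "Y \<in> obj C" shows "is_iso C (crossing g V Y)"
proof (rule direct_sum_diagonal_iso[OF finite_\<Gamma>])
  have "ra g (idm (fst V) \<boxtimes>\<^sub>m (k \<cdot> f)) = ra g (idm (fst V) \<boxtimes>\<^sub>m k) \<cdot> ra g (idm (fst V) \<boxtimes>\<^sub>m f)"
    if "f \<in> arr C" "k \<in> arr C" "src C k = tgt C f" for f k
    using ra_cmp[OF assms(1), of "idm (fst V) \<boxtimes>\<^sub>m f" "idm (fst V) \<boxtimes>\<^sub>m k"] assms that by (simp add: T.interchange)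
  then have "linear_functor C C \<lparr>fobj = \<lambda>Y. ro g (fst V \<boxtimes> Y), farr = \<lambda>f. ra g (idm (fst V) \<boxtimes>\<^sub>m f)\<rparr>"
    unfolding linear_functor_def using assms
    by (auto simp: T.tarr_hadd T.tarr_hscale functor_hadd[OF rho_linear[OF assms(1)]] functor_hscale[OF rho_linear[OF assms(1)]])
  from functor_direct_sum[OF linear_category_axioms this finite_\<Gamma> hparts[OF assms(3)]]
  show "is_direct_sum C (carrier \<Gamma>) (\<lambda>s. ro g (fst V \<boxtimes> hpart Y s)) (ro g (fst V \<boxtimes> Y))
      (\<lambda>s. ra g (idm (fst V) \<boxtimes>\<^sub>m hincl Y s)) (\<lambda>s. ra g (idm (fst V) \<boxtimes>\<^sub>m hproj Y s))" by simp
  have "linear_functor C C \<lparr>fobj = \<lambda>Y. fst V \<boxtimes> ro g Y, farr = \<lambda>f. idm (fst V) \<boxtimes>\<^sub>m ra g f\<rparr>"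
    using assms unfolding linear_functor_def
    by (auto simp: ra_cmp T.interchange T.tarr_hadd T.tarr_hscale functor_hadd[OF rho_linear[OF assms(1)]] functor_hscale[OF rho_linear[OF assms(1)]])
  from functor_direct_sum[OF linear_category_axioms this finite_\<Gamma> hparts[OF assms(3)]]
  show "is_direct_sum C (carrier \<Gamma>) (\<lambda>s. fst V \<boxtimes> ro g (hpart Y s)) (fst V \<boxtimes> ro g Y)
      (\<lambda>s. idm (fst V) \<boxtimes>\<^sub>m ra g (hincl Y s)) (\<lambda>s. idm (fst V) \<boxtimes>\<^sub>m ra g (hproj Y s))" by simp
  show "is_iso C (crossing g V (hpart Y s)) \<and> src C (crossing g V (hpart Y s)) = ro g (fst V \<boxtimes> hpart Y s) \<and>
      tgt C (crossing g V (hpart Y s)) = fst V \<boxtimes> ro g (hpart Y s) \<and>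
      crossing g V Y \<cdot> ra g (idm (fst V) \<boxtimes>\<^sub>m hincl Y s) = (idm (fst V) \<boxtimes>\<^sub>m ra g (hincl Y s)) \<cdot> crossing g V (hpart Y s)"
    if s: "s \<in> carrier \<Gamma>" for s
    using assms s crossing_degree[OF assms(1,2) s, of "hpart Y s"] crossing_homogeneous[OF assms(1,2) s, of "hincl Y s" Y]
    by (simp add: T.interchange_cmp)
qed (use assms in simp_all)

lemma crossing_natural:
  assumes "g \<in> carrier G" "a \<in> arr Q" "f \<in> arr C"
  shows "crossing g (fst (snd a)) (tgt C f) \<cdot> ra g (snd (snd a) \<boxtimes>\<^sub>m f) = (snd (snd a) \<boxtimes>\<^sub>m ra g f) \<cdot> crossing g (fst a) (src C f)"
proof (rule homogeneous_ext[OF assms(1), of "fst (fst a)" "src C f"])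
  let ?V = "fst a" and ?W = "fst (snd a)" and ?u = "snd (snd a)"
  have a: "?V \<in> obj Q" "?W \<in> obj Q" "?u \<in> arr C" "src C ?u = fst ?V" "tgt C ?u = fst ?W"
    and e: "\<And>g. g \<in> carrier G \<Longrightarrow> ?u \<cdot> snd ?V g = snd ?W g \<cdot> ra g ?u"
    using assms(2) by (auto simp: Q_arr_iff)
  fix t z assume z: "t \<in> carrier \<Gamma>" "z \<in> arr C" "src C z \<in> grade A t" "tgt C z = src C f"
  have "(?u \<boxtimes>\<^sub>m f) \<cdot> (idm (fst ?V) \<boxtimes>\<^sub>m z) = (idm (fst ?W) \<boxtimes>\<^sub>m (f \<cdot> z)) \<cdot> (?u \<boxtimes>\<^sub>m idm (src C z))"
    using z a assms by (simp add: T.interchange)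
  then have "ra g (?u \<boxtimes>\<^sub>m f) \<cdot> ra g (idm (fst ?V) \<boxtimes>\<^sub>m z) = ra g (idm (fst ?W) \<boxtimes>\<^sub>m (f \<cdot> z)) \<cdot> ra g (?u \<boxtimes>\<^sub>m idm (src C z))"
    using z a assms by (simp flip: ra_cmp)
  then have "(crossing g ?W (tgt C f) \<cdot> ra g (?u \<boxtimes>\<^sub>m f)) \<cdot> ra g (idm (fst ?V) \<boxtimes>\<^sub>m z) =
      crossing g ?W (tgt C f) \<cdot> ra g (idm (fst ?W) \<boxtimes>\<^sub>m (f \<cdot> z)) \<cdot> ra g (?u \<boxtimes>\<^sub>m idm (src C z))"
    using z a assms by simp
  also have "\<dots> = (snd ?W (t \<triangleright> g) \<boxtimes>\<^sub>m ra g (f \<cdot> z)) \<cdot> gam A t g (fst ?W) (src C z) \<cdot> ra g (?u \<boxtimes>\<^sub>m idm (src C z))"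
    using crossing_homogeneous_cmp[OF assms(1) a(2) z(1), of "f \<cdot> z" "tgt C f" "ra g (?u \<boxtimes>\<^sub>m idm (src C z))"] z a assms by simp
  also have "\<dots> = (snd ?W (t \<triangleright> g) \<boxtimes>\<^sub>m ra g (f \<cdot> z)) \<cdot> (ra (t \<triangleright> g) ?u \<boxtimes>\<^sub>m idm (ro g (src C z))) \<cdot> gam A t g (fst ?V) (src C z)"
    using gam_nat[OF assms(1) z(1) a(3), of "idm (src C z)"] z a assms by simp
  also have "\<dots> = ((?u \<cdot> snd ?V (t \<triangleright> g)) \<boxtimes>\<^sub>m (ra g f \<cdot> ra g z)) \<cdot> gam A t g (fst ?V) (src C z)"
    using e[of "t \<triangleright> g"] z a assms by (simp add: T.interchange_cmp ra_cmp)
  also have "\<dots> = ((?u \<boxtimes>\<^sub>m ra g f) \<cdot> crossing g ?V (src C f)) \<cdot> ra g (idm (fst ?V) \<boxtimes>\<^sub>m z)"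
    using crossing_homogeneous[OF assms(1) a(1) z] z a assms by (simp add: T.interchange_cmp)
  finally show "(crossing g ?W (tgt C f) \<cdot> ra g (?u \<boxtimes>\<^sub>m f)) \<cdot> ra g (idm (fst ?V) \<boxtimes>\<^sub>m z) =
      ((?u \<boxtimes>\<^sub>m ra g f) \<cdot> crossing g ?V (src C f)) \<cdot> ra g (idm (fst ?V) \<boxtimes>\<^sub>m z)" .
qed (use assms in \<open>simp_all add: Q_arr_iff\<close>)

lemma Q_ident_arr [simp]: "V \<in> obj Q \<Longrightarrow> (V, V, idm (fst V)) \<in> arr Q"
  by (simp add: Q_arr_iff)

lemma crossing_natural_right:
  assumes "g \<in> carrier G" "V \<in> obj Q" "f \<in> arr C"
  shows "crossing g V (tgt C f) \<cdot> ra g (idm (fst V) \<boxtimes>\<^sub>m f) = (idm (fst V) \<boxtimes>\<^sub>m ra g f) \<cdot> crossing g V (src C f)"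
  using crossing_natural[OF assms(1), of "(V, V, idm (fst V))" f] assms by simp

text \<open>
  For homogeneous \<open>Y\<close> this combines the compatibility of \<open>\<gamma>\<close> and \<open>\<rho>\<^sub>2\<close> with the equivariance of \<open>V\<close>; the
  group elements match because \<open>s \<triangleright> (h \<otimes> g) = (s \<triangleright> h) \<otimes> ((s \<triangleleft> h) \<triangleright> g)\<close>.  Naturality extends it to all \<open>Y\<close>.
\<close>

lemma crossing_rho2:
  assumes "g \<in> carrier G" "h \<in> carrier G" "V \<in> obj Q" "Y \<in> obj C"
  shows "crossing (h \<otimes>\<^bsub>G\<^esub> g) V Y \<cdot> rho2 A g h (fst V \<boxtimes> Y) =
    (idm (fst V) \<boxtimes>\<^sub>m rho2 A g h Y) \<cdot> crossing g V (ro h Y) \<cdot> ra g (crossing h V Y)"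
proof -
  let ?X = "fst V"
  have base: "crossing (h \<otimes>\<^bsub>G\<^esub> g) V Z \<cdot> rho2 A g h (?X \<boxtimes> Z) = (idm ?X \<boxtimes>\<^sub>m rho2 A g h Z) \<cdot> crossing g V (ro h Z) \<cdot> ra g (crossing h V Z)"
    if s: "s \<in> carrier \<Gamma>" "Z \<in> grade A s" for s Z
  proof -
    let ?a = "(s \<triangleleft> h) \<triangleright> g" and ?b = "s \<triangleright> h"
    note Zh = grade_rho[OF assms(2) s]
    have c: "s \<triangleright> (h \<otimes>\<^bsub>G\<^esub> g) = ?b \<otimes>\<^bsub>G\<^esub> ?a" using lact_compat s assms by simp
    have 1: "crossing (h \<otimes>\<^bsub>G\<^esub> g) V Z \<cdot> rho2 A g h (?X \<boxtimes> Z) =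
        (snd V (?b \<otimes>\<^bsub>G\<^esub> ?a) \<boxtimes>\<^sub>m idm (ro (h \<otimes>\<^bsub>G\<^esub> g) Z)) \<cdot> (rho2 A ?a ?b ?X \<boxtimes>\<^sub>m rho2 A g h Z)
          \<cdot> gam A (s \<triangleleft> h) g (ro ?b ?X) (ro h Z) \<cdot> ra g (gam A s h ?X Z)"
      using gam_rho2[OF assms(1,2) s(1), of ?X Z] crossing_degree[of "h \<otimes>\<^bsub>G\<^esub> g" V s Z] s assms c by simp
    have "ra g (crossing h V Z) = ra g (snd V ?b \<boxtimes>\<^sub>m idm (ro h Z)) \<cdot> ra g (gam A s h ?X Z)"
      using s assms Zh crossing_degree[of h V s Z] by (subst ra_cmp[symmetric]) simp_all
    then have 2: "crossing g V (ro h Z) \<cdot> ra g (crossing h V Z) =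
       (snd V ?a \<boxtimes>\<^sub>m idm (ro g (ro h Z))) \<cdot> gam A (s \<triangleleft> h) g ?X (ro h Z) \<cdot> ra g (snd V ?b \<boxtimes>\<^sub>m idm (ro h Z)) \<cdot> ra g (gam A s h ?X Z)"
      using s assms Zh crossing_degree[of g V "s \<triangleleft> h" "ro h Z"] by simp
    have 3: "gam A (s \<triangleleft> h) g ?X (ro h Z) \<cdot> ra g (snd V ?b \<boxtimes>\<^sub>m idm (ro h Z)) =
       (ra ?a (snd V ?b) \<boxtimes>\<^sub>m idm (ro g (ro h Z))) \<cdot> gam A (s \<triangleleft> h) g (ro ?b ?X) (ro h Z)"
      using gam_nat[of g "s \<triangleleft> h" "snd V ?b" "idm (ro h Z)"] s assms Zh by simp
    have 4: "crossing g V (ro h Z) \<cdot> ra g (crossing h V Z) =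
       ((snd V ?a \<cdot> ra ?a (snd V ?b)) \<boxtimes>\<^sub>m idm (ro g (ro h Z))) \<cdot> gam A (s \<triangleleft> h) g (ro ?b ?X) (ro h Z) \<cdot> ra g (gam A s h ?X Z)"
      unfolding 2 using extend[OF 3, of "ra g (gam A s h ?X Z)"] s assms Zh by (simp add: T.interchange_cmp)
    show ?thesis unfolding 1 4 using s assms Zh Q_equivariant[of V ?a ?b] by (simp add: T.interchange_cmp)
  qed
  show ?thesis
  proof (rule iso_cancel_right[of "inv_arr (rho2 A g h (?X \<boxtimes> Y))"])
    let ?L = "crossing (h \<otimes>\<^bsub>G\<^esub> g) V Y \<cdot> rho2 A g h (?X \<boxtimes> Y)"
      and ?R = "(idm ?X \<boxtimes>\<^sub>m rho2 A g h Y) \<cdot> crossing g V (ro h Y) \<cdot> ra g (crossing h V Y)"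
    show "?L \<cdot> inv_arr (rho2 A g h (?X \<boxtimes> Y)) = ?R \<cdot> inv_arr (rho2 A g h (?X \<boxtimes> Y))"
    proof (rule homogeneous_ext[of "h \<otimes>\<^bsub>G\<^esub> g" ?X Y])
      fix t f assume f: "t \<in> carrier \<Gamma>" "f \<in> arr C" "src C f \<in> grade A t" "tgt C f = Y"
      let ?f = "idm ?X \<boxtimes>\<^sub>m f" and ?Z = "src C f" and ?i = "inv_arr (rho2 A g h (?X \<boxtimes> Y))"
        and ?j = "inv_arr (rho2 A g h (?X \<boxtimes> src C f))"
      have n: "?i \<cdot> ra (h \<otimes>\<^bsub>G\<^esub> g) ?f = ra g (ra h ?f) \<cdot> ?j"
        by (rule iso_cancel_left[of "rho2 A g h (?X \<boxtimes> Y)"])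
          (use f assms rho2(5)[OF assms(1,2), of ?f] extend[OF rho2(5)[OF assms(1,2), of ?f], of ?j] in simp_all)
      have a: "ra g (crossing h V Y) \<cdot> ra g (ra h ?f) = ra g (idm ?X \<boxtimes>\<^sub>m ra h f) \<cdot> ra g (crossing h V ?Z)"
        using f assms crossing_natural_right[OF assms(2,3) f(2)] by (simp flip: ra_cmp)
      have b: "crossing g V (ro h Y) \<cdot> ra g (idm ?X \<boxtimes>\<^sub>m ra h f) = (idm ?X \<boxtimes>\<^sub>m ra g (ra h f)) \<cdot> crossing g V (ro h ?Z)"
        using f assms crossing_natural_right[OF assms(1,3), of "ra h f"] by simp
      have c: "(idm ?X \<boxtimes>\<^sub>m rho2 A g h Y) \<cdot> (idm ?X \<boxtimes>\<^sub>m ra g (ra h f)) = (idm ?X \<boxtimes>\<^sub>m ra (h \<otimes>\<^bsub>G\<^esub> g) f) \<cdot> (idm ?X \<boxtimes>\<^sub>m rho2 A g h ?Z)"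
        using f assms rho2(5)[OF assms(1,2) f(2)] by (simp add: T.interchange)
      have "?R \<cdot> ra g (ra h ?f) = (idm ?X \<boxtimes>\<^sub>m ra (h \<otimes>\<^bsub>G\<^esub> g) f) \<cdot> (idm ?X \<boxtimes>\<^sub>m rho2 A g h ?Z) \<cdot> crossing g V (ro h ?Z) \<cdot> ra g (crossing h V ?Z)"
        using a extend[OF b, of "ra g (crossing h V ?Z)"] extend[OF c, of "crossing g V (ro h ?Z) \<cdot> ra g (crossing h V ?Z)"] f assms by simp
      also have "\<dots> = (idm ?X \<boxtimes>\<^sub>m ra (h \<otimes>\<^bsub>G\<^esub> g) f) \<cdot> crossing (h \<otimes>\<^bsub>G\<^esub> g) V ?Z \<cdot> rho2 A g h (?X \<boxtimes> ?Z)"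
        using base[OF f(1,3)] f assms by simp
      finally have R: "?R \<cdot> ra g (ra h ?f) = (idm ?X \<boxtimes>\<^sub>m ra (h \<otimes>\<^bsub>G\<^esub> g) f) \<cdot> crossing (h \<otimes>\<^bsub>G\<^esub> g) V ?Z \<cdot> rho2 A g h (?X \<boxtimes> ?Z)" .
      have "(?R \<cdot> ?i) \<cdot> ra (h \<otimes>\<^bsub>G\<^esub> g) ?f = (idm ?X \<boxtimes>\<^sub>m ra (h \<otimes>\<^bsub>G\<^esub> g) f) \<cdot> crossing (h \<otimes>\<^bsub>G\<^esub> g) V ?Z"
        using n extend[OF R, of ?j] f assms by simp
      moreover have "(?L \<cdot> ?i) \<cdot> ra (h \<otimes>\<^bsub>G\<^esub> g) ?f = crossing (h \<otimes>\<^bsub>G\<^esub> g) V Y \<cdot> ra (h \<otimes>\<^bsub>G\<^esub> g) ?f"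
        using f assms by simp
      ultimately show "(?L \<cdot> ?i) \<cdot> ra (h \<otimes>\<^bsub>G\<^esub> g) ?f = (?R \<cdot> ?i) \<cdot> ra (h \<otimes>\<^bsub>G\<^esub> g) ?f"
        using crossing_natural_right[of "h \<otimes>\<^bsub>G\<^esub> g" V f] f assms by simp
    qed (use assms in simp_all)
  qed (use assms in simp_all)
qed

lemma crossing_rho0:
  assumes "V \<in> obj Q" "Y \<in> obj C"
  shows "crossing \<one>\<^bsub>G\<^esub> V Y \<cdot> rho0 A (fst V \<boxtimes> Y) = idm (fst V) \<boxtimes>\<^sub>m rho0 A Y"
proof (rule iso_cancel_right[of "inv_arr (rho0 A (fst V \<boxtimes> Y))"])
  let ?X = "fst V" and ?i = "inv_arr (rho0 A (fst V \<boxtimes> Y))"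
  show "(crossing \<one>\<^bsub>G\<^esub> V Y \<cdot> rho0 A (?X \<boxtimes> Y)) \<cdot> ?i = (idm ?X \<boxtimes>\<^sub>m rho0 A Y) \<cdot> ?i"
  proof (rule homogeneous_ext[of "\<one>\<^bsub>G\<^esub>" ?X Y])
    fix t f assume f: "t \<in> carrier \<Gamma>" "f \<in> arr C" "src C f \<in> grade A t" "tgt C f = Y"
    let ?f = "idm ?X \<boxtimes>\<^sub>m f" and ?Z = "src C f" and ?j = "inv_arr (rho0 A (?X \<boxtimes> src C f))"
    have t1: "t \<triangleright> \<one>\<^bsub>G\<^esub> = \<one>\<^bsub>G\<^esub>"
    proof -
      have "t \<triangleright> \<one>\<^bsub>G\<^esub> = (t \<triangleright> \<one>\<^bsub>G\<^esub>) \<otimes>\<^bsub>G\<^esub> (t \<triangleright> \<one>\<^bsub>G\<^esub>)" using lact_compat[of t "\<one>\<^bsub>G\<^esub>" "\<one>\<^bsub>G\<^esub>"] f by simp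
      then show ?thesis using f by (metis G.l_cancel_one' G.one_closed lact_closed)
    qed
    have n: "?i \<cdot> ra \<one>\<^bsub>G\<^esub> ?f = ?f \<cdot> ?j"
      by (rule iso_cancel_left[of "rho0 A (?X \<boxtimes> Y)"])
        (use f assms rho0(5)[of ?f] extend[OF rho0(5)[of ?f], of ?j] in simp_all)
    have "crossing \<one>\<^bsub>G\<^esub> V ?Z \<cdot> rho0 A (?X \<boxtimes> ?Z) = (snd V \<one>\<^bsub>G\<^esub> \<boxtimes>\<^sub>m idm (ro \<one>\<^bsub>G\<^esub> ?Z)) \<cdot> (rho0 A ?X \<boxtimes>\<^sub>m rho0 A ?Z)"
      using gam_rho0[OF f(1), of ?X ?Z] crossing_degree[of "\<one>\<^bsub>G\<^esub>" V t ?Z] f assms t1 by simp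
    also have "\<dots> = idm ?X \<boxtimes>\<^sub>m rho0 A ?Z" using f assms Q_objD(7)[OF assms(1)] by (simp add: T.interchange)
    finally have e: "crossing \<one>\<^bsub>G\<^esub> V ?Z \<cdot> rho0 A (?X \<boxtimes> ?Z) = idm ?X \<boxtimes>\<^sub>m rho0 A ?Z" .
    have "((idm ?X \<boxtimes>\<^sub>m rho0 A Y) \<cdot> ?i) \<cdot> ra \<one>\<^bsub>G\<^esub> ?f = (idm ?X \<boxtimes>\<^sub>m ra \<one>\<^bsub>G\<^esub> f) \<cdot> (idm ?X \<boxtimes>\<^sub>m rho0 A ?Z) \<cdot> ?j"
      using n rho0(5)[OF f(2)] f assms by (simp add: T.interchange_cmp)
    also have "\<dots> = (idm ?X \<boxtimes>\<^sub>m ra \<one>\<^bsub>G\<^esub> f) \<cdot> crossing \<one>\<^bsub>G\<^esub> V ?Z" using f assms by (simp flip: e)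
    finally show "((crossing \<one>\<^bsub>G\<^esub> V Y \<cdot> rho0 A (?X \<boxtimes> Y)) \<cdot> ?i) \<cdot> ra \<one>\<^bsub>G\<^esub> ?f = ((idm ?X \<boxtimes>\<^sub>m rho0 A Y) \<cdot> ?i) \<cdot> ra \<one>\<^bsub>G\<^esub> ?f"
      using crossing_natural_right[of "\<one>\<^bsub>G\<^esub>" V f] f assms by simp
  qed (use assms in simp_all)
qed (use assms in simp_all)

lemma component_tensor' [simp]:
  "\<lbrakk>X \<in> grade A s; Y \<in> grade A t; s \<in> carrier \<Gamma>; t \<in> carrier \<Gamma>\<rbrakk> \<Longrightarrow> X \<boxtimes> Y \<in> grade A (s \<otimes>\<^bsub>\<Gamma>\<^esub> t)"
  using component_tensor by blast

text \<open>
  As \<open>\<rho>\<close> at \<open>g\<close> moves degree \<open>s\<close> to degree \<open>s \<triangleleft> g\<close>, the projection to that degree in the definition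
  of the tensor product may be dropped, and what remains is \<open>crossing\<close>.
\<close>

lemma Q_tensor [simp]:
  assumes "V \<in> obj Q" "W \<in> obj Q"
  shows "fst (V \<boxtimes>\<^bsub>Q\<^esub> W) = fst V \<boxtimes> fst W"
    "g \<in> carrier G \<Longrightarrow> snd (V \<boxtimes>\<^bsub>Q\<^esub> W) g = (idm (fst V) \<boxtimes>\<^sub>m snd W g) \<cdot> crossing g V (fst W)"
proof -
  show "fst (V \<boxtimes>\<^bsub>Q\<^esub> W) = fst V \<boxtimes> fst W" by (simp add: equivariant_category_def split_beta)
  assume g: "g \<in> carrier G"
  let ?X = "fst V" and ?Y = "fst W"
  have Y: "?Y \<in> obj C" using assms by simp
  have "snd (V \<boxtimes>\<^bsub>Q\<^esub> W) g = hsum (ro g (?X \<boxtimes> ?Y)) (?X \<boxtimes> ?Y)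
      (\<lambda>s. (idm ?X \<boxtimes>\<^sub>m hincl ?Y (s \<triangleleft> g)) \<cdot> (snd V (s \<triangleright> g) \<boxtimes>\<^sub>m (hproj ?Y (s \<triangleleft> g) \<cdot> snd W g \<cdot> ra g (hincl ?Y s)))
        \<cdot> gam A s g ?X (hpart ?Y s) \<cdot> ra g (idm ?X \<boxtimes>\<^sub>m hproj ?Y s)) (carrier \<Gamma>)"
    using g by (simp add: equivariant_category_def equivariant_tensor_structure_def split_beta)
  also have "\<dots> = hsum (ro g (?X \<boxtimes> ?Y)) (?X \<boxtimes> ?Y) (\<lambda>s. (idm ?X \<boxtimes>\<^sub>m snd W g) \<cdot> (snd V (s \<triangleright> g) \<boxtimes>\<^sub>m ra g (hincl ?Y s))
        \<cdot> gam A s g ?X (hpart ?Y s) \<cdot> ra g (idm ?X \<boxtimes>\<^sub>m hproj ?Y s)) (carrier \<Gamma>)"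
  proof (rule hsum_cong)
    fix s assume s: "s \<in> carrier \<Gamma>"
    have "hincl ?Y (s \<triangleleft> g) \<cdot> hproj ?Y (s \<triangleleft> g) \<cdot> snd W g \<cdot> ra g (hincl ?Y s) = snd W g \<cdot> ra g (hincl ?Y s)"
      using incl_proj[of "s \<triangleleft> g" "snd W g \<cdot> ra g (hincl ?Y s)" ?Y] grade_rho[OF g s hpart_grade[OF Y s]] assms g s Y by simp
    then show "(idm ?X \<boxtimes>\<^sub>m hincl ?Y (s \<triangleleft> g)) \<cdot> (snd V (s \<triangleright> g) \<boxtimes>\<^sub>m (hproj ?Y (s \<triangleleft> g) \<cdot> snd W g \<cdot> ra g (hincl ?Y s)))
        \<cdot> gam A s g ?X (hpart ?Y s) \<cdot> ra g (idm ?X \<boxtimes>\<^sub>m hproj ?Y s) =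
      (idm ?X \<boxtimes>\<^sub>m snd W g) \<cdot> (snd V (s \<triangleright> g) \<boxtimes>\<^sub>m ra g (hincl ?Y s))
        \<cdot> gam A s g ?X (hpart ?Y s) \<cdot> ra g (idm ?X \<boxtimes>\<^sub>m hproj ?Y s)"
      using assms g s Y by (simp add: T.interchange_cmp)
  qed (use assms g Y in simp_all)
  also have "\<dots> = (idm ?X \<boxtimes>\<^sub>m snd W g) \<cdot> crossing g V ?Y"
    unfolding crossing_def using assms g Y finite_\<Gamma> by (subst cmp_hsum) simp_all
  finally show "snd (V \<boxtimes>\<^bsub>Q\<^esub> W) g = (idm ?X \<boxtimes>\<^sub>m snd W g) \<cdot> crossing g V ?Y" .
qed

lemma Q_tobj [simp]:
  assumes "V \<in> obj Q" "W \<in> obj Q" shows "V \<boxtimes>\<^bsub>Q\<^esub> W \<in> obj Q"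
proof -
  have "(fst (V \<boxtimes>\<^bsub>Q\<^esub> W), snd (V \<boxtimes>\<^bsub>Q\<^esub> W)) \<in> obj Q"
  proof (rule Q_objI)
    show "snd (V \<boxtimes>\<^bsub>Q\<^esub> W) \<in> extensional (carrier G)"
      by (simp add: equivariant_category_def equivariant_tensor_structure_def split_beta)
    let ?X = "fst V" and ?Y = "fst W"
    show "snd (V \<boxtimes>\<^bsub>Q\<^esub> W) g \<cdot> ra g (snd (V \<boxtimes>\<^bsub>Q\<^esub> W) h) = snd (V \<boxtimes>\<^bsub>Q\<^esub> W) (h \<otimes>\<^bsub>G\<^esub> g) \<cdot> rho2 A g h (fst (V \<boxtimes>\<^bsub>Q\<^esub> W))"
      if h: "g \<in> carrier G" "h \<in> carrier G" for g h
    proof -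
      have 1: "crossing g V ?Y \<cdot> ra g (idm ?X \<boxtimes>\<^sub>m snd W h) = (idm ?X \<boxtimes>\<^sub>m ra g (snd W h)) \<cdot> crossing g V (ro h ?Y)"
        using crossing_natural_right[OF h(1) assms(1), of "snd W h"] assms h by simp
      have "snd (V \<boxtimes>\<^bsub>Q\<^esub> W) g \<cdot> ra g (snd (V \<boxtimes>\<^bsub>Q\<^esub> W) h) =
          (idm ?X \<boxtimes>\<^sub>m snd W g) \<cdot> (crossing g V ?Y \<cdot> ra g (idm ?X \<boxtimes>\<^sub>m snd W h)) \<cdot> ra g (crossing h V ?Y)"
        using assms h by (simp add: ra_cmp)
      also have "\<dots> = (idm ?X \<boxtimes>\<^sub>m (snd W g \<cdot> ra g (snd W h))) \<cdot> crossing g V (ro h ?Y) \<cdot> ra g (crossing h V ?Y)"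
        unfolding 1 using assms h by (simp add: T.interchange_cmp)
      also have "\<dots> = (idm ?X \<boxtimes>\<^sub>m snd W (h \<otimes>\<^bsub>G\<^esub> g)) \<cdot> (idm ?X \<boxtimes>\<^sub>m rho2 A g h ?Y) \<cdot> crossing g V (ro h ?Y) \<cdot> ra g (crossing h V ?Y)"
        using assms h Q_equivariant[OF assms(2) h] by (simp add: T.interchange_cmp)
      finally show ?thesis using assms h by (simp flip: crossing_rho2)
    qed
    show "snd (V \<boxtimes>\<^bsub>Q\<^esub> W) \<one>\<^bsub>G\<^esub> \<cdot> rho0 A (fst (V \<boxtimes>\<^bsub>Q\<^esub> W)) = idm (fst (V \<boxtimes>\<^bsub>Q\<^esub> W))"
      using assms Q_objD(7)[OF assms(2)] by (simp add: crossing_rho0 T.interchange)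
  qed (use assms in simp_all)
  then show ?thesis by simp
qed

lemma Q_tunit: "tunit Q = (tunit C, \<lambda>g\<in>carrier G. gam0 A g)"
  by (simp add: equivariant_category_def)

lemma Q_tunit_obj [simp]: "tunit Q \<in> obj Q"
  unfolding Q_tunit by (rule Q_objI) (use gam0_rho2 gam0_rho0 in simp_all)

lemma Q_tunit_simps [simp]: "fst (tunit Q) = tunit C" "g \<in> carrier G \<Longrightarrow> snd (tunit Q) g = gam0 A g"
  by (simp_all add: Q_tunit)

lemma crossing_tunit:
  assumes "g \<in> carrier G" "Y \<in> obj C" shows "crossing g (tunit Q) Y = idm (ro g Y)"
proof (rule homogeneous_ext[OF assms(1), of "tunit C" Y])
  fix t f assume f: "t \<in> carrier \<Gamma>" "f \<in> arr C" "src C f \<in> grade A t" "tgt C f = Y"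
  have "crossing g (tunit Q) Y \<cdot> ra g (idm (tunit C) \<boxtimes>\<^sub>m f) = (gam0 A (t \<triangleright> g) \<boxtimes>\<^sub>m ra g f) \<cdot> gam A t g (tunit C) (src C f)"
    using crossing_homogeneous[OF assms(1) _ f, of "tunit Q"] assms f by simp
  also have "\<dots> = (idm (tunit C) \<boxtimes>\<^sub>m ra g f) \<cdot> (gam0 A (t \<triangleright> g) \<boxtimes>\<^sub>m idm (ro g (src C f))) \<cdot> gam A t g (tunit C) (src C f)"
    using assms f by (subst T.interchange_cmp) simp_all
  also have "\<dots> = ra g f" using gam_unit_left[OF assms(1) f(1,3)] assms f by simp
  finally show "crossing g (tunit Q) Y \<cdot> ra g (idm (tunit C) \<boxtimes>\<^sub>m f) = idm (ro g Y) \<cdot> ra g (idm (tunit C) \<boxtimes>\<^sub>m f)"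
    using assms f by simp
qed (use assms crossing_arr[of g "tunit Q" Y] in simp_all)

lemma crossing_at_tunit:
  assumes "g \<in> carrier G" "V \<in> obj Q"
  shows "(idm (fst V) \<boxtimes>\<^sub>m gam0 A g) \<cdot> crossing g V (tunit C) = snd V g"
proof -
  have "(idm (fst V) \<boxtimes>\<^sub>m gam0 A g) \<cdot> crossing g V (tunit C) = (snd V g \<boxtimes>\<^sub>m idm (tunit C)) \<cdot> (idm (ro g (fst V)) \<boxtimes>\<^sub>m gam0 A g) \<cdot> gam A \<one>\<^bsub>\<Gamma>\<^esub> g (fst V) (tunit C)"
    using crossing_degree[OF assms, of "\<one>\<^bsub>\<Gamma>\<^esub>" "tunit C"] assms by (simp add: T.interchange_cmp del: T.tarr_unit)
  also have "\<dots> = snd V g" using gam_unit_right[OF assms(1), of "fst V"] assms by simp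
  finally show ?thesis .
qed

lemma gam_assoc':
  assumes "g \<in> carrier G" "s \<in> carrier \<Gamma>" "t \<in> carrier \<Gamma>" "X \<in> obj C" "Y \<in> grade A s" "Z \<in> grade A t"
  shows "(gam A s (t \<triangleright> g) X Y \<boxtimes>\<^sub>m idm (ro g Z)) \<cdot> gam A t g (X \<boxtimes> Y) Z =
    (idm (ro (s \<triangleright> t \<triangleright> g) X) \<boxtimes>\<^sub>m gam A t g Y Z) \<cdot> gam A (s \<otimes>\<^bsub>\<Gamma>\<^esub> t) g X (Y \<boxtimes> Z)"
  using gam_assoc[OF assms] lact_mult assms by simp

text \<open>
  Both \<open>Y\<close> and the underlying object of \<open>W\<close> may be taken homogeneous; then this is the associativity of \<open>\<gamma>\<close>.
\<close>

lemma crossing_tensor: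
  assumes "g \<in> carrier G" "V \<in> obj Q" "W \<in> obj Q" "Y \<in> obj C"
  shows "crossing g (V \<boxtimes>\<^bsub>Q\<^esub> W) Y = (idm (fst V) \<boxtimes>\<^sub>m crossing g W Y) \<cdot> crossing g V (fst W \<boxtimes> Y)"
proof (rule homogeneous_ext[OF assms(1), of "fst V \<boxtimes> fst W" Y])
  let ?X = "fst V" and ?W = "fst W" and ?VW = "V \<boxtimes>\<^bsub>Q\<^esub> W"
  fix t f assume f: "t \<in> carrier \<Gamma>" "f \<in> arr C" "src C f \<in> grade A t" "tgt C f = Y"
  let ?Z = "src C f" and ?h = "t \<triangleright> g"
  have VW: "?VW \<in> obj Q" using assms by simp
  have "(snd ?VW ?h \<boxtimes>\<^sub>m ra g f) \<cdot> gam A t g (?X \<boxtimes> ?W) ?Z =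
      (idm ?X \<boxtimes>\<^sub>m ((snd W ?h \<boxtimes>\<^sub>m ra g f) \<cdot> gam A t g ?W ?Z)) \<cdot> crossing g V (?W \<boxtimes> ?Z)"
  proof (rule homogeneous_ext2[OF assms(1), of ?X ?W ?Z])
    fix s k assume k: "s \<in> carrier \<Gamma>" "k \<in> arr C" "src C k \<in> grade A s" "tgt C k = ?W"
    let ?W' = "src C k" and ?a = "s \<triangleright> t \<triangleright> g"
    have kZ: "(idm ?X \<boxtimes>\<^sub>m k) \<boxtimes>\<^sub>m idm ?Z = idm ?X \<boxtimes>\<^sub>m (k \<boxtimes>\<^sub>m idm ?Z)" using f k assms by simp
    have "snd ?VW ?h \<cdot> ra ?h (idm ?X \<boxtimes>\<^sub>m k) = (snd V ?a \<boxtimes>\<^sub>m (snd W ?h \<cdot> ra ?h k)) \<cdot> gam A s ?h ?X ?W'"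
      using crossing_homogeneous[of ?h V s k ?W] f k assms by (simp add: T.interchange_cmp)
    moreover have "gam A t g (?X \<boxtimes> ?W) ?Z \<cdot> ra g (idm ?X \<boxtimes>\<^sub>m k \<boxtimes>\<^sub>m idm ?Z) =
        (ra ?h (idm ?X \<boxtimes>\<^sub>m k) \<boxtimes>\<^sub>m idm (ro g ?Z)) \<cdot> gam A t g (?X \<boxtimes> ?W') ?Z"
      using gam_nat[OF assms(1) f(1), of "idm ?X \<boxtimes>\<^sub>m k" "idm ?Z"] f k assms by simp
    ultimately have "((snd ?VW ?h \<boxtimes>\<^sub>m ra g f) \<cdot> gam A t g (?X \<boxtimes> ?W) ?Z) \<cdot> ra g (idm ?X \<boxtimes>\<^sub>m k \<boxtimes>\<^sub>m idm ?Z) =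
        (((snd V ?a \<boxtimes>\<^sub>m (snd W ?h \<cdot> ra ?h k)) \<cdot> gam A s ?h ?X ?W') \<boxtimes>\<^sub>m ra g f) \<cdot> gam A t g (?X \<boxtimes> ?W') ?Z"
      using f k assms VW Q_objD(4,5)[OF VW, of ?h] by (simp add: T.interchange_cmp del: Q_tensor(2))
    also have "\<dots> = ((snd V ?a \<boxtimes>\<^sub>m (snd W ?h \<cdot> ra ?h k)) \<boxtimes>\<^sub>m ra g f) \<cdot> (gam A s ?h ?X ?W' \<boxtimes>\<^sub>m idm (ro g ?Z)) \<cdot> gam A t g (?X \<boxtimes> ?W') ?Z"
      using f k assms by (subst T.interchange_cmp) simp_all
    also have "\<dots> = (snd V ?a \<boxtimes>\<^sub>m ((snd W ?h \<cdot> ra ?h k) \<boxtimes>\<^sub>m ra g f)) \<cdot> (idm (ro ?a ?X) \<boxtimes>\<^sub>m gam A t g ?W' ?Z) \<cdot> gam A (s \<otimes>\<^bsub>\<Gamma>\<^esub> t) g ?X (?W' \<boxtimes> ?Z)"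
      using gam_assoc'[OF assms(1) k(1) f(1) _ k(3) f(3), of ?X] f k assms by simp
    also have "\<dots> = (snd V ?a \<boxtimes>\<^sub>m (((snd W ?h \<cdot> ra ?h k) \<boxtimes>\<^sub>m ra g f) \<cdot> gam A t g ?W' ?Z)) \<cdot> gam A (s \<otimes>\<^bsub>\<Gamma>\<^esub> t) g ?X (?W' \<boxtimes> ?Z)"
      using f k assms lact_mult[OF k(1) f(1) assms(1)] by (simp add: T.interchange_cmp)
    finally have L: "((snd ?VW ?h \<boxtimes>\<^sub>m ra g f) \<cdot> gam A t g (?X \<boxtimes> ?W) ?Z) \<cdot> ra g (idm ?X \<boxtimes>\<^sub>m k \<boxtimes>\<^sub>m idm ?Z) =
        (snd V ?a \<boxtimes>\<^sub>m (((snd W ?h \<cdot> ra ?h k) \<boxtimes>\<^sub>m ra g f) \<cdot> gam A t g ?W' ?Z)) \<cdot> gam A (s \<otimes>\<^bsub>\<Gamma>\<^esub> t) g ?X (?W' \<boxtimes> ?Z)" .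
    have "crossing g V (?W \<boxtimes> ?Z) \<cdot> ra g (idm ?X \<boxtimes>\<^sub>m k \<boxtimes>\<^sub>m idm ?Z) =
        (snd V ?a \<boxtimes>\<^sub>m ra g (k \<boxtimes>\<^sub>m idm ?Z)) \<cdot> gam A (s \<otimes>\<^bsub>\<Gamma>\<^esub> t) g ?X (?W' \<boxtimes> ?Z)"
      using crossing_homogeneous[OF assms(1,2), of "s \<otimes>\<^bsub>\<Gamma>\<^esub> t" "k \<boxtimes>\<^sub>m idm ?Z" "?W \<boxtimes> ?Z"] f k assms lact_mult[OF k(1) f(1) assms(1)] by simp
    moreover have "gam A t g ?W ?Z \<cdot> ra g (k \<boxtimes>\<^sub>m idm ?Z) = (ra ?h k \<boxtimes>\<^sub>m idm (ro g ?Z)) \<cdot> gam A t g ?W' ?Z"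
      using gam_nat[OF assms(1) f(1), of k "idm ?Z"] f k assms by simp
    ultimately have "((idm ?X \<boxtimes>\<^sub>m ((snd W ?h \<boxtimes>\<^sub>m ra g f) \<cdot> gam A t g ?W ?Z)) \<cdot> crossing g V (?W \<boxtimes> ?Z)) \<cdot> ra g (idm ?X \<boxtimes>\<^sub>m k \<boxtimes>\<^sub>m idm ?Z) =
        (snd V ?a \<boxtimes>\<^sub>m (((snd W ?h \<cdot> ra ?h k) \<boxtimes>\<^sub>m ra g f) \<cdot> gam A t g ?W' ?Z)) \<cdot> gam A (s \<otimes>\<^bsub>\<Gamma>\<^esub> t) g ?X (?W' \<boxtimes> ?Z)"
      using f k assms lact_mult[OF k(1) f(1) assms(1)] by (simp add: T.interchange_cmp)
    then show "((snd ?VW ?h \<boxtimes>\<^sub>m ra g f) \<cdot> gam A t g (?X \<boxtimes> ?W) ?Z) \<cdot> ra g (idm ?X \<boxtimes>\<^sub>m k \<boxtimes>\<^sub>m idm ?Z) =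
        ((idm ?X \<boxtimes>\<^sub>m ((snd W ?h \<boxtimes>\<^sub>m ra g f) \<cdot> gam A t g ?W ?Z)) \<cdot> crossing g V (?W \<boxtimes> ?Z)) \<cdot> ra g (idm ?X \<boxtimes>\<^sub>m k \<boxtimes>\<^sub>m idm ?Z)"
      using L by simp
  qed (use f assms VW Q_objD(4,5)[OF VW, of ?h] in \<open>simp_all del: Q_tensor(2)\<close>)
  also have "\<dots> = (idm ?X \<boxtimes>\<^sub>m crossing g W Y) \<cdot> (idm ?X \<boxtimes>\<^sub>m ra g (idm ?W \<boxtimes>\<^sub>m f)) \<cdot> crossing g V (?W \<boxtimes> ?Z)"
    using crossing_homogeneous[OF assms(1,3) f] f assms by (simp add: T.interchange_cmp)
  also have "\<dots> = ((idm ?X \<boxtimes>\<^sub>m crossing g W Y) \<cdot> crossing g V (?W \<boxtimes> Y)) \<cdot> ra g (idm (?X \<boxtimes> ?W) \<boxtimes>\<^sub>m f)"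
    using crossing_natural_right[OF assms(1,2), of "idm ?W \<boxtimes>\<^sub>m f"] f assms by (simp flip: T.tarr_ident)
  finally show "crossing g ?VW Y \<cdot> ra g (idm (?X \<boxtimes> ?W) \<boxtimes>\<^sub>m f) =
      ((idm ?X \<boxtimes>\<^sub>m crossing g W Y) \<cdot> crossing g V (?W \<boxtimes> Y)) \<cdot> ra g (idm (?X \<boxtimes> ?W) \<boxtimes>\<^sub>m f)"
    using crossing_homogeneous[OF assms(1) VW f] f assms by simp
qed (use assms crossing_arr[of g "V \<boxtimes>\<^bsub>Q\<^esub> W" Y] in simp_all)

text \<open>
  For homogeneous \<open>Y\<close> this is again the associativity of \<open>\<gamma>\<close>, now with the homogeneous object \<open>X\<close> in
  the last place.  It says that \<open>\<gamma>\<close> is a transformation of module functors.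
\<close>

lemma crossing_gam:
  assumes "g \<in> carrier G" "s \<in> carrier \<Gamma>" "V \<in> obj Q" "Y \<in> obj C" "X \<in> grade A s"
  shows "(idm (fst V) \<boxtimes>\<^sub>m gam A s g Y X) \<cdot> crossing g V (Y \<boxtimes> X) =
    (crossing (s \<triangleright> g) V Y \<boxtimes>\<^sub>m idm (ro g X)) \<cdot> gam A s g (fst V \<boxtimes> Y) X"
proof (rule homogeneous_ext2[OF assms(1), of "fst V" Y X])
  let ?V = "fst V" and ?h = "s \<triangleright> g"
  fix t f assume f: "t \<in> carrier \<Gamma>" "f \<in> arr C" "src C f \<in> grade A t" "tgt C f = Y"
  let ?Z = "src C f" and ?a = "t \<triangleright> s \<triangleright> g"
  have X: "X \<in> obj C" using assms by simp
  have 1: "gam A s g Y X \<cdot> ra g (f \<boxtimes>\<^sub>m idm X) = (ra ?h f \<boxtimes>\<^sub>m idm (ro g X)) \<cdot> gam A s g ?Z X"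
    using gam_nat[OF assms(1,2), of f "idm X"] f assms X by simp
  have "crossing g V (Y \<boxtimes> X) \<cdot> ra g (idm ?V \<boxtimes>\<^sub>m f \<boxtimes>\<^sub>m idm X) = (snd V ?a \<boxtimes>\<^sub>m ra g (f \<boxtimes>\<^sub>m idm X)) \<cdot> gam A (t \<otimes>\<^bsub>\<Gamma>\<^esub> s) g ?V (?Z \<boxtimes> X)"
    using crossing_homogeneous[OF assms(1,3), of "t \<otimes>\<^bsub>\<Gamma>\<^esub> s" "f \<boxtimes>\<^sub>m idm X" "Y \<boxtimes> X"] f assms X lact_mult[OF f(1) assms(2,1)] by simp
  then have L: "((idm ?V \<boxtimes>\<^sub>m gam A s g Y X) \<cdot> crossing g V (Y \<boxtimes> X)) \<cdot> ra g (idm ?V \<boxtimes>\<^sub>m f \<boxtimes>\<^sub>m idm X) =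
      (snd V ?a \<boxtimes>\<^sub>m ((ra ?h f \<boxtimes>\<^sub>m idm (ro g X)) \<cdot> gam A s g ?Z X)) \<cdot> gam A (t \<otimes>\<^bsub>\<Gamma>\<^esub> s) g ?V (?Z \<boxtimes> X)"
    using f assms X 1 lact_mult[OF f(1) assms(2,1)] by (simp add: T.interchange_cmp)
  have "gam A s g (?V \<boxtimes> Y) X \<cdot> ra g (idm ?V \<boxtimes>\<^sub>m f \<boxtimes>\<^sub>m idm X) = (ra ?h (idm ?V \<boxtimes>\<^sub>m f) \<boxtimes>\<^sub>m idm (ro g X)) \<cdot> gam A s g (?V \<boxtimes> ?Z) X"
    using gam_nat[OF assms(1,2), of "idm ?V \<boxtimes>\<^sub>m f" "idm X"] f assms X by simp
  then have "((crossing ?h V Y \<boxtimes>\<^sub>m idm (ro g X)) \<cdot> gam A s g (?V \<boxtimes> Y) X) \<cdot> ra g (idm ?V \<boxtimes>\<^sub>m f \<boxtimes>\<^sub>m idm X) =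
      (((snd V ?a \<boxtimes>\<^sub>m ra ?h f) \<cdot> gam A t ?h ?V ?Z) \<boxtimes>\<^sub>m idm (ro g X)) \<cdot> gam A s g (?V \<boxtimes> ?Z) X"
    using crossing_homogeneous[OF _ assms(3) f, of ?h] f assms X by (simp add: T.interchange_cmp)
  also have "\<dots> = ((snd V ?a \<boxtimes>\<^sub>m ra ?h f) \<boxtimes>\<^sub>m idm (ro g X)) \<cdot> (gam A t ?h ?V ?Z \<boxtimes>\<^sub>m idm (ro g X)) \<cdot> gam A s g (?V \<boxtimes> ?Z) X"
    using f assms X by (subst T.interchange_cmp) simp_all
  also have "\<dots> = (snd V ?a \<boxtimes>\<^sub>m (ra ?h f \<boxtimes>\<^sub>m idm (ro g X))) \<cdot> (idm (ro ?a ?V) \<boxtimes>\<^sub>m gam A s g ?Z X) \<cdot> gam A (t \<otimes>\<^bsub>\<Gamma>\<^esub> s) g ?V (?Z \<boxtimes> X)"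
    using gam_assoc'[OF assms(1) f(1) assms(2) _ f(3) assms(5), of ?V] f assms X by simp
  also have "\<dots> = (snd V ?a \<boxtimes>\<^sub>m ((ra ?h f \<boxtimes>\<^sub>m idm (ro g X)) \<cdot> gam A s g ?Z X)) \<cdot> gam A (t \<otimes>\<^bsub>\<Gamma>\<^esub> s) g ?V (?Z \<boxtimes> X)"
    using f assms X lact_mult[OF f(1) assms(2,1)] by (simp add: T.interchange_cmp)
  finally show "((idm ?V \<boxtimes>\<^sub>m gam A s g Y X) \<cdot> crossing g V (Y \<boxtimes> X)) \<cdot> ra g (idm ?V \<boxtimes>\<^sub>m f \<boxtimes>\<^sub>m idm X) =
      ((crossing ?h V Y \<boxtimes>\<^sub>m idm (ro g X)) \<cdot> gam A s g (?V \<boxtimes> Y) X) \<cdot> ra g (idm ?V \<boxtimes>\<^sub>m f \<boxtimes>\<^sub>m idm X)"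
    using L by simp
qed (use assms in simp_all)

section \<open>Module endofunctors of a crossed tensor category\<close>

lemma forgetful_simps [simp]:
  "aobj (forgetful_action C) V Y = fst V \<boxtimes> Y" "aarr (forgetful_action C) a f = snd (snd a) \<boxtimes>\<^sub>m f"
  by (simp_all add: forgetful_action_def split_beta)

sublocale E: strict_module_category Q C "forgetful_action C"
proof unfold_locales
  show "aarr (forgetful_action C) (ident Q V) g \<cdot> aarr (forgetful_action C) u f = aarr (forgetful_action C) u (g \<cdot> f)"
    if "u \<in> arr Q" "f \<in> arr C" "g \<in> arr C" "src C g = tgt C f" "V = tgt Q u" for u f g V
    using that by (simp add: Q_arr_iff T.interchange)
  show "aarr (forgetful_action C) u g \<cdot> aarr (forgetful_action C) (ident Q V) f = aarr (forgetful_action C) u (g \<cdot> f)"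
    if "u \<in> arr Q" "f \<in> arr C" "g \<in> arr C" "src C g = tgt C f" "V = src Q u" for u f g V
    using that by (simp add: Q_arr_iff T.interchange)
qed (simp_all add: Q_arr_iff T.interchange T.tarr_hadd T.tarr_hscale flip: T.tarr_ident)

abbreviation "B \<equiv> op_tensor (module_endofunctors Q C (forgetful_action C))"

text \<open>
  An equivalence preserves cokernels; it is a family of coordinates indexed by a single element.
\<close>

lemma rho_right_exact:
  assumes "g \<in> carrier G" "is_cokernel C f p" shows "is_cokernel C (ra g f) (ra g p)"
proof -
  have eq: "linear_functor C C (rho A g)" "fully_faithful C C (rho A g)" "ess_image C (rho A g) (obj C) = obj C"
    using rho_equivalence[OF assms(1)] by (auto simp: linear_equivalence_def)
  interpret J: jointly_equivalent_abelian C C "{()}" "\<lambda>_. rho A g"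
  proof
    show "f = k" if "f \<in> arr C" "k \<in> arr C" "src C f = src C k" "tgt C f = tgt C k" "\<And>i. i \<in> {()} \<Longrightarrow> ra g f = ra g k" for f k
      using fully_faithfulD(2)[OF eq(2), of "src C k" "tgt C k" f k] that by simp
    show "\<exists>f\<in>arr C. src C f = X \<and> tgt C f = Y \<and> (\<forall>i\<in>{()}. ra g f = u i)"
      if "X \<in> obj C" "Y \<in> obj C" "\<And>i. i \<in> {()} \<Longrightarrow> u i \<in> arr C \<and> src C (u i) = ro g X \<and> tgt C (u i) = ro g Y" for X Y u
      using fully_faithfulD(1)[OF eq(2) that(1,2), of "u ()"] that(3)[of "()"] by auto
    show "\<exists>X\<in>obj C. \<forall>i\<in>{()}. isomorphic C (ro g X) (Z i)" if "\<And>i. i \<in> {()} \<Longrightarrow> Z i \<in> obj C" for Z :: "unit \<Rightarrow> 'o"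
    proof -
      have "Z () \<in> ess_image C (rho A g) (obj C)" using that eq(3) by simp
      then show ?thesis by (auto simp: ess_image_def)
    qed
  qed (use eq in simp_all)
  show ?thesis using J.cokernel_preserve[OF assms(2), of "()"] by simp
qed

definition T :: "'g \<Rightarrow> (('g, 'o, 'm) equiv_obj, 'o, 'm) mod_functor" where
  "T g = \<lparr>fobj = (\<lambda>X\<in>obj C. ro g X), farr = (\<lambda>f\<in>arr C. ra g f), mconstr = (\<lambda>V\<in>obj Q. \<lambda>Y\<in>obj C. crossing g V Y)\<rparr>"

lemma T_simps [simp]:
  "X \<in> obj C \<Longrightarrow> fobj (T g) X = ro g X" "f \<in> arr C \<Longrightarrow> farr (T g) f = ra g f"
  "V \<in> obj Q \<Longrightarrow> X \<in> obj C \<Longrightarrow> mconstr (T g) V X = crossing g V X"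
  by (simp_all add: T_def)

lemma T_obj [simp]:
  assumes "g \<in> carrier G" shows "T g \<in> obj B"
proof (rule E.objI)
  show "linear_functor C C (T g)"
    unfolding linear_functor_def using assms
    by (auto simp: ra_cmp functor_hadd[OF rho_linear[OF assms]] functor_hscale[OF rho_linear[OF assms]])
  show "is_cokernel C (farr (T g) f) (farr (T g) p)" if "is_cokernel C f p" for f p
    using rho_right_exact[OF assms that] cokernelD[OF that] by simp
  show "mconstr (T g) (tgt Q u) (tgt C f) \<cdot> farr (T g) (aarr (forgetful_action C) u f) =
      aarr (forgetful_action C) u (farr (T g) f) \<cdot> mconstr (T g) (src Q u) (src C f)" if "u \<in> arr Q" "f \<in> arr C" for u f
    using crossing_natural[OF assms that] that E.D_arr[OF that(1)] by (simp add: Q_arr_iff)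
  show "mconstr (T g) (V \<boxtimes>\<^bsub>Q\<^esub> W) X = E.whisker V (mconstr (T g) W X) \<cdot> mconstr (T g) V (E.acted W X)"
    if "V \<in> obj Q" "W \<in> obj Q" "X \<in> obj C" for V W X
    using crossing_tensor[OF assms that] that by simp
  show "mconstr (T g) (tunit Q) X = idm (fobj (T g) X)" if "X \<in> obj C" for X
    using crossing_tunit[OF assms that] that by simp
  show "fobj (T g) \<in> extensional (obj C)" "farr (T g) \<in> extensional (arr C)" "mconstr (T g) \<in> extensional (obj Q)"
    by (simp_all add: T_def)
  show "mconstr (T g) V \<in> extensional (obj C)" if "V \<in> obj Q" for V using that by (simp add: T_def)
qed (use assms in simp_all)

abbreviation "R \<equiv> right_mult_functor Q C (forgetful_action C)"

lemma R_simps [simp]: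
  "Y \<in> obj C \<Longrightarrow> fobj (R X) Y = Y \<boxtimes> X" "f \<in> arr C \<Longrightarrow> farr (R X) f = f \<boxtimes>\<^sub>m idm X"
  "V \<in> obj Q \<Longrightarrow> Y \<in> obj C \<Longrightarrow> mconstr (R X) V Y = idm ((fst V \<boxtimes> Y) \<boxtimes> X)"
  by (simp_all add: right_mult_functor_def)

lemma R_obj [simp]:
  assumes "X \<in> obj C" shows "R X \<in> obj B"
proof (rule E.objI)
  show "linear_functor C C (R X)"
    unfolding linear_functor_def using assms
    by (auto simp: T.interchange T.tarr_hadd T.tarr_hscale)
  show "is_cokernel C (farr (R X) f) (farr (R X) p)" if c: "is_cokernel C f p" for f p
    using left_dual_exists[OF assms] T.tensor_right_exact[OF _ c] cokernelD[OF c] by auto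
  show "mconstr (R X) (tgt Q u) (tgt C f) \<cdot> farr (R X) (aarr (forgetful_action C) u f) =
      aarr (forgetful_action C) u (farr (R X) f) \<cdot> mconstr (R X) (src Q u) (src C f)" if "u \<in> arr Q" "f \<in> arr C" for u f
    using assms that E.D_arr[OF that(1)] by (simp add: Q_arr_iff)
  show "fobj (R X) \<in> extensional (obj C)" "farr (R X) \<in> extensional (arr C)" "mconstr (R X) \<in> extensional (obj Q)"
    by (simp_all add: right_mult_functor_def)
  show "mconstr (R X) V \<in> extensional (obj C)" if "V \<in> obj Q" for V using that by (simp add: right_mult_functor_def)
qed (use assms in simp_all)

abbreviation "emb \<equiv> right_mult_embedding G \<Gamma> lact ract C A"

lemma emb_simps [simp]:
  "fobj emb = R" "fst (farr emb f) = R (src C f)" "fst (snd (farr emb f)) = R (tgt C f)"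
  "Y \<in> obj C \<Longrightarrow> snd (snd (farr emb f)) Y = idm Y \<boxtimes>\<^sub>m f"
  by (simp_all add: right_mult_embedding_def Let_def)

lemma emb_arr [simp]:
  assumes "f \<in> arr C" shows "farr emb f \<in> arr B"
proof -
  have "(R (src C f), R (tgt C f), \<lambda>Y\<in>obj C. idm Y \<boxtimes>\<^sub>m f) \<in> arr B"
  proof (rule E.arrI)
    show "E.whisker V (idm Y \<boxtimes>\<^sub>m f) \<cdot> mconstr (R (src C f)) V Y = mconstr (R (tgt C f)) V Y \<cdot> (idm (E.acted V Y) \<boxtimes>\<^sub>m f)"
      if "V \<in> obj Q" "Y \<in> obj C" for V Y
      using assms that by (simp add: T.interchange flip: T.tarr_ident)
  qed (use assms in \<open>simp_all add: T.interchange\<close>)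
  then show ?thesis by (simp add: right_mult_embedding_def Let_def)
qed

lemma emb_linear: "linear_functor C B emb"
  unfolding linear_functor_def
proof (intro conjI ballI allI impI)
  show "farr emb (idm X) = ident B (fobj emb X)" if "X \<in> obj C" for X
    by (rule E.arr_eqI) (use that in simp_all)
  show "farr emb (g \<cdot> f) = farr emb g \<cdot>\<^bsub>B\<^esub> farr emb f" if "f \<in> arr C" "g \<in> arr C" "src C g = tgt C f" for f g
    by (rule E.arr_eqI) (use that in \<open>simp_all add: T.interchange\<close>)
  show "farr emb (hadd C f g) = hadd B (farr emb f) (farr emb g)"
    if "X \<in> obj C" "Y \<in> obj C" "f \<in> Hom C X Y" "g \<in> Hom C X Y" for X Y f g
    by (rule E.arr_eqI) (use that in \<open>simp_all add: T.tarr_hadd\<close>)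
  show "farr emb (hscale C a f) = hscale B a (farr emb f)" if "f \<in> arr C" for f a
    by (rule E.arr_eqI) (use that in \<open>simp_all add: T.tarr_hscale\<close>)
qed simp_all

lemma R_tunit: "R (tunit C) = tunit B"
  by (rule E.obj_eqI) simp_all

lemma R_tensor:
  assumes "X \<in> obj C" "Y \<in> obj C" shows "R (X \<boxtimes> Y) = R X \<boxtimes>\<^bsub>B\<^esub> R Y"
  by (rule E.obj_eqI) (use assms in simp_all)

lemma emb_tensor:
  assumes "f \<in> arr C" "g \<in> arr C" shows "farr emb (f \<boxtimes>\<^sub>m g) = farr emb f \<boxtimes>\<^sub>m\<^bsub>B\<^esub> farr emb g"
proof (rule E.arr_eqI)
  fix Y assume "Y \<in> obj C"
  then show "E.comp (farr emb (f \<boxtimes>\<^sub>m g)) Y = E.comp (farr emb f \<boxtimes>\<^sub>m\<^bsub>B\<^esub> farr emb g) Y"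
    using assms T.interchange[of "idm Y \<boxtimes>\<^sub>m f" "idm (Y \<boxtimes> tgt C f)" "idm (src C g)" g] by simp
qed (use assms R_tensor in simp_all)

subsection \<open>Induced objects\<close>

abbreviation "ind Y \<equiv> fst (E.pointwise_sum (carrier G) T Y)"
abbreviation "\<iota> x Y \<equiv> fst (snd (E.pointwise_sum (carrier G) T Y)) x"
abbreviation "\<pi> x Y \<equiv> snd (snd (E.pointwise_sum (carrier G) T Y)) x"
abbreviation "Ind \<equiv> E.sum_functor (carrier G) T"

lemma ind_sum:
  assumes "Y \<in> obj C" shows "is_direct_sum C (carrier G) (\<lambda>x. ro x Y) (ind Y) (\<lambda>x. \<iota> x Y) (\<lambda>x. \<pi> x Y)"
  using E.pointwise_sum[OF finite_G T_obj assms] assms by simp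

lemmas ind_simps [simp] = direct_sumD(1,4-10)[OF ind_sum]
lemmas ind_zero = direct_sumD(11)[OF ind_sum]
lemmas ind_cancel = direct_sum_cancel[OF ind_sum]
lemmas ind_ext = direct_sum_ext_src[OF finite_G ind_sum]

lemma Ind_obj [simp]: "Ind \<in> obj B"
  by (rule E.sum_functor_obj[OF finite_G T_obj])

lemma Ind_simps [simp]: "Y \<in> obj C \<Longrightarrow> fobj Ind Y = ind Y"
  by (rule E.sum_fobj[OF finite_G T_obj])

lemma Ind_iota:
  "\<lbrakk>f \<in> arr C; x \<in> carrier G; Y = src C f\<rbrakk> \<Longrightarrow> farr Ind f \<cdot> \<iota> x Y = \<iota> x (tgt C f) \<cdot> ra x f"
  by (simp add: E.sum_farr_iota[OF finite_G T_obj])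

lemma Ind_mconstr_iota:
  "\<lbrakk>V \<in> obj Q; Y \<in> obj C; x \<in> carrier G\<rbrakk>
   \<Longrightarrow> mconstr Ind V Y \<cdot> \<iota> x (fst V \<boxtimes> Y) = (idm (fst V) \<boxtimes>\<^sub>m \<iota> x Y) \<cdot> crossing x V Y"
  using E.sum_mconstr_iota[OF finite_G T_obj, where V = V and X = Y and j = x] by simp

text \<open>
  The group element \<open>g\<close> carries the summand at \<open>x\<close> to the summand at \<open>x \<otimes> g\<close>, through \<open>\<rho>\<^sub>2\<close>.
\<close>

definition ind_action :: "'o \<Rightarrow> 'g \<Rightarrow> 'm" where
  "ind_action Y = (\<lambda>g\<in>carrier G. hsum (ro g (ind Y)) (ind Y) (\<lambda>x. (\<iota> (x \<otimes>\<^bsub>G\<^esub> g) Y \<cdot> rho2 A g x Y) \<cdot> ra g (\<pi> x Y)) (carrier G))"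

lemma rho_ind_sum:
  assumes "g \<in> carrier G" "Y \<in> obj C"
  shows "is_direct_sum C (carrier G) (\<lambda>x. ro g (ro x Y)) (ro g (ind Y)) (\<lambda>x. ra g (\<iota> x Y)) (\<lambda>x. ra g (\<pi> x Y))"
  by (rule functor_direct_sum[OF linear_category_axioms rho_linear[OF assms(1)] finite_G ind_sum[OF assms(2)]])

lemma ind_action_arr [simp]:
  assumes "g \<in> carrier G" "Y \<in> obj C"
  shows "ind_action Y g \<in> arr C" "src C (ind_action Y g) = ro g (ind Y)" "tgt C (ind_action Y g) = ind Y"
  using assms by (simp_all add: ind_action_def)

lemma ind_action_iota:
  assumes "g \<in> carrier G" "Y \<in> obj C" "x \<in> carrier G"
  shows "ind_action Y g \<cdot> ra g (\<iota> x Y) = \<iota> (x \<otimes>\<^bsub>G\<^esub> g) Y \<cdot> rho2 A g x Y"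
  using assms direct_sum_hsum_iota[OF finite_G rho_ind_sum[OF assms(1,2)] assms(3), of "ind Y" "\<lambda>x. \<iota> (x \<otimes>\<^bsub>G\<^esub> g) Y \<cdot> rho2 A g x Y"]
  by (simp add: ind_action_def)

lemma ind_action_iota_cmp:
  assumes "g \<in> carrier G" "Y \<in> obj C" "x \<in> carrier G" "z \<in> arr C" "tgt C z = ro g (ro x Y)"
  shows "ind_action Y g \<cdot> ra g (\<iota> x Y) \<cdot> z = \<iota> (x \<otimes>\<^bsub>G\<^esub> g) Y \<cdot> rho2 A g x Y \<cdot> z"
  using extend[OF ind_action_iota[OF assms(1-3)], of z] assms by simp

lemma ind_action_pi:
  assumes "g \<in> carrier G" "Y \<in> obj C" "x \<in> carrier G"
  shows "\<pi> (x \<otimes>\<^bsub>G\<^esub> g) Y \<cdot> ind_action Y g = rho2 A g x Y \<cdot> ra g (\<pi> x Y)"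
proof (rule direct_sum_ext_src[OF finite_G rho_ind_sum[OF assms(1,2)]])
  fix y assume y: "y \<in> carrier G"
  show "(\<pi> (x \<otimes>\<^bsub>G\<^esub> g) Y \<cdot> ind_action Y g) \<cdot> ra g (\<iota> y Y) = (rho2 A g x Y \<cdot> ra g (\<pi> x Y)) \<cdot> ra g (\<iota> y Y)"
  proof (cases "x = y")
    case True
    then show ?thesis using assms ind_cancel(1)[OF assms(2), of "x \<otimes>\<^bsub>G\<^esub> g"] direct_sumD(10)[OF rho_ind_sum[OF assms(1,2)]]
      by (simp add: ind_action_iota)
  next
    case False
    then have "x \<otimes>\<^bsub>G\<^esub> g \<noteq> y \<otimes>\<^bsub>G\<^esub> g" using assms y by (simp add: G.right_cancel)
    then show ?thesis using assms y False ind_cancel(2)[OF assms(2), of "x \<otimes>\<^bsub>G\<^esub> g"] direct_sumD(11)[OF rho_ind_sum[OF assms(1,2)], of x y]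
      by (simp add: ind_action_iota)
  qed
qed (use assms in simp_all)

text \<open>Right translation by \<open>g\<close> permutes the summands, and \<open>\<rho>\<^sub>2\<close> is invertible.\<close>

lemma ind_action_iso:
  assumes "g \<in> carrier G" "Y \<in> obj C" shows "is_iso C (ind_action Y g)"
proof (rule direct_sum_diagonal_iso[OF finite_G rho_ind_sum[OF assms], where \<phi> = "\<lambda>x. rho2 A g x Y"])
  let ?\<sigma> = "\<lambda>x. x \<otimes>\<^bsub>G\<^esub> g"
  have inj: "x \<otimes>\<^bsub>G\<^esub> g = y \<otimes>\<^bsub>G\<^esub> g \<longleftrightarrow> x = y" if "x \<in> carrier G" "y \<in> carrier G" for x y
    using that assms by (simp add: G.right_cancel)
  have "hsum (ind Y) (ind Y) (\<lambda>x. \<iota> (?\<sigma> x) Y \<cdot> \<pi> (?\<sigma> x) Y) (carrier G) = idm (ind Y)"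
  proof (rule ind_ext[OF assms(2)])
    fix y assume y: "y \<in> carrier G"
    define x where "x = y \<otimes>\<^bsub>G\<^esub> inv\<^bsub>G\<^esub> g"
    have x: "x \<in> carrier G" "?\<sigma> x = y" using y assms by (simp_all add: x_def G.m_assoc)
    have "hsum (ind Y) (ind Y) (\<lambda>x. \<iota> (?\<sigma> x) Y \<cdot> \<pi> (?\<sigma> x) Y) (carrier G) \<cdot> \<iota> y Y =
        hsum (ro y Y) (ind Y) (\<lambda>x. (\<iota> (?\<sigma> x) Y \<cdot> \<pi> (?\<sigma> x) Y) \<cdot> \<iota> y Y) (carrier G)"
      using assms y finite_G by (subst hsum_cmp) simp_all
    also have "\<dots> = (\<iota> (?\<sigma> x) Y \<cdot> \<pi> (?\<sigma> x) Y) \<cdot> \<iota> y Y"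
    proof (rule hsum_single[where f = "\<lambda>x. (\<iota> (?\<sigma> x) Y \<cdot> \<pi> (?\<sigma> x) Y) \<cdot> \<iota> y Y"])
      fix z assume z: "z \<in> carrier G" "z \<noteq> x"
      then have "?\<sigma> z \<noteq> y" using inj[of z x] x by auto
      then show "(\<iota> (?\<sigma> z) Y \<cdot> \<pi> (?\<sigma> z) Y) \<cdot> \<iota> y Y = hzero C (ro y Y) (ind Y)"
        using ind_zero[OF assms(2), of "?\<sigma> z" y] z y assms by simp
    qed (use assms y x finite_G in simp_all)
    finally show "hsum (ind Y) (ind Y) (\<lambda>x. \<iota> (?\<sigma> x) Y \<cdot> \<pi> (?\<sigma> x) Y) (carrier G) \<cdot> \<iota> y Y = idm (ind Y) \<cdot> \<iota> y Y"
      using x y assms by simp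
  qed (use assms in simp_all)
  then show "is_direct_sum C (carrier G) (\<lambda>x. ro (?\<sigma> x) Y) (ind Y) (\<lambda>x. \<iota> (?\<sigma> x) Y) (\<lambda>x. \<pi> (?\<sigma> x) Y)"
    using assms inj ind_zero[OF assms(2)] by (simp add: is_direct_sum_def)
qed (use assms ind_action_iota in simp_all)

definition induced :: "'o \<Rightarrow> 'o \<times> ('g \<Rightarrow> 'm)" where
  "induced Y = (ind Y, ind_action Y)"

lemma induced_simps [simp]: "fst (induced Y) = ind Y" "snd (induced Y) = ind_action Y"
  by (simp_all add: induced_def)

lemma induced_obj [simp]:
  assumes "Y \<in> obj C" shows "induced Y \<in> obj Q"
  unfolding induced_def
proof (rule Q_objI)
  show "ind_action Y g \<cdot> ra g (ind_action Y h) = ind_action Y (h \<otimes>\<^bsub>G\<^esub> g) \<cdot> rho2 A g h (ind Y)"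
    if h: "g \<in> carrier G" "h \<in> carrier G" for g h
  proof (rule direct_sum_ext_src[OF finite_G functor_direct_sum[OF linear_category_axioms rho_linear[OF h(1)] finite_G rho_ind_sum[OF h(2) assms]]])
    fix x assume x: "x \<in> carrier G"
    have "(ind_action Y g \<cdot> ra g (ind_action Y h)) \<cdot> ra g (ra h (\<iota> x Y)) = ind_action Y g \<cdot> ra g (ind_action Y h \<cdot> ra h (\<iota> x Y))"
      using h x assms by (simp add: ra_cmp)
    also have "\<dots> = \<iota> ((x \<otimes>\<^bsub>G\<^esub> h) \<otimes>\<^bsub>G\<^esub> g) Y \<cdot> rho2 A g (x \<otimes>\<^bsub>G\<^esub> h) Y \<cdot> ra g (rho2 A h x Y)"
      using h x assms by (simp add: ind_action_iota ind_action_iota_cmp ra_cmp)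
    also have "rho2 A g (x \<otimes>\<^bsub>G\<^esub> h) Y \<cdot> ra g (rho2 A h x Y) = rho2 A (h \<otimes>\<^bsub>G\<^esub> g) x Y \<cdot> rho2 A g h (ro x Y)"
      using rho2_assoc[OF h x assms] by simp
    also have "\<iota> ((x \<otimes>\<^bsub>G\<^esub> h) \<otimes>\<^bsub>G\<^esub> g) Y \<cdot> \<dots> = ind_action Y (h \<otimes>\<^bsub>G\<^esub> g) \<cdot> ra (h \<otimes>\<^bsub>G\<^esub> g) (\<iota> x Y) \<cdot> rho2 A g h (ro x Y)"
      using h x assms by (simp add: ind_action_iota_cmp G.m_assoc)
    also have "\<dots> = (ind_action Y (h \<otimes>\<^bsub>G\<^esub> g) \<cdot> rho2 A g h (ind Y)) \<cdot> ra g (ra h (\<iota> x Y))"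
      using rho2(5)[OF h, of "\<iota> x Y"] h x assms by simp
    finally show "(ind_action Y g \<cdot> ra g (ind_action Y h)) \<cdot> ra g (ra h (\<iota> x Y)) =
        (ind_action Y (h \<otimes>\<^bsub>G\<^esub> g) \<cdot> rho2 A g h (ind Y)) \<cdot> ra g (ra h (\<iota> x Y))" .
  qed (use h assms in simp_all)
  show "ind_action Y \<one>\<^bsub>G\<^esub> \<cdot> rho0 A (ind Y) = idm (ind Y)"
  proof (rule ind_ext[OF assms])
    fix x assume x: "x \<in> carrier G"
    have "(ind_action Y \<one>\<^bsub>G\<^esub> \<cdot> rho0 A (ind Y)) \<cdot> \<iota> x Y = ind_action Y \<one>\<^bsub>G\<^esub> \<cdot> ra \<one>\<^bsub>G\<^esub> (\<iota> x Y) \<cdot> rho0 A (ro x Y)"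
      using rho0(5)[of "\<iota> x Y"] x assms by simp
    also have "\<dots> = \<iota> x Y" using x assms rho2_one_left[OF x assms] by (simp add: ind_action_iota_cmp)
    finally show "(ind_action Y \<one>\<^bsub>G\<^esub> \<cdot> rho0 A (ind Y)) \<cdot> \<iota> x Y = idm (ind Y) \<cdot> \<iota> x Y" using x assms by simp
  qed (use assms in simp_all)
qed (use assms ind_action_iso in \<open>simp_all add: ind_action_def\<close>)

lemma Ind_arr [simp]:
  assumes "f \<in> arr C" shows "(induced (src C f), induced (tgt C f), farr Ind f) \<in> arr Q"
proof -
  have "farr Ind f \<cdot> ind_action (src C f) g = ind_action (tgt C f) g \<cdot> ra g (farr Ind f)" if g: "g \<in> carrier G" for g
  proof (rule direct_sum_ext_src[OF finite_G rho_ind_sum[OF g, of "src C f"]])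
    fix x assume x: "x \<in> carrier G"
    have "(ind_action (tgt C f) g \<cdot> ra g (farr Ind f)) \<cdot> ra g (\<iota> x (src C f)) = ind_action (tgt C f) g \<cdot> ra g (farr Ind f \<cdot> \<iota> x (src C f))"
      using x g assms by (simp add: ra_cmp)
    also have "\<dots> = \<iota> (x \<otimes>\<^bsub>G\<^esub> g) (tgt C f) \<cdot> rho2 A g x (tgt C f) \<cdot> ra g (ra x f)"
      using x g assms by (simp add: Ind_iota ra_cmp ind_action_iota_cmp)
    also have "\<dots> = (\<iota> (x \<otimes>\<^bsub>G\<^esub> g) (tgt C f) \<cdot> ra (x \<otimes>\<^bsub>G\<^esub> g) f) \<cdot> rho2 A g x (src C f)"
      using rho2(5)[OF g x assms] x g assms by simp
    also have "\<dots> = (farr Ind f \<cdot> \<iota> (x \<otimes>\<^bsub>G\<^esub> g) (src C f)) \<cdot> rho2 A g x (src C f)"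
      using x g assms Ind_iota[of f "x \<otimes>\<^bsub>G\<^esub> g"] by simp
    also have "\<dots> = (farr Ind f \<cdot> ind_action (src C f) g) \<cdot> ra g (\<iota> x (src C f))"
      using x g assms by (simp add: ind_action_iota)
    finally show "(farr Ind f \<cdot> ind_action (src C f) g) \<cdot> ra g (\<iota> x (src C f)) =
      (ind_action (tgt C f) g \<cdot> ra g (farr Ind f)) \<cdot> ra g (\<iota> x (src C f))" by simp
  qed (use g assms in simp_all)
  then show ?thesis using assms by (simp add: Q_arr_iff)
qed

text \<open>The projection formula: inducing commutes, equivariantly, with tensoring by an equivariant object.\<close>

lemma Ind_mconstr_arr [simp]:
  assumes "V \<in> obj Q" "Y \<in> obj C" shows "(induced (fst V \<boxtimes> Y), V \<boxtimes>\<^bsub>Q\<^esub> induced Y, mconstr Ind V Y) \<in> arr Q"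
proof -
  let ?k = "mconstr Ind V Y" and ?VY = "fst V \<boxtimes> Y"
  have k: "?k \<in> arr C" "src C ?k = ind ?VY" "tgt C ?k = fst V \<boxtimes> ind Y"
    using E.mconstr[OF Ind_obj assms] assms by simp_all
  have "?k \<cdot> ind_action ?VY g = snd (V \<boxtimes>\<^bsub>Q\<^esub> induced Y) g \<cdot> ra g ?k" if g: "g \<in> carrier G" for g
  proof (rule direct_sum_ext_src[OF finite_G rho_ind_sum[OF g, of ?VY]])
    fix x assume x: "x \<in> carrier G"
    have xg: "x \<otimes>\<^bsub>G\<^esub> g \<in> carrier G" using x g by simp
    have "(snd (V \<boxtimes>\<^bsub>Q\<^esub> induced Y) g \<cdot> ra g ?k) \<cdot> ra g (\<iota> x ?VY) =
        (idm (fst V) \<boxtimes>\<^sub>m ind_action Y g) \<cdot> crossing g V (ind Y) \<cdot> ra g (?k \<cdot> \<iota> x ?VY)"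
      using x g assms k by (simp add: ra_cmp)
    also have "\<dots> = (idm (fst V) \<boxtimes>\<^sub>m ind_action Y g) \<cdot> (crossing g V (ind Y) \<cdot> ra g (idm (fst V) \<boxtimes>\<^sub>m \<iota> x Y)) \<cdot> ra g (crossing x V Y)"
      using x g assms k by (simp add: Ind_mconstr_iota ra_cmp)
    also have "crossing g V (ind Y) \<cdot> ra g (idm (fst V) \<boxtimes>\<^sub>m \<iota> x Y) = (idm (fst V) \<boxtimes>\<^sub>m ra g (\<iota> x Y)) \<cdot> crossing g V (ro x Y)"
      using crossing_natural_right[OF g assms(1), of "\<iota> x Y"] x g assms by simp
    also have "(idm (fst V) \<boxtimes>\<^sub>m ind_action Y g) \<cdot> \<dots> \<cdot> ra g (crossing x V Y) =
        (idm (fst V) \<boxtimes>\<^sub>m \<iota> (x \<otimes>\<^bsub>G\<^esub> g) Y) \<cdot> (idm (fst V) \<boxtimes>\<^sub>m rho2 A g x Y) \<cdot> crossing g V (ro x Y) \<cdot> ra g (crossing x V Y)"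
      using x g assms by (simp add: T.interchange_cmp ind_action_iota)
    also have "\<dots> = (idm (fst V) \<boxtimes>\<^sub>m \<iota> (x \<otimes>\<^bsub>G\<^esub> g) Y) \<cdot> crossing (x \<otimes>\<^bsub>G\<^esub> g) V Y \<cdot> rho2 A g x ?VY"
      using crossing_rho2[OF g x assms] by simp
    also have "\<dots> = (?k \<cdot> ind_action ?VY g) \<cdot> ra g (\<iota> x ?VY)"
      using x g xg assms k extend[OF Ind_mconstr_iota[OF assms xg], of "rho2 A g x ?VY"] by (simp add: ind_action_iota)
    finally show "(?k \<cdot> ind_action ?VY g) \<cdot> ra g (\<iota> x ?VY) = (snd (V \<boxtimes>\<^bsub>Q\<^esub> induced Y) g \<cdot> ra g ?k) \<cdot> ra g (\<iota> x ?VY)" by simp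
  qed (use g assms k in simp_all)
  then show ?thesis using assms k by (simp add: Q_arr_iff)
qed

text \<open>Up to \<open>\<rho>\<^sub>0\<close>, the object \<open>Y\<close> is the summand at \<open>1\<close> of the object induced from it.\<close>

definition unit_ind :: "'o \<Rightarrow> 'm" where "unit_ind Y = \<iota> \<one>\<^bsub>G\<^esub> Y \<cdot> rho0 A Y"
definition counit_ind :: "'o \<Rightarrow> 'm" where "counit_ind Y = inv_arr (rho0 A Y) \<cdot> \<pi> \<one>\<^bsub>G\<^esub> Y"

lemma unit_ind [simp]:
  assumes "Y \<in> obj C"
  shows "unit_ind Y \<in> arr C" "src C (unit_ind Y) = Y" "tgt C (unit_ind Y) = ind Y"
    "counit_ind Y \<in> arr C" "src C (counit_ind Y) = ind Y" "tgt C (counit_ind Y) = Y"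
    "counit_ind Y \<cdot> unit_ind Y = idm Y"
  using assms ind_cancel(1)[OF assms, of "\<one>\<^bsub>G\<^esub>" "rho0 A Y"] by (simp_all add: unit_ind_def counit_ind_def)

lemma Ind_pi_arr: "x \<in> carrier G \<Longrightarrow> (Ind, T x, \<lambda>Y\<in>obj C. \<pi> x Y) \<in> arr B"
  by (rule E.B.direct_sumD(7)[OF E.sum_functor_direct_sum[OF finite_G T_obj]])

lemma Ind_pi:
  assumes "x \<in> carrier G" "f \<in> arr C" shows "\<pi> x (tgt C f) \<cdot> farr Ind f = ra x f \<cdot> \<pi> x (src C f)"
  using E.arr_natural[OF Ind_pi_arr[OF assms(1)] assms(2)] assms by simp

lemma Ind_mconstr_pi:
  assumes "x \<in> carrier G" "V \<in> obj Q" "Y \<in> obj C"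
  shows "(idm (fst V) \<boxtimes>\<^sub>m \<pi> x Y) \<cdot> mconstr Ind V Y = crossing x V Y \<cdot> \<pi> x (fst V \<boxtimes> Y)"
  using E.arr_module[OF Ind_pi_arr[OF assms(1)] assms(2,3)] assms by simp

lemma unit_ind_natural:
  assumes "f \<in> arr C"
  shows "farr Ind f \<cdot> unit_ind (src C f) = unit_ind (tgt C f) \<cdot> f"
    "counit_ind (tgt C f) \<cdot> farr Ind f = f \<cdot> counit_ind (src C f)"
proof -
  show "farr Ind f \<cdot> unit_ind (src C f) = unit_ind (tgt C f) \<cdot> f"
    using assms rho0(5)[OF assms] extend[OF Ind_iota[OF assms, of "\<one>\<^bsub>G\<^esub>" "src C f"], of "rho0 A (src C f)"]
    by (simp add: unit_ind_def)
  have "inv_arr (rho0 A (tgt C f)) \<cdot> ra \<one>\<^bsub>G\<^esub> f = f \<cdot> inv_arr (rho0 A (src C f))"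
    by (rule iso_cancel_right[of "rho0 A (src C f)"]) (use assms rho0(5)[OF assms, symmetric] in simp_all)
  from extend[OF this, of "\<pi> \<one>\<^bsub>G\<^esub> (src C f)"]
  show "counit_ind (tgt C f) \<cdot> farr Ind f = f \<cdot> counit_ind (src C f)"
    using assms Ind_pi[of "\<one>\<^bsub>G\<^esub>" f] by (simp add: counit_ind_def)
qed

lemma unit_ind_module:
  assumes "V \<in> obj Q" "Y \<in> obj C"
  shows "mconstr Ind V Y \<cdot> unit_ind (fst V \<boxtimes> Y) = idm (fst V) \<boxtimes>\<^sub>m unit_ind Y"
    "(idm (fst V) \<boxtimes>\<^sub>m counit_ind Y) \<cdot> mconstr Ind V Y = counit_ind (fst V \<boxtimes> Y)"
proof -
  have k: "mconstr Ind V Y \<in> arr C" "src C (mconstr Ind V Y) = ind (fst V \<boxtimes> Y)" "tgt C (mconstr Ind V Y) = fst V \<boxtimes> ind Y"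
    using E.mconstr[OF Ind_obj assms] assms by simp_all
  show "mconstr Ind V Y \<cdot> unit_ind (fst V \<boxtimes> Y) = idm (fst V) \<boxtimes>\<^sub>m unit_ind Y"
    using assms k crossing_rho0[OF assms] extend[OF Ind_mconstr_iota[OF assms, of "\<one>\<^bsub>G\<^esub>"], of "rho0 A (fst V \<boxtimes> Y)"]
    by (simp add: unit_ind_def T.interchange)
  have "(idm (fst V) \<boxtimes>\<^sub>m inv_arr (rho0 A Y)) \<cdot> crossing \<one>\<^bsub>G\<^esub> V Y = inv_arr (rho0 A (fst V \<boxtimes> Y))"
    by (rule iso_cancel_right[of "rho0 A (fst V \<boxtimes> Y)"]) (use assms crossing_rho0[OF assms] in \<open>simp_all add: T.interchange\<close>)
  from extend[OF this, of "\<pi> \<one>\<^bsub>G\<^esub> (fst V \<boxtimes> Y)"]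
  have "(idm (fst V) \<boxtimes>\<^sub>m inv_arr (rho0 A Y)) \<cdot> (idm (fst V) \<boxtimes>\<^sub>m \<pi> \<one>\<^bsub>G\<^esub> Y) \<cdot> mconstr Ind V Y = counit_ind (fst V \<boxtimes> Y)"
    using assms Ind_mconstr_pi[of "\<one>\<^bsub>G\<^esub>", OF _ assms] by (simp add: counit_ind_def)
  then show "(idm (fst V) \<boxtimes>\<^sub>m counit_ind Y) \<cdot> mconstr Ind V Y = counit_ind (fst V \<boxtimes> Y)"
    using assms k by (simp add: counit_ind_def T.interchange_cmp)
qed

text \<open>
  The module structure determines a transformation at an equivariant object from its component at the
  unit, and every object is a retract of an induced one.
\<close>

lemma eq_at_tunit:
  assumes "a \<in> arr B" "b \<in> arr B" "fst a = fst b" "fst (snd a) = fst (snd b)" "E.comp a (tunit C) = E.comp b (tunit C)"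
  shows "a = b"
proof (rule E.arr_eqI[OF assms(1-4)])
  note s = E.arrD[OF assms(1)] E.arrD[OF assms(2)]
  have equi: "E.comp a (fst V) = E.comp b (fst V)" if V: "V \<in> obj Q" for V
  proof -
    have "mconstr (fst (snd b)) V (tunit C) \<cdot> E.comp a (fst V) = mconstr (fst (snd b)) V (tunit C) \<cdot> E.comp b (fst V)"
      using E.arr_module[OF assms(1) V, of "tunit C"] E.arr_module[OF assms(2) V, of "tunit C"] assms(3-5) V by simp
    then show ?thesis using s V assms(3,4) by - (rule iso_cancel_left; simp)
  qed
  fix Y assume Y: "Y \<in> obj C"
  have *: "E.comp c Y = farr (fst (snd c)) (counit_ind Y) \<cdot> E.comp c (ind Y) \<cdot> farr (fst c) (unit_ind Y)" if c: "c \<in> arr B" for c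
  proof -
    have "farr (fst (snd c)) (counit_ind Y) \<cdot> E.comp c (ind Y) = E.comp c Y \<cdot> farr (fst c) (counit_ind Y)"
      using E.arr_natural[OF c, of "counit_ind Y"] Y by simp
    from extend[OF this, of "farr (fst c) (unit_ind Y)"]
    have "farr (fst (snd c)) (counit_ind Y) \<cdot> E.comp c (ind Y) \<cdot> farr (fst c) (unit_ind Y) =
        E.comp c Y \<cdot> farr (fst c) (counit_ind Y \<cdot> unit_ind Y)"
      using E.arrD[OF c] Y by (simp del: unit_ind(7))
    then show ?thesis using E.arrD[OF c] Y by simp
  qed
  show "E.comp a Y = E.comp b Y"
    using *[OF assms(1)] *[OF assms(2)] equi[OF induced_obj[OF Y]] assms(3,4) by simp
qed

subsection \<open>Homogeneous functors\<close>

text \<open>The functor \<open>\<Phi> g X\<close> sends \<open>Y\<close> to the tensor product of \<open>\<rho>\<close> at \<open>g\<close> of \<open>Y\<close> with \<open>X\<close>.\<close>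

definition \<Phi> :: "'g \<Rightarrow> ('o, 'm, (('g, 'o, 'm) equiv_obj, 'o, 'm) mod_functor, (('g, 'o, 'm) equiv_obj, 'o, 'm) mod_transf) cat_functor" where
  "\<Phi> g = \<lparr>fobj = \<lambda>X. T g \<boxtimes>\<^bsub>B\<^esub> R X, farr = \<lambda>f. ident B (T g) \<boxtimes>\<^sub>m\<^bsub>B\<^esub> farr emb f\<rparr>"

lemma \<Phi>_simps [simp]:
  "fobj (\<Phi> g) X = T g \<boxtimes>\<^bsub>B\<^esub> R X" "farr (\<Phi> g) f = ident B (T g) \<boxtimes>\<^sub>m\<^bsub>B\<^esub> farr emb f"
  by (simp_all add: \<Phi>_def)

lemma \<Phi>_linear:
  assumes "g \<in> carrier G" shows "linear_functor C B (\<Phi> g)"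
  unfolding linear_functor_def
proof (intro conjI ballI allI impI)
  note s = functor_simps[OF emb_linear] and T = T_obj[OF assms]
  show "farr (\<Phi> g) (idm X) = ident B (fobj (\<Phi> g) X)" if "X \<in> obj C" for X
    using s(5)[OF that] that T by simp
  show "farr (\<Phi> g) (k \<cdot> f) = farr (\<Phi> g) k \<cdot>\<^bsub>B\<^esub> farr (\<Phi> g) f" if "f \<in> arr C" "k \<in> arr C" "src C k = tgt C f" for f k
    using s(6)[OF that] that T E.B.interchange[of "ident B (T g)" "ident B (T g)" "farr emb f" "farr emb k"] by simp
  show "farr (\<Phi> g) (hadd C f k) = hadd B (farr (\<Phi> g) f) (farr (\<Phi> g) k)"
    if "X \<in> obj C" "Y \<in> obj C" "f \<in> Hom C X Y" "k \<in> Hom C X Y" for X Y f k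
    using s(7)[of f k] that T E.B.tarr_hadd(2)[of "ident B (T g)" "farr emb f" "farr emb k"] by simp
  show "farr (\<Phi> g) (hscale C a f) = hscale B a (farr (\<Phi> g) f)" if "f \<in> arr C" for f a
    using s(8)[OF that] that T E.B.tarr_hscale(2)[of "ident B (T g)" "farr emb f"] by simp
qed (use T_obj[OF assms] in simp_all)

lemma \<Phi>_comp:
  assumes "g \<in> carrier G" "f \<in> arr C" "Y \<in> obj C" shows "E.comp (farr (\<Phi> g) f) Y = idm (ro g Y) \<boxtimes>\<^sub>m f"
  using assms by (simp add: T.interchange)

text \<open>
  As \<open>\<rho>\<close> preserves the unit up to \<open>\<gamma>\<^sub>0\<close>, the component at the unit of a transformation from \<open>\<Phi> g X\<close> to
  \<open>\<Phi> h Y\<close> amounts to an arrow from \<open>X\<close> to \<open>Y\<close>.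
\<close>

definition core :: "'g \<Rightarrow> 'g \<Rightarrow> 'o \<Rightarrow> 'o \<Rightarrow> (('g, 'o, 'm) equiv_obj, 'o, 'm) mod_transf \<Rightarrow> 'm" where
  "core g h X Y a = (gam0 A h \<boxtimes>\<^sub>m idm Y) \<cdot> E.comp a (tunit C) \<cdot> (inv_arr (gam0 A g) \<boxtimes>\<^sub>m idm X)"

text \<open>The last claim expresses the component at an equivariant object by the core, through the module structure.\<close>

lemma core:
  assumes "g \<in> carrier G" "h \<in> carrier G" "X \<in> obj C" "Y \<in> obj C" "a \<in> arr B" "fst a = T g \<boxtimes>\<^bsub>B\<^esub> R X"
    "fst (snd a) = T h \<boxtimes>\<^bsub>B\<^esub> R Y"
  shows "core g h X Y a \<in> arr C" "src C (core g h X Y a) = X" "tgt C (core g h X Y a) = Y"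
    "E.comp a (tunit C) = (inv_arr (gam0 A h) \<boxtimes>\<^sub>m idm Y) \<cdot> core g h X Y a \<cdot> (gam0 A g \<boxtimes>\<^sub>m idm X)"
    "V \<in> obj Q \<Longrightarrow> (snd V h \<boxtimes>\<^sub>m idm Y) \<cdot> E.comp a (fst V) = (idm (fst V) \<boxtimes>\<^sub>m core g h X Y a) \<cdot> (snd V g \<boxtimes>\<^sub>m idm X)"
proof -
  note s = E.arrD[OF assms(5)]
  have a: "E.comp a Z \<in> arr C" "src C (E.comp a Z) = ro g Z \<boxtimes> X" "tgt C (E.comp a Z) = ro h Z \<boxtimes> Y" if "Z \<in> obj C" for Z
    using s that assms by simp_all
  note a1 = a[OF T.tunit_closed]
  show c: "core g h X Y a \<in> arr C" "src C (core g h X Y a) = X" "tgt C (core g h X Y a) = Y"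
    using assms(1-4) a1 by (simp_all add: core_def)
  show e: "E.comp a (tunit C) = (inv_arr (gam0 A h) \<boxtimes>\<^sub>m idm Y) \<cdot> core g h X Y a \<cdot> (gam0 A g \<boxtimes>\<^sub>m idm X)"
    unfolding core_def using assms(1-4) a1 by (simp add: T.interchange T.interchange_cmp)
  assume V: "V \<in> obj Q"
  have m: "(idm (fst V) \<boxtimes>\<^sub>m E.comp a (tunit C)) \<cdot> (crossing g V (tunit C) \<boxtimes>\<^sub>m idm X) =
      (crossing h V (tunit C) \<boxtimes>\<^sub>m idm Y) \<cdot> E.comp a (fst V)"
    using E.arr_module[OF assms(5) V, of "tunit C"] assms(1-4,6,7) V a[of "fst V"] by simp
  have k: "((idm (fst V) \<boxtimes>\<^sub>m gam0 A x) \<boxtimes>\<^sub>m idm W) \<cdot> (crossing x V (tunit C) \<boxtimes>\<^sub>m idm W) = snd V x \<boxtimes>\<^sub>m idm W"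
    if "x \<in> carrier G" "W \<in> obj C" for x W
    using crossing_at_tunit[OF that(1) V] that V T.interchange[of "crossing x V (tunit C)" "idm (fst V) \<boxtimes>\<^sub>m gam0 A x" "idm W" "idm W"] by simp
  have "(snd V h \<boxtimes>\<^sub>m idm Y) \<cdot> E.comp a (fst V) =
      ((idm (fst V) \<boxtimes>\<^sub>m gam0 A h) \<boxtimes>\<^sub>m idm Y) \<cdot> (crossing h V (tunit C) \<boxtimes>\<^sub>m idm Y) \<cdot> E.comp a (fst V)"
    by (rule extend[OF k, symmetric]) (use assms(1-4) V a[of "fst V"] in simp_all)
  also have "\<dots> = (idm (fst V) \<boxtimes>\<^sub>m ((gam0 A h \<boxtimes>\<^sub>m idm Y) \<cdot> E.comp a (tunit C))) \<cdot> (crossing g V (tunit C) \<boxtimes>\<^sub>m idm X)"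
    unfolding m[symmetric] using assms(1-4) V a1 by (simp add: T.interchange_cmp)
  also have "(gam0 A h \<boxtimes>\<^sub>m idm Y) \<cdot> E.comp a (tunit C) = core g h X Y a \<cdot> (gam0 A g \<boxtimes>\<^sub>m idm X)"
    unfolding e using assms(1-4) c by (simp add: T.interchange_cmp)
  also have "(idm (fst V) \<boxtimes>\<^sub>m (core g h X Y a \<cdot> (gam0 A g \<boxtimes>\<^sub>m idm X))) \<cdot> (crossing g V (tunit C) \<boxtimes>\<^sub>m idm X) =
      (idm (fst V) \<boxtimes>\<^sub>m core g h X Y a) \<cdot> ((idm (fst V) \<boxtimes>\<^sub>m gam0 A g) \<boxtimes>\<^sub>m idm X) \<cdot> (crossing g V (tunit C) \<boxtimes>\<^sub>m idm X)"
    using assms(1-4) c V by (simp add: T.interchange_cmp)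
  also have "((idm (fst V) \<boxtimes>\<^sub>m gam0 A g) \<boxtimes>\<^sub>m idm X) \<cdot> (crossing g V (tunit C) \<boxtimes>\<^sub>m idm X) = snd V g \<boxtimes>\<^sub>m idm X"
    by (rule k[OF assms(1,3)])
  finally show "(snd V h \<boxtimes>\<^sub>m idm Y) \<cdot> E.comp a (fst V) = (idm (fst V) \<boxtimes>\<^sub>m core g h X Y a) \<cdot> (snd V g \<boxtimes>\<^sub>m idm X)" .
qed

lemma \<Phi>_fully_faithful:
  assumes "g \<in> carrier G" shows "fully_faithful C B (\<Phi> g)"
  unfolding fully_faithful_def
proof (intro ballI)
  fix X Y assume XY: "X \<in> obj C" "Y \<in> obj C"
  note l = functor_simps[OF \<Phi>_linear[OF assms]]
  show "bij_betw (farr (\<Phi> g)) (Hom C X Y) (Hom B (fobj (\<Phi> g) X) (fobj (\<Phi> g) Y))"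
  proof (rule bij_betw_imageI)
    show "inj_on (farr (\<Phi> g)) (Hom C X Y)"
    proof (rule inj_onI)
      fix f k assume h: "f \<in> Hom C X Y" "k \<in> Hom C X Y" "farr (\<Phi> g) f = farr (\<Phi> g) k"
      have "idm (ro g (tunit C)) \<boxtimes>\<^sub>m f = idm (ro g (tunit C)) \<boxtimes>\<^sub>m k"
        using \<Phi>_comp[OF assms, of f "tunit C"] \<Phi>_comp[OF assms, of k "tunit C"] h by (simp del: \<Phi>_simps)
      then have "(gam0 A g \<boxtimes>\<^sub>m idm Y) \<cdot> (idm (ro g (tunit C)) \<boxtimes>\<^sub>m f) \<cdot> (inv_arr (gam0 A g) \<boxtimes>\<^sub>m idm X) =
         (gam0 A g \<boxtimes>\<^sub>m idm Y) \<cdot> (idm (ro g (tunit C)) \<boxtimes>\<^sub>m k) \<cdot> (inv_arr (gam0 A g) \<boxtimes>\<^sub>m idm X)" by simp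
      then show "f = k" using h(1,2) XY assms by (simp add: T.interchange)
    qed
    show "farr (\<Phi> g) ` Hom C X Y = Hom B (fobj (\<Phi> g) X) (fobj (\<Phi> g) Y)"
    proof (intro equalityI subsetI)
      fix a assume "a \<in> farr (\<Phi> g) ` Hom C X Y"
      then show "a \<in> Hom B (fobj (\<Phi> g) X) (fobj (\<Phi> g) Y)" using l(2-4) by (auto simp del: \<Phi>_simps)
    next
      fix a assume "a \<in> Hom B (fobj (\<Phi> g) X) (fobj (\<Phi> g) Y)"
      then have a: "a \<in> arr B" "fst a = T g \<boxtimes>\<^bsub>B\<^esub> R X" "fst (snd a) = T g \<boxtimes>\<^bsub>B\<^esub> R Y" by simp_all
      note c = core[OF assms assms XY a]
      have "farr (\<Phi> g) (core g g X Y a) = a"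
      proof (rule eq_at_tunit)
        show "E.comp (farr (\<Phi> g) (core g g X Y a)) (tunit C) = E.comp a (tunit C)"
          unfolding c(4) \<Phi>_comp[OF assms c(1) T.tunit_closed] using c(1-3) XY assms
            T.interchange_cmp[of "idm (tunit C)" "inv_arr (gam0 A g)" "core g g X Y a" "idm Y" "gam0 A g \<boxtimes>\<^sub>m idm X"]
          by (simp add: T.interchange)
      qed (use a c l(2) in simp_all)
      then show "a \<in> farr (\<Phi> g) ` Hom C X Y" using c(1-3) by (intro image_eqI[of _ _ "core g g X Y a"]) simp_all
    qed
  qed
qed

text \<open>
  Evaluate at the object induced from the unit, and let \<open>e x\<close> be the idempotent of its summand at \<open>x\<close>.
  Naturality for \<open>e 1\<close>, transported by the actions of \<open>g\<close> and \<open>h\<close>, becomes \<open>e g \<otimes> u = e h \<otimes> u\<close> for the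
  core \<open>u\<close> of the transformation.  As \<open>e g\<close> and \<open>e h\<close> belong to different summands, \<open>u\<close> is zero.
\<close>

lemma \<Phi>_orthogonal:
  assumes "g \<in> carrier G" "h \<in> carrier G" "g \<noteq> h" "X \<in> obj C" "Y \<in> obj C" "a \<in> arr B"
    "fst a = T g \<boxtimes>\<^bsub>B\<^esub> R X" "fst (snd a) = T h \<boxtimes>\<^bsub>B\<^esub> R Y"
  shows "a = hzero B (T g \<boxtimes>\<^bsub>B\<^esub> R X) (T h \<boxtimes>\<^bsub>B\<^esub> R Y)"
proof -
  let ?V = "induced (tunit C)" and ?u = "core g h X Y a" and ?e = "\<lambda>x. \<iota> x (tunit C) \<cdot> \<pi> x (tunit C)"
  note c = core[OF assms(1,2,4-8)]
  have V: "?V \<in> obj Q" by simp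
  let ?I = "ind (tunit C)" and ?r = "ind_action (tunit C)"
  have I: "?I \<in> obj C" by simp
  have av: "E.comp a ?I \<in> arr C" "src C (E.comp a ?I) = ro g ?I \<boxtimes> X" "tgt C (E.comp a ?I) = ro h ?I \<boxtimes> Y"
    using E.arrD[OF assms(6)] assms I by simp_all
  have e: "?e x \<in> arr C" "src C (?e x) = ?I" "tgt C (?e x) = ?I" if "x \<in> carrier G" for x using that by simp_all
  have re: "?r k \<cdot> ra k (?e \<one>\<^bsub>G\<^esub>) = ?e k \<cdot> ?r k" if k: "k \<in> carrier G" for k
    using k ind_action_pi[OF k T.tunit_closed, of "\<one>\<^bsub>G\<^esub>"] by (simp add: ra_cmp ind_action_iota_cmp)
  have 1: "(?r h \<boxtimes>\<^sub>m idm Y) \<cdot> E.comp a ?I = (idm ?I \<boxtimes>\<^sub>m ?u) \<cdot> (?r g \<boxtimes>\<^sub>m idm X)"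
    using c(5)[OF V] by simp
  have "E.comp a ?I \<cdot> (ra g x \<boxtimes>\<^sub>m idm X) = (ra h x \<boxtimes>\<^sub>m idm Y) \<cdot> E.comp a ?I" if "x \<in> arr C" "src C x = ?I" "tgt C x = ?I" for x
    using E.arr_natural[OF assms(6) that(1)] assms that by simp
  note n = this[OF e[OF G.one_closed]]
  have "(?e h \<boxtimes>\<^sub>m ?u) \<cdot> (?r g \<boxtimes>\<^sub>m idm X) = (?e h \<boxtimes>\<^sub>m idm Y) \<cdot> (?r h \<boxtimes>\<^sub>m idm Y) \<cdot> E.comp a ?I"
    unfolding 1 using e[OF assms(2)] c(1-3) assms(1,2,4,5) I by (simp add: T.interchange_cmp T.interchange)
  also have "\<dots> = ((?r h \<cdot> ra h (?e \<one>\<^bsub>G\<^esub>)) \<boxtimes>\<^sub>m idm Y) \<cdot> E.comp a ?I"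
    unfolding re[OF assms(2)] using e[OF assms(2)] assms(1,2,4,5) I av by (simp add: T.interchange_cmp)
  also have "\<dots> = (?r h \<boxtimes>\<^sub>m idm Y) \<cdot> E.comp a ?I \<cdot> (ra g (?e \<one>\<^bsub>G\<^esub>) \<boxtimes>\<^sub>m idm X)"
    unfolding n using e[OF G.one_closed] assms(1,2,4,5) I av by (simp add: T.interchange_cmp)
  also have "\<dots> = ((idm ?I \<boxtimes>\<^sub>m ?u) \<cdot> (?r g \<boxtimes>\<^sub>m idm X)) \<cdot> (ra g (?e \<one>\<^bsub>G\<^esub>) \<boxtimes>\<^sub>m idm X)"
    unfolding 1[symmetric] using e[OF G.one_closed] assms(1,2,4,5) I av by simp
  also have "\<dots> = (idm ?I \<boxtimes>\<^sub>m ?u) \<cdot> ((?r g \<cdot> ra g (?e \<one>\<^bsub>G\<^esub>)) \<boxtimes>\<^sub>m idm X)"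
    using e[OF G.one_closed] assms(1,2,4,5) I c(1-3) T.interchange[of "ra g (?e \<one>\<^bsub>G\<^esub>)" "?r g" "idm X" "idm X"] by simp
  also have "\<dots> = (?e g \<boxtimes>\<^sub>m ?u) \<cdot> (?r g \<boxtimes>\<^sub>m idm X)"
    unfolding re[OF assms(1)] using e[OF assms(1)] assms(1,2,4,5) I c(1-3) by (simp add: T.interchange)
  finally have "?e h \<boxtimes>\<^sub>m ?u = ?e g \<boxtimes>\<^sub>m ?u"
    by - (rule iso_cancel_right[of "?r g \<boxtimes>\<^sub>m idm X"]; use e[OF assms(1)] e[OF assms(2)] c(1-3) assms(1,2,4,5) ind_action_iso I in simp)
  then have "(\<pi> g (tunit C) \<boxtimes>\<^sub>m idm Y) \<cdot> (?e h \<boxtimes>\<^sub>m ?u) \<cdot> (\<iota> g (tunit C) \<boxtimes>\<^sub>m idm X) =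
      (\<pi> g (tunit C) \<boxtimes>\<^sub>m idm Y) \<cdot> (?e g \<boxtimes>\<^sub>m ?u) \<cdot> (\<iota> g (tunit C) \<boxtimes>\<^sub>m idm X)" by simp
  then have z: "hzero C (ro g (tunit C)) (ro g (tunit C)) \<boxtimes>\<^sub>m ?u = idm (ro g (tunit C)) \<boxtimes>\<^sub>m ?u"
    using e[OF assms(1)] e[OF assms(2)] c(1-3) assms(1-5) ind_cancel(1)[OF T.tunit_closed assms(1)]
      ind_zero[OF T.tunit_closed assms(1,2,3)] ind_zero[OF T.tunit_closed assms(2,1)] by (simp add: T.interchange)
  then have z: "idm (ro g (tunit C)) \<boxtimes>\<^sub>m ?u = hzero C (ro g (tunit C) \<boxtimes> X) (ro g (tunit C) \<boxtimes> Y)"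
    using assms(1) c(1-3) by (simp add: T.tarr_hzero)
  have "(gam0 A g \<boxtimes>\<^sub>m idm Y) \<cdot> (idm (ro g (tunit C)) \<boxtimes>\<^sub>m ?u) \<cdot> (inv_arr (gam0 A g) \<boxtimes>\<^sub>m idm X) = ?u"
    using c(1-3) assms(1,4,5) by (simp add: T.interchange)
  then have "?u = hzero C X Y" unfolding z using assms(1,4,5) by simp
  then have "E.comp a (tunit C) = hzero C (ro g (tunit C) \<boxtimes> X) (ro h (tunit C) \<boxtimes> Y)"
    unfolding c(4) using assms(1,2,4,5) by simp
  then show ?thesis by (intro eq_at_tunit) (use assms in simp_all)
qed

subsection \<open>Decomposition of module functors\<close>

text \<open>
  The comparison of \<open>F\<close> with the functors \<open>\<Phi> g (F 1)\<close> goes through the value of \<open>F\<close> on induced objects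
  \<open>V\<close>, where the module structure identifies \<open>F V\<close> with \<open>V \<otimes> F 1\<close>.
\<close>

context
  fixes F :: "(('g, 'o, 'm) equiv_obj, 'o, 'm) mod_functor"
  assumes F: "F \<in> obj B"
begin

lemma at_induced_simps [simp]:
  assumes "Y \<in> obj C"
  shows "mconstr F (induced Y) (tunit C) \<in> arr C" "src C (mconstr F (induced Y) (tunit C)) = fobj F (ind Y)"
    "tgt C (mconstr F (induced Y) (tunit C)) = ind Y \<boxtimes> fobj F (tunit C)" "is_iso C (mconstr F (induced Y) (tunit C))"
    "fobj F (tunit C) \<in> obj C"
  using E.mconstr[OF F induced_obj[OF assms] T.tunit_closed] F assms by simp_all

lemma at_induced_natural:
  assumes "f \<in> arr C"
  shows "mconstr F (induced (tgt C f)) (tunit C) \<cdot> farr F (farr Ind f) =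
    (farr Ind f \<boxtimes>\<^sub>m idm (fobj F (tunit C))) \<cdot> mconstr F (induced (src C f)) (tunit C)"
  using E.mconstr_natural[OF F Ind_arr[OF assms], of "idm (tunit C)"] F assms by simp

lemma at_induced_module:
  assumes "V \<in> obj Q" "Y \<in> obj C"
  shows "(mconstr Ind V Y \<boxtimes>\<^sub>m idm (fobj F (tunit C))) \<cdot> mconstr F (induced (fst V \<boxtimes> Y)) (tunit C) =
    (idm (fst V) \<boxtimes>\<^sub>m mconstr F (induced Y) (tunit C)) \<cdot> mconstr F V (ind Y) \<cdot> farr F (mconstr Ind V Y)"
proof -
  have k: "mconstr Ind V Y \<in> arr C" "src C (mconstr Ind V Y) = ind (fst V \<boxtimes> Y)" "tgt C (mconstr Ind V Y) = fst V \<boxtimes> ind Y"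
    using E.mconstr[OF Ind_obj assms] assms by simp_all
  show ?thesis
    using E.mconstr_natural[OF F Ind_mconstr_arr[OF assms], of "idm (tunit C)"] F assms k
      E.mconstr_tobj[OF F assms(1) induced_obj[OF assms(2)] T.tunit_closed] E.mconstr[OF F assms(1), of "ind Y"] by simp
qed

text \<open>
  The composition \<open>F Y \<rightarrow> F (Ind Y) \<cong> Ind Y \<otimes> F 1\<close>, followed by the projection to the summand at \<open>g\<close>.
\<close>

lemma project_arr:
  assumes "g \<in> carrier G"
  shows "(F, T g \<boxtimes>\<^bsub>B\<^esub> R (fobj F (tunit C)),
    \<lambda>Y\<in>obj C. (\<pi> g Y \<boxtimes>\<^sub>m idm (fobj F (tunit C))) \<cdot> mconstr F (induced Y) (tunit C) \<cdot> farr F (unit_ind Y)) \<in> arr B"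
proof -
  let ?Z = "fobj F (tunit C)" and ?m = "\<lambda>Y. mconstr F (induced Y) (tunit C)"
  have Z: "?Z \<in> obj C" using F by simp
  show ?thesis
  proof (rule E.arrI)
    fix f assume f: "f \<in> arr C"
    have "farr F (unit_ind (tgt C f)) \<cdot> farr F f = farr F (farr Ind f) \<cdot> farr F (unit_ind (src C f))"
      using arg_cong[OF unit_ind_natural(1)[OF f], of "farr F"] f F by simp
    then have "((\<pi> g (tgt C f) \<boxtimes>\<^sub>m idm ?Z) \<cdot> ?m (tgt C f) \<cdot> farr F (unit_ind (tgt C f))) \<cdot> farr F f =
        (\<pi> g (tgt C f) \<boxtimes>\<^sub>m idm ?Z) \<cdot> (?m (tgt C f) \<cdot> farr F (farr Ind f)) \<cdot> farr F (unit_ind (src C f))"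
      using f F assms Z by simp
    also have "\<dots> = ((\<pi> g (tgt C f) \<cdot> farr Ind f) \<boxtimes>\<^sub>m idm ?Z) \<cdot> ?m (src C f) \<cdot> farr F (unit_ind (src C f))"
      unfolding at_induced_natural[OF f] using f F assms Z by (simp add: T.interchange_cmp)
    also have "\<dots> = (ra g f \<boxtimes>\<^sub>m idm ?Z) \<cdot> (\<pi> g (src C f) \<boxtimes>\<^sub>m idm ?Z) \<cdot> ?m (src C f) \<cdot> farr F (unit_ind (src C f))"
      unfolding Ind_pi[OF assms f] using f F assms Z by (simp add: T.interchange_cmp)
    finally show "((\<pi> g (tgt C f) \<boxtimes>\<^sub>m idm ?Z) \<cdot> ?m (tgt C f) \<cdot> farr F (unit_ind (tgt C f))) \<cdot> farr F f =
        farr (T g \<boxtimes>\<^bsub>B\<^esub> R ?Z) f \<cdot> (\<pi> g (src C f) \<boxtimes>\<^sub>m idm ?Z) \<cdot> ?m (src C f) \<cdot> farr F (unit_ind (src C f))"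
      using f F assms Z by simp
  next
    fix V Y assume V: "V \<in> obj Q" and Y: "Y \<in> obj C"
    let ?VY = "fst V \<boxtimes> Y"
    have k: "mconstr Ind V Y \<in> arr C" "src C (mconstr Ind V Y) = ind ?VY" "tgt C (mconstr Ind V Y) = fst V \<boxtimes> ind Y"
      using E.mconstr[OF Ind_obj V Y] V Y by simp_all
    have a: "(crossing g V Y \<boxtimes>\<^sub>m idm ?Z) \<cdot> (\<pi> g ?VY \<boxtimes>\<^sub>m idm ?Z) = ((idm (fst V) \<boxtimes>\<^sub>m \<pi> g Y) \<boxtimes>\<^sub>m idm ?Z) \<cdot> (mconstr Ind V Y \<boxtimes>\<^sub>m idm ?Z)"
      using Ind_mconstr_pi[OF assms V Y] V Y assms Z k T.interchange[of "\<pi> g ?VY" "crossing g V Y" "idm ?Z" "idm ?Z"]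
        T.interchange[of "mconstr Ind V Y" "idm (fst V) \<boxtimes>\<^sub>m \<pi> g Y" "idm ?Z" "idm ?Z"] by simp
    have "(crossing g V Y \<boxtimes>\<^sub>m idm ?Z) \<cdot> (\<pi> g ?VY \<boxtimes>\<^sub>m idm ?Z) \<cdot> ?m ?VY \<cdot> farr F (unit_ind ?VY) =
        ((idm (fst V) \<boxtimes>\<^sub>m \<pi> g Y) \<boxtimes>\<^sub>m idm ?Z) \<cdot> ((mconstr Ind V Y \<boxtimes>\<^sub>m idm ?Z) \<cdot> ?m ?VY) \<cdot> farr F (unit_ind ?VY)"
      using extend[OF a, of "?m ?VY \<cdot> farr F (unit_ind ?VY)"] V Y F assms Z k by simp
    also have "\<dots> = ((idm (fst V) \<boxtimes>\<^sub>m \<pi> g Y) \<boxtimes>\<^sub>m idm ?Z) \<cdot> (idm (fst V) \<boxtimes>\<^sub>m ?m Y) \<cdot> mconstr F V (ind Y) \<cdot> farr F (mconstr Ind V Y \<cdot> unit_ind ?VY)"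
      unfolding at_induced_module[OF V Y] using V Y F assms Z k E.mconstr[OF F V, of "ind Y"] by simp
    also have "mconstr F V (ind Y) \<cdot> farr F (mconstr Ind V Y \<cdot> unit_ind ?VY) = (idm (fst V) \<boxtimes>\<^sub>m farr F (unit_ind Y)) \<cdot> mconstr F V Y"
      unfolding unit_ind_module(1)[OF V Y] using E.mconstr_whisker[OF F V, of "unit_ind Y"] V Y F by simp
    also have "((idm (fst V) \<boxtimes>\<^sub>m \<pi> g Y) \<boxtimes>\<^sub>m idm ?Z) \<cdot> (idm (fst V) \<boxtimes>\<^sub>m ?m Y) \<cdot> \<dots> =
        (idm (fst V) \<boxtimes>\<^sub>m ((\<pi> g Y \<boxtimes>\<^sub>m idm ?Z) \<cdot> ?m Y \<cdot> farr F (unit_ind Y))) \<cdot> mconstr F V Y"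
      using V Y F assms Z E.mconstr[OF F V Y] by (simp add: T.interchange_cmp)
    finally show "E.whisker V ((\<pi> g Y \<boxtimes>\<^sub>m idm ?Z) \<cdot> ?m Y \<cdot> farr F (unit_ind Y)) \<cdot> mconstr F V Y =
        mconstr (T g \<boxtimes>\<^bsub>B\<^esub> R ?Z) V Y \<cdot> (\<pi> g (E.acted V Y) \<boxtimes>\<^sub>m idm ?Z) \<cdot> ?m (E.acted V Y) \<cdot> farr F (unit_ind (E.acted V Y))"
      using V Y F assms Z by simp
  qed (use F assms Z in simp_all)
qed

text \<open>
  The composition from the summand at \<open>g\<close> to \<open>Ind Y \<otimes> F 1 \<cong> F (Ind Y) \<rightarrow> F Y\<close>.
\<close>

lemma inject_arr:
  assumes "g \<in> carrier G"
  shows "(T g \<boxtimes>\<^bsub>B\<^esub> R (fobj F (tunit C)), F,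
    \<lambda>Y\<in>obj C. farr F (counit_ind Y) \<cdot> inv_arr (mconstr F (induced Y) (tunit C)) \<cdot> (\<iota> g Y \<boxtimes>\<^sub>m idm (fobj F (tunit C)))) \<in> arr B"
proof -
  let ?Z = "fobj F (tunit C)" and ?m = "\<lambda>Y. mconstr F (induced Y) (tunit C)"
  have Z: "?Z \<in> obj C" using F by simp
  show ?thesis
  proof (rule E.arrI)
    fix f assume f: "f \<in> arr C"
    have n: "inv_arr (?m (tgt C f)) \<cdot> (farr Ind f \<boxtimes>\<^sub>m idm ?Z) = farr F (farr Ind f) \<cdot> inv_arr (?m (src C f))"
      by (rule iso_cancel_right[of "?m (src C f)"])
        (use f F Z at_induced_natural[OF f, symmetric] in simp_all)
    have c: "farr F (counit_ind (tgt C f)) \<cdot> farr F (farr Ind f) = farr F f \<cdot> farr F (counit_ind (src C f))"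
      using arg_cong[OF unit_ind_natural(2)[OF f], of "farr F"] f F by simp
    have "(\<iota> g (tgt C f) \<boxtimes>\<^sub>m idm ?Z) \<cdot> (ra g f \<boxtimes>\<^sub>m idm ?Z) = (farr Ind f \<boxtimes>\<^sub>m idm ?Z) \<cdot> (\<iota> g (src C f) \<boxtimes>\<^sub>m idm ?Z)"
      using Ind_iota[OF f assms refl] f F assms Z by (simp add: T.interchange)
    then have "(farr F (counit_ind (tgt C f)) \<cdot> inv_arr (?m (tgt C f)) \<cdot> (\<iota> g (tgt C f) \<boxtimes>\<^sub>m idm ?Z)) \<cdot> (ra g f \<boxtimes>\<^sub>m idm ?Z) =
        farr F (counit_ind (tgt C f)) \<cdot> inv_arr (?m (tgt C f)) \<cdot> (farr Ind f \<boxtimes>\<^sub>m idm ?Z) \<cdot> (\<iota> g (src C f) \<boxtimes>\<^sub>m idm ?Z)"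
      using f F assms Z by simp
    also have "\<dots> = farr F f \<cdot> farr F (counit_ind (src C f)) \<cdot> inv_arr (?m (src C f)) \<cdot> (\<iota> g (src C f) \<boxtimes>\<^sub>m idm ?Z)"
      using extend[OF n, of "\<iota> g (src C f) \<boxtimes>\<^sub>m idm ?Z"] extend[OF c, of "inv_arr (?m (src C f)) \<cdot> (\<iota> g (src C f) \<boxtimes>\<^sub>m idm ?Z)"] f F assms Z
      by simp
    finally show "(farr F (counit_ind (tgt C f)) \<cdot> inv_arr (?m (tgt C f)) \<cdot> (\<iota> g (tgt C f) \<boxtimes>\<^sub>m idm ?Z)) \<cdot> farr (T g \<boxtimes>\<^bsub>B\<^esub> R ?Z) f =
        farr F f \<cdot> farr F (counit_ind (src C f)) \<cdot> inv_arr (?m (src C f)) \<cdot> (\<iota> g (src C f) \<boxtimes>\<^sub>m idm ?Z)"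
      using f F assms Z by simp
  next
    fix V Y assume V: "V \<in> obj Q" and Y: "Y \<in> obj C"
    let ?VY = "fst V \<boxtimes> Y"
    have k: "mconstr Ind V Y \<in> arr C" "src C (mconstr Ind V Y) = ind ?VY" "tgt C (mconstr Ind V Y) = fst V \<boxtimes> ind Y"
      using E.mconstr[OF Ind_obj V Y] V Y by simp_all
    note mF = E.mconstr[OF F V Y] E.mconstr[OF F V, of "ind Y"]
    have n: "mconstr F V (ind Y) \<cdot> farr F (mconstr Ind V Y) \<cdot> inv_arr (?m ?VY) = (idm (fst V) \<boxtimes>\<^sub>m inv_arr (?m Y)) \<cdot> (mconstr Ind V Y \<boxtimes>\<^sub>m idm ?Z)"
    proof (rule iso_cancel_left[of "idm (fst V) \<boxtimes>\<^sub>m ?m Y"])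
      show "(idm (fst V) \<boxtimes>\<^sub>m ?m Y) \<cdot> mconstr F V (ind Y) \<cdot> farr F (mconstr Ind V Y) \<cdot> inv_arr (?m ?VY) =
          (idm (fst V) \<boxtimes>\<^sub>m ?m Y) \<cdot> (idm (fst V) \<boxtimes>\<^sub>m inv_arr (?m Y)) \<cdot> (mconstr Ind V Y \<boxtimes>\<^sub>m idm ?Z)"
      proof -
        have "(idm (fst V) \<boxtimes>\<^sub>m ?m Y) \<cdot> mconstr F V (ind Y) \<cdot> farr F (mconstr Ind V Y) \<cdot> inv_arr (?m ?VY) =
            ((idm (fst V) \<boxtimes>\<^sub>m ?m Y) \<cdot> mconstr F V (ind Y) \<cdot> farr F (mconstr Ind V Y)) \<cdot> inv_arr (?m ?VY)"
          using V Y F Z k mF by simp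
        also have "\<dots> = mconstr Ind V Y \<boxtimes>\<^sub>m idm ?Z"
          unfolding at_induced_module[OF V Y, symmetric] using V Y F Z k by simp
        finally show ?thesis using V Y F Z k by (simp add: T.interchange_cmp)
      qed
    qed (use V Y F Z k mF in simp_all)
    have w: "mconstr F V Y \<cdot> farr F (idm (fst V) \<boxtimes>\<^sub>m counit_ind Y) = (idm (fst V) \<boxtimes>\<^sub>m farr F (counit_ind Y)) \<cdot> mconstr F V (ind Y)"
      using E.mconstr_whisker[OF F V, of "counit_ind Y"] V Y by simp
    have "mconstr F V Y \<cdot> farr F (counit_ind ?VY) \<cdot> inv_arr (?m ?VY) \<cdot> (\<iota> g ?VY \<boxtimes>\<^sub>m idm ?Z) =
        (mconstr F V Y \<cdot> farr F (idm (fst V) \<boxtimes>\<^sub>m counit_ind Y)) \<cdot> farr F (mconstr Ind V Y) \<cdot> inv_arr (?m ?VY) \<cdot> (\<iota> g ?VY \<boxtimes>\<^sub>m idm ?Z)"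
      unfolding unit_ind_module(2)[OF V Y, symmetric] using V Y F Z k mF assms by simp
    also have "\<dots> = (idm (fst V) \<boxtimes>\<^sub>m farr F (counit_ind Y)) \<cdot> (mconstr F V (ind Y) \<cdot> farr F (mconstr Ind V Y) \<cdot> inv_arr (?m ?VY)) \<cdot> (\<iota> g ?VY \<boxtimes>\<^sub>m idm ?Z)"
      unfolding w using V Y F Z k mF assms by simp
    also have "\<dots> = (idm (fst V) \<boxtimes>\<^sub>m farr F (counit_ind Y)) \<cdot> (idm (fst V) \<boxtimes>\<^sub>m inv_arr (?m Y)) \<cdot> ((mconstr Ind V Y \<cdot> \<iota> g ?VY) \<boxtimes>\<^sub>m idm ?Z)"
      unfolding n using V Y F Z k mF assms T.interchange[of "\<iota> g ?VY" "mconstr Ind V Y" "idm ?Z" "idm ?Z"] by simp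
    also have "(mconstr Ind V Y \<cdot> \<iota> g ?VY) \<boxtimes>\<^sub>m idm ?Z = (idm (fst V) \<boxtimes>\<^sub>m (\<iota> g Y \<boxtimes>\<^sub>m idm ?Z)) \<cdot> (crossing g V Y \<boxtimes>\<^sub>m idm ?Z)"
      unfolding Ind_mconstr_iota[OF V Y assms]
      using V Y F Z assms T.interchange[of "crossing g V Y" "idm (fst V) \<boxtimes>\<^sub>m \<iota> g Y" "idm ?Z" "idm ?Z"] by simp
    finally have 1: "mconstr F V Y \<cdot> farr F (counit_ind ?VY) \<cdot> inv_arr (?m ?VY) \<cdot> (\<iota> g ?VY \<boxtimes>\<^sub>m idm ?Z) =
      (idm (fst V) \<boxtimes>\<^sub>m farr F (counit_ind Y)) \<cdot> (idm (fst V) \<boxtimes>\<^sub>m inv_arr (?m Y)) \<cdot> (idm (fst V) \<boxtimes>\<^sub>m (\<iota> g Y \<boxtimes>\<^sub>m idm ?Z)) \<cdot> (crossing g V Y \<boxtimes>\<^sub>m idm ?Z)" .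
    have wc: "idm (fst V) \<boxtimes>\<^sub>m (a \<cdot> b) = (idm (fst V) \<boxtimes>\<^sub>m a) \<cdot> (idm (fst V) \<boxtimes>\<^sub>m b)"
      if "a \<in> arr C" "b \<in> arr C" "src C a = tgt C b" for a b
      using T.interchange[of "idm (fst V)" "idm (fst V)" b a] that V by simp
    have "mconstr F V Y \<cdot> farr F (counit_ind ?VY) \<cdot> inv_arr (?m ?VY) \<cdot> (\<iota> g ?VY \<boxtimes>\<^sub>m idm ?Z) =
      (idm (fst V) \<boxtimes>\<^sub>m (farr F (counit_ind Y) \<cdot> inv_arr (?m Y) \<cdot> (\<iota> g Y \<boxtimes>\<^sub>m idm ?Z))) \<cdot> (crossing g V Y \<boxtimes>\<^sub>m idm ?Z)"
      unfolding 1 using V Y F Z assms by (simp add: wc)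
    then show "E.whisker V (farr F (counit_ind Y) \<cdot> inv_arr (?m Y) \<cdot> (\<iota> g Y \<boxtimes>\<^sub>m idm ?Z)) \<cdot> mconstr (T g \<boxtimes>\<^bsub>B\<^esub> R ?Z) V Y =
        mconstr F V Y \<cdot> farr F (counit_ind (E.acted V Y)) \<cdot> inv_arr (?m (E.acted V Y)) \<cdot> (\<iota> g (E.acted V Y) \<boxtimes>\<^sub>m idm ?Z)"
      using V Y F Z assms by simp
  qed (use F assms Z in simp_all)
qed

text \<open>
  Thus \<open>F\<close> is a retract of the direct sum of the \<open>\<Phi> g (F 1)\<close>.  By orthogonality the corresponding
  idempotent is diagonal, and by full faithfulness its entries are idempotents of \<open>F 1\<close>; these split.
\<close>

lemma decomposition_exists:
  "\<exists>X j q. (\<forall>g\<in>carrier G. X g \<in> obj C) \<and> is_direct_sum B (carrier G) (\<lambda>g. fobj (\<Phi> g) (X g)) F j q"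
proof -
  let ?Z = "fobj F (tunit C)" and ?m = "\<lambda>Y. mconstr F (induced Y) (tunit C)"
  define p where "p = (\<lambda>g. (F, T g \<boxtimes>\<^bsub>B\<^esub> R ?Z, \<lambda>Y\<in>obj C. (\<pi> g Y \<boxtimes>\<^sub>m idm ?Z) \<cdot> ?m Y \<cdot> farr F (unit_ind Y)))"
  define i where "i = (\<lambda>g. (T g \<boxtimes>\<^bsub>B\<^esub> R ?Z, F, \<lambda>Y\<in>obj C. farr F (counit_ind Y) \<cdot> inv_arr (?m Y) \<cdot> (\<iota> g Y \<boxtimes>\<^sub>m idm ?Z)))"
  have Z: "?Z \<in> obj C" using F by simp
  have p: "p g \<in> arr B" "fst (p g) = F" "fst (snd (p g)) = T g \<boxtimes>\<^bsub>B\<^esub> R ?Z" if "g \<in> carrier G" for g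
    using project_arr[OF that] by (simp_all add: p_def)
  have i: "i g \<in> arr B" "fst (i g) = T g \<boxtimes>\<^bsub>B\<^esub> R ?Z" "fst (snd (i g)) = F" if "g \<in> carrier G" for g
    using inject_arr[OF that] by (simp_all add: i_def)
  have sum: "E.B.hsum F F (\<lambda>g. i g \<cdot>\<^bsub>B\<^esub> p g) (carrier G) = ident B F"
  proof (rule E.arr_eqI)
    have tot: "E.B.hsum F F (\<lambda>g. i g \<cdot>\<^bsub>B\<^esub> p g) (carrier G) \<in> Hom B F F"
      by (rule E.B.hsum_closed) (use F p i in simp_all)
    then show "E.B.hsum F F (\<lambda>g. i g \<cdot>\<^bsub>B\<^esub> p g) (carrier G) \<in> arr B"
      "fst (E.B.hsum F F (\<lambda>g. i g \<cdot>\<^bsub>B\<^esub> p g) (carrier G)) = fst (ident B F)"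
      "fst (snd (E.B.hsum F F (\<lambda>g. i g \<cdot>\<^bsub>B\<^esub> p g) (carrier G))) = fst (snd (ident B F))" by simp_all
    fix Y assume Y: "Y \<in> obj C"
    let ?c = "farr F (counit_ind Y) \<cdot> inv_arr (?m Y)" and ?d = "?m Y \<cdot> farr F (unit_ind Y)"
    have "E.comp (E.B.hsum F F (\<lambda>g. i g \<cdot>\<^bsub>B\<^esub> p g) (carrier G)) Y =
        hsum (fobj F Y) (fobj F Y) (\<lambda>g. E.comp (i g \<cdot>\<^bsub>B\<^esub> p g) Y) (carrier G)"
      by (rule E.comp_hsum) (use F Y finite_G p i in simp_all)
    also have "\<dots> = hsum (fobj F Y) (fobj F Y) (\<lambda>g. ?c \<cdot> ((\<iota> g Y \<cdot> \<pi> g Y) \<boxtimes>\<^sub>m idm ?Z) \<cdot> ?d) (carrier G)"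
      by (rule hsum_cong) (use F Y Z in \<open>simp_all add: p_def i_def T.interchange_cmp\<close>)
    also have "\<dots> = ?c \<cdot> hsum (fobj F Y) (ind Y \<boxtimes> ?Z) (\<lambda>g. ((\<iota> g Y \<cdot> \<pi> g Y) \<boxtimes>\<^sub>m idm ?Z) \<cdot> ?d) (carrier G)"
      using F Y Z finite_G by (subst cmp_hsum) simp_all
    also have "hsum (fobj F Y) (ind Y \<boxtimes> ?Z) (\<lambda>g. ((\<iota> g Y \<cdot> \<pi> g Y) \<boxtimes>\<^sub>m idm ?Z) \<cdot> ?d) (carrier G) =
        hsum (ind Y \<boxtimes> ?Z) (ind Y \<boxtimes> ?Z) (\<lambda>g. (\<iota> g Y \<cdot> \<pi> g Y) \<boxtimes>\<^sub>m idm ?Z) (carrier G) \<cdot> ?d"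
      using F Y Z finite_G by (subst hsum_cmp) simp_all
    also have "hsum (ind Y \<boxtimes> ?Z) (ind Y \<boxtimes> ?Z) (\<lambda>g. (\<iota> g Y \<cdot> \<pi> g Y) \<boxtimes>\<^sub>m idm ?Z) (carrier G) = idm (ind Y \<boxtimes> ?Z)"
      using T.hsum_tarr_left[of "carrier G" "ind Y" "ind Y" "idm ?Z" "\<lambda>g. \<iota> g Y \<cdot> \<pi> g Y"] direct_sumD(2)[OF ind_sum[OF Y]] F Y Z finite_G by simp
    also have "?c \<cdot> idm (ind Y \<boxtimes> ?Z) \<cdot> ?d = farr F (counit_ind Y \<cdot> unit_ind Y)" using F Y Z by (simp del: unit_ind(7))
    also have "\<dots> = idm (fobj F Y)" using F Y by simp
    finally show "E.comp (E.B.hsum F F (\<lambda>g. i g \<cdot>\<^bsub>B\<^esub> p g) (carrier G)) Y = E.comp (ident B F) Y" using F Y by simp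
  qed (use F in simp)
  have off: "p h \<cdot>\<^bsub>B\<^esub> w \<cdot>\<^bsub>B\<^esub> i g = hzero B (T g \<boxtimes>\<^bsub>B\<^esub> R ?Z) (T h \<boxtimes>\<^bsub>B\<^esub> R ?Z)"
    if "g \<in> carrier G" "h \<in> carrier G" "g \<noteq> h" "w \<in> arr B" "fst w = F" "fst (snd w) = F" for g h w
    by (rule \<Phi>_orthogonal[OF that(1-3) Z Z]) (use that p[OF that(2)] i[OF that(1)] in simp_all)
  have ip: "i g \<cdot>\<^bsub>B\<^esub> p g \<cdot>\<^bsub>B\<^esub> i g = i g" if g: "g \<in> carrier G" for g
  proof -
    have "i g = E.B.hsum F F (\<lambda>h. i h \<cdot>\<^bsub>B\<^esub> p h) (carrier G) \<cdot>\<^bsub>B\<^esub> i g" using sum i[OF g] by simp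
    also have "\<dots> = E.B.hsum (T g \<boxtimes>\<^bsub>B\<^esub> R ?Z) F (\<lambda>h. (i h \<cdot>\<^bsub>B\<^esub> p h) \<cdot>\<^bsub>B\<^esub> i g) (carrier G)"
      using F i[OF g] i p finite_G by (subst E.B.hsum_cmp) simp_all
    also have "\<dots> = (i g \<cdot>\<^bsub>B\<^esub> p g) \<cdot>\<^bsub>B\<^esub> i g"
    proof (rule E.B.hsum_single[where f = "\<lambda>h. (i h \<cdot>\<^bsub>B\<^esub> p h) \<cdot>\<^bsub>B\<^esub> i g"])
      fix h assume h: "h \<in> carrier G" "h \<noteq> g"
      show "(i h \<cdot>\<^bsub>B\<^esub> p h) \<cdot>\<^bsub>B\<^esub> i g = hzero B (T g \<boxtimes>\<^bsub>B\<^esub> R ?Z) F"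
        using off[OF g h(1) h(2)[symmetric], of "ident B F"] F i[OF g] i[OF h(1)] p[OF h(1)] g Z by simp
    qed (use F i[OF g] p[OF g] g Z finite_G in simp_all)
    finally show ?thesis using i[OF g] p[OF g] by simp
  qed
  have "\<exists>X j q. X \<in> obj C \<and> j \<in> arr C \<and> src C j = X \<and> tgt C j = ?Z \<and> q \<in> arr C \<and> src C q = ?Z \<and> tgt C q = X \<and>
    q \<cdot> j = idm X \<and> farr (\<Phi> g) (j \<cdot> q) = p g \<cdot>\<^bsub>B\<^esub> i g" if g: "g \<in> carrier G" for g
  proof -
    have "p g \<cdot>\<^bsub>B\<^esub> i g \<in> Hom B (fobj (\<Phi> g) ?Z) (fobj (\<Phi> g) ?Z)" using p[OF g] i[OF g] by simp
    then obtain u where u: "u \<in> Hom C ?Z ?Z" "farr (\<Phi> g) u = p g \<cdot>\<^bsub>B\<^esub> i g"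
      using fully_faithfulD(1)[OF \<Phi>_fully_faithful[OF g] Z Z] by blast
    have "farr (\<Phi> g) (u \<cdot> u) = farr (\<Phi> g) u"
      using u functor_cmp[OF \<Phi>_linear[OF g], of u u] ip[OF g] p[OF g] i[OF g] by (simp del: \<Phi>_simps)
    then have "u \<cdot> u = u"
      using fully_faithfulD(2)[OF \<Phi>_fully_faithful[OF g] Z Z, of "u \<cdot> u" u] u by simp
    then show ?thesis using idempotent_splits[of u ?Z] u by auto
  qed
  then obtain X j q where X: "\<And>g. g \<in> carrier G \<Longrightarrow> X g \<in> obj C \<and> j g \<in> arr C \<and> src C (j g) = X g \<and> tgt C (j g) = ?Z \<and>
      q g \<in> arr C \<and> src C (q g) = ?Z \<and> tgt C (q g) = X g \<and> q g \<cdot> j g = idm (X g) \<and> farr (\<Phi> g) (j g \<cdot> q g) = p g \<cdot>\<^bsub>B\<^esub> i g"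
    by metis
  let ?j = "\<lambda>g. i g \<cdot>\<^bsub>B\<^esub> farr (\<Phi> g) (j g)" and ?q = "\<lambda>g. farr (\<Phi> g) (q g) \<cdot>\<^bsub>B\<^esub> p g"
  have a: "farr (\<Phi> g) (j g) \<in> arr B" "fst (farr (\<Phi> g) (j g)) = fobj (\<Phi> g) (X g)" "fst (snd (farr (\<Phi> g) (j g))) = T g \<boxtimes>\<^bsub>B\<^esub> R ?Z"
    "farr (\<Phi> g) (q g) \<in> arr B" "fst (farr (\<Phi> g) (q g)) = T g \<boxtimes>\<^bsub>B\<^esub> R ?Z" "fst (snd (farr (\<Phi> g) (q g))) = fobj (\<Phi> g) (X g)"
    if "g \<in> carrier G" for g
    using functor_arr[OF \<Phi>_linear[OF that], of "j g"] functor_arr[OF \<Phi>_linear[OF that], of "q g"] X[OF that] by simp_all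
  have jq: "farr (\<Phi> g) (j g) \<cdot>\<^bsub>B\<^esub> farr (\<Phi> g) (q g) = p g \<cdot>\<^bsub>B\<^esub> i g" if g: "g \<in> carrier G" for g
    using functor_cmp[OF \<Phi>_linear[OF g], of "q g" "j g"] X[OF g] by simp
  have qj: "farr (\<Phi> g) (q g) \<cdot>\<^bsub>B\<^esub> farr (\<Phi> g) (j g) = ident B (fobj (\<Phi> g) (X g))" if g: "g \<in> carrier G" for g
    using functor_cmp[OF \<Phi>_linear[OF g], of "j g" "q g"] functor_ident[OF \<Phi>_linear[OF g], of "X g"] X[OF g] by simp
  have diag: "?q g \<cdot>\<^bsub>B\<^esub> ?j g = ident B (fobj (\<Phi> g) (X g))" if g: "g \<in> carrier G" for g
  proof -
    have "?q g \<cdot>\<^bsub>B\<^esub> ?j g = farr (\<Phi> g) (q g) \<cdot>\<^bsub>B\<^esub> (p g \<cdot>\<^bsub>B\<^esub> i g) \<cdot>\<^bsub>B\<^esub> farr (\<Phi> g) (j g)"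
      using a[OF g] i[OF g] p[OF g] by (simp del: \<Phi>_simps)
    also have "\<dots> = (farr (\<Phi> g) (q g) \<cdot>\<^bsub>B\<^esub> farr (\<Phi> g) (j g)) \<cdot>\<^bsub>B\<^esub> (farr (\<Phi> g) (q g) \<cdot>\<^bsub>B\<^esub> farr (\<Phi> g) (j g))"
      unfolding jq[OF g, symmetric] using a[OF g] by (simp del: \<Phi>_simps)
    also have "\<dots> = ident B (fobj (\<Phi> g) (X g))" unfolding qj[OF g] using X[OF g] g by simp
    finally show ?thesis .
  qed
  have offd: "?q h \<cdot>\<^bsub>B\<^esub> ?j g = hzero B (fobj (\<Phi> g) (X g)) (fobj (\<Phi> h) (X h))"
    if "g \<in> carrier G" "h \<in> carrier G" "g \<noteq> h" for g h
    unfolding \<Phi>_simps(1)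
    by (rule \<Phi>_orthogonal[OF that])
      (use a[OF that(1)] a[OF that(2)] i[OF that(1)] p[OF that(2)] X[OF that(1)] X[OF that(2)] in \<open>simp_all del: \<Phi>_simps(2)\<close>)
  have "?j g \<cdot>\<^bsub>B\<^esub> ?q g = i g \<cdot>\<^bsub>B\<^esub> p g" if g: "g \<in> carrier G" for g
  proof -
    have "?j g \<cdot>\<^bsub>B\<^esub> ?q g = i g \<cdot>\<^bsub>B\<^esub> (farr (\<Phi> g) (j g) \<cdot>\<^bsub>B\<^esub> farr (\<Phi> g) (q g)) \<cdot>\<^bsub>B\<^esub> p g"
      using a[OF g] i[OF g] p[OF g] by (simp del: \<Phi>_simps)
    also have "\<dots> = (i g \<cdot>\<^bsub>B\<^esub> p g \<cdot>\<^bsub>B\<^esub> i g) \<cdot>\<^bsub>B\<^esub> p g" unfolding jq[OF g] using i[OF g] p[OF g] by simp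
    finally show ?thesis unfolding ip[OF g] .
  qed
  then have "E.B.hsum F F (\<lambda>g. ?j g \<cdot>\<^bsub>B\<^esub> ?q g) (carrier G) = ident B F"
    unfolding sum[symmetric] by (intro E.B.hsum_cong) (use F i p in simp_all)
  then have "is_direct_sum B (carrier G) (\<lambda>g. fobj (\<Phi> g) (X g)) F ?j ?q"
    unfolding is_direct_sum_def using diag offd a i p X F
    by (auto simp del: \<Phi>_simps(2) simp: Hom_def)
  then show ?thesis using X by blast
qed

end

sublocale O: orthogonal_decomposition B C "carrier G" \<Phi>
proof unfold_locales
  show "f = hzero B (fobj (\<Phi> i) X) (fobj (\<Phi> j) Y)"
    if "i \<in> carrier G" "j \<in> carrier G" "i \<noteq> j" "X \<in> obj C" "Y \<in> obj C" "f \<in> arr B" "src B f = fobj (\<Phi> i) X" "tgt B f = fobj (\<Phi> j) Y"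
    for i j X Y f using \<Phi>_orthogonal[OF that(1-6)] that(7,8) by simp
  show "\<exists>F j q. is_direct_sum B (carrier G) (\<lambda>i. fobj (\<Phi> i) (Z i)) F j q" if "\<And>i. i \<in> carrier G \<Longrightarrow> Z i \<in> obj C" for Z
    using E.sum_functor_direct_sum[of "carrier G" "\<lambda>i. fobj (\<Phi> i) (Z i)", OF finite_G] that by auto
qed (use finite_G \<Phi>_linear \<Phi>_fully_faithful decomposition_exists in simp_all)

section \<open>The dual category is a tensor category\<close>

text \<open>Both injectivity and surjectivity on arrows are seen at the unit, where \<open>R X\<close> takes the value \<open>X\<close>.\<close>

lemma emb_fully_faithful: "fully_faithful C B emb"
  unfolding fully_faithful_def
proof (intro ballI)
  fix X Y assume XY: "X \<in> obj C" "Y \<in> obj C"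
  show "bij_betw (farr emb) (Hom C X Y) (Hom B (fobj emb X) (fobj emb Y))"
  proof (rule bij_betw_imageI)
    show "inj_on (farr emb) (Hom C X Y)"
    proof (rule inj_onI)
      fix f k assume h: "f \<in> Hom C X Y" "k \<in> Hom C X Y" "farr emb f = farr emb k"
      have "E.comp (farr emb f) (tunit C) = E.comp (farr emb k) (tunit C)" using h(3) by simp
      then show "f = k" using h(1,2) by simp
    qed
    show "farr emb ` Hom C X Y = Hom B (fobj emb X) (fobj emb Y)"
    proof (intro equalityI subsetI)
      fix a assume "a \<in> farr emb ` Hom C X Y"
      then show "a \<in> Hom B (fobj emb X) (fobj emb Y)" by auto
    next
      fix a assume "a \<in> Hom B (fobj emb X) (fobj emb Y)"
      then have a: "a \<in> arr B" "fst a = R X" "fst (snd a) = R Y" by simp_all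
      let ?u = "E.comp a (tunit C)"
      have u: "?u \<in> arr C" "src C ?u = X" "tgt C ?u = Y" using E.arrD[OF a(1)] a XY by simp_all
      have "farr emb ?u = a" by (rule eq_at_tunit) (use a u in simp_all)
      then show "a \<in> farr emb ` Hom C X Y" using u by (intro image_eqI[of _ _ ?u]) simp_all
    qed
  qed
qed

lemma emb_embedding: "tensor_embedding C B emb"
  unfolding tensor_embedding_def using emb_linear emb_fully_faithful R_tunit R_tensor emb_tensor by simp

text \<open>The isomorphisms \<open>\<rho>\<^sub>0\<close> and \<open>\<rho>\<^sub>2\<close>, as transformations of module functors.\<close>

definition unit_iso :: "(('g, 'o, 'm) equiv_obj, 'o, 'm) mod_transf" where
  "unit_iso = (tunit B, T \<one>\<^bsub>G\<^esub>, \<lambda>X\<in>obj C. rho0 A X)"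

definition mult_iso :: "'g \<Rightarrow> 'g \<Rightarrow> (('g, 'o, 'm) equiv_obj, 'o, 'm) mod_transf" where
  "mult_iso g h = (T h \<boxtimes>\<^bsub>B\<^esub> T g, T (h \<otimes>\<^bsub>G\<^esub> g), \<lambda>X\<in>obj C. rho2 A g h X)"

lemma unit_iso [simp]:
  "unit_iso \<in> arr B" "fst unit_iso = tunit B" "fst (snd unit_iso) = T \<one>\<^bsub>G\<^esub>" "Y \<in> obj C \<Longrightarrow> E.comp unit_iso Y = rho0 A Y"
  "is_iso B unit_iso"
proof -
  show a: "unit_iso \<in> arr B"
    unfolding unit_iso_def by (rule E.arrI) (use rho0(5) crossing_rho0 in simp_all)
  show "fst unit_iso = tunit B" "fst (snd unit_iso) = T \<one>\<^bsub>G\<^esub>" by (simp_all add: unit_iso_def)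
  show c: "E.comp unit_iso Y = rho0 A Y" if "Y \<in> obj C" for Y using that by (simp add: unit_iso_def)
  show "is_iso B unit_iso" by (rule E.iso_pointwise[OF a]) (simp add: c)
qed

lemma mult_iso [simp]:
  assumes "g \<in> carrier G" "h \<in> carrier G"
  shows "mult_iso g h \<in> arr B" "fst (mult_iso g h) = T h \<boxtimes>\<^bsub>B\<^esub> T g" "fst (snd (mult_iso g h)) = T (h \<otimes>\<^bsub>G\<^esub> g)"
    "Y \<in> obj C \<Longrightarrow> E.comp (mult_iso g h) Y = rho2 A g h Y" "is_iso B (mult_iso g h)"
proof -
  show a: "mult_iso g h \<in> arr B"
    unfolding mult_iso_def
  proof (rule E.arrI)
    show "rho2 A g h (tgt C f) \<cdot> farr (T h \<boxtimes>\<^bsub>B\<^esub> T g) f = farr (T (h \<otimes>\<^bsub>G\<^esub> g)) f \<cdot> rho2 A g h (src C f)" if "f \<in> arr C" for f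
      using rho2(5)[OF assms that] that assms by simp
    show "E.whisker V (rho2 A g h Y) \<cdot> mconstr (T h \<boxtimes>\<^bsub>B\<^esub> T g) V Y = mconstr (T (h \<otimes>\<^bsub>G\<^esub> g)) V Y \<cdot> rho2 A g h (E.acted V Y)"
      if "V \<in> obj Q" "Y \<in> obj C" for V Y
      using crossing_rho2[OF assms that] that assms by simp
  qed (use assms in simp_all)
  show "fst (mult_iso g h) = T h \<boxtimes>\<^bsub>B\<^esub> T g" "fst (snd (mult_iso g h)) = T (h \<otimes>\<^bsub>G\<^esub> g)" by (simp_all add: mult_iso_def)
  show c: "E.comp (mult_iso g h) Y = rho2 A g h Y" if "Y \<in> obj C" for Y using that by (simp add: mult_iso_def)
  show "is_iso B (mult_iso g h)" by (rule E.iso_pointwise[OF a]) (simp add: c assms)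
qed

lemma T_one: "isomorphic B (tunit B) (T \<one>\<^bsub>G\<^esub>)"
  unfolding E.B.isomorphic_iff by (rule bexI[of _ unit_iso]) simp_all

lemma T_mult:
  assumes "g \<in> carrier G" "h \<in> carrier G" shows "isomorphic B (T g \<boxtimes>\<^bsub>B\<^esub> T h) (T (g \<otimes>\<^bsub>G\<^esub> h))"
  unfolding E.B.isomorphic_iff using assms by (intro bexI[of _ "mult_iso h g"]) simp_all

text \<open>
  This is where the degree of \<open>X\<close> acts on the index \<open>g\<close>; the isomorphism is \<open>\<gamma>\<close>.
\<close>

lemma R_T:
  assumes "g \<in> carrier G" "s \<in> carrier \<Gamma>" "X \<in> grade A s"
  shows "isomorphic B (R X \<boxtimes>\<^bsub>B\<^esub> T g) (T (s \<triangleright> g) \<boxtimes>\<^bsub>B\<^esub> R (ro g X))"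
proof -
  let ?a = "(R X \<boxtimes>\<^bsub>B\<^esub> T g, T (s \<triangleright> g) \<boxtimes>\<^bsub>B\<^esub> R (ro g X), \<lambda>Y\<in>obj C. gam A s g Y X)"
  have X: "X \<in> obj C" using assms by simp
  have a: "?a \<in> arr B"
  proof (rule E.arrI)
    show "gam A s g (tgt C f) X \<cdot> farr (R X \<boxtimes>\<^bsub>B\<^esub> T g) f = farr (T (s \<triangleright> g) \<boxtimes>\<^bsub>B\<^esub> R (ro g X)) f \<cdot> gam A s g (src C f) X" if "f \<in> arr C" for f
      using gam_nat[OF assms(1,2) that, of "idm X"] that assms X by simp
    show "E.whisker V (gam A s g Y X) \<cdot> mconstr (R X \<boxtimes>\<^bsub>B\<^esub> T g) V Y =
        mconstr (T (s \<triangleright> g) \<boxtimes>\<^bsub>B\<^esub> R (ro g X)) V Y \<cdot> gam A s g (E.acted V Y) X" if "V \<in> obj Q" "Y \<in> obj C" for V Y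
      using crossing_gam[OF assms(1,2) that assms(3)] that assms X by simp
  qed (use assms X in simp_all)
  have "is_iso B ?a" by (rule E.iso_pointwise[OF a]) (use assms in simp)
  then show ?thesis unfolding E.B.isomorphic_iff using a by (intro bexI[of _ ?a]) simp_all
qed

text \<open>Since \<open>\<rho>\<close> is an action, \<open>T g\<close> is invertible, hence dual to \<open>T k\<close> for \<open>k\<close> inverse to \<open>g\<close>.\<close>

lemma T_dual:
  assumes "g \<in> carrier G" "k \<in> carrier G" "g \<otimes>\<^bsub>G\<^esub> k = \<one>\<^bsub>G\<^esub>" "k \<otimes>\<^bsub>G\<^esub> g = \<one>\<^bsub>G\<^esub>"
  shows "is_left_dual B (T g) (T k) (E.B.inv_arr unit_iso \<cdot>\<^bsub>B\<^esub> mult_iso g k) (E.B.inv_arr (mult_iso k g) \<cdot>\<^bsub>B\<^esub> unit_iso)"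
proof -
  let ?z = "E.B.inv_arr unit_iso" and ?n = "E.B.inv_arr (mult_iso k g)"
  have z: "?z \<in> arr B" "fst ?z = T \<one>\<^bsub>G\<^esub>" "fst (snd ?z) = tunit B"
    and n: "?n \<in> arr B" "fst ?n = T \<one>\<^bsub>G\<^esub>" "fst (snd ?n) = T g \<boxtimes>\<^bsub>B\<^esub> T k"
    using E.B.inv_arr(1-3)[of unit_iso] E.B.inv_arr(1-3)[of "mult_iso k g"] assms by simp_all
  have zc: "E.comp ?z Y \<in> arr C" "src C (E.comp ?z Y) = ro \<one>\<^bsub>G\<^esub> Y" "tgt C (E.comp ?z Y) = Y" "rho0 A Y \<cdot> E.comp ?z Y = idm (ro \<one>\<^bsub>G\<^esub> Y)"
    and nc: "E.comp ?n Y \<in> arr C" "src C (E.comp ?n Y) = ro \<one>\<^bsub>G\<^esub> Y" "tgt C (E.comp ?n Y) = ro k (ro g Y)"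
      "rho2 A k g Y \<cdot> E.comp ?n Y = idm (ro \<one>\<^bsub>G\<^esub> Y)"
    if "Y \<in> obj C" for Y
  proof -
    show "E.comp ?z Y \<in> arr C" "src C (E.comp ?z Y) = ro \<one>\<^bsub>G\<^esub> Y" "tgt C (E.comp ?z Y) = Y"
      "E.comp ?n Y \<in> arr C" "src C (E.comp ?n Y) = ro \<one>\<^bsub>G\<^esub> Y" "tgt C (E.comp ?n Y) = ro k (ro g Y)"
      using E.arrD[OF z(1)] E.arrD[OF n(1)] z n that assms by simp_all
    have "rho0 A Y \<cdot> E.comp ?z Y = E.comp (unit_iso \<cdot>\<^bsub>B\<^esub> ?z) Y"
      "rho2 A k g Y \<cdot> E.comp ?n Y = E.comp (mult_iso k g \<cdot>\<^bsub>B\<^esub> ?n) Y"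
      using that assms by (simp_all del: E.B.inv_arr)
    then show "rho0 A Y \<cdot> E.comp ?z Y = idm (ro \<one>\<^bsub>G\<^esub> Y)" "rho2 A k g Y \<cdot> E.comp ?n Y = idm (ro \<one>\<^bsub>G\<^esub> Y)"
      unfolding E.B.inv_arr(5)[OF unit_iso(5)] E.B.inv_arr(5)[OF mult_iso(5)[OF assms(2,1)]] using that assms by simp_all
  qed
  have ev: "?z \<cdot>\<^bsub>B\<^esub> mult_iso g k \<in> arr B" and co: "?n \<cdot>\<^bsub>B\<^esub> unit_iso \<in> arr B" using z n assms by simp_all
  have one: "(ident B (T g) \<boxtimes>\<^sub>m\<^bsub>B\<^esub> (?z \<cdot>\<^bsub>B\<^esub> mult_iso g k)) \<cdot>\<^bsub>B\<^esub> ((?n \<cdot>\<^bsub>B\<^esub> unit_iso) \<boxtimes>\<^sub>m\<^bsub>B\<^esub> ident B (T g)) = ident B (T g)"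
  proof (rule E.arr_eqI)
    fix Y assume Y: "Y \<in> obj C"
    note zY = zc[of "ro g Y"] and nY = nc[OF Y]
    have "rho2 A \<one>\<^bsub>G\<^esub> g Y = (rho2 A \<one>\<^bsub>G\<^esub> g Y \<cdot> rho0 A (ro g Y)) \<cdot> E.comp ?z (ro g Y)"
      using zY Y assms by simp
    then have "E.comp ?z (ro g Y) = rho2 A \<one>\<^bsub>G\<^esub> g Y"
      unfolding rho2_one_left[OF assms(1) Y] using zY Y assms by simp
    then have "E.comp ?z (ro g Y) \<cdot> rho2 A g k (ro g Y) \<cdot> ra g (E.comp ?n Y) \<cdot> ra g (rho0 A Y) =
        (rho2 A (k \<otimes>\<^bsub>G\<^esub> g) g Y \<cdot> rho2 A g k (ro g Y)) \<cdot> ra g (E.comp ?n Y) \<cdot> ra g (rho0 A Y)"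
      using nY Y assms by simp
    also have "\<dots> = rho2 A g \<one>\<^bsub>G\<^esub> Y \<cdot> ra g (rho2 A k g Y \<cdot> E.comp ?n Y) \<cdot> ra g (rho0 A Y)"
      unfolding rho2_assoc[OF assms(1,2,1) Y] using nY(1-3) Y assms by (simp add: ra_cmp)
    also have "\<dots> = idm (ro g Y)" unfolding nY(4) using rho2_one_right[OF assms(1) Y] Y assms by simp
    finally show "E.comp ((ident B (T g) \<boxtimes>\<^sub>m\<^bsub>B\<^esub> (?z \<cdot>\<^bsub>B\<^esub> mult_iso g k)) \<cdot>\<^bsub>B\<^esub> ((?n \<cdot>\<^bsub>B\<^esub> unit_iso) \<boxtimes>\<^sub>m\<^bsub>B\<^esub> ident B (T g))) Y = E.comp (ident B (T g)) Y"
      using zY(1-3) nY(1-3) z n Y assms by (simp add: ra_cmp)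
  qed (use z n ev co assms in simp_all)
  have two: "((?z \<cdot>\<^bsub>B\<^esub> mult_iso g k) \<boxtimes>\<^sub>m\<^bsub>B\<^esub> ident B (T k)) \<cdot>\<^bsub>B\<^esub> (ident B (T k) \<boxtimes>\<^sub>m\<^bsub>B\<^esub> (?n \<cdot>\<^bsub>B\<^esub> unit_iso)) = ident B (T k)"
  proof (rule E.arr_eqI)
    fix Y assume Y: "Y \<in> obj C"
    note zY = zc[OF Y] and nY = nc[of "ro k Y"]
    have "rho2 A k \<one>\<^bsub>G\<^esub> Y = rho2 A k \<one>\<^bsub>G\<^esub> Y \<cdot> ra k (rho0 A Y \<cdot> E.comp ?z Y)"
      unfolding zY(4) using Y assms by simp
    also have "\<dots> = (rho2 A k \<one>\<^bsub>G\<^esub> Y \<cdot> ra k (rho0 A Y)) \<cdot> ra k (E.comp ?z Y)" using zY(1-3) Y assms by (simp add: ra_cmp)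
    finally have "ra k (E.comp ?z Y) = rho2 A k \<one>\<^bsub>G\<^esub> Y"
      unfolding rho2_one_right[OF assms(2) Y] using zY(1-3) Y assms by simp
    then have "ra k (E.comp ?z Y) \<cdot> ra k (rho2 A g k Y) \<cdot> E.comp ?n (ro k Y) \<cdot> rho0 A (ro k Y) =
        (rho2 A k (k \<otimes>\<^bsub>G\<^esub> g) Y \<cdot> ra k (rho2 A g k Y)) \<cdot> E.comp ?n (ro k Y) \<cdot> rho0 A (ro k Y)"
      using nY(1-3) Y assms by simp
    also have "\<dots> = rho2 A \<one>\<^bsub>G\<^esub> k Y \<cdot> (rho2 A k g (ro k Y) \<cdot> E.comp ?n (ro k Y)) \<cdot> rho0 A (ro k Y)"
      unfolding rho2_assoc[OF assms(2,1,2) Y, symmetric] using nY(1-3) Y assms by simp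
    also have "\<dots> = idm (ro k Y)" using nY rho2_one_left[OF assms(2) Y] Y assms by simp
    finally show "E.comp (((?z \<cdot>\<^bsub>B\<^esub> mult_iso g k) \<boxtimes>\<^sub>m\<^bsub>B\<^esub> ident B (T k)) \<cdot>\<^bsub>B\<^esub> (ident B (T k) \<boxtimes>\<^sub>m\<^bsub>B\<^esub> (?n \<cdot>\<^bsub>B\<^esub> unit_iso))) Y = E.comp (ident B (T k)) Y"
      using zY(1-3) nY(1-3) z n Y assms by (simp add: ra_cmp)
  qed (use z n ev co assms in simp_all)
  show ?thesis unfolding is_left_dual_def using one two ev co z n assms by simp
qed

lemma \<Phi>_duals:
  assumes "g \<in> carrier G" "X \<in> obj C"
  shows "\<exists>D ev coev. is_left_dual B (fobj (\<Phi> g) X) D ev coev" "\<exists>D ev coev. is_left_dual B D (fobj (\<Phi> g) X) ev coev"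
proof -
  have k: "inv\<^bsub>G\<^esub> g \<in> carrier G" "g \<otimes>\<^bsub>G\<^esub> inv\<^bsub>G\<^esub> g = \<one>\<^bsub>G\<^esub>" "inv\<^bsub>G\<^esub> g \<otimes>\<^bsub>G\<^esub> g = \<one>\<^bsub>G\<^esub>" using assms(1) by simp_all
  obtain D ev coev where "is_left_dual C X D ev coev" using left_dual_exists[OF assms(2)] by blast
  from E.B.left_dual_tensor[OF T_dual[OF assms(1) k] T.left_dual_functor[OF emb_embedding this]]
  show "\<exists>D ev coev. is_left_dual B (fobj (\<Phi> g) X) D ev coev" unfolding \<Phi>_simps emb_simps(1) by blast
  obtain D' ev' coev' where "is_left_dual C D' X ev' coev'" using right_dual_exists[OF assms(2)] by blast
  from E.B.left_dual_tensor[OF T.left_dual_functor[OF emb_embedding this] T_dual[OF k(1) assms(1) k(3,2)]]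
  show "\<exists>D ev coev. is_left_dual B D (fobj (\<Phi> g) X) ev coev" unfolding \<Phi>_simps emb_simps(1) by blast
qed

text \<open>
  Duals of the homogeneous summands add up to duals of the object.
\<close>

lemma duals:
  assumes F: "F \<in> obj B"
  shows "\<exists>D ev coev. is_left_dual B F D ev coev" "\<exists>D ev coev. is_left_dual B D F ev coev"
proof -
  let ?X = "\<lambda>g. fobj (\<Phi> g) (O.part g F)"
  note d = O.ds[OF F]
  have "\<forall>g\<in>carrier G. \<exists>D. is_left_dual B (?X g) (fst D) (fst (snd D)) (snd (snd D))"
    using \<Phi>_duals(1) O.part_obj[OF F] by (metis fst_conv snd_conv)
  then obtain D where "\<forall>g\<in>carrier G. is_left_dual B (?X g) (fst (D g)) (fst (snd (D g))) (snd (snd (D g)))"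
    by (rule bchoice[THEN exE])
  note D = bspec[OF this]
  obtain Y a b where "is_direct_sum B (carrier G) (\<lambda>g. fst (D g)) Y a b"
    using O.direct_sum_exists_via[OF finite_G, of "\<lambda>g. fst (D g)"] E.B.left_dualD(2)[OF D] by blast
  from E.B.left_dual_direct_sum[OF finite_G d this D] show "\<exists>D ev coev. is_left_dual B F D ev coev" by blast
  have "\<forall>g\<in>carrier G. \<exists>D. is_left_dual B (fst D) (?X g) (fst (snd D)) (snd (snd D))"
    using \<Phi>_duals(2) O.part_obj[OF F] by (metis fst_conv snd_conv)
  then obtain D where "\<forall>g\<in>carrier G. is_left_dual B (fst (D g)) (?X g) (fst (snd (D g))) (snd (snd (D g)))"
    by (rule bchoice[THEN exE])
  note D = bspec[OF this]
  obtain Y a b where "is_direct_sum B (carrier G) (\<lambda>g. fst (D g)) Y a b"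
    using O.direct_sum_exists_via[OF finite_G, of "\<lambda>g. fst (D g)"] E.B.left_dualD(1)[OF D] by blast
  from E.B.left_dual_direct_sum[OF finite_G this d D] show "\<exists>D ev coev. is_left_dual B D F ev coev" by blast
qed

lemma \<Phi>_one: "X \<in> obj C \<Longrightarrow> isomorphic B (fobj (\<Phi> \<one>\<^bsub>G\<^esub>) X) (R X)"
  using E.B.isomorphic_tensor[OF E.B.isomorphic_sym[OF T_one] E.B.isomorphic_refl[OF R_obj], of X] by simp

text \<open>
  The unit object is isomorphic to \<open>\<Phi> 1 1\<close>, which has the single non-zero coordinate \<open>1\<close>; as that is simple, so is the unit.
\<close>

lemma tensor_category_B: "tensor_category B"
proof (rule E.B.tensor_categoryI)
  show "is_simple B (tunit B)"
  proof (rule O.simple_reflect)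
    have "isomorphic B (fobj (\<Phi> \<one>\<^bsub>G\<^esub>) (tunit C)) (tunit B)" using \<Phi>_one[OF T.tunit_closed] R_tunit by simp
    then have *: "isomorphic C (tunit C) (O.part \<one>\<^bsub>G\<^esub> (tunit B))" "\<forall>h\<in>carrier G. h \<noteq> \<one>\<^bsub>G\<^esub> \<longrightarrow> is_zero_obj C (O.part h (tunit B))"
      using O.isomorphic_\<Phi>_iff[of "\<one>\<^bsub>G\<^esub>" "tunit C" "tunit B"] by simp_all
    show "is_simple C (fobj (O.coordinate \<one>\<^bsub>G\<^esub>) (tunit B))" using simple_iso[OF tunit_simple *(1)] by simp
    show "is_zero_obj C (fobj (O.coordinate h) (tunit B))" if "h \<in> carrier G" "h \<noteq> \<one>\<^bsub>G\<^esub>" for h using *(2) that by simp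
  qed simp_all
qed (use O.abelian duals O.finite_length[OF finite_length] O.finite_dim_hom[OF finite_dim] in blast)+

section \<open>The grading\<close>

abbreviation "L \<equiv> bicrossed_group G \<Gamma> lact ract"

definition component :: "'g \<times> 's \<Rightarrow> (('g, 'o, 'm) equiv_obj, 'o, 'm) mod_functor set" where
  "component = (\<lambda>(g, s). ess_image B (\<Phi> g) (grade A s))"

lemma component_iff:
  assumes "g \<in> carrier G" "s \<in> carrier \<Gamma>"
  shows "F \<in> component (g, s) \<longleftrightarrow> F \<in> obj B \<and> O.part g F \<in> grade A s \<and> (\<forall>h\<in>carrier G. h \<noteq> g \<longrightarrow> is_zero_obj C (O.part h F))"
proof
  assume "F \<in> component (g, s)"
  then obtain X where X: "F \<in> obj B" "X \<in> grade A s" "isomorphic B (fobj (\<Phi> g) X) F"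
    unfolding component_def ess_image_def by blast
  then have "isomorphic C X (O.part g F) \<and> (\<forall>h\<in>carrier G. h \<noteq> g \<longrightarrow> is_zero_obj C (O.part h F))"
    using O.isomorphic_\<Phi>_iff[OF assms(1) grade_obj[OF X(2) assms(2)] X(1)] by blast
  then show "F \<in> obj B \<and> O.part g F \<in> grade A s \<and> (\<forall>h\<in>carrier G. h \<noteq> g \<longrightarrow> is_zero_obj C (O.part h F))"
    using grade_iso[OF assms(2) X(2)] X(1) by blast
next
  assume h: "F \<in> obj B \<and> O.part g F \<in> grade A s \<and> (\<forall>h\<in>carrier G. h \<noteq> g \<longrightarrow> is_zero_obj C (O.part h F))"
  then have "isomorphic B (fobj (\<Phi> g) (O.part g F)) F"
    using O.isomorphic_\<Phi>_iff[OF assms(1), of "O.part g F" F] isomorphic_refl[of "O.part g F"] O.part_obj[of F g] assms(1) by blast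
  then show "F \<in> component (g, s)" unfolding component_def ess_image_def using h by blast
qed

lemma \<Phi>_component:
  assumes "g \<in> carrier G" "s \<in> carrier \<Gamma>" "X \<in> grade A s" shows "fobj (\<Phi> g) X \<in> component (g, s)"
proof -
  have "fobj (\<Phi> g) X \<in> obj B" using assms by simp
  then show ?thesis unfolding component_def ess_image_def using assms(3) E.B.isomorphic_refl by blast
qed

text \<open>Moving \<open>R X\<close> past \<open>T h\<close> changes the degrees as in the multiplication of the bicrossed product.\<close>

lemma \<Phi>_tensor:
  assumes "g \<in> carrier G" "h \<in> carrier G" "s \<in> carrier \<Gamma>" "X \<in> grade A s" "Y \<in> obj C"
  shows "isomorphic B (fobj (\<Phi> g) X \<boxtimes>\<^bsub>B\<^esub> fobj (\<Phi> h) Y) (fobj (\<Phi> (g \<otimes>\<^bsub>G\<^esub> (s \<triangleright> h))) (ro h X \<boxtimes> Y))"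
proof -
  have X: "X \<in> obj C" using assms by simp
  note i = E.B.isomorphic_tensor and r = E.B.isomorphic_refl and t = E.B.isomorphic_trans
  have "isomorphic B (T g \<boxtimes>\<^bsub>B\<^esub> (R X \<boxtimes>\<^bsub>B\<^esub> T h) \<boxtimes>\<^bsub>B\<^esub> R Y) (T g \<boxtimes>\<^bsub>B\<^esub> (T (s \<triangleright> h) \<boxtimes>\<^bsub>B\<^esub> R (ro h X)) \<boxtimes>\<^bsub>B\<^esub> R Y)"
    by (intro i r R_T) (use assms X in simp_all)
  moreover have "isomorphic B ((T g \<boxtimes>\<^bsub>B\<^esub> T (s \<triangleright> h)) \<boxtimes>\<^bsub>B\<^esub> R (ro h X \<boxtimes> Y)) (T (g \<otimes>\<^bsub>G\<^esub> (s \<triangleright> h)) \<boxtimes>\<^bsub>B\<^esub> R (ro h X \<boxtimes> Y))"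
    by (intro i r T_mult) (use assms X in simp_all)
  ultimately show ?thesis using t R_tensor[of "ro h X" Y] assms X by simp
qed

lemma component_closed: "F \<in> component l \<Longrightarrow> F \<in> obj B"
  by (auto simp: component_def ess_image_def split: prod.splits)

lemma dual_tensor_component:
  assumes "g \<in> carrier G" "s \<in> carrier \<Gamma>" "h \<in> carrier G" "t \<in> carrier \<Gamma>" "F \<in> component (g, s)" "H \<in> component (h, t)"
  shows "F \<boxtimes>\<^bsub>B\<^esub> H \<in> component (g \<otimes>\<^bsub>G\<^esub> (s \<triangleright> h), (s \<triangleleft> h) \<otimes>\<^bsub>\<Gamma>\<^esub> t)"
proof -
  obtain X Y where X: "X \<in> grade A s" "isomorphic B (fobj (\<Phi> g) X) F" and Y: "Y \<in> grade A t" "isomorphic B (fobj (\<Phi> h) Y) H"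
    using assms(5,6) by (auto simp: component_def ess_image_def simp del: \<Phi>_simps)
  have "ro h X \<boxtimes> Y \<in> grade A ((s \<triangleleft> h) \<otimes>\<^bsub>\<Gamma>\<^esub> t)"
    by (rule component_tensor) (use assms X Y grade_rho in simp_all)
  moreover have "isomorphic B (fobj (\<Phi> (g \<otimes>\<^bsub>G\<^esub> (s \<triangleright> h))) (ro h X \<boxtimes> Y)) (F \<boxtimes>\<^bsub>B\<^esub> H)"
    by (rule E.B.isomorphic_trans[OF E.B.isomorphic_sym[OF \<Phi>_tensor] E.B.isomorphic_tensor]) (rule assms X Y grade_obj)+
  moreover have "F \<boxtimes>\<^bsub>B\<^esub> H \<in> obj B" using component_closed[OF assms(5)] component_closed[OF assms(6)] by simp
  ultimately show ?thesis unfolding component_def ess_image_def by blast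
qed

text \<open>
  In coordinates, the component is a component of \<open>C\<close> at \<open>g\<close> and the zero objects elsewhere.
\<close>

lemma component_subcategory:
  assumes "g \<in> carrier G" "s \<in> carrier \<Gamma>" shows "abelian_subcategory B (component (g, s))"
proof -
  let ?S = "\<lambda>h. if h = g then grade A s else {Z. is_zero_obj C Z}"
  have "abelian_subcategory B {F \<in> obj B. \<forall>h\<in>carrier G. fobj (O.coordinate h) F \<in> ?S h}"
    by (rule O.coordinatewise_subcategory) (use component_abelian[OF assms(2)] zero_subcategory in simp)
  moreover have "{F \<in> obj B. \<forall>h\<in>carrier G. fobj (O.coordinate h) F \<in> ?S h} = component (g, s)"
    using component_iff[OF assms] assms(1) by auto
  ultimately show ?thesis by simp
qed

lemma component_hom_zero:
  assumes "g \<in> carrier G" "s \<in> carrier \<Gamma>" "h \<in> carrier G" "t \<in> carrier \<Gamma>" "(g, s) \<noteq> (h, t)"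
    "a \<in> arr B" "fst a \<in> component (g, s)" "fst (snd a) \<in> component (h, t)"
  shows "a = hzero B (fst a) (fst (snd a))"
proof (rule O.faithful)
  note F = assms(7)[unfolded component_iff[OF assms(1,2)]] and H = assms(8)[unfolded component_iff[OF assms(3,4)]]
  fix x assume x: "x \<in> carrier G"
  note c = O.coordinate_arr[OF x assms(6)]
  have "farr (O.coordinate x) a = hzero C (O.part x (fst a)) (O.part x (fst (snd a)))"
  proof (cases "x = g \<and> x = h")
    case True
    then show ?thesis using grade_orthogonal[OF assms(2,4), of "farr (O.coordinate x) a"] assms(5) F H c by auto
  next
    case False
    then have "is_zero_obj C (O.part x (fst a)) \<or> is_zero_obj C (O.part x (fst (snd a)))" using F H x by auto
    then show ?thesis using zero_obj_arr(1)[OF _ c(1,2)] zero_obj_arr(2)[OF _ c(1,3)] c by auto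
  qed
  then show "farr (O.coordinate x) a = farr (O.coordinate x) (hzero B (fst a) (fst (snd a)))"
    using O.\<Psi>_hzero[OF x] F H by simp
qed (use assms(6) E.arrD[OF assms(6)] in simp_all)

text \<open>
  Decompose into homogeneous functors, and then the coordinates into their homogeneous parts.
\<close>

lemma component_decomposition:
  assumes F: "F \<in> obj B"
  shows "\<exists>I Z j q. finite I \<and> I \<subseteq> carrier L \<and> (\<forall>l\<in>I. Z l \<in> component l) \<and> is_direct_sum B I Z F j q"
proof -
  let ?X = "\<lambda>g. O.part g F"
  have X: "?X g \<in> obj C" if "g \<in> carrier G" for g using O.part_obj[OF F that] .
  have "is_direct_sum B (carrier \<Gamma>) (\<lambda>s. fobj (\<Phi> g) (hpart (?X g) s)) (fobj (\<Phi> g) (?X g))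
      (\<lambda>s. farr (\<Phi> g) (hincl (?X g) s)) (\<lambda>s. farr (\<Phi> g) (hproj (?X g) s))" if "g \<in> carrier G" for g
    by (rule functor_direct_sum[OF E.B.linear_category_axioms \<Phi>_linear[OF that] finite_\<Gamma> hparts[OF X[OF that]]])
  from E.B.direct_sum_nested[OF finite_G finite_\<Gamma> O.ds[OF F] this]
  obtain j q where *: "is_direct_sum B (carrier G \<times> carrier \<Gamma>) (\<lambda>(g, s). fobj (\<Phi> g) (hpart (?X g) s)) F j q" by blast
  have "\<forall>l\<in>carrier G \<times> carrier \<Gamma>. (\<lambda>(g, s). fobj (\<Phi> g) (hpart (?X g) s)) l \<in> component l"
    using \<Phi>_component X hpart_grade by auto
  then show ?thesis using * finite_G finite_\<Gamma>
    by (intro exI[of _ "carrier G \<times> carrier \<Gamma>"] exI conjI) (simp_all add: bicrossed_group_def)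
qed

lemma dual_graded: "graded_tensor_category L B component"
proof (rule graded_tensor_category.intro[OF bicrossed_group tensor_category_B], unfold_locales)
  show "abelian_subcategory B (component l)" if "l \<in> carrier L" for l
    using that component_subcategory by (cases l) (simp add: bicrossed_group_def)
  show "Hom B F H = {hzero B F H}" if h: "l \<in> carrier L" "l' \<in> carrier L" "l \<noteq> l'" "F \<in> component l" "H \<in> component l'" for l l' F H
  proof -
    obtain g s k t where l: "l = (g, s)" "l' = (k, t)" "g \<in> carrier G" "s \<in> carrier \<Gamma>" "k \<in> carrier G" "t \<in> carrier \<Gamma>"
      using h(1,2) by (auto simp: bicrossed_group_def)
    have "a = hzero B F H" if "a \<in> Hom B F H" for a
      using component_hom_zero[OF l(3-6), of a] h(3-5) l(1,2) that by simp
    moreover have "hzero B F H \<in> Hom B F H" using h(4,5)[THEN component_closed] by simp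
    ultimately show ?thesis by blast
  qed
  show "\<exists>I Z j q. finite I \<and> I \<subseteq> carrier L \<and> (\<forall>l\<in>I. Z l \<in> component l) \<and> is_direct_sum B I Z F j q" if "F \<in> obj B" for F
    by (rule component_decomposition[OF that])
  show "F \<boxtimes>\<^bsub>B\<^esub> H \<in> component (l \<otimes>\<^bsub>L\<^esub> l')" if h: "l \<in> carrier L" "l' \<in> carrier L" "F \<in> component l" "H \<in> component l'" for l l' F H
    using dual_tensor_component h by (auto simp: bicrossed_group_def)
qed

lemma component_one: "component \<one>\<^bsub>L\<^esub> = ess_image B emb (grade A \<one>\<^bsub>\<Gamma>\<^esub>)"
proof -
  have "isomorphic B (fobj (\<Phi> \<one>\<^bsub>G\<^esub>) X) F \<longleftrightarrow> isomorphic B (R X) F" if "X \<in> obj C" for X F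
    using \<Phi>_one[OF that] E.B.isomorphic_trans E.B.isomorphic_sym by blast
  then show ?thesis unfolding component_def ess_image_def bicrossed_group_def by (auto simp del: \<Phi>_simps)
qed

lemma dual_faithful_iff: "faithful_grading L B component \<longleftrightarrow> faithful_grading \<Gamma> C (grade A)"
proof
  assume f: "faithful_grading L B component"
  show "faithful_grading \<Gamma> C (grade A)"
    unfolding faithful_grading_def
  proof
    fix s assume s: "s \<in> carrier \<Gamma>"
    then have "(\<one>\<^bsub>G\<^esub>, s) \<in> carrier L" by (simp add: bicrossed_group_def)
    then obtain F where F: "F \<in> component (\<one>\<^bsub>G\<^esub>, s)" "\<not> is_zero_obj B F" using f unfolding faithful_grading_def by blast
    then obtain X where X: "X \<in> grade A s" "isomorphic B (fobj (\<Phi> \<one>\<^bsub>G\<^esub>) X) F" unfolding component_def ess_image_def by blast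
    have "\<not> is_zero_obj C X"
      using functor_zero_obj[OF E.B.linear_category_axioms \<Phi>_linear[OF G.one_closed]] E.B.zero_obj_iso[OF _ X(2)] F(2) by blast
    then show "\<exists>X\<in>grade A s. \<not> is_zero_obj C X" using X(1) by blast
  qed
next
  assume f: "faithful_grading \<Gamma> C (grade A)"
  show "faithful_grading L B component"
    unfolding faithful_grading_def
  proof
    fix l assume "l \<in> carrier L"
    then obtain g s where l: "l = (g, s)" "g \<in> carrier G" "s \<in> carrier \<Gamma>" by (auto simp: bicrossed_group_def)
    obtain X where X: "X \<in> grade A s" "\<not> is_zero_obj C X" using f l(3) unfolding faithful_grading_def by blast
    have Xo: "X \<in> obj C" using X(1) l(3) by simp
    have "\<not> is_zero_obj B (fobj (\<Phi> g) X)"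
    proof
      assume "is_zero_obj B (fobj (\<Phi> g) X)"
      from E.B.functor_zero_obj[OF linear_category_axioms O.coordinate_linear[OF l(2)] this]
      have "is_zero_obj C (O.part g (fobj (\<Phi> g) X))" by simp
      then show False using zero_obj_iso[OF _ O.coordinate_\<Phi>(1)[OF l(2) Xo l(2) refl]] X(2) by blast
    qed
    then show "\<exists>F\<in>component l. \<not> is_zero_obj B F" using \<Phi>_component[OF l(2,3) X(1)] l(1) by blast
  qed
qed

end

theorem theorem4p5:
  fixes G :: "('g, 'a) monoid_scheme" and \<Gamma> :: "('s, 'b) monoid_scheme"
    and lact :: "'s \<Rightarrow> 'g \<Rightarrow> 'g" and ract :: "'s \<Rightarrow> 'g \<Rightarrow> 's"
    and C :: "('o, 'm, 'k::{alg_closed_field, field_char_0}) tensor_cat"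
    and A :: "('g, 's, 'o, 'm) crossed_action"
  assumes "matched_pair G \<Gamma> lact ract"
    and "finite (carrier G)" and "finite (carrier \<Gamma>)"
    and "finite_tensor_category C"
    and "crossed_tensor_category G \<Gamma> lact ract C A"
  shows "tensor_embedding C (crossed_dual G \<Gamma> lact ract C A)
           (right_mult_embedding G \<Gamma> lact ract C A) \<and>
         (\<exists>component.
            graded_tensor_category (bicrossed_group G \<Gamma> lact ract)
              (crossed_dual G \<Gamma> lact ract C A) component \<and>
            component (\<one>\<^bsub>bicrossed_group G \<Gamma> lact ract\<^esub>) =
              ess_image (crossed_dual G \<Gamma> lact ract C A)
                (right_mult_embedding G \<Gamma> lact ract C A) (grade A \<one>\<^bsub>\<Gamma>\<^esub>) \<and>
            (faithful_grading (bicrossed_group G \<Gamma> lact ract)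
               (crossed_dual G \<Gamma> lact ract C A) component \<longleftrightarrow>
             faithful_grading \<Gamma> C (grade A)))"
proof -
  interpret finite_crossed G \<Gamma> lact ract C A
    using assms(2,3,5) by (intro finite_crossed.intro finite_crossed_axioms.intro)
  show ?thesis
    unfolding crossed_dual_def using emb_embedding dual_graded component_one dual_faithful_iff by blast
qed

end
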